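(* Let $(\mathscr{E},\mathscr{L},\mathscr{B})$ be a normal labelled space with alphabet $\mathscr{A}$, tight spectrum $\mathsf{T}$, and partial action $\Phi=(\{V_t\}_{t\in\mathbb{F}},\{\phi_t\}_{t\in\mathbb{F}})$ of the free group $\mathbb{F}$ on $\mathscr{A}$ on $\mathsf{T}$ as defined in the context. There is a $*$-isomorphism $\psi$ from $C^*(\mathscr{E},\mathscr{L},\mathscr{B})$ onto $C_0(\mathsf{T})\rtimes_{\hat\phi}\mathbb{F}$ such that $\psi(p_A)=1_A\delta_\omega$ for all $A\in\mathscr{B}$ and $\psi(s_a)=1_a\delta_a$ for all $a\in\mathscr{A}$, where $1_A$ is the characteristic function of $V_{(\omega,A,\omega)}$ (zero if $A=\emptyset$) and $1_a$ is the characteristic function of $V_{(a,r(a),a)}$.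
   Context: **Labelled spaces.** A (directed) graph $\mathscr{E}=(\mathscr{E}^0,\mathscr{E}^1,r,s)$ consists of non-empty sets of vertices and edges and range/source maps $r,s:\mathscr{E}^1\to\mathscr{E}^0$; $\mathscr{E}^0_{sink}=\{v:s^{-1}(v)=\emptyset\}$. A path is a finite or infinite sequence of edges $\lambda_1\lambda_2\ldots$ with $r(\lambda_i)=s(\lambda_{i+1})$. A labelled graph is a graph with a surjective labelling map $\mathscr{L}:\mathscr{E}^1\to\mathscr{A}$ onto a non-empty set $\mathscr{A}$ (the alphabet), extended letterwise to paths. $\mathscr{L}^{\geq 1}$ is the set of labels of finite paths of length $\geq 1$; $\mathscr{L}^*=\{\omega\}\cup\mathscr{L}^{\geq1}$ with $\omega$ the empty word; $\overline{\mathscr{L}^\infty}$ is the set of infinite words over $\mathscr{A}$ all of whose finite beginnings lie in $\mathscr{L}^*$; $\overline{\mathscr{L}^{\leq\infty}}=\mathscr{L}^*\cup\overline{\mathscr{L}^\infty}$. $|\alpha|$ is the length of $\alpha$; $\alpha_{i,j}=\alpha_i\cdots\alpha_j$, and $\alpha_{i,j}=\omega$ if $j<i$. For $A\subseteq\mathscr{E}^0$: $r(A,\alpha)=\{r(\lambda): \mathscr{L}(\lambda)=\alpha,\ s(\lambda)\in A\}$ for $\alpha\in\mathscr{L}^{\geq1}$, $r(A,\omega)=A$, $r(\alpha)=r(\mathscr{E}^0,\alpha)$, and $\mathscr{L}(A\mathscr{E}^1)=\{a\in\mathscr{A}:r(A,a)\neq\emptyset\}$. A labelled space is a triple $(\mathscr{E},\mathscr{L},\mathscr{B})$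 with $\mathscr{B}$ a family of subsets of $\mathscr{E}^0$ closed under finite intersections and finite unions, containing $r(\alpha)$ for all $\alpha\in\mathscr{L}^{\geq1}$, and with $r(A,\alpha)\in\mathscr{B}$ for $A\in\mathscr{B}$, $\alpha\in\mathscr{L}^*$. It is weakly left-resolving if $r(A\cap B,\alpha)=r(A,\alpha)\cap r(B,\alpha)$ for all $A,B\in\mathscr{B}$, $\alpha\in\mathscr{L}^{\geq 1}$; it is normal if it is weakly left-resolving and $\mathscr{B}$ is closed under relative complements. $\mathscr{B}_\alpha=\{A\in\mathscr{B}: A\subseteq r(\alpha)\}$ (so $\mathscr{B}_\omega=\mathscr{B}$). **The C*-algebra.** $C^*(\mathscr{E},\mathscr{L},\mathscr{B})$ is the universal C*-algebra generated by projections $\{p_A:A\in\mathscr{B}\}$ and partial isometries $\{s_a:a\in\mathscr{A}\}$ subject to: (i) $p_{A\cap B}=p_Ap_B$, $p_{A\cup B}=p_A+p_B-p_{A\cap B}$, $p_\emptyset=0$; (ii) $p_As_a=s_ap_{r(A,a)}$; (iii) $s_a^*s_a=p_{r(a)}$ and $s_b^*s_a=0$ if $b\neq a$; (iv) $p_A=\sum_{a\in\mathscr{L}(A\mathscr{E}^1)}s_ap_{r(A,a)}s_a^*$ for every $A\in\mathscr{B}$ such that $0<\#\mathscr{L}(A\mathscr{E}^1)<\infty$ and there is no $B\in\mathscr{B}$ with $\emptyset\neq B\subseteq A\cap\mathscr{E}^0_{sink}$. **Tight spectrum.** $E(S)=\{(\alpha,A,\alpha):\alpha\in\mathscr{L}^*,\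 \emptyset\neq A\in\mathscr{B}_\alpha\}\cup\{0\}$ is a meet semilattice with zero, where for non-zero elements $(\alpha,A,\alpha)\leq(\beta,B,\beta)$ iff $\alpha=\beta\alpha'$ and $A\subseteq r(B,\alpha')$. A filter in $E(S)$ is a non-empty upward closed subset, closed under meets, not containing $0$; ultrafilters are maximal filters. Filters are identified with their characteristic functions, given the topology of pointwise convergence; the tight spectrum $\mathsf{T}$ is the closure of the set of ultrafilters; its elements are the tight filters. For $e\in E(S)$, $V_e=\{\xi\in\mathsf{T}:e\in\xi\}$; the sets $V_{e:e_1,\dots,e_n}=V_e\setminus(V_{e_1}\cup\dots\cup V_{e_n})$ form a basis of compact-open sets of the Hausdorff space $\mathsf{T}$. Each tight filter $\xi$ has an associated word $\alpha\in\overline{\mathscr{L}^{\leq\infty}}$ (write $\xi=\xi^\alpha$) and filters $\xi_n=\{A\in\mathscr{B}:(\alpha_{1,n},A,\alpha_{1,n})\in\xi\}$, $0\le n\le|\alpha|$ ($n<\infty$), where $\xi_0$ may be empty; $(\beta,A,\beta)\in\xi^\alpha$ iff $\beta$ is a beginning of $\alpha$ and $A\in\xi_{|\beta|}$, and $\xi$ is determined by $\alpha$ and the family $\{\xi_n\}$. $\mathsf{T}_\alpha$ denotes the tight filters with word $\alpha$. **Gluing and cutting maps.** For $\alpha\in\mathscr{L}^{\geq1}$ and $\beta\in\overline{\mathscr{L}^{\leq\infty}}$ with $\alpha\beta\in\overline{\mathscr{L}^{\leq\infty}}$, let $\mathsf{T}_{(\alpha)\beta}=\{\xi\in\mathsf{T}_\beta:\xi_0\text{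 is an ultrafilter in }\mathscr{B}\text{ with }r(\alpha)\in\xi_0\}$. The map $G_{(\alpha)\beta}:\mathsf{T}_{(\alpha)\beta}\to\mathsf{T}_{\alpha\beta}$ sends $\xi$ to $\eta$, where: if $\beta=\omega$, $\eta_{|\alpha|}=\{C\cap r(\alpha):C\in\xi_0\}$ and $\eta_i=\{D\in\mathscr{B}_{\alpha_{1,i}}:r(D,\alpha_{i+1,|\alpha|})\in\eta_{|\alpha|}\}$ for $0\leq i<|\alpha|$; if $\beta\neq\omega$, $\eta_{|\alpha|+n}=\{C\cap r(\alpha\beta_{1,n}):C\in\xi_n\}$ for $1\leq n\leq|\beta|$ ($n<\infty$) and $\eta_i=\{D\in\mathscr{B}_{\alpha_{1,i}}:r(D,\alpha_{i+1,|\alpha|}\beta_1)\in\eta_{|\alpha|+1}\}$ for $0\le i\le|\alpha|$. Its inverse $H_{[\alpha]\beta}:\mathsf{T}_{\alpha\beta}\to\mathsf{T}_{(\alpha)\beta}$ sends $\xi$ to $\eta$ with $\eta_n=\{C\in\mathscr{B}_{\beta_{1,n}}:D\subseteq C\text{ for some }D\in\xi_{n+|\alpha|}\}$, $0\le n\le|\beta|$ ($n<\infty$). **Partial action.** Identify the identity of $\mathbb{F}$ with $\omega$ and words over $\mathscr{A}$ with elements of $\mathbb{F}$. Put $V_\omega=\mathsf{T}$, $\phi_\omega=\mathrm{id}$; for $a\in\mathscr{A}$, $V_a=V_{(a,r(a),a)}$ (the disjoint union of the $\mathsf{T}_{a\beta}$), $V_{a^{-1}}=V_{(\omega,r(a),\omega)}$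 (the disjoint union of the $\mathsf{T}_{(a)\beta}$), $\phi_a:V_{a^{-1}}\to V_a$ with $\phi_a|_{\mathsf{T}_{(a)\beta}}=G_{(a)\beta}$, and $\phi_{a^{-1}}=\phi_a^{-1}$. For $t=a_n\cdots a_1$ reduced, $a_i\in\mathscr{A}\cup\mathscr{A}^{-1}$, $n\geq2$, inductively $V_{t^{-1}}=\phi_{a_{n-1}\cdots a_1}^{-1}(V_{a_n^{-1}})$ and $\phi_t=\phi_{a_n}\circ\phi_{a_{n-1}\cdots a_1}$ on $V_{t^{-1}}$, so $\phi_t:V_{t^{-1}}\to V_t$. This is a partial action of $\mathbb{F}$ on $\mathsf{T}$ by homeomorphisms between open sets. **Partial crossed product.** Let $D_t=C_0(V_t)$, viewed (extending by zero) as a closed two-sided ideal of $C_0(\mathsf{T})$, and $\hat\phi_t:D_{t^{-1}}\to D_t$, $\hat\phi_t(f)=f\circ\phi_{t^{-1}}$. $C_0(\mathsf{T})\rtimes_{\hat\phi}\mathbb{F}$ is the (full) partial crossed product: the completion in the universal C*-norm of the $*$-algebra of finite formal sums $\sum_t f_t\delta_t$, $f_t\in D_t$, with $(a\delta_s)(b\delta_t)=\hat\phi_s(\hat\phi_{s^{-1}}(a)b)\delta_{st}$ and $(a\delta_s)^*=\hat\phi_{s^{-1}}(a^* )\delta_{s^{-1}}$. *)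

theory Defs
  imports
    "HOL-Analysis.Analysis"
    "HOL-Algebra.Group"
    "HOL-Algebra.Lattice"
    "HOL-Library.Stream"
    "HOL-Library.Extended_Nat"
    "Graph_Theory.Arc_Walk"
begin

section \<open>Complex *-algebras and their C*-completions\<close>

record 'x star_algebra = "'x partial_object" +
  plus_sa :: "'x \<Rightarrow> 'x \<Rightarrow> 'x"
  scale_sa :: "complex \<Rightarrow> 'x \<Rightarrow> 'x"
  times_sa :: "'x \<Rightarrow> 'x \<Rightarrow> 'x"
  star_sa :: "'x \<Rightarrow> 'x"

record 'x normed_star_algebra = "'x star_algebra" +
  norm_sa :: "'x \<Rightarrow> real"

definition diff_sa :: "('x, 'm) star_algebra_scheme \<Rightarrow> 'x \<Rightarrow> 'x \<Rightarrow> 'x" where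
  "diff_sa R x y = plus_sa R x (scale_sa R (-1) y)"

definition star_isomorphism ::
  "('x, 'm) star_algebra_scheme \<Rightarrow> ('y, 'n) star_algebra_scheme \<Rightarrow> ('x \<Rightarrow> 'y) \<Rightarrow> bool" where
  "star_isomorphism R S \<psi> \<longleftrightarrow>
     bij_betw \<psi> (carrier R) (carrier S) \<and>
     (\<forall>x\<in>carrier R. \<forall>y\<in>carrier R. \<psi> (plus_sa R x y) = plus_sa S (\<psi> x) (\<psi> y)) \<and>
     (\<forall>c. \<forall>x\<in>carrier R. \<psi> (scale_sa R c x) = scale_sa S c (\<psi> x)) \<and>
     (\<forall>x\<in>carrier R. \<forall>y\<in>carrier R. \<psi> (times_sa R x y) = times_sa S (\<psi> x) (\<psi> y)) \<and>
     (\<forall>x\<in>carrier R. \<psi> (star_sa R x) = star_sa S (\<psi> x))"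

definition cstar_seminorm :: "('x, 'm) star_algebra_scheme \<Rightarrow> ('x \<Rightarrow> real) \<Rightarrow> bool" where
  "cstar_seminorm R p \<longleftrightarrow>
     (\<forall>x\<in>carrier R. 0 \<le> p x) \<and>
     (\<forall>x\<in>carrier R. \<forall>y\<in>carrier R. p (plus_sa R x y) \<le> p x + p y) \<and>
     (\<forall>c. \<forall>x\<in>carrier R. p (scale_sa R c x) = cmod c * p x) \<and>
     (\<forall>x\<in>carrier R. \<forall>y\<in>carrier R. p (times_sa R x y) \<le> p x * p y) \<and>
     (\<forall>x\<in>carrier R. p (times_sa R (star_sa R x) x) = (p x)\<^sup>2)"

text \<open>The set \<open>Rel\<close> consists of relations, a pair \<open>(x, y)\<close> standing for \<open>x = y\<close>.
  The C*-seminorms under which all relations hold are exactly the functions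
  \<open>x \<mapsto> \<parallel>\<pi> x\<parallel>\<close> for *-homomorphisms \<open>\<pi>\<close> into C*-algebras that respect the relations, so
  their supremum is the universal C*-seminorm. It is to be used only where this supremum is
  finite, as it is for both algebras considered below.\<close>

definition universal_seminorm ::
  "('x, 'm) star_algebra_scheme \<Rightarrow> ('x \<times> 'x) set \<Rightarrow> 'x \<Rightarrow> real" where
  "universal_seminorm R Rel x =
     (SUP p\<in>{p. cstar_seminorm R p \<and> (\<forall>(y, z)\<in>Rel. p (diff_sa R y z) = 0)}. p x)"

text \<open>Hausdorff completion for a seminorm \<open>p\<close>: Cauchy sequences modulo sequences tending to zero.\<close>

definition cauchy_seqs :: "('x, 'm) star_algebra_scheme \<Rightarrow> ('x \<Rightarrow> real) \<Rightarrow> (nat \<Rightarrow> 'x) set" where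
  "cauchy_seqs R p = {X. range X \<subseteq> carrier R \<and>
     (\<forall>e>0. \<exists>N. \<forall>m\<ge>N. \<forall>n\<ge>N. p (diff_sa R (X m) (X n)) < e)}"

definition null_rel ::
  "('x, 'm) star_algebra_scheme \<Rightarrow> ('x \<Rightarrow> real) \<Rightarrow> ((nat \<Rightarrow> 'x) \<times> (nat \<Rightarrow> 'x)) set" where
  "null_rel R p = {(X, Y). X \<in> cauchy_seqs R p \<and> Y \<in> cauchy_seqs R p \<and>
     (\<lambda>n. p (diff_sa R (X n) (Y n))) \<longlonglongrightarrow> 0}"

definition completion ::
  "('x, 'm) star_algebra_scheme \<Rightarrow> ('x \<Rightarrow> real) \<Rightarrow> (nat \<Rightarrow> 'x) set normed_star_algebra" where
  "completion R p =
     \<lparr> carrier = cauchy_seqs R p // null_rel R p,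
       plus_sa = (\<lambda>x y. \<Union>X\<in>x. \<Union>Y\<in>y. null_rel R p `` {\<lambda>n. plus_sa R (X n) (Y n)}),
       scale_sa = (\<lambda>c x. \<Union>X\<in>x. null_rel R p `` {\<lambda>n. scale_sa R c (X n)}),
       times_sa = (\<lambda>x y. \<Union>X\<in>x. \<Union>Y\<in>y. null_rel R p `` {\<lambda>n. times_sa R (X n) (Y n)}),
       star_sa = (\<lambda>x. \<Union>X\<in>x. null_rel R p `` {\<lambda>n. star_sa R (X n)}),
       norm_sa = (\<lambda>x. lim (\<lambda>n. p ((SOME X. X \<in> x) n))) \<rparr>"

definition completion_embed ::
  "('x, 'm) star_algebra_scheme \<Rightarrow> ('x \<Rightarrow> real) \<Rightarrow> 'x \<Rightarrow> (nat \<Rightarrow> 'x) set" where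
  "completion_embed R p x = null_rel R p `` {\<lambda>n. x}"

section \<open>Universal C*-algebras given by generators and relations\<close>

text \<open>Non-unital free *-algebra on a set \<open>\<Gamma>\<close> of generators: an element is given by its
  coefficients on the non-empty words in the letters \<open>(g, False)\<close>, standing for \<open>g\<close>, and
  \<open>(g, True)\<close>, standing for \<open>g\<^sup>*\<close>.\<close>

type_synonym 'g star_poly = "('g \<times> bool) list \<Rightarrow> complex"

definition free_star_algebra :: "'g set \<Rightarrow> 'g star_poly star_algebra" where
  "free_star_algebra \<Gamma> =
     \<lparr> carrier = {f. finite {w. f w \<noteq> 0} \<and> (\<forall>w. f w \<noteq> 0 \<longrightarrow> w \<noteq> [] \<and> fst ` set w \<subseteq> \<Gamma>)},
       plus_sa = (\<lambda>f g w. f w + g w),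
       scale_sa = (\<lambda>c f w. c * f w),
       times_sa = (\<lambda>f g w. \<Sum>i\<le>length w. f (take i w) * g (drop i w)),
       star_sa = (\<lambda>f w. cnj (f (rev (map (\<lambda>(g, b). (g, \<not> b)) w)))) \<rparr>"

definition free_gen :: "'g \<Rightarrow> 'g star_poly" where
  "free_gen g = (\<lambda>w. if w = [(g, False)] then 1 else 0)"

definition universal_cstar_algebra ::
  "'g set \<Rightarrow> ('g star_poly \<times> 'g star_poly) set \<Rightarrow> (nat \<Rightarrow> 'g star_poly) set normed_star_algebra" where
  "universal_cstar_algebra \<Gamma> Rel =
     completion (free_star_algebra \<Gamma>) (universal_seminorm (free_star_algebra \<Gamma>) Rel)"

definition universal_gen ::
  "'g set \<Rightarrow> ('g star_poly \<times> 'g star_poly) set \<Rightarrow> 'g \<Rightarrow> (nat \<Rightarrow> 'g star_poly) set" where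
  "universal_gen \<Gamma> Rel g =
     completion_embed (free_star_algebra \<Gamma>) (universal_seminorm (free_star_algebra \<Gamma>) Rel) (free_gen g)"

section \<open>Partial crossed products\<close>

text \<open>\<open>C\<^sub>0(U)\<close> for a subset \<open>U\<close> of the space \<open>X\<close>, its elements being extended by zero.\<close>

definition C0 :: "'x topology \<Rightarrow> 'x set \<Rightarrow> ('x \<Rightarrow> complex) set" where
  "C0 X U = {f. continuous_map (subtopology X U) euclidean f \<and>
     (\<forall>e>0. compactin (subtopology X U) {x \<in> U. e \<le> cmod (f x)}) \<and>
     (\<forall>x. x \<notin> U \<longrightarrow> f x = 0)}"

text \<open>\<open>V\<close> and \<open>\<phi>\<close> form a partial action of the group \<open>F\<close>, with \<open>\<phi> t\<close> mapping \<open>V (inv t)\<close> to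
  \<open>V t\<close>.\<close>

definition dual_action ::
  "('g, 'm) monoid_scheme \<Rightarrow> ('g \<Rightarrow> 'x set) \<Rightarrow> ('g \<Rightarrow> 'x \<Rightarrow> 'x) \<Rightarrow> 'g \<Rightarrow> ('x \<Rightarrow> complex) \<Rightarrow> 'x \<Rightarrow> complex" where
  "dual_action F V \<phi> t f = (\<lambda>x. if x \<in> V t then f (\<phi> (inv\<^bsub>F\<^esub> t) x) else 0)"

text \<open>A finite formal sum of terms \<open>f\<^sub>t \<delta>\<^sub>t\<close> is given by the function \<open>t \<mapsto> f\<^sub>t\<close>.\<close>

definition alg_crossed_product ::
  "('g, 'm) monoid_scheme \<Rightarrow> 'x topology \<Rightarrow> ('g \<Rightarrow> 'x set) \<Rightarrow> ('g \<Rightarrow> 'x \<Rightarrow> 'x)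
    \<Rightarrow> ('g \<Rightarrow> 'x \<Rightarrow> complex) star_algebra" where
  "alg_crossed_product F X V \<phi> =
     \<lparr> carrier = {f. finite {t. f t \<noteq> (\<lambda>x. 0)} \<and> (\<forall>t\<in>carrier F. f t \<in> C0 X (V t)) \<and>
                     (\<forall>t. t \<notin> carrier F \<longrightarrow> f t = (\<lambda>x. 0))},
       plus_sa = (\<lambda>f g t x. f t x + g t x),
       scale_sa = (\<lambda>c f t x. c * f t x),
       times_sa = (\<lambda>f g u x.
         \<Sum>(s, t) | f s \<noteq> (\<lambda>x. 0) \<and> g t \<noteq> (\<lambda>x. 0) \<and> s \<otimes>\<^bsub>F\<^esub> t = u.
           dual_action F V \<phi> s (\<lambda>y. dual_action F V \<phi> (inv\<^bsub>F\<^esub> s) (f s) y * g t y) x),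
       star_sa = (\<lambda>f u. if u \<in> carrier F
         then dual_action F V \<phi> u (\<lambda>y. cnj (f (inv\<^bsub>F\<^esub> u) y)) else (\<lambda>x. 0)) \<rparr>"

definition crossed_product ::
  "('g, 'm) monoid_scheme \<Rightarrow> 'x topology \<Rightarrow> ('g \<Rightarrow> 'x set) \<Rightarrow> ('g \<Rightarrow> 'x \<Rightarrow> 'x)
    \<Rightarrow> (nat \<Rightarrow> 'g \<Rightarrow> 'x \<Rightarrow> complex) set normed_star_algebra" where
  "crossed_product F X V \<phi> =
     completion (alg_crossed_product F X V \<phi>) (universal_seminorm (alg_crossed_product F X V \<phi>) {})"

definition crossed_monomial ::
  "('g, 'm) monoid_scheme \<Rightarrow> 'x topology \<Rightarrow> ('g \<Rightarrow> 'x set) \<Rightarrow> ('g \<Rightarrow> 'x \<Rightarrow> 'x)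
    \<Rightarrow> ('x \<Rightarrow> complex) \<Rightarrow> 'g \<Rightarrow> (nat \<Rightarrow> 'g \<Rightarrow> 'x \<Rightarrow> complex) set" where
  "crossed_monomial F X V \<phi> f t =
     completion_embed (alg_crossed_product F X V \<phi>) (universal_seminorm (alg_crossed_product F X V \<phi>) {})
       (\<lambda>s. if s = t then f else (\<lambda>x. 0))"

section \<open>Free groups\<close>

datatype 'a letter = Pos 'a | Neg 'a

fun inv_letter :: "'a letter \<Rightarrow> 'a letter" where
  "inv_letter (Pos a) = Neg a"
| "inv_letter (Neg a) = Pos a"

definition reduced :: "'a letter list \<Rightarrow> bool" where
  "reduced t \<longleftrightarrow> (\<forall>i. Suc i < length t \<longrightarrow> t ! i \<noteq> inv_letter (t ! Suc i))"

text \<open>Multiplication by a letter from the left, with cancellation.\<close>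

fun letter_mult :: "'a letter \<Rightarrow> 'a letter list \<Rightarrow> 'a letter list" where
  "letter_mult x [] = [x]"
| "letter_mult x (y # t) = (if x = inv_letter y then t else x # y # t)"

definition free_group :: "'a letter list monoid" where
  "free_group = \<lparr> carrier = {t. reduced t}, mult = foldr letter_mult, one = [] \<rparr>"

section \<open>Filters in meet semilattices with zero\<close>

definition is_filter :: "('x, 'm) gorder_scheme \<Rightarrow> 'x \<Rightarrow> 'x set \<Rightarrow> bool" where
  "is_filter L z \<xi> \<longleftrightarrow> \<xi> \<subseteq> carrier L \<and> \<xi> \<noteq> {} \<and> z \<notin> \<xi> \<and>
     (\<forall>x\<in>\<xi>. \<forall>y\<in>carrier L. x \<sqsubseteq>\<^bsub>L\<^esub> y \<longrightarrow> y \<in> \<xi>) \<and>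
     (\<forall>x\<in>\<xi>. \<forall>y\<in>\<xi>. x \<sqinter>\<^bsub>L\<^esub> y \<in> \<xi>)"

definition is_ultrafilter :: "('x, 'm) gorder_scheme \<Rightarrow> 'x \<Rightarrow> 'x set \<Rightarrow> bool" where
  "is_ultrafilter L z \<xi> \<longleftrightarrow> is_filter L z \<xi> \<and> (\<forall>\<eta>. is_filter L z \<eta> \<and> \<xi> \<subseteq> \<eta> \<longrightarrow> \<eta> = \<xi>)"

section \<open>Finite and infinite words\<close>

datatype 'a word = Fin "'a list" | Inf "'a stream"

fun word_length :: "'a word \<Rightarrow> enat" where
  "word_length (Fin \<alpha>) = enat (length \<alpha>)"
| "word_length (Inf s) = \<infinity>"

fun beginning :: "nat \<Rightarrow> 'a word \<Rightarrow> 'a list" where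
  "beginning n (Fin \<alpha>) = take n \<alpha>"
| "beginning n (Inf s) = stake n s"

fun append_word :: "'a list \<Rightarrow> 'a word \<Rightarrow> 'a word" where
  "append_word \<alpha> (Fin \<beta>) = Fin (\<alpha> @ \<beta>)"
| "append_word \<alpha> (Inf s) = Inf (\<alpha> @- s)"

section \<open>Labelled spaces\<close>

text \<open>The alphabet is the type \<open>'a\<close>; the edges are the arcs of \<open>G\<close>, with source \<open>tail G\<close> and
  range \<open>head G\<close>.\<close>

locale labelled_graph = wf_digraph G for G :: "('v, 'e) pre_digraph" +
  fixes lab :: "'e \<Rightarrow> 'a"
  assumes verts_nonempty: "verts G \<noteq> {}"
    and arcs_nonempty: "arcs G \<noteq> {}"
    and lab_surj: "lab ` arcs G = UNIV"
begin

definition path_labels1 :: "'a list set" where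
  "path_labels1 = {map lab \<pi> | \<pi>. \<pi> \<noteq> [] \<and> (\<exists>u v. awalk u \<pi> v)}"

definition path_labels :: "'a list set" where
  "path_labels = {[]} \<union> path_labels1"

definition words_le_infinity :: "'a word set" where
  "words_le_infinity = Fin ` path_labels \<union> {Inf s | s. \<forall>n. stake n s \<in> path_labels}"

definition relrange :: "'v set \<Rightarrow> 'a list \<Rightarrow> 'v set" where
  "relrange A \<alpha> = (if \<alpha> = [] then A else {v. \<exists>u\<in>A. \<exists>\<pi>. awalk u \<pi> v \<and> map lab \<pi> = \<alpha>})"

definition range_of :: "'a list \<Rightarrow> 'v set" where
  "range_of \<alpha> = relrange (verts G) \<alpha>"

definition out_labels :: "'v set \<Rightarrow> 'a set" where
  "out_labels A = {a. relrange A [a] \<noteq> {}}"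

definition sinks :: "'v set" where
  "sinks = {v \<in> verts G. out_arcs G v = {}}"

end

locale labelled_space = labelled_graph G lab
  for G :: "('v, 'e) pre_digraph" and lab :: "'e \<Rightarrow> 'a" +
  fixes B :: "'v set set"
  assumes B_verts: "A \<in> B \<Longrightarrow> A \<subseteq> verts G"
    and B_Int: "A \<in> B \<Longrightarrow> A' \<in> B \<Longrightarrow> A \<inter> A' \<in> B"
    and B_Un: "A \<in> B \<Longrightarrow> A' \<in> B \<Longrightarrow> A \<union> A' \<in> B"
    and B_range: "\<alpha> \<in> path_labels1 \<Longrightarrow> range_of \<alpha> \<in> B"
    and B_relrange: "A \<in> B \<Longrightarrow> \<alpha> \<in> path_labels \<Longrightarrow> relrange A \<alpha> \<in> B"

locale weakly_left_resolving = labelled_space +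
  assumes relrange_Int: "A \<in> B \<Longrightarrow> A' \<in> B \<Longrightarrow> \<alpha> \<in> path_labels1 \<Longrightarrow>
    relrange (A \<inter> A') \<alpha> = relrange A \<alpha> \<inter> relrange A' \<alpha>"

locale normal_labelled_space = weakly_left_resolving +
  assumes B_Diff: "A \<in> B \<Longrightarrow> A' \<in> B \<Longrightarrow> A - A' \<in> B"

subsection \<open>The C*-algebra of a labelled space\<close>

datatype ('v, 'a) generator = Proj "'v set" | Isom 'a

context labelled_space
begin

definition generators :: "('v, 'a) generator set" where
  "generators = Proj ` B \<union> range Isom"

definition free_proj :: "'v set \<Rightarrow> ('v, 'a) generator star_poly" ("\<p>") where
  "free_proj A = free_gen (Proj A)"

definition free_isom :: "'a \<Rightarrow> ('v, 'a) generator star_poly" ("\<s>") where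
  "free_isom a = free_gen (Isom a)"

abbreviation free_times (infixl "\<cdot>" 70) where
  "x \<cdot> y \<equiv> times_sa (free_star_algebra generators) x y"

abbreviation free_star ("(_)\<^sup>\<star>" [1000] 999) where
  "x\<^sup>\<star> \<equiv> star_sa (free_star_algebra generators) x"

text \<open>Linear combinations are written coefficientwise.\<close>

inductive_set relations :: "(('v, 'a) generator star_poly \<times> ('v, 'a) generator star_poly) set" where
  proj_idem: "A \<in> B \<Longrightarrow> (\<p> A \<cdot> \<p> A, \<p> A) \<in> relations"
| proj_selfadj: "A \<in> B \<Longrightarrow> ((\<p> A)\<^sup>\<star>, \<p> A) \<in> relations"
| partial_isometry: "(\<s> a \<cdot> (\<s> a)\<^sup>\<star> \<cdot> \<s> a, \<s> a) \<in> relations"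
| proj_Int: "A \<in> B \<Longrightarrow> A' \<in> B \<Longrightarrow> (\<p> (A \<inter> A'), \<p> A \<cdot> \<p> A') \<in> relations"
| proj_Un: "A \<in> B \<Longrightarrow> A' \<in> B \<Longrightarrow>
    (\<p> (A \<union> A'), \<lambda>w. \<p> A w + \<p> A' w - \<p> (A \<inter> A') w) \<in> relations"
| proj_empty: "(\<p> {}, \<lambda>w. 0) \<in> relations"
| proj_isom: "A \<in> B \<Longrightarrow> (\<p> A \<cdot> \<s> a, \<s> a \<cdot> \<p> (relrange A [a])) \<in> relations"
| isom_isom: "((\<s> a)\<^sup>\<star> \<cdot> \<s> a, \<p> (range_of [a])) \<in> relations"
| isom_orth: "b \<noteq> a \<Longrightarrow> ((\<s> b)\<^sup>\<star> \<cdot> \<s> a, \<lambda>w. 0) \<in> relations"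
| cuntz_krieger: "A \<in> B \<Longrightarrow> finite (out_labels A) \<Longrightarrow> out_labels A \<noteq> {} \<Longrightarrow>
    \<not> (\<exists>A'\<in>B. A' \<noteq> {} \<and> A' \<subseteq> A \<inter> sinks) \<Longrightarrow>
    (\<p> A, \<lambda>w. \<Sum>a\<in>out_labels A. (\<s> a \<cdot> \<p> (relrange A [a]) \<cdot> (\<s> a)\<^sup>\<star>) w) \<in> relations"

definition cstar_algebra :: "(nat \<Rightarrow> ('v, 'a) generator star_poly) set normed_star_algebra" where
  "cstar_algebra = universal_cstar_algebra generators relations"

definition cs_proj :: "'v set \<Rightarrow> (nat \<Rightarrow> ('v, 'a) generator star_poly) set" where
  "cs_proj A = universal_gen generators relations (Proj A)"

definition cs_isom :: "'a \<Rightarrow> (nat \<Rightarrow> ('v, 'a) generator star_poly) set" where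
  "cs_isom a = universal_gen generators relations (Isom a)"

subsection \<open>The tight spectrum\<close>

definition B_below :: "'a list \<Rightarrow> 'v set set" where
  "B_below \<alpha> = {A \<in> B. A \<subseteq> range_of \<alpha>}"

text \<open>\<open>Some (\<alpha>, A)\<close> stands for the triple \<open>(\<alpha>, A, \<alpha>)\<close> and \<open>None\<close> for \<open>0\<close>.\<close>

fun idem_le :: "('a list \<times> 'v set) option \<Rightarrow> ('a list \<times> 'v set) option \<Rightarrow> bool" where
  "idem_le None e \<longleftrightarrow> True"
| "idem_le (Some (\<alpha>, A)) None \<longleftrightarrow> False"
| "idem_le (Some (\<alpha>, A)) (Some (\<beta>, A')) \<longleftrightarrow> (\<exists>\<alpha>'. \<alpha> = \<beta> @ \<alpha>' \<and> A \<subseteq> relrange A' \<alpha>')"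

definition ES :: "('a list \<times> 'v set) option gorder" where
  "ES = \<lparr> carrier = {Some (\<alpha>, A) | \<alpha> A. \<alpha> \<in> path_labels \<and> A \<noteq> {} \<and> A \<in> B_below \<alpha>} \<union> {None},
          eq = (=), le = idem_le \<rparr>"

text \<open>Topology of pointwise convergence of characteristic functions, on the set of all filters.
  The closure defining the tight spectrum is taken in this space of filters, so that the empty set
  (the zero function), which is not a filter, is not a tight filter.\<close>

definition filter_topology :: "('a list \<times> 'v set) option set topology" where
  "filter_topology = pullback_topology {\<xi>. is_filter ES None \<xi>}
     (\<lambda>\<xi>. \<lambda>e\<in>carrier ES. e \<in> \<xi>)
     (product_topology (\<lambda>_. discrete_topology (UNIV :: bool set)) (carrier ES))"

definition tight :: "('a list \<times> 'v set) option set set" where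
  "tight = filter_topology closure_of {\<xi>. is_ultrafilter ES None \<xi>}"

definition tight_topology :: "('a list \<times> 'v set) option set topology" where
  "tight_topology = subtopology filter_topology tight"

definition V_elem :: "'a list \<Rightarrow> 'v set \<Rightarrow> ('a list \<times> 'v set) option set set" where
  "V_elem \<alpha> A = {\<xi> \<in> tight. Some (\<alpha>, A) \<in> \<xi>}"

text \<open>If \<open>(\<alpha>, A, \<alpha>)\<close> lies in a filter, so does \<open>(\<beta>, r(\<beta>), \<beta>)\<close> for each beginning \<open>\<beta> \<noteq> \<omega>\<close> of
  \<open>\<alpha>\<close>, while no element with word \<open>\<omega>\<close> need be present. So the words occurring in a filter,
  together with \<open>\<omega>\<close>, are the finite beginnings of exactly one finite or infinite word.\<close>

definition filter_word :: "('a list \<times> 'v set) option set \<Rightarrow> 'a word" where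
  "filter_word \<xi> = (THE \<alpha>. \<alpha> \<in> words_le_infinity \<and>
     insert [] {\<beta>. \<exists>A. Some (\<beta>, A) \<in> \<xi>} = range (\<lambda>n. beginning n \<alpha>))"

definition layer :: "('a list \<times> 'v set) option set \<Rightarrow> nat \<Rightarrow> 'v set set" where
  "layer \<xi> n = {A \<in> B. Some (beginning n (filter_word \<xi>), A) \<in> \<xi>}"

definition filter_of :: "'a word \<Rightarrow> (nat \<Rightarrow> 'v set set) \<Rightarrow> ('a list \<times> 'v set) option set" where
  "filter_of \<alpha> \<eta> = {Some (beginning n \<alpha>, A) | n A. enat n \<le> word_length \<alpha> \<and> A \<in> \<eta> n}"

subsection \<open>The partial action of the free group\<close>

text \<open>\<open>glue \<alpha> \<beta>\<close> is the gluing map on the tight filters with word \<open>\<beta>\<close> for which the layer at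
  \<open>0\<close> is an ultrafilter in \<open>B\<close> containing \<open>r(\<alpha>)\<close>; its value is irrelevant elsewhere.\<close>

definition glue_layers ::
  "'a list \<Rightarrow> 'a word \<Rightarrow> ('a list \<times> 'v set) option set \<Rightarrow> nat \<Rightarrow> 'v set set" where
  "glue_layers \<alpha> \<beta> \<xi> i =
     (if \<beta> = Fin [] then
        (let \<eta>_last = {C \<inter> range_of \<alpha> | C. C \<in> layer \<xi> 0}
         in if i < length \<alpha> then {D \<in> B_below (take i \<alpha>). relrange D (drop i \<alpha>) \<in> \<eta>_last}
            else \<eta>_last)
      else
        (let \<eta>_upper = (\<lambda>n. {C \<inter> range_of (\<alpha> @ beginning n \<beta>) | C. C \<in> layer \<xi> n})
         in if i \<le> length \<alpha>
            then {D \<in> B_below (take i \<alpha>). relrange D (drop i \<alpha> @ beginning 1 \<beta>) \<in> \<eta>_upper 1}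
            else \<eta>_upper (i - length \<alpha>)))"

definition glue ::
  "'a list \<Rightarrow> 'a word \<Rightarrow> ('a list \<times> 'v set) option set \<Rightarrow> ('a list \<times> 'v set) option set" where
  "glue \<alpha> \<beta> \<xi> = filter_of (append_word \<alpha> \<beta>) (glue_layers \<alpha> \<beta> \<xi>)"

fun V_letter :: "'a letter \<Rightarrow> ('a list \<times> 'v set) option set set" where
  "V_letter (Pos a) = V_elem [a] (range_of [a])"
| "V_letter (Neg a) = V_elem [] (range_of [a])"

definition phi_gen :: "'a \<Rightarrow> ('a list \<times> 'v set) option set \<Rightarrow> ('a list \<times> 'v set) option set" where
  "phi_gen a \<xi> = glue [a] (filter_word \<xi>) \<xi>"

fun phi_letter ::
  "'a letter \<Rightarrow> ('a list \<times> 'v set) option set \<Rightarrow> ('a list \<times> 'v set) option set" where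
  "phi_letter (Pos a) = phi_gen a"
| "phi_letter (Neg a) = inv_into (V_letter (Neg a)) (phi_gen a)"

fun phi :: "'a letter list \<Rightarrow> ('a list \<times> 'v set) option set \<Rightarrow> ('a list \<times> 'v set) option set" where
  "phi [] \<xi> = \<xi>"
| "phi (x # t) \<xi> = phi_letter x (phi t \<xi>)"

text \<open>\<open>action_dom t\<close> is the domain of \<open>phi t\<close>, that is, the set indexed by the inverse of \<open>t\<close>. The word
  \<open>a\<^sub>n \<dots> a\<^sub>1\<close> is the list with head \<open>a\<^sub>n\<close>.\<close>

fun action_dom :: "'a letter list \<Rightarrow> ('a list \<times> 'v set) option set set" where
  "action_dom [] = tight"
| "action_dom [x] = V_letter (inv_letter x)"
| "action_dom (x # t) = {\<xi> \<in> action_dom t. phi t \<xi> \<in> V_letter (inv_letter x)}"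

definition V_action :: "'a letter list \<Rightarrow> ('a list \<times> 'v set) option set set" where
  "V_action t = action_dom (inv\<^bsub>free_group\<^esub> t)"

definition tight_crossed_product ::
  "(nat \<Rightarrow> 'a letter list \<Rightarrow> ('a list \<times> 'v set) option set \<Rightarrow> complex) set normed_star_algebra" where
  "tight_crossed_product = crossed_product free_group tight_topology V_action phi"

definition tight_monomial ::
  "(('a list \<times> 'v set) option set \<Rightarrow> complex) \<Rightarrow> 'a letter list
    \<Rightarrow> (nat \<Rightarrow> 'a letter list \<Rightarrow> ('a list \<times> 'v set) option set \<Rightarrow> complex) set" where
  "tight_monomial f t = crossed_monomial free_group tight_topology V_action phi f t"

end

end

theory Submission
  imports Defs "HOL-Library.Sublist"
begin

text \<open>Let \<open>\<Psi>\<close> be the *-homomorphism from the free *-algebra on the generators to the algebraic crossed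
  product with \<open>p\<^sub>A \<mapsto> 1\<^sub>A \<delta>\<^sub>\<omega>\<close> and \<open>s\<^sub>a \<mapsto> 1\<^sub>a \<delta>\<^sub>a\<close>, and let \<open>N (\<Sum> f\<^sub>t \<delta>\<^sub>t) = \<Sum> \<parallel>f\<^sub>t\<parallel>\<close> with sup
  norms. The range of \<open>\<Psi>\<close> is dense for \<open>N\<close>, because linear combinations of characteristic functions
  of basic compact-open sets are uniformly dense in \<open>C\<^sub>0\<close> of the tight spectrum. So the two universal
  completions agree as soon as every C*-seminorm on the crossed product is at most \<open>N\<close> and every
  C*-seminorm \<open>p\<close> on the free algebra that respects the relations satisfies \<open>p x \<le> N (\<Psi> x)\<close>.

  By the C*-identity both bounds reduce to elements of degree \<open>\<omega>\<close>, and there to the fact that a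
  C*-seminorm on an algebra of bounded functions with enough square roots is at most the sup norm,
  provided that \<open>p x = 0\<close> whenever \<open>x\<close> has degree \<open>\<omega>\<close> and \<open>\<Psi> x = 0\<close>. Modulo the relations such an \<open>x\<close>
  is a combination of projections \<open>s\<^sub>\<alpha> p\<^sub>A s\<^sub>\<alpha>\<^sup>*\<close>, which multiply as in \<open>E(S)\<close>. Tightness enters at this
  point: if finitely many \<open>z\<close> cover \<open>e\<close> in \<open>E(S)\<close>, then by repeated use of the Cuntz-Krieger relation
  everything annihilated by the projections of all \<open>z\<close> is annihilated by that of \<open>e\<close>.\<close>

section \<open>Completions of *-algebras\<close>

text \<open>No Hilbert space occurs: a representation enters only through the C*-seminorm it
  induces, so both universal norms are suprema of seminorms, and the isomorphism comes from
  comparing two families of seminorms. A seminorm on the free algebra must be carried to the crossed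
  product although \<open>\<Psi>\<close> only has dense range. The carried seminorm is a limit for
  \<open>N\<close>, which is why \<open>N\<close> has to dominate seminorms on both sides.

  The reduction to degree \<open>\<omega>\<close> rests on this: if \<open>x\<close> is homogeneous
  of any degree, then \<open>x\<^sup>* x\<close> has degree \<open>\<omega>\<close> and
  \<open>p (x\<^sup>* x)\<close> is the square of \<open>p x\<close>. In degree
  \<open>\<omega>\<close> the comparison with the sup norm replaces the spectral radius by an
  explicit unitary, whose real part is the square root in question.

  The obstacle in the kernel statement is that the free algebra has no unit, so the complement of a
  projection is not an element.\<close>

locale star_alg =
  fixes R :: "('x, 'm) star_algebra_scheme"
  assumes plus_closed [simp]: "x \<in> carrier R \<Longrightarrow> y \<in> carrier R \<Longrightarrow> plus_sa R x y \<in> carrier R"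
    and scale_closed [simp]: "x \<in> carrier R \<Longrightarrow> scale_sa R c x \<in> carrier R"
    and times_closed [simp]: "x \<in> carrier R \<Longrightarrow> y \<in> carrier R \<Longrightarrow> times_sa R x y \<in> carrier R"
    and star_closed [simp]: "x \<in> carrier R \<Longrightarrow> star_sa R x \<in> carrier R"
    and carrier_nonempty: "carrier R \<noteq> {}"
    and plus_assoc: "x \<in> carrier R \<Longrightarrow> y \<in> carrier R \<Longrightarrow> z \<in> carrier R \<Longrightarrow>
      plus_sa R (plus_sa R x y) z = plus_sa R x (plus_sa R y z)"
    and plus_commute: "x \<in> carrier R \<Longrightarrow> y \<in> carrier R \<Longrightarrow> plus_sa R x y = plus_sa R y x"
    and plus_zero: "x \<in> carrier R \<Longrightarrow> y \<in> carrier R \<Longrightarrow> plus_sa R x (scale_sa R 0 y) = x"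
    and scale_one: "x \<in> carrier R \<Longrightarrow> scale_sa R 1 x = x"
    and scale_scale: "x \<in> carrier R \<Longrightarrow> scale_sa R c (scale_sa R d x) = scale_sa R (c * d) x"
    and scale_plus: "x \<in> carrier R \<Longrightarrow> y \<in> carrier R \<Longrightarrow>
      scale_sa R c (plus_sa R x y) = plus_sa R (scale_sa R c x) (scale_sa R c y)"
    and scale_add: "x \<in> carrier R \<Longrightarrow>
      scale_sa R (c + d) x = plus_sa R (scale_sa R c x) (scale_sa R d x)"
    and times_plus: "x \<in> carrier R \<Longrightarrow> y \<in> carrier R \<Longrightarrow> z \<in> carrier R \<Longrightarrow>
      times_sa R x (plus_sa R y z) = plus_sa R (times_sa R x y) (times_sa R x z)"
    and plus_times: "x \<in> carrier R \<Longrightarrow> y \<in> carrier R \<Longrightarrow> z \<in> carrier R \<Longrightarrow>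
      times_sa R (plus_sa R x y) z = plus_sa R (times_sa R x z) (times_sa R y z)"
    and times_scale: "x \<in> carrier R \<Longrightarrow> y \<in> carrier R \<Longrightarrow>
      times_sa R x (scale_sa R c y) = scale_sa R c (times_sa R x y)"
    and scale_times: "x \<in> carrier R \<Longrightarrow> y \<in> carrier R \<Longrightarrow>
      times_sa R (scale_sa R c x) y = scale_sa R c (times_sa R x y)"
    and star_plus: "x \<in> carrier R \<Longrightarrow> y \<in> carrier R \<Longrightarrow>
      star_sa R (plus_sa R x y) = plus_sa R (star_sa R x) (star_sa R y)"
    and star_scale: "x \<in> carrier R \<Longrightarrow> star_sa R (scale_sa R c x) = scale_sa R (cnj c) (star_sa R x)"
    and star_star [simp]: "x \<in> carrier R \<Longrightarrow> star_sa R (star_sa R x) = x"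
begin

abbreviation add (infixl "\<oplus>" 65) where "x \<oplus> y \<equiv> plus_sa R x y"
abbreviation smult (infixr "\<odot>" 75) where "c \<odot> x \<equiv> scale_sa R c x"
abbreviation mul (infixl "\<cdot>" 70) where "x \<cdot> y \<equiv> times_sa R x y"
abbreviation adj ("(_)\<^sup>\<star>" [1000] 999) where "x\<^sup>\<star> \<equiv> star_sa R x"
abbreviation sub (infixl "\<ominus>" 65) where "x \<ominus> y \<equiv> diff_sa R x y"

lemma diff_closed [simp]: "x \<in> carrier R \<Longrightarrow> y \<in> carrier R \<Longrightarrow> x \<ominus> y \<in> carrier R"
  by (simp add: diff_sa_def)

text \<open>The signature has no constant for zero; \<open>0 \<odot> x\<close>, for any
  \<open>x\<close> in the carrier, takes its place throughout.\<close>

lemma diff_self: "x \<in> carrier R \<Longrightarrow> x \<ominus> x = 0 \<odot> x"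
  using scale_add[of x 1 "-1"] by (simp add: diff_sa_def scale_one)

lemma zero_plus: "x \<in> carrier R \<Longrightarrow> y \<in> carrier R \<Longrightarrow> 0 \<odot> y \<oplus> x = x"
  by (simp add: plus_commute[of "0 \<odot> y"] plus_zero)

lemma diff_flip: "x \<in> carrier R \<Longrightarrow> y \<in> carrier R \<Longrightarrow> y \<ominus> x = (-1) \<odot> (x \<ominus> y)"
  by (simp add: diff_sa_def scale_plus scale_scale scale_one plus_commute[of y])

lemma diff_plus_diff:
  assumes "x \<in> carrier R" "y \<in> carrier R" "z \<in> carrier R"
  shows "(x \<ominus> y) \<oplus> (y \<ominus> z) = x \<ominus> z"
proof -
  have "(-1) \<odot> y \<oplus> (y \<oplus> (-1) \<odot> z) = (-1) \<odot> y \<oplus> y \<oplus> (-1) \<odot> z"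
    using assms by (simp add: plus_assoc)
  also have "(-1) \<odot> y \<oplus> y = 0 \<odot> y"
    using assms scale_add[of y "-1" 1] by (simp add: scale_one)
  finally show ?thesis
    using assms by (simp add: diff_sa_def plus_assoc zero_plus)
qed

lemma plus_diff_cancel:
  assumes "x \<in> carrier R" "y \<in> carrier R"
  shows "y \<oplus> (x \<ominus> y) = x"
proof -
  have "y \<oplus> (x \<ominus> y) = y \<oplus> ((-1) \<odot> y \<oplus> x)"
    using assms by (simp add: diff_sa_def plus_commute[of x])
  also have "\<dots> = (y \<ominus> y) \<oplus> x"
    using assms by (simp add: diff_sa_def plus_assoc)
  finally show ?thesis
    using assms by (simp add: diff_self zero_plus)
qed

lemma plus_diff_plus:
  assumes "x \<in> carrier R" "y \<in> carrier R" "x' \<in> carrier R" "y' \<in> carrier R"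
  shows "(x \<oplus> x') \<ominus> (y \<oplus> y') = (x \<ominus> y) \<oplus> (x' \<ominus> y')"
proof -
  have "x' \<oplus> ((-1) \<odot> y \<oplus> (-1) \<odot> y') = (x' \<oplus> (-1) \<odot> y) \<oplus> (-1) \<odot> y'"
    using assms by (simp only: plus_assoc scale_closed)
  also have "\<dots> = ((-1) \<odot> y \<oplus> x') \<oplus> (-1) \<odot> y'"
    using assms by (simp only: plus_commute[of x'] scale_closed)
  also have "\<dots> = (-1) \<odot> y \<oplus> (x' \<oplus> (-1) \<odot> y')"
    using assms by (simp only: plus_assoc scale_closed)
  finally have "x' \<oplus> ((-1) \<odot> y \<oplus> (-1) \<odot> y') = (-1) \<odot> y \<oplus> (x' \<oplus> (-1) \<odot> y')" .
  then show ?thesis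
    using assms by (simp add: diff_sa_def scale_plus plus_assoc)
qed

lemma scale_diff: "x \<in> carrier R \<Longrightarrow> y \<in> carrier R \<Longrightarrow> c \<odot> (x \<ominus> y) = c \<odot> x \<ominus> c \<odot> y"
  by (simp add: diff_sa_def scale_plus scale_scale mult.commute)

lemma times_diff: "x \<in> carrier R \<Longrightarrow> y \<in> carrier R \<Longrightarrow> z \<in> carrier R \<Longrightarrow>
    x \<cdot> (y \<ominus> z) = x \<cdot> y \<ominus> x \<cdot> z"
  by (simp add: diff_sa_def times_plus times_scale)

lemma diff_times: "x \<in> carrier R \<Longrightarrow> y \<in> carrier R \<Longrightarrow> z \<in> carrier R \<Longrightarrow>
    (x \<ominus> y) \<cdot> z = x \<cdot> z \<ominus> y \<cdot> z"
  by (simp add: diff_sa_def plus_times scale_times)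

lemma star_diff: "x \<in> carrier R \<Longrightarrow> y \<in> carrier R \<Longrightarrow> (x \<ominus> y)\<^sup>\<star> = x\<^sup>\<star> \<ominus> y\<^sup>\<star>"
  by (simp add: diff_sa_def star_plus star_scale)

text \<open>The splitting behind continuity of multiplication, both on Cauchy sequences and when a
  seminorm is extended from a dense image.\<close>

lemma times_diff_times:
  assumes "x \<in> carrier R" "y \<in> carrier R" "x' \<in> carrier R" "y' \<in> carrier R"
  shows "x \<cdot> x' \<ominus> y \<cdot> y' = x \<cdot> (x' \<ominus> y') \<oplus> (x \<ominus> y) \<cdot> y'"
  using assms by (simp add: times_diff diff_times diff_plus_diff)

end

section \<open>C*-seminorms and the operations on Hausdorff completions\<close>

locale cstar_seminormed = star_alg +
  fixes p :: "'a \<Rightarrow> real"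
  assumes cstar: "cstar_seminorm R p"
begin

lemma p_nonneg [simp]: "x \<in> carrier R \<Longrightarrow> 0 \<le> p x"
  and p_plus: "x \<in> carrier R \<Longrightarrow> y \<in> carrier R \<Longrightarrow> p (x \<oplus> y) \<le> p x + p y"
  and p_scale: "x \<in> carrier R \<Longrightarrow> p (c \<odot> x) = cmod c * p x"
  and p_times: "x \<in> carrier R \<Longrightarrow> y \<in> carrier R \<Longrightarrow> p (x \<cdot> y) \<le> p x * p y"
  and p_cstar: "x \<in> carrier R \<Longrightarrow> p (x\<^sup>\<star> \<cdot> x) = (p x)\<^sup>2"
  using cstar by (simp_all add: cstar_seminorm_def)

text \<open>Isometry of the adjoint is not part of \<open>cstar_seminorm\<close>. The C*-identity
  and submultiplicativity bound the square of \<open>p x\<close> by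
  \<open>p (x\<^sup>\<star>) * p x\<close>; cancelling \<open>p x\<close>, and applying the result
  to the adjoint as well, gives equality.\<close>

lemma p_star [simp]:
  assumes "x \<in> carrier R"
  shows "p (x\<^sup>\<star>) = p x"
proof -
  have le: "p x \<le> p (x\<^sup>\<star>)" if "x \<in> carrier R" for x
  proof -
    have "p x * p x \<le> p (x\<^sup>\<star>) * p x"
      using p_cstar[OF that] p_times[of "x\<^sup>\<star>" x] that by (simp add: power2_eq_square)
    then show ?thesis
      using p_nonneg[OF that] p_nonneg[of "x\<^sup>\<star>"] that
      by (cases "p x = 0") (auto simp: mult_le_cancel_right)
  qed
  from le[of x] le[of "x\<^sup>\<star>"] assms show ?thesis by simp
qed

lemma p_diff_self [simp]: "x \<in> carrier R \<Longrightarrow> p (x \<ominus> x) = 0"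
  by (simp add: diff_self p_scale)

lemma p_diff_commute: "x \<in> carrier R \<Longrightarrow> y \<in> carrier R \<Longrightarrow> p (x \<ominus> y) = p (y \<ominus> x)"
  by (subst diff_flip) (simp_all add: p_scale)

lemma p_diff_triangle:
  "x \<in> carrier R \<Longrightarrow> y \<in> carrier R \<Longrightarrow> z \<in> carrier R \<Longrightarrow> p (x \<ominus> z) \<le> p (x \<ominus> y) + p (y \<ominus> z)"
  by (metis diff_closed diff_plus_diff p_plus)

lemma p_le_diff: "x \<in> carrier R \<Longrightarrow> y \<in> carrier R \<Longrightarrow> p x \<le> p y + p (x \<ominus> y)"
  by (metis diff_closed plus_diff_cancel p_plus)

lemma p_diff_abs: "x \<in> carrier R \<Longrightarrow> y \<in> carrier R \<Longrightarrow> \<bar>p x - p y\<bar> \<le> p (x \<ominus> y)"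
  using p_le_diff[of x y] p_le_diff[of y x] p_diff_commute[of x y] by auto

lemma p_plus_diff_plus:
  "x \<in> carrier R \<Longrightarrow> y \<in> carrier R \<Longrightarrow> x' \<in> carrier R \<Longrightarrow> y' \<in> carrier R \<Longrightarrow>
    p ((x \<oplus> x') \<ominus> (y \<oplus> y')) \<le> p (x \<ominus> y) + p (x' \<ominus> y')"
  by (simp add: plus_diff_plus p_plus)

lemma p_times_diff_times:
  assumes "x \<in> carrier R" "y \<in> carrier R" "x' \<in> carrier R" "y' \<in> carrier R"
  shows "p (x \<cdot> x' \<ominus> y \<cdot> y') \<le> p x * p (x' \<ominus> y') + p (x \<ominus> y) * p y'"
proof -
  have "p (x \<cdot> x' \<ominus> y \<cdot> y') \<le> p (x \<cdot> (x' \<ominus> y')) + p ((x \<ominus> y) \<cdot> y')"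
    using assms by (simp add: times_diff_times p_plus)
  with p_times[of x "x' \<ominus> y'"] p_times[of "x \<ominus> y" y'] assms show ?thesis
    by simp
qed

lemma cauchy_in_carrier [simp]: "X \<in> cauchy_seqs R p \<Longrightarrow> X n \<in> carrier R"
  by (auto simp: cauchy_seqs_def)

lemma cauchy_seqsI:
  assumes "\<And>n. X n \<in> carrier R"
    and "\<And>e. e > 0 \<Longrightarrow> \<exists>N. \<forall>m\<ge>N. \<forall>n\<ge>N. p (X m \<ominus> X n) < e"
  shows "X \<in> cauchy_seqs R p"
  using assms by (auto simp: cauchy_seqs_def)

lemma cauchy_seqsD:
  assumes "X \<in> cauchy_seqs R p" "e > 0"
  shows "\<exists>N. \<forall>m\<ge>N. \<forall>n\<ge>N. p (X m \<ominus> X n) < e"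
  using assms by (auto simp: cauchy_seqs_def)

lemma cauchy_bounded:
  assumes "X \<in> cauchy_seqs R p"
  obtains K where "K > 0" "\<And>n. p (X n) \<le> K"
proof -
  from assms obtain N where N: "\<And>m n. m \<ge> N \<Longrightarrow> n \<ge> N \<Longrightarrow> p (X m \<ominus> X n) < 1"
    using cauchy_seqsD[OF assms, of 1] by auto
  \<comment> \<open>From \<open>N\<close> on all terms are within 1 of \<open>X N\<close>; the
    finite sum takes care of the earlier ones. Strict positivity matters because later estimates
    divide by the bound.\<close>
  define K where "K = p (X N) + 1 + (\<Sum>n<N. p (X n))"
  have "p (X n) \<le> K" for n
  proof (cases "n < N")
    case True
    then have "p (X n) \<le> (\<Sum>n<N. p (X n))"
      using assms by (intro member_le_sum) auto
    then show ?thesis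
      using assms by (simp add: K_def add_increasing)
  next
    case False
    then have "p (X n) \<le> p (X N) + 1"
      using p_le_diff[of "X n" "X N"] N[of n N] assms by simp
    moreover have "0 \<le> (\<Sum>n<N. p (X n))"
      using assms by (intro sum_nonneg) auto
    ultimately show ?thesis by (simp add: K_def)
  qed
  moreover have "K > 0"
  proof -
    have "0 \<le> (\<Sum>n<N. p (X n))" "0 \<le> p (X N)"
      using assms by (auto intro: sum_nonneg)
    then show ?thesis by (simp add: K_def)
  qed
  ultimately show ?thesis by (rule that[rotated])
qed

lemma const_cauchy [simp]: "x \<in> carrier R \<Longrightarrow> (\<lambda>n. x) \<in> cauchy_seqs R p"
  by (intro cauchy_seqsI) auto

lemma plus_cauchy [simp]:
  assumes "X \<in> cauchy_seqs R p" "Y \<in> cauchy_seqs R p"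
  shows "(\<lambda>n. X n \<oplus> Y n) \<in> cauchy_seqs R p"
proof (rule cauchy_seqsI)
  fix e :: real assume "e > 0"
  then obtain M N where M: "\<forall>m\<ge>M. \<forall>n\<ge>M. p (X m \<ominus> X n) < e / 2"
    and N: "\<forall>m\<ge>N. \<forall>n\<ge>N. p (Y m \<ominus> Y n) < e / 2"
    using cauchy_seqsD[OF assms(1), of "e / 2"] cauchy_seqsD[OF assms(2), of "e / 2"] by auto
  have "p ((X m \<oplus> Y m) \<ominus> (X n \<oplus> Y n)) < e" if "m \<ge> max M N" "n \<ge> max M N" for m n
  proof -
    have "p ((X m \<oplus> Y m) \<ominus> (X n \<oplus> Y n)) \<le> p (X m \<ominus> X n) + p (Y m \<ominus> Y n)"
      using assms by (intro p_plus_diff_plus) auto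
    moreover have "p (X m \<ominus> X n) < e / 2" "p (Y m \<ominus> Y n) < e / 2"
      using M N that by auto
    ultimately show ?thesis by linarith
  qed
  then show "\<exists>N. \<forall>m\<ge>N. \<forall>n\<ge>N. p ((X m \<oplus> Y m) \<ominus> (X n \<oplus> Y n)) < e"
    by blast
qed (use assms in simp)

lemma scale_cauchy [simp]:
  assumes "X \<in> cauchy_seqs R p"
  shows "(\<lambda>n. c \<odot> X n) \<in> cauchy_seqs R p"
proof (rule cauchy_seqsI)
  fix e :: real assume "e > 0"
  \<comment> \<open>The summand 1 in the denominator covers the case \<open>c = 0\<close>.\<close>
  then obtain N where N: "\<forall>m\<ge>N. \<forall>n\<ge>N. p (X m \<ominus> X n) < e / (cmod c + 1)"
    using cauchy_seqsD[OF assms, of "e / (cmod c + 1)"] by (auto simp: add_nonneg_pos)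
  have "p (c \<odot> X m \<ominus> c \<odot> X n) < e" if "m \<ge> N" "n \<ge> N" for m n
  proof -
    have "p (c \<odot> X m \<ominus> c \<odot> X n) = cmod c * p (X m \<ominus> X n)"
      using assms by (simp add: p_scale flip: scale_diff)
    also have "\<dots> \<le> (cmod c + 1) * p (X m \<ominus> X n)"
      using assms by (simp add: mult_right_mono)
    also have "\<dots> < (cmod c + 1) * (e / (cmod c + 1))"
      using N that by (intro mult_strict_left_mono) (auto simp: add_nonneg_pos)
    also have "\<dots> = e"
      by (simp add: add_nonneg_eq_0_iff)
    finally show ?thesis .
  qed
  then show "\<exists>N. \<forall>m\<ge>N. \<forall>n\<ge>N. p (c \<odot> X m \<ominus> c \<odot> X n) < e"
    by blast
qed (use assms in simp)

lemma star_cauchy [simp]: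
  assumes "X \<in> cauchy_seqs R p"
  shows "(\<lambda>n. (X n)\<^sup>\<star>) \<in> cauchy_seqs R p"
proof (rule cauchy_seqsI)
  fix e :: real assume "e > 0"
  with cauchy_seqsD[OF assms this]
  show "\<exists>N. \<forall>m\<ge>N. \<forall>n\<ge>N. p ((X m)\<^sup>\<star> \<ominus> (X n)\<^sup>\<star>) < e"
    using assms by (simp flip: star_diff)
qed (use assms in simp)

lemma times_cauchy [simp]:
  assumes "X \<in> cauchy_seqs R p" "Y \<in> cauchy_seqs R p"
  shows "(\<lambda>n. X n \<cdot> Y n) \<in> cauchy_seqs R p"
proof (rule cauchy_seqsI)
  fix e :: real assume e: "e > 0"
  obtain K where K: "K > 0" "\<And>n. p (X n) \<le> K"
    using cauchy_bounded[OF assms(1)] by auto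
  obtain L where L: "L > 0" "\<And>n. p (Y n) \<le> L"
    using cauchy_bounded[OF assms(2)] by auto
  obtain M N where M: "\<forall>m\<ge>M. \<forall>n\<ge>M. p (X m \<ominus> X n) < e / (2 * L)"
    and N: "\<forall>m\<ge>N. \<forall>n\<ge>N. p (Y m \<ominus> Y n) < e / (2 * K)"
    using cauchy_seqsD[OF assms(1), of "e / (2 * L)"] cauchy_seqsD[OF assms(2), of "e / (2 * K)"]
      e K L by auto
  have "p (X m \<cdot> Y m \<ominus> X n \<cdot> Y n) < e" if "m \<ge> max M N" "n \<ge> max M N" for m n
  proof -
    have "p (X m \<cdot> Y m \<ominus> X n \<cdot> Y n) \<le> p (X m) * p (Y m \<ominus> Y n) + p (X m \<ominus> X n) * p (Y n)"
      using assms by (intro p_times_diff_times) auto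
    also have "\<dots> \<le> K * p (Y m \<ominus> Y n) + p (X m \<ominus> X n) * L"
      using assms K L by (intro add_mono mult_mono) (auto simp: less_imp_le)
    also have "\<dots> < K * (e / (2 * K)) + e / (2 * L) * L"
      using M N K L that by (intro add_strict_mono mult_strict_left_mono mult_strict_right_mono) auto
    also have "\<dots> = e"
      using K L by simp
    finally show ?thesis .
  qed
  then show "\<exists>N. \<forall>m\<ge>N. \<forall>n\<ge>N. p (X m \<cdot> Y m \<ominus> X n \<cdot> Y n) < e"
    by blast
qed (use assms in simp)

lemma null_relI:
  assumes "X \<in> cauchy_seqs R p" "Y \<in> cauchy_seqs R p" "(\<lambda>n. p (X n \<ominus> Y n)) \<longlonglongrightarrow> 0"
  shows "(X, Y) \<in> null_rel R p"
  using assms by (simp add: null_rel_def)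

lemma null_rel_bound:
  assumes "X \<in> cauchy_seqs R p" "Y \<in> cauchy_seqs R p"
    and "\<And>n. p (X n \<ominus> Y n) \<le> b n" "b \<longlonglongrightarrow> 0"
  shows "(X, Y) \<in> null_rel R p"
proof (rule null_relI[OF assms(1,2)])
  show "(\<lambda>n. p (X n \<ominus> Y n)) \<longlonglongrightarrow> 0"
  proof (rule tendsto_sandwich[OF _ _ tendsto_const assms(4)])
    show "\<forall>\<^sub>F n in sequentially. 0 \<le> p (X n \<ominus> Y n)"
      using assms(1,2) by (intro always_eventually allI p_nonneg diff_closed cauchy_in_carrier)
    show "\<forall>\<^sub>F n in sequentially. p (X n \<ominus> Y n) \<le> b n"
      using assms(3) by (intro always_eventually allI)
  qed
qed

lemma equiv_null_rel: "equiv (cauchy_seqs R p) (null_rel R p)"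
proof (rule equivI)
  show "null_rel R p \<subseteq> cauchy_seqs R p \<times> cauchy_seqs R p"
    by (auto simp: null_rel_def)
  show "refl_on (cauchy_seqs R p) (null_rel R p)"
    by (intro refl_onI null_relI) simp_all
  show "sym (null_rel R p)"
  proof (rule symI)
    fix X Y assume "(X, Y) \<in> null_rel R p"
    then have c: "X \<in> cauchy_seqs R p" "Y \<in> cauchy_seqs R p" and "(\<lambda>n. p (X n \<ominus> Y n)) \<longlonglongrightarrow> 0"
      by (auto simp: null_rel_def)
    moreover have "p (X n \<ominus> Y n) = p (Y n \<ominus> X n)" for n
      using c by (intro p_diff_commute cauchy_in_carrier)
    ultimately show "(Y, X) \<in> null_rel R p"
      by (simp add: null_rel_def)
  qed
  show "trans (null_rel R p)"
  proof (rule transI)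
    fix X Y Z assume XY: "(X, Y) \<in> null_rel R p" and YZ: "(Y, Z) \<in> null_rel R p"
    then have c: "X \<in> cauchy_seqs R p" "Y \<in> cauchy_seqs R p" "Z \<in> cauchy_seqs R p"
      by (auto simp: null_rel_def)
    have "(\<lambda>n. p (X n \<ominus> Y n) + p (Y n \<ominus> Z n)) \<longlonglongrightarrow> 0 + 0"
      using XY YZ by (intro tendsto_add) (auto simp: null_rel_def)
    then show "(X, Z) \<in> null_rel R p"
      using c by (intro null_rel_bound[of _ _ "\<lambda>n. p (X n \<ominus> Y n) + p (Y n \<ominus> Z n)"] p_diff_triangle) auto
  qed
qed

definition cls :: "(nat \<Rightarrow> 'a) \<Rightarrow> (nat \<Rightarrow> 'a) set" where
  "cls X = null_rel R p `` {X}"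

lemma carrier_completion: "carrier (completion R p) = cls ` cauchy_seqs R p"
  by (auto simp: completion_def cls_def quotient_def)

lemma completion_embed_eq: "completion_embed R p x = cls (\<lambda>n. x)"
  by (simp add: completion_embed_def cls_def)

lemma cls_eq_iff:
  "X \<in> cauchy_seqs R p \<Longrightarrow> Y \<in> cauchy_seqs R p \<Longrightarrow>
    cls X = cls Y \<longleftrightarrow> (\<lambda>n. p (X n \<ominus> Y n)) \<longlonglongrightarrow> 0"
  unfolding cls_def using eq_equiv_class_iff[OF equiv_null_rel, of X Y] by (simp add: null_rel_def)

lemma cls_eqI: "(X, Y) \<in> null_rel R p \<Longrightarrow> cls X = cls Y"
  unfolding cls_def using equiv_class_eq[OF equiv_null_rel] .

text \<open>The operations of \<open>completion\<close> are unions over representatives. A union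
  over a class of a function constant on that class is the value at any representative, so each
  operation reduces to well-definedness.\<close>

lemma UN_cls:
  assumes "X \<in> cauchy_seqs R p"
    and "\<And>X Y. (X, Y) \<in> null_rel R p \<Longrightarrow> f X = f Y"
  shows "(\<Union>X\<in>cls X. f X) = f X"
  unfolding cls_def
  by (rule UN_equiv_class[OF equiv_null_rel _ assms(1)]) (use assms(2) in \<open>auto simp: congruent_def\<close>)

lemma UN_cls2:
  assumes "X \<in> cauchy_seqs R p" "Y \<in> cauchy_seqs R p"
    and "\<And>X X' Y Y'. (X, X') \<in> null_rel R p \<Longrightarrow> (Y, Y') \<in> null_rel R p \<Longrightarrow> cls (f X Y) = cls (f X' Y')"
  shows "(\<Union>X\<in>cls X. \<Union>Y\<in>cls Y. cls (f X Y)) = cls (f X Y)"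
proof -
  have "congruent2 (null_rel R p) (null_rel R p) (\<lambda>X Y. cls (f X Y))"
    using assms(3) by (auto simp: congruent2_def)
  from UN_equiv_class2[OF equiv_null_rel equiv_null_rel this assms(1,2)]
  show ?thesis by (simp add: cls_def)
qed

lemma null_relD:
  assumes "(X, Y) \<in> null_rel R p"
  shows "X \<in> cauchy_seqs R p" "Y \<in> cauchy_seqs R p" "(\<lambda>n. p (X n \<ominus> Y n)) \<longlonglongrightarrow> 0"
  using assms by (auto simp: null_rel_def)

lemma plus_completion:
  assumes "X \<in> cauchy_seqs R p" "Y \<in> cauchy_seqs R p"
  shows "plus_sa (completion R p) (cls X) (cls Y) = cls (\<lambda>n. X n \<oplus> Y n)"
proof -
  have "cls (\<lambda>n. X n \<oplus> Y n) = cls (\<lambda>n. X' n \<oplus> Y' n)"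
    if "(X, X') \<in> null_rel R p" "(Y, Y') \<in> null_rel R p" for X X' Y Y'
  proof (rule cls_eqI)
    note c = null_relD[OF that(1)] null_relD[OF that(2)]
    have "(\<lambda>n. p (X n \<ominus> X' n) + p (Y n \<ominus> Y' n)) \<longlonglongrightarrow> 0"
      using tendsto_add[OF c(3,6)] by simp
    then show "(\<lambda>n. X n \<oplus> Y n, \<lambda>n. X' n \<oplus> Y' n) \<in> null_rel R p"
      using c by (intro null_rel_bound[of _ _ "\<lambda>n. p (X n \<ominus> X' n) + p (Y n \<ominus> Y' n)"] p_plus_diff_plus) simp_all
  qed
  from UN_cls2[OF assms this] show ?thesis
    by (simp add: completion_def cls_def)
qed

lemma times_completion:
  assumes "X \<in> cauchy_seqs R p" "Y \<in> cauchy_seqs R p"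
  shows "times_sa (completion R p) (cls X) (cls Y) = cls (\<lambda>n. X n \<cdot> Y n)"
proof -
  have "cls (\<lambda>n. X n \<cdot> Y n) = cls (\<lambda>n. X' n \<cdot> Y' n)"
    if "(X, X') \<in> null_rel R p" "(Y, Y') \<in> null_rel R p" for X X' Y Y'
  proof (rule cls_eqI)
    note c = null_relD[OF that(1)] null_relD[OF that(2)]
    obtain K where K: "K > 0" "\<And>n. p (X n) \<le> K"
      using cauchy_bounded[OF c(1)] by auto
    obtain L where L: "L > 0" "\<And>n. p (Y' n) \<le> L"
      using cauchy_bounded[OF c(5)] by auto
    have "(\<lambda>n. K * p (Y n \<ominus> Y' n) + p (X n \<ominus> X' n) * L) \<longlonglongrightarrow> K * 0 + 0 * L"
      using c by (intro tendsto_intros)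
    moreover have "p (X n \<cdot> Y n \<ominus> X' n \<cdot> Y' n) \<le> K * p (Y n \<ominus> Y' n) + p (X n \<ominus> X' n) * L" for n
    proof -
      have "p (X n \<cdot> Y n \<ominus> X' n \<cdot> Y' n) \<le> p (X n) * p (Y n \<ominus> Y' n) + p (X n \<ominus> X' n) * p (Y' n)"
        using c by (intro p_times_diff_times) simp_all
      also have "\<dots> \<le> K * p (Y n \<ominus> Y' n) + p (X n \<ominus> X' n) * L"
        using c K L by (intro add_mono mult_mono) (simp_all add: less_imp_le)
      finally show ?thesis .
    qed
    ultimately show "(\<lambda>n. X n \<cdot> Y n, \<lambda>n. X' n \<cdot> Y' n) \<in> null_rel R p"
      using c by (intro null_rel_bound[of _ _ "\<lambda>n. K * p (Y n \<ominus> Y' n) + p (X n \<ominus> X' n) * L"]) simp_all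
  qed
  from UN_cls2[OF assms this] show ?thesis
    by (simp add: completion_def cls_def)
qed

lemma scale_completion:
  assumes "X \<in> cauchy_seqs R p"
  shows "scale_sa (completion R p) c (cls X) = cls (\<lambda>n. c \<odot> X n)"
proof -
  have "cls (\<lambda>n. c \<odot> X n) = cls (\<lambda>n. c \<odot> Y n)" if "(X, Y) \<in> null_rel R p" for X Y
  proof (rule cls_eqI)
    note c = null_relD[OF that]
    have "(\<lambda>n. cmod c * p (X n \<ominus> Y n)) \<longlonglongrightarrow> 0"
      using tendsto_mult_left[OF c(3)] by simp
    with c show "(\<lambda>n. c \<odot> X n, \<lambda>n. c \<odot> Y n) \<in> null_rel R p"
      by (intro null_relI) (simp_all add: p_scale flip: scale_diff)
  qed
  from UN_cls[OF assms this] show ?thesis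
    by (simp add: completion_def cls_def)
qed

lemma star_completion:
  assumes "X \<in> cauchy_seqs R p"
  shows "star_sa (completion R p) (cls X) = cls (\<lambda>n. (X n)\<^sup>\<star>)"
proof -
  have "cls (\<lambda>n. (X n)\<^sup>\<star>) = cls (\<lambda>n. (Y n)\<^sup>\<star>)" if "(X, Y) \<in> null_rel R p" for X Y
    using null_relD[OF that] by (intro cls_eqI null_relI) (simp_all flip: star_diff)
  from UN_cls[OF assms this] show ?thesis
    by (simp add: completion_def cls_def)
qed

end

section \<open>Homomorphisms and isomorphisms of completions\<close>

definition star_hom ::
  "('x, 'm) star_algebra_scheme \<Rightarrow> ('y, 'n) star_algebra_scheme \<Rightarrow> ('x \<Rightarrow> 'y) \<Rightarrow> bool" where
  "star_hom R S \<Psi> \<longleftrightarrow>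
     \<Psi> ` carrier R \<subseteq> carrier S \<and>
     (\<forall>x\<in>carrier R. \<forall>y\<in>carrier R. \<Psi> (plus_sa R x y) = plus_sa S (\<Psi> x) (\<Psi> y)) \<and>
     (\<forall>c. \<forall>x\<in>carrier R. \<Psi> (scale_sa R c x) = scale_sa S c (\<Psi> x)) \<and>
     (\<forall>x\<in>carrier R. \<forall>y\<in>carrier R. \<Psi> (times_sa R x y) = times_sa S (\<Psi> x) (\<Psi> y)) \<and>
     (\<forall>x\<in>carrier R. \<Psi> (star_sa R x) = star_sa S (\<Psi> x))"

locale star_hom_pair = R: star_alg R + S: star_alg S
  for R :: "('x, 'm) star_algebra_scheme" and S :: "('y, 'n) star_algebra_scheme" +
  fixes \<Psi> :: "'x \<Rightarrow> 'y"
  assumes hom: "star_hom R S \<Psi>"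
begin

lemma hom_closed [simp]: "x \<in> carrier R \<Longrightarrow> \<Psi> x \<in> carrier S"
  and hom_plus: "x \<in> carrier R \<Longrightarrow> y \<in> carrier R \<Longrightarrow> \<Psi> (plus_sa R x y) = plus_sa S (\<Psi> x) (\<Psi> y)"
  and hom_scale: "x \<in> carrier R \<Longrightarrow> \<Psi> (scale_sa R c x) = scale_sa S c (\<Psi> x)"
  and hom_times: "x \<in> carrier R \<Longrightarrow> y \<in> carrier R \<Longrightarrow> \<Psi> (times_sa R x y) = times_sa S (\<Psi> x) (\<Psi> y)"
  and hom_star: "x \<in> carrier R \<Longrightarrow> \<Psi> (star_sa R x) = star_sa S (\<Psi> x)"
  using hom by (auto simp: star_hom_def)

lemma hom_diff: "x \<in> carrier R \<Longrightarrow> y \<in> carrier R \<Longrightarrow> \<Psi> (diff_sa R x y) = diff_sa S (\<Psi> x) (\<Psi> y)"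
  by (simp add: diff_sa_def hom_plus hom_scale)

text \<open>An isometric homomorphism acts termwise on Cauchy sequences and is injective on classes.
  For surjectivity, the n-th term of a Cauchy sequence in \<open>S\<close> is approximated within
  \<open>1/(n+1)\<close> by an image; the chosen preimages are Cauchy because \<open>\<Psi>\<close>
  is isometric.\<close>

lemma completion_isomorphism:
  assumes R: "cstar_seminorm R p" and S: "cstar_seminorm S q"
    and iso: "\<And>x. x \<in> carrier R \<Longrightarrow> q (\<Psi> x) = p x"
    and dense: "\<And>y e. y \<in> carrier S \<Longrightarrow> e > 0 \<Longrightarrow> \<exists>x\<in>carrier R. q (diff_sa S y (\<Psi> x)) < e"
  shows "\<exists>\<psi>. star_isomorphism (completion R p) (completion S q) \<psi> \<and>
    (\<forall>x\<in>carrier R. \<psi> (completion_embed R p x) = completion_embed S q (\<Psi> x))"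
proof -
  interpret R: cstar_seminormed R p
    by unfold_locales (rule R)
  interpret S: cstar_seminormed S q
    by unfold_locales (rule S)
  have p_diff: "p (diff_sa R x y) = q (diff_sa S (\<Psi> x) (\<Psi> y))"
    if "x \<in> carrier R" "y \<in> carrier R" for x y
    using that by (simp add: iso flip: hom_diff)
  have cauchy: "(\<lambda>n. \<Psi> (X n)) \<in> cauchy_seqs S q" if "X \<in> cauchy_seqs R p" for X
    using that R.cauchy_seqsD[OF that] by (intro S.cauchy_seqsI) (simp_all add: p_diff)
  define \<psi> where "\<psi> = (\<lambda>x. \<Union>X\<in>x. S.cls (\<lambda>n. \<Psi> (X n)))"
  have \<psi>: "\<psi> (R.cls X) = S.cls (\<lambda>n. \<Psi> (X n))" if "X \<in> cauchy_seqs R p" for X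
    unfolding \<psi>_def
  proof (rule R.UN_cls[OF that])
    fix X Y assume "(X, Y) \<in> null_rel R p"
    note c = R.null_relD[OF this]
    then show "S.cls (\<lambda>n. \<Psi> (X n)) = S.cls (\<lambda>n. \<Psi> (Y n))"
      by (subst S.cls_eq_iff) (simp_all add: cauchy p_diff)
  qed
  have "star_isomorphism (completion R p) (completion S q) \<psi>"
    unfolding star_isomorphism_def
  proof (intro conjI ballI allI)
    show "bij_betw \<psi> (carrier (completion R p)) (carrier (completion S q))"
    proof (rule bij_betwI')
      fix x y assume "x \<in> carrier (completion R p)" "y \<in> carrier (completion R p)"
      then obtain X Y where "x = R.cls X" "X \<in> cauchy_seqs R p" "y = R.cls Y" "Y \<in> cauchy_seqs R p"
        by (auto simp: R.carrier_completion)
      then show "\<psi> x = \<psi> y \<longleftrightarrow> x = y"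
        by (simp add: \<psi> R.cls_eq_iff S.cls_eq_iff cauchy p_diff)
    next
      fix x assume "x \<in> carrier (completion R p)"
      then show "\<psi> x \<in> carrier (completion S q)"
        by (auto simp: R.carrier_completion S.carrier_completion \<psi> cauchy)
    next
      fix y assume "y \<in> carrier (completion S q)"
      then obtain Y where y: "y = S.cls Y" and Y: "Y \<in> cauchy_seqs S q"
        by (auto simp: S.carrier_completion)
      have "\<exists>x\<in>carrier R. q (diff_sa S (Y n) (\<Psi> x)) < inverse (real (Suc n))" for n
        using Y by (intro dense) simp_all
      then obtain X where X: "\<And>n. X n \<in> carrier R"
        and XY: "\<And>n. q (diff_sa S (Y n) (\<Psi> (X n))) < inverse (real (Suc n))"
        by metis
      have null: "(\<lambda>n. q (diff_sa S (Y n) (\<Psi> (X n)))) \<longlonglongrightarrow> 0"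
      proof (rule tendsto_sandwich[OF _ _ tendsto_const LIMSEQ_inverse_real_of_nat])
        show "\<forall>\<^sub>F n in sequentially. 0 \<le> q (diff_sa S (Y n) (\<Psi> (X n)))"
          using X Y by simp
        show "\<forall>\<^sub>F n in sequentially. q (diff_sa S (Y n) (\<Psi> (X n))) \<le> inverse (real (Suc n))"
          using XY by (intro always_eventually allI less_imp_le)
      qed
      have "X \<in> cauchy_seqs R p"
      proof (rule R.cauchy_seqsI[OF X])
        fix e :: real assume e: "e > 0"
        obtain N where N: "\<forall>m\<ge>N. \<forall>n\<ge>N. q (diff_sa S (Y m) (Y n)) < e / 3"
          using S.cauchy_seqsD[OF Y, of "e / 3"] e by auto
        obtain M where M: "\<forall>n\<ge>M. q (diff_sa S (Y n) (\<Psi> (X n))) < e / 3"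
          using LIMSEQ_D[OF null, of "e / 3"] e X Y by auto
        have "p (diff_sa R (X m) (X n)) < e" if "m \<ge> max M N" "n \<ge> max M N" for m n
        proof -
          have "p (diff_sa R (X m) (X n)) = q (diff_sa S (\<Psi> (X m)) (\<Psi> (X n)))"
            using X by (simp add: p_diff)
          also have "\<dots> \<le> q (diff_sa S (\<Psi> (X m)) (Y m)) + q (diff_sa S (Y m) (\<Psi> (X n)))"
            using X Y by (intro S.p_diff_triangle) simp_all
          also have "q (diff_sa S (Y m) (\<Psi> (X n))) \<le>
              q (diff_sa S (Y m) (Y n)) + q (diff_sa S (Y n) (\<Psi> (X n)))"
            using X Y by (intro S.p_diff_triangle) simp_all
          also have "q (diff_sa S (\<Psi> (X m)) (Y m)) = q (diff_sa S (Y m) (\<Psi> (X m)))"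
            using X Y by (intro S.p_diff_commute) simp_all
          finally have "p (diff_sa R (X m) (X n)) \<le> q (diff_sa S (Y m) (\<Psi> (X m))) +
              (q (diff_sa S (Y m) (Y n)) + q (diff_sa S (Y n) (\<Psi> (X n))))"
            by simp
          moreover have "q (diff_sa S (Y m) (\<Psi> (X m))) < e / 3" "q (diff_sa S (Y m) (Y n)) < e / 3"
            "q (diff_sa S (Y n) (\<Psi> (X n))) < e / 3"
            using M N that by auto
          ultimately show ?thesis by linarith
        qed
        then show "\<exists>N. \<forall>m\<ge>N. \<forall>n\<ge>N. p (diff_sa R (X m) (X n)) < e"
          by blast
      qed
      then show "\<exists>x\<in>carrier (completion R p). y = \<psi> x"
        using Y null by (intro bexI[of _ "R.cls X"])
          (simp_all add: R.carrier_completion \<psi> y S.cls_eq_iff cauchy)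
    qed
  next
    fix x y assume "x \<in> carrier (completion R p)" "y \<in> carrier (completion R p)"
    then obtain X Y where x: "x = R.cls X" "X \<in> cauchy_seqs R p"
      and y: "y = R.cls Y" "Y \<in> cauchy_seqs R p"
      by (auto simp: R.carrier_completion)
    show "\<psi> (plus_sa (completion R p) x y) = plus_sa (completion S q) (\<psi> x) (\<psi> y)"
      using x y by (simp add: R.plus_completion S.plus_completion \<psi> cauchy hom_plus)
    show "\<psi> (times_sa (completion R p) x y) = times_sa (completion S q) (\<psi> x) (\<psi> y)"
      using x y by (simp add: R.times_completion S.times_completion \<psi> cauchy hom_times)
  next
    fix c x assume "x \<in> carrier (completion R p)"
    then obtain X where x: "x = R.cls X" "X \<in> cauchy_seqs R p"
      by (auto simp: R.carrier_completion)
    then show "\<psi> (scale_sa (completion R p) c x) = scale_sa (completion S q) c (\<psi> x)"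
      by (simp add: R.scale_completion S.scale_completion \<psi> cauchy hom_scale)
  next
    fix x assume "x \<in> carrier (completion R p)"
    then obtain X where x: "x = R.cls X" "X \<in> cauchy_seqs R p"
      by (auto simp: R.carrier_completion)
    then show "\<psi> (star_sa (completion R p) x) = star_sa (completion S q) (\<psi> x)"
      by (simp add: R.star_completion S.star_completion \<psi> cauchy hom_star)
  qed
  moreover have "\<psi> (completion_embed R p x) = completion_embed S q (\<Psi> x)" if "x \<in> carrier R" for x
    using that by (simp add: R.completion_embed_eq S.completion_embed_eq \<psi>)
  ultimately show ?thesis by blast
qed

end

section \<open>The universal C*-seminorm\<close>

context star_alg
begin

text \<open>It respects every set of relations, so the supremum in \<open>universal_seminorm\<close>
  is never taken over the empty set.\<close>

lemma zero_cstar_seminorm: "cstar_seminorm R (\<lambda>x. 0)"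
  by (simp add: cstar_seminorm_def)

text \<open>The bound \<open>M\<close> is essential: a supremum of an unbounded set of reals has no
  meaningful value.\<close>

lemma universal_seminorm_upper:
  assumes "\<And>p. cstar_seminorm R p \<Longrightarrow> \<forall>(y, z)\<in>Rel. p (y \<ominus> z) = 0 \<Longrightarrow> p x \<le> M"
    and "cstar_seminorm R p" "\<forall>(y, z)\<in>Rel. p (y \<ominus> z) = 0"
  shows "p x \<le> universal_seminorm R Rel x"
  unfolding universal_seminorm_def using assms by (intro cSUP_upper bdd_aboveI2[of _ _ M]) auto

lemma universal_seminorm_least:
  assumes "\<And>p. cstar_seminorm R p \<Longrightarrow> \<forall>(y, z)\<in>Rel. p (y \<ominus> z) = 0 \<Longrightarrow> p x \<le> M"
  shows "universal_seminorm R Rel x \<le> M"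
proof -
  have "(\<lambda>x. 0) \<in> {p. cstar_seminorm R p \<and> (\<forall>(y, z)\<in>Rel. p (y \<ominus> z) = 0)}"
    using zero_cstar_seminorm by auto
  then show ?thesis
    unfolding universal_seminorm_def using assms by (intro cSUP_least) auto
qed

text \<open>Inequalities pass to a pointwise supremum at once. The two equalities are proved as
  pairs of inequalities, and in the harder direction the supremum is isolated first, by a square
  root for the C*-identity and by dividing by \<open>cmod c\<close> for homogeneity.\<close>

lemma cstar_universal_seminorm:
  assumes bound: "\<And>p x. cstar_seminorm R p \<Longrightarrow> \<forall>(y, z)\<in>Rel. p (y \<ominus> z) = 0 \<Longrightarrow> x \<in> carrier R \<Longrightarrow> p x \<le> M x"
  shows "cstar_seminorm R (universal_seminorm R Rel)"
proof -
  let ?u = "universal_seminorm R Rel"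
  have upper: "p x \<le> ?u x"
    if "cstar_seminorm R p" "\<forall>(y, z)\<in>Rel. p (y \<ominus> z) = 0" "x \<in> carrier R" for p x
    by (rule universal_seminorm_upper[OF bound that(1,2)]) (use that(3) in simp_all)
  have nonneg: "0 \<le> ?u x" if "x \<in> carrier R" for x
    using upper[OF zero_cstar_seminorm] that by auto
  show ?thesis
    unfolding cstar_seminorm_def
  proof (intro conjI ballI allI)
    fix x y assume x: "x \<in> carrier R" and y: "y \<in> carrier R"
    show "?u (x \<oplus> y) \<le> ?u x + ?u y"
    proof (rule universal_seminorm_least)
      fix p assume p: "cstar_seminorm R p" "\<forall>(y, z)\<in>Rel. p (y \<ominus> z) = 0"
      interpret cstar_seminormed R p
        by unfold_locales (rule p)
      show "p (x \<oplus> y) \<le> ?u x + ?u y"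
        using p_plus[OF x y] upper[OF p x] upper[OF p y] by linarith
    qed
    show "?u (x \<cdot> y) \<le> ?u x * ?u y"
    proof (rule universal_seminorm_least)
      fix p assume p: "cstar_seminorm R p" "\<forall>(y, z)\<in>Rel. p (y \<ominus> z) = 0"
      interpret cstar_seminormed R p
        by unfold_locales (rule p)
      have "p (x \<cdot> y) \<le> p x * p y"
        by (rule p_times[OF x y])
      also have "\<dots> \<le> ?u x * ?u y"
        using upper[OF p] x y nonneg by (intro mult_mono) simp_all
      finally show "p (x \<cdot> y) \<le> ?u x * ?u y" .
    qed
  next
    fix x assume x: "x \<in> carrier R"
    show "0 \<le> ?u x"
      by (rule nonneg[OF x])
    show "?u (x\<^sup>\<star> \<cdot> x) = (?u x)\<^sup>2"
    proof (rule antisym)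
      show "?u (x\<^sup>\<star> \<cdot> x) \<le> (?u x)\<^sup>2"
      proof (rule universal_seminorm_least)
        fix p assume p: "cstar_seminorm R p" "\<forall>(y, z)\<in>Rel. p (y \<ominus> z) = 0"
        interpret cstar_seminormed R p
          by unfold_locales (rule p)
        show "p (x\<^sup>\<star> \<cdot> x) \<le> (?u x)\<^sup>2"
          using x upper[OF p x] by (simp add: p_cstar power_mono)
      qed
      have "?u x \<le> sqrt (?u (x\<^sup>\<star> \<cdot> x))"
      proof (rule universal_seminorm_least)
        fix p assume p: "cstar_seminorm R p" "\<forall>(y, z)\<in>Rel. p (y \<ominus> z) = 0"
        interpret cstar_seminormed R p
          by unfold_locales (rule p)
        show "p x \<le> sqrt (?u (x\<^sup>\<star> \<cdot> x))"
          using x upper[OF p, of "x\<^sup>\<star> \<cdot> x"] by (intro real_le_rsqrt) (simp add: p_cstar)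
      qed
      then have "(?u x)\<^sup>2 \<le> (sqrt (?u (x\<^sup>\<star> \<cdot> x)))\<^sup>2"
        using nonneg[OF x] by (intro power_mono)
      then show "(?u x)\<^sup>2 \<le> ?u (x\<^sup>\<star> \<cdot> x)"
        using nonneg[of "x\<^sup>\<star> \<cdot> x"] x by simp
    qed
  next
    fix c x assume x: "x \<in> carrier R"
    have le: "?u (c \<odot> x) \<le> cmod c * ?u x"
    proof (rule universal_seminorm_least)
      fix p assume p: "cstar_seminorm R p" "\<forall>(y, z)\<in>Rel. p (y \<ominus> z) = 0"
      interpret cstar_seminormed R p
        by unfold_locales (rule p)
      show "p (c \<odot> x) \<le> cmod c * ?u x"
        using x upper[OF p x] by (simp add: p_scale mult_left_mono)
    qed
    show "?u (c \<odot> x) = cmod c * ?u x"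
    proof (cases "c = 0")
      case True
      then show ?thesis
        using le nonneg[of "c \<odot> x"] x by simp
    next
      case False
      have "?u x \<le> ?u (c \<odot> x) / cmod c"
      proof (rule universal_seminorm_least)
        fix p assume p: "cstar_seminorm R p" "\<forall>(y, z)\<in>Rel. p (y \<ominus> z) = 0"
        interpret cstar_seminormed R p
          by unfold_locales (rule p)
        show "p x \<le> ?u (c \<odot> x) / cmod c"
          using x upper[OF p, of "c \<odot> x"] False by (simp add: p_scale field_simps)
      qed
      with le False show ?thesis
        by (simp add: field_simps)
    qed
  qed
qed

end

context star_hom_pair
begin

text \<open>The extension is \<open>p' y = (INF x. p x + N (y - \<Psi> x))\<close>.\<close>

lemma extend_cstar_seminorm:
  assumes N_plus: "\<And>y z. y \<in> carrier S \<Longrightarrow> z \<in> carrier S \<Longrightarrow> N (plus_sa S y z) \<le> N y + N z"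
    and N_scale: "\<And>c y. y \<in> carrier S \<Longrightarrow> N (scale_sa S c y) = cmod c * N y"
    and N_times: "\<And>y z. y \<in> carrier S \<Longrightarrow> z \<in> carrier S \<Longrightarrow> N (times_sa S y z) \<le> N y * N z"
    and N_star: "\<And>y. y \<in> carrier S \<Longrightarrow> N (star_sa S y) = N y"
    and dense: "\<And>y e. y \<in> carrier S \<Longrightarrow> e > 0 \<Longrightarrow> \<exists>x\<in>carrier R. N (diff_sa S y (\<Psi> x)) < e"
    and p: "cstar_seminorm R p"
    and p_le: "\<And>x. x \<in> carrier R \<Longrightarrow> p x \<le> N (\<Psi> x)"
  obtains p' where "cstar_seminorm S p'" "\<And>x. x \<in> carrier R \<Longrightarrow> p' (\<Psi> x) = p x"
proof -
  interpret R: cstar_seminormed R p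
    by unfold_locales (rule p)
  \<comment> \<open>Follows from subadditivity and homogeneity: \<open>N (y - y)\<close> is 0 and at
    most \<open>2 * N y\<close>.\<close>
  have N_nonneg: "0 \<le> N y" if y: "y \<in> carrier S" for y
  proof -
    have "N (diff_sa S y y) = 0"
      using y by (simp add: S.diff_self N_scale)
    moreover have "N (diff_sa S y y) \<le> N y + N y"
      using N_plus[of y "scale_sa S (-1) y"] y by (simp add: diff_sa_def N_scale)
    ultimately show ?thesis by simp
  qed
  have N_diff_commute: "N (diff_sa S y z) = N (diff_sa S z y)"
    if "y \<in> carrier S" "z \<in> carrier S" for y z
    using that by (subst S.diff_flip) (simp_all add: N_scale)
  have N_triangle: "N (diff_sa S x z) \<le> N (diff_sa S x y) + N (diff_sa S y z)"
    if "x \<in> carrier S" "y \<in> carrier S" "z \<in> carrier S" for x y z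
    using N_plus[of "diff_sa S x y" "diff_sa S y z"] that by (simp add: S.diff_plus_diff)
  have p_diff: "\<bar>p x - p x'\<bar> \<le> N (diff_sa S (\<Psi> x) (\<Psi> x'))" if "x \<in> carrier R" "x' \<in> carrier R" for x x'
    using R.p_diff_abs[OF that] p_le[of "diff_sa R x x'"] that by (simp add: hom_diff)
  define p' where "p' y = (INF x\<in>carrier R. p x + N (diff_sa S y (\<Psi> x)))" for y
  \<comment> \<open>The lower bound is the content: \<open>p\<close> is \<open>N\<close>-Lipschitz
    along \<open>\<Psi>\<close>, so no competitor \<open>x'\<close> in the infimum can undercut
    \<open>p x\<close> by more than the distance from \<open>y\<close> to
    \<open>\<Psi> x\<close>.\<close>
  have p'_near: "\<bar>p' y - p x\<bar> \<le> N (diff_sa S y (\<Psi> x))" if y: "y \<in> carrier S" and x: "x \<in> carrier R" for x y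
  proof -
    have "p' y \<le> p x + N (diff_sa S y (\<Psi> x))"
      unfolding p'_def using x y by (intro cINF_lower bdd_belowI2[of _ 0]) (auto simp: N_nonneg)
    moreover have "p x - N (diff_sa S y (\<Psi> x)) \<le> p' y"
      unfolding p'_def
    proof (rule cINF_greatest)
      fix x' assume x': "x' \<in> carrier R"
      have "N (diff_sa S (\<Psi> x) (\<Psi> x')) \<le> N (diff_sa S (\<Psi> x) y) + N (diff_sa S y (\<Psi> x'))"
        using x x' y by (intro N_triangle) simp_all
      moreover have "N (diff_sa S (\<Psi> x) y) = N (diff_sa S y (\<Psi> x))"
        using x y by (intro N_diff_commute) simp_all
      ultimately show "p x - N (diff_sa S y (\<Psi> x)) \<le> p x' + N (diff_sa S y (\<Psi> x'))"
        using p_diff[OF x x'] by linarith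
    qed (use x in auto)
    ultimately show ?thesis by linarith
  qed
  have approx: "\<exists>X. (\<forall>n. X n \<in> carrier R) \<and> (\<lambda>n. N (diff_sa S y (\<Psi> (X n)))) \<longlonglongrightarrow> 0"
    if y: "y \<in> carrier S" for y
  proof -
    have "\<exists>x\<in>carrier R. N (diff_sa S y (\<Psi> x)) < inverse (real (Suc n))" for n
      using y by (intro dense) simp_all
    then obtain X where X: "\<And>n. X n \<in> carrier R"
      and yX: "\<And>n. N (diff_sa S y (\<Psi> (X n))) < inverse (real (Suc n))"
      by metis
    have "(\<lambda>n. N (diff_sa S y (\<Psi> (X n)))) \<longlonglongrightarrow> 0"
    proof (rule tendsto_sandwich[OF _ _ tendsto_const LIMSEQ_inverse_real_of_nat])
      show "\<forall>\<^sub>F n in sequentially. 0 \<le> N (diff_sa S y (\<Psi> (X n)))"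
        using X y by (simp add: N_nonneg)
      show "\<forall>\<^sub>F n in sequentially. N (diff_sa S y (\<Psi> (X n))) \<le> inverse (real (Suc n))"
        using yX by (intro always_eventually allI less_imp_le)
    qed
    with X show ?thesis by blast
  qed
  \<comment> \<open>Any sequence whose images converge to \<open>y\<close> for \<open>N\<close>
    computes \<open>p' y\<close>. Each C*-seminorm law for \<open>p'\<close> is then the limit of
    the same law for \<open>p\<close>; \<open>b\<close> is an explicit rate of convergence supplied
    for each operation.\<close>
  have p'_lim: "(\<lambda>n. p (X n)) \<longlonglongrightarrow> p' y"
    if "y \<in> carrier S" "\<And>n. X n \<in> carrier R" "\<And>n. N (diff_sa S y (\<Psi> (X n))) \<le> b n" "b \<longlonglongrightarrow> 0" for y X b
  proof -
    have "(\<lambda>n. \<bar>p (X n) - p' y\<bar>) \<longlonglongrightarrow> 0"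
    proof (rule tendsto_sandwich[OF _ _ tendsto_const that(4)])
      show "\<forall>\<^sub>F n in sequentially. \<bar>p (X n) - p' y\<bar> \<le> b n"
      proof (intro always_eventually allI)
        fix n
        show "\<bar>p (X n) - p' y\<bar> \<le> b n"
          using p'_near[OF that(1,2), of n] that(3)[of n] by linarith
      qed
    qed simp
    then show ?thesis
      by (rule LIM_zero_cancel[OF tendsto_rabs_zero_cancel])
  qed
  have p'_\<Psi>: "p' (\<Psi> x) = p x" if "x \<in> carrier R" for x
    using p'_near[of "\<Psi> x" x] that by (simp add: S.diff_self N_scale)
  have "cstar_seminorm S p'"
    unfolding cstar_seminorm_def
  proof (intro conjI ballI allI)
    fix y z assume y: "y \<in> carrier S" and z: "z \<in> carrier S"
    obtain Y where Y: "\<And>n. Y n \<in> carrier R" and Yl: "(\<lambda>n. N (diff_sa S y (\<Psi> (Y n)))) \<longlonglongrightarrow> 0"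
      using approx[OF y] by blast
    obtain Z where Z: "\<And>n. Z n \<in> carrier R" and Zl: "(\<lambda>n. N (diff_sa S z (\<Psi> (Z n)))) \<longlonglongrightarrow> 0"
      using approx[OF z] by blast
    have pY: "(\<lambda>n. p (Y n)) \<longlonglongrightarrow> p' y"
      using p'_lim[OF y Y order.refl Yl] .
    have pZ: "(\<lambda>n. p (Z n)) \<longlonglongrightarrow> p' z"
      using p'_lim[OF z Z order.refl Zl] .
    have "(\<lambda>n. p (plus_sa R (Y n) (Z n))) \<longlonglongrightarrow> p' (plus_sa S y z)"
    proof (rule p'_lim)
      show "N (diff_sa S (plus_sa S y z) (\<Psi> (plus_sa R (Y n) (Z n)))) \<le>
          N (diff_sa S y (\<Psi> (Y n))) + N (diff_sa S z (\<Psi> (Z n)))" for n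
        using N_plus[of "diff_sa S y (\<Psi> (Y n))" "diff_sa S z (\<Psi> (Z n))"] y z Y Z
        by (simp add: hom_plus S.plus_diff_plus)
      show "(\<lambda>n. N (diff_sa S y (\<Psi> (Y n))) + N (diff_sa S z (\<Psi> (Z n)))) \<longlonglongrightarrow> 0"
        using tendsto_add[OF Yl Zl] by simp
    qed (simp_all add: y z Y Z)
    then show "p' (plus_sa S y z) \<le> p' y + p' z"
      by (rule LIMSEQ_le[OF _ tendsto_add[OF pY pZ]]) (use Y Z in \<open>auto intro: R.p_plus\<close>)
    have "(\<lambda>n. p (times_sa R (Y n) (Z n))) \<longlonglongrightarrow> p' (times_sa S y z)"
    proof (rule p'_lim)
      show "N (diff_sa S (times_sa S y z) (\<Psi> (times_sa R (Y n) (Z n)))) \<le>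
          N y * N (diff_sa S z (\<Psi> (Z n))) +
          N (diff_sa S y (\<Psi> (Y n))) * (N z + N (diff_sa S z (\<Psi> (Z n))))" for n
      proof -
        have "N (\<Psi> (Z n)) \<le> N z + N (diff_sa S (\<Psi> (Z n)) z)"
          using N_plus[of z "diff_sa S (\<Psi> (Z n)) z"] z Z by (simp add: S.plus_diff_cancel)
        also have "N (diff_sa S (\<Psi> (Z n)) z) = N (diff_sa S z (\<Psi> (Z n)))"
          using z Z by (intro N_diff_commute) simp_all
        finally have "N (diff_sa S y (\<Psi> (Y n))) * N (\<Psi> (Z n)) \<le>
            N (diff_sa S y (\<Psi> (Y n))) * (N z + N (diff_sa S z (\<Psi> (Z n))))"
          using y Y by (intro mult_left_mono) (simp_all add: N_nonneg)
        moreover have "N (diff_sa S (times_sa S y z) (\<Psi> (times_sa R (Y n) (Z n)))) \<le>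
            N (times_sa S y (diff_sa S z (\<Psi> (Z n)))) + N (times_sa S (diff_sa S y (\<Psi> (Y n))) (\<Psi> (Z n)))"
          using y z Y Z by (simp add: hom_times S.times_diff_times N_plus)
        moreover have "N (times_sa S y (diff_sa S z (\<Psi> (Z n)))) \<le> N y * N (diff_sa S z (\<Psi> (Z n)))"
          using y z Z by (intro N_times) simp_all
        moreover have "N (times_sa S (diff_sa S y (\<Psi> (Y n))) (\<Psi> (Z n))) \<le> N (diff_sa S y (\<Psi> (Y n))) * N (\<Psi> (Z n))"
          using y Y Z by (intro N_times) simp_all
        ultimately show ?thesis by linarith
      qed
      have "(\<lambda>n. N y * N (diff_sa S z (\<Psi> (Z n))) +
          N (diff_sa S y (\<Psi> (Y n))) * (N z + N (diff_sa S z (\<Psi> (Z n))))) \<longlonglongrightarrow> N y * 0 + 0 * (N z + 0)"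
        by (intro tendsto_intros Yl Zl)
      then show "(\<lambda>n. N y * N (diff_sa S z (\<Psi> (Z n))) +
          N (diff_sa S y (\<Psi> (Y n))) * (N z + N (diff_sa S z (\<Psi> (Z n))))) \<longlonglongrightarrow> 0"
        by simp
    qed (simp_all add: y z Y Z)
    then show "p' (times_sa S y z) \<le> p' y * p' z"
      by (rule LIMSEQ_le[OF _ tendsto_mult[OF pY pZ]]) (use Y Z in \<open>auto intro: R.p_times\<close>)
  next
    fix y assume y: "y \<in> carrier S"
    obtain Y where Y: "\<And>n. Y n \<in> carrier R" and Yl: "(\<lambda>n. N (diff_sa S y (\<Psi> (Y n)))) \<longlonglongrightarrow> 0"
      using approx[OF y] by blast
    have pY: "(\<lambda>n. p (Y n)) \<longlonglongrightarrow> p' y"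
      using p'_lim[OF y Y order.refl Yl] .
    then show "0 \<le> p' y"
      by (rule LIMSEQ_le[OF tendsto_const]) (use Y in auto)
    have "(\<lambda>n. p (times_sa R (star_sa R (Y n)) (Y n))) \<longlonglongrightarrow> p' (times_sa S (star_sa S y) y)"
    proof (rule p'_lim)
      show "N (diff_sa S (times_sa S (star_sa S y) y) (\<Psi> (times_sa R (star_sa R (Y n)) (Y n)))) \<le>
          N y * N (diff_sa S y (\<Psi> (Y n))) +
          N (diff_sa S y (\<Psi> (Y n))) * (N y + N (diff_sa S y (\<Psi> (Y n))))" for n
      proof -
        have "N (\<Psi> (Y n)) \<le> N y + N (diff_sa S (\<Psi> (Y n)) y)"
          using N_plus[of y "diff_sa S (\<Psi> (Y n)) y"] y Y by (simp add: S.plus_diff_cancel)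
        also have "N (diff_sa S (\<Psi> (Y n)) y) = N (diff_sa S y (\<Psi> (Y n)))"
          using y Y by (intro N_diff_commute) simp_all
        finally have "N (diff_sa S y (\<Psi> (Y n))) * N (\<Psi> (Y n)) \<le>
            N (diff_sa S y (\<Psi> (Y n))) * (N y + N (diff_sa S y (\<Psi> (Y n))))"
          using y Y by (intro mult_left_mono) (simp_all add: N_nonneg)
        moreover have "N (diff_sa S (times_sa S (star_sa S y) y) (\<Psi> (times_sa R (star_sa R (Y n)) (Y n)))) \<le>
            N (times_sa S (star_sa S y) (diff_sa S y (\<Psi> (Y n)))) +
            N (times_sa S (star_sa S (diff_sa S y (\<Psi> (Y n)))) (\<Psi> (Y n)))"
          using y Y by (simp add: hom_times hom_star S.times_diff_times S.star_diff N_plus)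
        moreover have "N (times_sa S (star_sa S y) (diff_sa S y (\<Psi> (Y n)))) \<le> N (star_sa S y) * N (diff_sa S y (\<Psi> (Y n)))"
          using y Y by (intro N_times) simp_all
        moreover have "N (times_sa S (star_sa S (diff_sa S y (\<Psi> (Y n)))) (\<Psi> (Y n))) \<le>
            N (star_sa S (diff_sa S y (\<Psi> (Y n)))) * N (\<Psi> (Y n))"
          using y Y by (intro N_times) simp_all
        moreover have "N (star_sa S y) = N y" "N (star_sa S (diff_sa S y (\<Psi> (Y n)))) = N (diff_sa S y (\<Psi> (Y n)))"
          using y Y by (simp_all add: N_star)
        ultimately show ?thesis by simp
      qed
      have "(\<lambda>n. N y * N (diff_sa S y (\<Psi> (Y n))) +
          N (diff_sa S y (\<Psi> (Y n))) * (N y + N (diff_sa S y (\<Psi> (Y n))))) \<longlonglongrightarrow> N y * 0 + 0 * (N y + 0)"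
        by (intro tendsto_intros Yl)
      then show "(\<lambda>n. N y * N (diff_sa S y (\<Psi> (Y n))) +
          N (diff_sa S y (\<Psi> (Y n))) * (N y + N (diff_sa S y (\<Psi> (Y n))))) \<longlonglongrightarrow> 0"
        by simp
    qed (simp_all add: y Y)
    moreover have "(\<lambda>n. p (times_sa R (star_sa R (Y n)) (Y n))) \<longlonglongrightarrow> (p' y)\<^sup>2"
      using tendsto_power[OF pY, of 2] Y by (simp add: R.p_cstar)
    ultimately show "p' (times_sa S (star_sa S y) y) = (p' y)\<^sup>2"
      by (rule LIMSEQ_unique)
  next
    fix c y assume y: "y \<in> carrier S"
    obtain Y where Y: "\<And>n. Y n \<in> carrier R" and Yl: "(\<lambda>n. N (diff_sa S y (\<Psi> (Y n)))) \<longlonglongrightarrow> 0"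
      using approx[OF y] by blast
    have pY: "(\<lambda>n. p (Y n)) \<longlonglongrightarrow> p' y"
      using p'_lim[OF y Y order.refl Yl] .
    have "(\<lambda>n. p (scale_sa R c (Y n))) \<longlonglongrightarrow> p' (scale_sa S c y)"
    proof (rule p'_lim)
      show "N (diff_sa S (scale_sa S c y) (\<Psi> (scale_sa R c (Y n)))) \<le> cmod c * N (diff_sa S y (\<Psi> (Y n)))" for n
        using y Y by (simp add: hom_scale N_scale flip: S.scale_diff)
      show "(\<lambda>n. cmod c * N (diff_sa S y (\<Psi> (Y n)))) \<longlonglongrightarrow> 0"
        using tendsto_mult_left[OF Yl] by simp
    qed (simp_all add: y Y)
    moreover have "(\<lambda>n. p (scale_sa R c (Y n))) \<longlonglongrightarrow> cmod c * p' y"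
      using tendsto_mult_left[OF pY] Y by (simp add: R.p_scale)
    ultimately show "p' (scale_sa S c y) = cmod c * p' y"
      by (rule LIMSEQ_unique)
  qed
  then show ?thesis
    using p'_\<Psi> by (rule that)
qed

text \<open>The two universal seminorms correspond under \<open>\<Psi>\<close>: a seminorm on
  \<open>S\<close> pulls back to one on \<open>R\<close> that respects \<open>Rel\<close>, and a
  seminorm on \<open>R\<close> respecting \<open>Rel\<close> is the pullback of its extension to
  \<open>S\<close>. So \<open>\<Psi>\<close> is isometric, and it has dense range because the
  universal seminorm of \<open>S\<close> is at most \<open>N\<close>.\<close>

theorem universal_completion_isomorphism:
  assumes N_plus: "\<And>y z. y \<in> carrier S \<Longrightarrow> z \<in> carrier S \<Longrightarrow> N (plus_sa S y z) \<le> N y + N z"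
    and N_scale: "\<And>c y. y \<in> carrier S \<Longrightarrow> N (scale_sa S c y) = cmod c * N y"
    and N_times: "\<And>y z. y \<in> carrier S \<Longrightarrow> z \<in> carrier S \<Longrightarrow> N (times_sa S y z) \<le> N y * N z"
    and N_star: "\<And>y. y \<in> carrier S \<Longrightarrow> N (star_sa S y) = N y"
    and dense: "\<And>y e. y \<in> carrier S \<Longrightarrow> e > 0 \<Longrightarrow> \<exists>x\<in>carrier R. N (diff_sa S y (\<Psi> x)) < e"
    and Rel: "Rel \<subseteq> carrier R \<times> carrier R"
    and \<Psi>_Rel: "\<And>x y. (x, y) \<in> Rel \<Longrightarrow> \<Psi> x = \<Psi> y"
    and S_bound: "\<And>q y. cstar_seminorm S q \<Longrightarrow> y \<in> carrier S \<Longrightarrow> q y \<le> N y"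
    and R_bound: "\<And>p x. cstar_seminorm R p \<Longrightarrow> \<forall>(y, z)\<in>Rel. p (diff_sa R y z) = 0 \<Longrightarrow> x \<in> carrier R \<Longrightarrow>
      p x \<le> N (\<Psi> x)"
  shows "\<exists>\<psi>. star_isomorphism (completion R (universal_seminorm R Rel)) (completion S (universal_seminorm S {})) \<psi> \<and>
    (\<forall>x\<in>carrier R. \<psi> (completion_embed R (universal_seminorm R Rel) x) =
      completion_embed S (universal_seminorm S {}) (\<Psi> x))"
proof (rule completion_isomorphism)
  show "cstar_seminorm R (universal_seminorm R Rel)"
    by (rule R.cstar_universal_seminorm[where M = "\<lambda>x. N (\<Psi> x)"]) (rule R_bound)
  show S: "cstar_seminorm S (universal_seminorm S {})"
    by (rule S.cstar_universal_seminorm[where M = N]) (rule S_bound)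
  fix x assume x: "x \<in> carrier R"
  show "universal_seminorm S {} (\<Psi> x) = universal_seminorm R Rel x"
  proof (rule antisym)
    show "universal_seminorm S {} (\<Psi> x) \<le> universal_seminorm R Rel x"
    proof (rule S.universal_seminorm_least)
      fix q assume q: "cstar_seminorm S q"
      interpret q: cstar_seminormed S q
        by unfold_locales (rule q)
      have "cstar_seminorm R (\<lambda>x. q (\<Psi> x))"
        by (simp add: cstar_seminorm_def hom_plus hom_times hom_scale hom_star
            q.p_scale q.p_cstar q.p_plus q.p_times)
      moreover have "\<forall>(y, z)\<in>Rel. q (\<Psi> (diff_sa R y z)) = 0"
      proof safe
        fix y z assume yz: "(y, z) \<in> Rel"
        with Rel have "y \<in> carrier R" "z \<in> carrier R" by auto
        with \<Psi>_Rel[OF yz] show "q (\<Psi> (diff_sa R y z)) = 0"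
          by (simp add: hom_diff)
      qed
      ultimately show "q (\<Psi> x) \<le> universal_seminorm R Rel x"
        by (rule R.universal_seminorm_upper[where p = "\<lambda>x. q (\<Psi> x)" and M = "N (\<Psi> x)", rotated])
          (rule R_bound[OF _ _ x])
    qed
    show "universal_seminorm R Rel x \<le> universal_seminorm S {} (\<Psi> x)"
    proof (rule R.universal_seminorm_least)
      fix p assume p: "cstar_seminorm R p" "\<forall>(y, z)\<in>Rel. p (diff_sa R y z) = 0"
      obtain p' where p': "cstar_seminorm S p'" "\<And>x. x \<in> carrier R \<Longrightarrow> p' (\<Psi> x) = p x"
        by (rule extend_cstar_seminorm[of N p])
          (use N_plus N_scale N_times N_star dense p R_bound[OF p] in \<open>assumption | blast\<close>)+
      have "p' (\<Psi> x) \<le> universal_seminorm S {} (\<Psi> x)"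
        by (rule S.universal_seminorm_upper[where p = p' and M = "N (\<Psi> x)"]) (simp_all add: p' x S_bound)
      with p' x show "p x \<le> universal_seminorm S {} (\<Psi> x)" by simp
    qed
  qed
next
  fix y and e :: real assume y: "y \<in> carrier S" and e: "e > 0"
  from dense[OF this] obtain x where x: "x \<in> carrier R" "N (diff_sa S y (\<Psi> x)) < e" by blast
  have "universal_seminorm S {} (diff_sa S y (\<Psi> x)) \<le> N (diff_sa S y (\<Psi> x))"
    by (rule S.universal_seminorm_least, rule S_bound) (simp_all add: x y)
  with x show "\<exists>x\<in>carrier R. universal_seminorm S {} (diff_sa S y (\<Psi> x)) < e"
    by (intro bexI[of _ x]) simp_all
qed

end

section \<open>Partial crossed products\<close>

text \<open>For real \<open>h\<close> with \<open>\<bar>h\<bar> \<le> 1\<close> and \<open>w = sqrt (1 - h\<^sup>2) - 1\<close>, the function \<open>1 + w + \<i> h\<close> is unitary.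
  By the C*-identity, multiplication by it and by its adjoint is isometric, and \<open>\<i> h\<close> is
  half of the difference of the two.\<close>

lemma cstar_seminorm_le_sup:
  fixes p :: "('x \<Rightarrow> complex) \<Rightarrow> real" and \<A> :: "('x \<Rightarrow> complex) set"
  assumes add: "\<And>f g. f \<in> \<A> \<Longrightarrow> g \<in> \<A> \<Longrightarrow> (\<lambda>x. f x + g x) \<in> \<A>"
    and scale: "\<And>c f. f \<in> \<A> \<Longrightarrow> (\<lambda>x. c * f x) \<in> \<A>"
    and times: "\<And>f g. f \<in> \<A> \<Longrightarrow> g \<in> \<A> \<Longrightarrow> (\<lambda>x. f x * g x) \<in> \<A>"
    and conj: "\<And>f. f \<in> \<A> \<Longrightarrow> (\<lambda>x. cnj (f x)) \<in> \<A>"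
    and root: "\<And>h :: 'x \<Rightarrow> real. (\<lambda>x. of_real (h x)) \<in> \<A> \<Longrightarrow> (\<And>x. \<bar>h x\<bar> \<le> 1) \<Longrightarrow>
      (\<lambda>x. of_real (sqrt (1 - (h x)\<^sup>2) - 1)) \<in> \<A>"
    and p_nonneg: "\<And>f. f \<in> \<A> \<Longrightarrow> 0 \<le> p f"
    and p_add: "\<And>f g. f \<in> \<A> \<Longrightarrow> g \<in> \<A> \<Longrightarrow> p (\<lambda>x. f x + g x) \<le> p f + p g"
    and p_scale: "\<And>c f. f \<in> \<A> \<Longrightarrow> p (\<lambda>x. c * f x) = cmod c * p f"
    and p_cstar: "\<And>f. f \<in> \<A> \<Longrightarrow> p (\<lambda>x. cnj (f x) * f x) = (p f)\<^sup>2"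
    and f: "f \<in> \<A>" and M: "\<And>x. cmod (f x) \<le> M"
  shows "p f \<le> M"
proof -
  have contraction: "p (\<lambda>x. of_real (h x)) \<le> 1"
    if h: "(\<lambda>x. of_real (h x)) \<in> \<A>" and h1: "\<And>x. \<bar>h x\<bar> \<le> 1" for h :: "'x \<Rightarrow> real"
  proof -
    define w where "w x = sqrt (1 - (h x)\<^sup>2) - 1" for x
    have w: "(\<lambda>x. of_real (w x)) \<in> \<A>"
      unfolding w_def by (rule root[OF h h1])
    have sq: "(1 + w x)\<^sup>2 + (h x)\<^sup>2 = 1" for x
    proof -
      have "(h x)\<^sup>2 \<le> 1"
        using h1[of x] by (simp add: abs_square_le_1)
      then show ?thesis by (simp add: w_def)
    qed
    define b where "b = (\<lambda>x. complex_of_real (h x))"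
    \<comment> \<open>This is \<open>(1 + w + \<sigma> * \<i> * h) * h\<close>, the unitary (or its
      adjoint) times \<open>h\<close>. It is expanded because the constant 1 need not belong to
      \<open>\<A>\<close>.\<close>
    define u where "u \<sigma> x = b x + (of_real (w x) * b x + (\<sigma> * \<i>) * (b x * b x))" for \<sigma> x
    have u: "u \<sigma> \<in> \<A>" for \<sigma>
      unfolding u_def b_def by (intro add scale times h w)
    have pu: "p (u \<sigma>) = p b" if "\<sigma> = 1 \<or> \<sigma> = -1" for \<sigma>
    proof -
      have "cnj (u \<sigma> x) * u \<sigma> x = cnj (b x) * b x" for x
      proof -
        have "u \<sigma> x = (of_real (1 + w x) + \<sigma> * \<i> * of_real (h x)) * b x"
          by (simp add: u_def b_def algebra_simps)
        moreover have "cnj (of_real (1 + w x) + \<sigma> * \<i> * of_real (h x)) *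
            (of_real (1 + w x) + \<sigma> * \<i> * of_real (h x)) = of_real ((1 + w x)\<^sup>2 + (h x)\<^sup>2)"
          using that by (auto simp: complex_eq_iff power2_eq_square algebra_simps)
        ultimately show ?thesis
          by (simp add: sq mult_ac)
      qed
      then have "(p (u \<sigma>))\<^sup>2 = (p b)\<^sup>2"
        using p_cstar[OF u, of \<sigma>] p_cstar[of b] h by (simp add: b_def)
      then show ?thesis
        using p_nonneg[OF u, of \<sigma>] p_nonneg[of b] h by (simp add: b_def)
    qed
    \<comment> \<open>The difference of \<open>u 1\<close> and \<open>u (-1)\<close> is
      \<open>2 * \<i>\<close> times the square of \<open>b\<close>. Both have seminorm
      \<open>p b\<close>, so \<open>p\<close> of the square, which is the square of
      \<open>p b\<close>, is at most \<open>p b\<close>; hence \<open>p b \<le> 1\<close>.\<close>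
    have "(\<lambda>x. b x * b x) = (\<lambda>x. (1 / (2 * \<i>)) * u 1 x + (- (1 / (2 * \<i>))) * u (-1) x)"
      by (auto simp: u_def fun_eq_iff field_simps)
    then have "p (\<lambda>x. b x * b x) \<le> p (\<lambda>x. (1 / (2 * \<i>)) * u 1 x) + p (\<lambda>x. (- (1 / (2 * \<i>))) * u (-1) x)"
      using p_add[OF scale[OF u] scale[OF u]] by metis
    also have "\<dots> = p b"
      using pu by (simp only: p_scale[OF u]) (simp add: norm_divide norm_mult)
    finally have "p (\<lambda>x. b x * b x) \<le> p b" .
    moreover have "p (\<lambda>x. b x * b x) = (p b)\<^sup>2"
      using p_cstar[of b] h by (simp add: b_def)
    ultimately have "p b * p b \<le> p b * 1"
      by (simp add: power2_eq_square)
    then show ?thesis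
      using p_nonneg[of b] h unfolding b_def by (cases "p (\<lambda>x. complex_of_real (h x)) = 0")
        (auto simp: mult_le_cancel_left)
  qed
  have M0: "0 \<le> M"
    using M[of undefined] norm_ge_zero order.trans by blast
  show ?thesis
  proof (cases "M = 0")
    case True
    with M have "f = (\<lambda>x. 0 * f x)" by auto
    with p_scale[OF f, of 0] True show ?thesis by simp
  next
    case False
    with M0 have M_pos: "M > 0" by simp
    \<comment> \<open>A general \<open>f\<close> is reduced to the real function
      \<open>\<bar>f\<bar>\<^sup>2 / M\<^sup>2\<close>, whose seminorm is
      \<open>(p f)\<^sup>2 / M\<^sup>2\<close> by the C*-identity.\<close>
    define h where "h x = (cmod (f x))\<^sup>2 / M\<^sup>2" for x
    have eq: "(\<lambda>x. complex_of_real (h x)) = (\<lambda>x. of_real (1 / M\<^sup>2) * (cnj (f x) * f x))"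
      by (auto simp: h_def complex_norm_square[symmetric] mult.commute[of "cnj _"])
    have le: "p (\<lambda>x. of_real (h x)) \<le> 1"
    proof (rule contraction)
      show "(\<lambda>x. complex_of_real (h x)) \<in> \<A>"
        unfolding eq by (intro scale times conj f)
      show "\<bar>h x\<bar> \<le> 1" for x
        using power_mono[OF M, of x 2] M_pos by (simp add: h_def)
    qed
    have "p (\<lambda>x. of_real (h x)) = cmod (of_real (1 / M\<^sup>2)) * (p f)\<^sup>2"
      unfolding eq p_scale[OF times[OF conj[OF f] f]] p_cstar[OF f] ..
    also have "cmod (of_real (1 / M\<^sup>2)) = 1 / M\<^sup>2"
      by (simp only: norm_of_real) simp
    finally have "1 / M\<^sup>2 * (p f)\<^sup>2 \<le> 1"
      using le by linarith
    then have "(p f)\<^sup>2 \<le> M\<^sup>2"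
      using M_pos by (simp add: divide_le_eq)
    then show ?thesis
      by (rule power2_le_imp_le[OF _ M0])
  qed
qed

section \<open>Sup norms and the algebraic crossed product as a *-algebra\<close>

definition sup_norm :: "('x \<Rightarrow> complex) \<Rightarrow> real" where
  "sup_norm f = (SUP x. cmod (f x))"

lemma sup_norm_upper: "bounded (range f) \<Longrightarrow> cmod (f x) \<le> sup_norm f"
  unfolding sup_norm_def by (intro cSUP_upper) (auto simp: bounded_iff bdd_above_def)

lemma sup_norm_least: "(\<And>x. cmod (f x) \<le> M) \<Longrightarrow> sup_norm f \<le> M"
  unfolding sup_norm_def by (intro cSUP_least) auto

lemma sup_norm_nonneg: "bounded (range f) \<Longrightarrow> 0 \<le> sup_norm f"
  using sup_norm_upper[of f undefined] norm_ge_zero order.trans by blast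

lemma sup_norm_zero [simp]: "sup_norm (\<lambda>x. 0) = 0"
  by (simp add: sup_norm_def)

lemma sup_norm_scale:
  assumes "bounded (range f)"
  shows "sup_norm (\<lambda>x. c * f x) = cmod c * sup_norm f"
proof (rule antisym)
  show "sup_norm (\<lambda>x. c * f x) \<le> cmod c * sup_norm f"
    using sup_norm_upper[OF assms] by (intro sup_norm_least) (simp add: norm_mult mult_left_mono)
  have b: "bounded (range (\<lambda>x. c * f x))"
    using sup_norm_upper[OF assms]
    by (intro boundedI[of _ "cmod c * sup_norm f"]) (auto simp: norm_mult mult_left_mono)
  show "cmod c * sup_norm f \<le> sup_norm (\<lambda>x. c * f x)"
  proof (cases "c = 0")
    case False
    have "sup_norm f \<le> sup_norm (\<lambda>x. c * f x) / cmod c"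
      using sup_norm_upper[OF b] False by (intro sup_norm_least) (simp add: norm_mult field_simps)
    with False show ?thesis by (simp add: field_simps)
  qed simp
qed

text \<open>All conditions are phrased for \<open>\<phi> (inv t)\<close> on \<open>V t\<close>,
  since functions are translated as \<open>f (\<phi> (inv t) x)\<close>. The last two say that the
  map of a product extends the composite, which may have a smaller domain.\<close>

locale partial_action = group F for F (structure) +
  fixes X :: "'x set" and V :: "'a \<Rightarrow> 'x set" and \<phi> :: "'a \<Rightarrow> 'x \<Rightarrow> 'x"
  assumes V_one: "V \<one> = X"
    and \<phi>_one: "x \<in> X \<Longrightarrow> \<phi> \<one> x = x"
    and V_subset: "t \<in> carrier F \<Longrightarrow> V t \<subseteq> X"
    and \<phi>_closed: "t \<in> carrier F \<Longrightarrow> x \<in> V t \<Longrightarrow> \<phi> (inv t) x \<in> V (inv t)"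
    and \<phi>_inverse: "t \<in> carrier F \<Longrightarrow> x \<in> V t \<Longrightarrow> \<phi> t (\<phi> (inv t) x) = x"
    and V_mult: "s \<in> carrier F \<Longrightarrow> t \<in> carrier F \<Longrightarrow> x \<in> V s \<Longrightarrow> \<phi> (inv s) x \<in> V t \<Longrightarrow> x \<in> V (s \<otimes> t)"
    and \<phi>_mult: "s \<in> carrier F \<Longrightarrow> t \<in> carrier F \<Longrightarrow> x \<in> V s \<Longrightarrow> \<phi> (inv s) x \<in> V t \<Longrightarrow>
      \<phi> (inv (s \<otimes> t)) x = \<phi> (inv t) (\<phi> (inv s) x)"

text \<open>Collects the closure properties of \<open>C0\<close> behind the *-algebra structure,
  together with the square root that the comparison with the sup norm asks for.\<close>

locale crossed_algebra = partial_action F X V \<phi>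
  for F (structure) and X :: "'x set" and V :: "'a \<Rightarrow> 'x set" and \<phi> :: "'a \<Rightarrow> 'x \<Rightarrow> 'x" +
  fixes T :: "'x topology"
  assumes C0_zero: "t \<in> carrier F \<Longrightarrow> (\<lambda>x. 0) \<in> C0 T (V t)"
    and C0_add: "t \<in> carrier F \<Longrightarrow> f \<in> C0 T (V t) \<Longrightarrow> g \<in> C0 T (V t) \<Longrightarrow> (\<lambda>x. f x + g x) \<in> C0 T (V t)"
    and C0_scale: "t \<in> carrier F \<Longrightarrow> f \<in> C0 T (V t) \<Longrightarrow> (\<lambda>x. c * f x) \<in> C0 T (V t)"
    and C0_transport: "s \<in> carrier F \<Longrightarrow> t \<in> carrier F \<Longrightarrow> f \<in> C0 T (V s) \<Longrightarrow> g \<in> C0 T (V t) \<Longrightarrow>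
      (\<lambda>x. f x * g (\<phi> (inv s) x)) \<in> C0 T (V (s \<otimes> t))"
    and C0_adjoint: "t \<in> carrier F \<Longrightarrow> f \<in> C0 T (V (inv t)) \<Longrightarrow>
      (\<lambda>x. if x \<in> V t then cnj (f (\<phi> (inv t) x)) else 0) \<in> C0 T (V t)"
    and C0_bounded: "t \<in> carrier F \<Longrightarrow> f \<in> C0 T (V t) \<Longrightarrow> bounded (range f)"
    and C0_root: "\<And>h :: 'x \<Rightarrow> real. (\<lambda>x. of_real (h x)) \<in> C0 T X \<Longrightarrow> (\<And>x. \<bar>h x\<bar> \<le> 1) \<Longrightarrow>
      (\<lambda>x. of_real (sqrt (1 - (h x)\<^sup>2) - 1)) \<in> C0 T X"
begin

abbreviation cp :: "('a \<Rightarrow> 'x \<Rightarrow> complex) star_algebra" where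
  "cp \<equiv> alg_crossed_product F T V \<phi>"

definition supp :: "('a \<Rightarrow> 'x \<Rightarrow> complex) \<Rightarrow> 'a set" where
  "supp f = {t. f t \<noteq> (\<lambda>x. 0)}"

definition mono :: "'a \<Rightarrow> ('x \<Rightarrow> complex) \<Rightarrow> 'a \<Rightarrow> 'x \<Rightarrow> complex" where
  "mono t f = (\<lambda>s. if s = t then f else (\<lambda>x. 0))"

lemma C0_off: "f \<in> C0 T U \<Longrightarrow> x \<notin> U \<Longrightarrow> f x = 0"
  by (simp add: C0_def)

lemma C0_sum:
  assumes "t \<in> carrier F" "finite I" "\<And>i. i \<in> I \<Longrightarrow> f i \<in> C0 T (V t)"
  shows "(\<lambda>x. \<Sum>i\<in>I. f i x) \<in> C0 T (V t)"
  using assms(2,3) by (induction I) (auto intro: C0_zero C0_add assms(1))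

lemma carrier_cp: "f \<in> carrier cp \<longleftrightarrow>
    finite (supp f) \<and> (\<forall>t\<in>carrier F. f t \<in> C0 T (V t)) \<and> (\<forall>t. t \<notin> carrier F \<longrightarrow> f t = (\<lambda>x. 0))"
  by (simp add: alg_crossed_product_def supp_def)

lemma cp_simps [simp]:
  "plus_sa cp f g = (\<lambda>t x. f t x + g t x)"
  "scale_sa cp c f = (\<lambda>t x. c * f t x)"
  by (simp_all add: alg_crossed_product_def)

lemma cp_diff [simp]: "diff_sa cp f g = (\<lambda>t x. f t x - g t x)"
  by (simp add: diff_sa_def)

lemma supp_carrier: "f \<in> carrier cp \<Longrightarrow> supp f \<subseteq> carrier F"
  by (auto simp: carrier_cp supp_def)

lemma finite_supp: "f \<in> carrier cp \<Longrightarrow> finite (supp f)"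
  by (simp add: carrier_cp)

lemma cp_off: "f \<in> carrier cp \<Longrightarrow> x \<notin> V t \<Longrightarrow> f t x = 0"
  by (cases "t \<in> carrier F") (auto simp: carrier_cp C0_off)

lemma cp_component: "f \<in> carrier cp \<Longrightarrow> t \<in> carrier F \<Longrightarrow> f t \<in> C0 T (V t)"
  by (simp add: carrier_cp)

lemma cp_bounded: "f \<in> carrier cp \<Longrightarrow> bounded (range (f t))"
  by (cases "t \<in> carrier F") (auto simp: carrier_cp intro: C0_bounded)

lemma not_supp: "t \<notin> supp f \<Longrightarrow> f t x = 0"
  by (simp add: supp_def)

lemma mono_carrier [simp]: "t \<in> carrier F \<Longrightarrow> f \<in> C0 T (V t) \<Longrightarrow> mono t f \<in> carrier cp"
  by (auto simp: carrier_cp supp_def mono_def C0_zero)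

lemma inv_closed_eq: "t \<in> carrier F \<Longrightarrow> s \<in> carrier F \<Longrightarrow> s \<otimes> (inv s \<otimes> t) = t"
  by (simp add: m_assoc[symmetric])

text \<open>In the sum over pairs with product \<open>u\<close> the second degree is determined by
  the first. The two uses of \<open>dual_action\<close> cancel: on \<open>V s\<close> the function
  \<open>f s\<close> is moved away and back, and off \<open>V s\<close> it vanishes.
  \<open>S\<close> may exceed the support of \<open>f\<close>, so that products of sums can be
  computed over a common index set.\<close>

lemma cp_times_closed_form:
  assumes f: "f \<in> carrier cp" and g: "g \<in> carrier cp" and u: "u \<in> carrier F"
    and S: "finite S" "supp f \<subseteq> S" "S \<subseteq> carrier F"
  shows "times_sa cp f g u x = (\<Sum>s\<in>S. f s x * g (inv s \<otimes> u) (\<phi> (inv s) x))"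
proof -
  define S' where "S' = {s \<in> supp f. g (inv s \<otimes> u) \<noteq> (\<lambda>x. 0)}"
  have S'_car: "s \<in> carrier F" if "s \<in> S'" for s
    using that supp_carrier[OF f] by (auto simp: S'_def)
  have t_car: "t \<in> carrier F" if "g t \<noteq> (\<lambda>x. 0)" for t
    using that g by (auto simp: carrier_cp)
  have eq: "{(s, t). f s \<noteq> (\<lambda>x. 0) \<and> g t \<noteq> (\<lambda>x. 0) \<and> s \<otimes> t = u} = (\<lambda>s. (s, inv s \<otimes> u)) ` S'"
  proof safe
    fix s t assume a: "f s \<noteq> (\<lambda>x. 0)" "g t \<noteq> (\<lambda>x. 0)" "u = s \<otimes> t"
    have "s \<in> carrier F" "t \<in> carrier F"
      using a supp_carrier[OF f] t_car by (auto simp: supp_def)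
    then have "inv s \<otimes> (s \<otimes> t) = t"
      by (simp add: m_assoc[symmetric])
    with a show "(s, t) \<in> (\<lambda>sa. (sa, inv sa \<otimes> (s \<otimes> t))) ` S'"
      by (auto simp: S'_def supp_def image_iff)
  next
    fix s assume s: "s \<in> S'"
    then show "s \<otimes> (inv s \<otimes> u) = u"
      using S'_car u by (simp add: inv_closed_eq)
  qed (auto simp: S'_def supp_def)
  have "times_sa cp f g u x = (\<Sum>(s, t)\<in>(\<lambda>s. (s, inv s \<otimes> u)) ` S'.
      dual_action F V \<phi> s (\<lambda>y. dual_action F V \<phi> (inv s) (f s) y * g t y) x)"
    by (simp add: alg_crossed_product_def eq)
  also have "\<dots> = (\<Sum>s\<in>S'. dual_action F V \<phi> s (\<lambda>y. dual_action F V \<phi> (inv s) (f s) y * g (inv s \<otimes> u) y) x)"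
    by (subst sum.reindex) (auto simp: inj_on_def)
  also have "\<dots> = (\<Sum>s\<in>S'. f s x * g (inv s \<otimes> u) (\<phi> (inv s) x))"
  proof (rule sum.cong[OF refl])
    fix s assume "s \<in> S'"
    then have s: "s \<in> carrier F" by (rule S'_car)
    show "dual_action F V \<phi> s (\<lambda>y. dual_action F V \<phi> (inv s) (f s) y * g (inv s \<otimes> u) y) x =
        f s x * g (inv s \<otimes> u) (\<phi> (inv s) x)"
    proof (cases "x \<in> V s")
      case True
      then show ?thesis
        using s \<phi>_closed[OF s True] \<phi>_inverse[OF s True] by (simp add: dual_action_def)
    next
      case False
      then show ?thesis
        using f by (simp add: dual_action_def cp_off)
    qed
  qed
  also have "\<dots> = (\<Sum>s\<in>S. f s x * g (inv s \<otimes> u) (\<phi> (inv s) x))"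
    using S by (intro sum.mono_neutral_left) (auto simp: S'_def supp_def)
  finally show ?thesis .
qed

lemma cp_times_off:
  assumes f: "f \<in> carrier cp" and g: "g \<in> carrier cp" and u: "u \<notin> carrier F"
  shows "times_sa cp f g u = (\<lambda>x. 0)"
proof -
  have "{(s, t). f s \<noteq> (\<lambda>x. 0) \<and> g t \<noteq> (\<lambda>x. 0) \<and> s \<otimes> t = u} = {}"
    using f g u by (auto simp: carrier_cp)
  then show ?thesis
    unfolding alg_crossed_product_def star_algebra.select_convs by (simp only: sum.empty)
qed

lemma cp_star: "star_sa cp f u x =
    (if u \<in> carrier F \<and> x \<in> V u then cnj (f (inv u) (\<phi> (inv u) x)) else 0)"
  by (simp add: alg_crossed_product_def dual_action_def)

lemma supp_times:
  assumes f: "f \<in> carrier cp" and g: "g \<in> carrier cp"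
  shows "supp (times_sa cp f g) \<subseteq> (\<lambda>(s, t). s \<otimes> t) ` (supp f \<times> supp g)"
proof
  fix u assume u: "u \<in> supp (times_sa cp f g)"
  then have uF: "u \<in> carrier F"
    using cp_times_off[OF f g] by (auto simp: supp_def)
  from u obtain x where "times_sa cp f g u x \<noteq> 0"
    by (auto simp: supp_def)
  then obtain s where s: "s \<in> supp f" "f s x * g (inv s \<otimes> u) (\<phi> (inv s) x) \<noteq> 0"
    using cp_times_closed_form[OF f g uF finite_supp[OF f] order.refl supp_carrier[OF f], of x]
    by (auto elim: sum.not_neutral_contains_not_neutral)
  then have "inv s \<otimes> u \<in> supp g"
    using not_supp[of "inv s \<otimes> u" g] by auto
  moreover have "u = s \<otimes> (inv s \<otimes> u)"
    using inv_closed_eq[OF uF] supp_carrier[OF f] s by auto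
  ultimately show "u \<in> (\<lambda>(s, t). s \<otimes> t) ` (supp f \<times> supp g)"
    using s(1) by force
qed

lemma supp_star:
  assumes f: "f \<in> carrier cp"
  shows "supp (star_sa cp f) \<subseteq> m_inv F ` supp f"
proof
  fix u assume u: "u \<in> supp (star_sa cp f)"
  then obtain x where "star_sa cp f u x \<noteq> 0"
    by (auto simp: supp_def)
  then have "u \<in> carrier F" "f (inv u) (\<phi> (inv u) x) \<noteq> 0"
    by (auto simp: cp_star split: if_splits)
  then have "inv u \<in> supp f" "u = inv (inv u)"
    using not_supp[of "inv u" f] by auto
  then show "u \<in> m_inv F ` supp f" by blast
qed

lemma cp_times_closed:
  assumes f: "f \<in> carrier cp" and g: "g \<in> carrier cp"
  shows "times_sa cp f g \<in> carrier cp"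
  unfolding carrier_cp
proof (intro conjI ballI allI impI)
  show "finite (supp (times_sa cp f g))"
    using supp_times[OF f g] finite_supp[OF f] finite_supp[OF g] by (auto intro: finite_subset)
  fix u assume u: "u \<in> carrier F"
  have "(\<lambda>x. \<Sum>s\<in>supp f. f s x * g (inv s \<otimes> u) (\<phi> (inv s) x)) \<in> C0 T (V u)"
  proof (rule C0_sum[OF u finite_supp[OF f]])
    fix s assume "s \<in> supp f"
    then have s: "s \<in> carrier F"
      using supp_carrier[OF f] by auto
    from C0_transport[OF s _ cp_component[OF f s] cp_component[OF g], of "inv s \<otimes> u"] s u
    show "(\<lambda>x. f s x * g (inv s \<otimes> u) (\<phi> (inv s) x)) \<in> C0 T (V u)"
      by (simp add: inv_closed_eq)
  qed
  moreover have "times_sa cp f g u = (\<lambda>x. \<Sum>s\<in>supp f. f s x * g (inv s \<otimes> u) (\<phi> (inv s) x))"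
    by (intro ext cp_times_closed_form[OF f g u finite_supp[OF f] order.refl supp_carrier[OF f]])
  ultimately show "times_sa cp f g u \<in> C0 T (V u)" by simp
qed (use cp_times_off[OF f g] in auto)

lemma cp_star_closed:
  assumes f: "f \<in> carrier cp"
  shows "star_sa cp f \<in> carrier cp"
  unfolding carrier_cp
proof (intro conjI ballI allI impI)
  show "finite (supp (star_sa cp f))"
    using supp_star[OF f] finite_supp[OF f] by (auto intro: finite_subset)
  fix u assume u: "u \<in> carrier F"
  have "star_sa cp f u = (\<lambda>x. if x \<in> V u then cnj (f (inv u) (\<phi> (inv u) x)) else 0)"
    using u by (simp add: cp_star fun_eq_iff)
  then show "star_sa cp f u \<in> C0 T (V u)"
    using C0_adjoint[OF u cp_component[OF f]] u by simp
qed (simp add: cp_star fun_eq_iff)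

lemma cp_scale_closed:
  assumes f: "f \<in> carrier cp"
  shows "scale_sa cp c f \<in> carrier cp"
proof -
  have "supp (scale_sa cp c f) \<subseteq> supp f"
    by (auto simp: supp_def)
  then have "finite (supp (scale_sa cp c f))"
    using finite_supp[OF f] by (rule finite_subset)
  then show ?thesis
    using f by (simp add: carrier_cp C0_scale)
qed

lemma cp_plus_closed:
  assumes f: "f \<in> carrier cp" and g: "g \<in> carrier cp"
  shows "plus_sa cp f g \<in> carrier cp"
proof -
  have "supp (plus_sa cp f g) \<subseteq> supp f \<union> supp g"
    by (auto simp: supp_def)
  then have "finite (supp (plus_sa cp f g))"
    by (rule finite_subset) (simp add: finite_supp[OF f] finite_supp[OF g])
  then show ?thesis
    using f g by (simp add: carrier_cp C0_add)
qed

sublocale star_alg cp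
proof
  fix f g h :: "'a \<Rightarrow> 'x \<Rightarrow> complex" and c d :: complex
  assume f: "f \<in> carrier cp"
  show "scale_sa cp c f \<in> carrier cp"
    by (rule cp_scale_closed[OF f])
  show "star_sa cp f \<in> carrier cp"
    by (rule cp_star_closed[OF f])
  show "star_sa cp (scale_sa cp c f) = scale_sa cp (cnj c) (star_sa cp f)"
    by (simp add: cp_star fun_eq_iff)
  show "star_sa cp (star_sa cp f) = f"
    using f cp_off[OF f] \<phi>_closed \<phi>_inverse by (auto simp: cp_star fun_eq_iff carrier_cp)
  assume g: "g \<in> carrier cp"
  show "plus_sa cp f g \<in> carrier cp"
    by (rule cp_plus_closed[OF f g])
  show "times_sa cp f g \<in> carrier cp"
    by (rule cp_times_closed[OF f g])
  show "star_sa cp (plus_sa cp f g) = plus_sa cp (star_sa cp f) (star_sa cp g)"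
    by (simp add: cp_star fun_eq_iff)
  note cf = cp_scale_closed[OF f, of c] and cg = cp_scale_closed[OF g, of c]
  show "times_sa cp f (scale_sa cp c g) = scale_sa cp c (times_sa cp f g)"
  proof (intro ext)
    fix u x show "times_sa cp f (scale_sa cp c g) u x = scale_sa cp c (times_sa cp f g) u x"
      using cp_times_closed_form[OF f g _ finite_supp[OF f] order.refl supp_carrier[OF f], of u x]
        cp_times_closed_form[OF f cg _ finite_supp[OF f] order.refl supp_carrier[OF f], of u x]
        cp_times_off[OF f g, of u] cp_times_off[OF f cg, of u]
      by (cases "u \<in> carrier F") (simp_all add: sum_distrib_left mult_ac)
  qed
  have "supp (scale_sa cp c f) \<subseteq> supp f"
    by (auto simp: supp_def)
  note cf_form = cp_times_closed_form[OF cf g _ finite_supp[OF f] this supp_carrier[OF f]]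
  show "times_sa cp (scale_sa cp c f) g = scale_sa cp c (times_sa cp f g)"
  proof (intro ext)
    fix u x show "times_sa cp (scale_sa cp c f) g u x = scale_sa cp c (times_sa cp f g) u x"
      using cp_times_closed_form[OF f g _ finite_supp[OF f] order.refl supp_carrier[OF f], of u x]
        cf_form[of u x] cp_times_off[OF f g, of u] cp_times_off[OF cf g, of u]
      by (cases "u \<in> carrier F") (simp_all add: sum_distrib_left mult_ac)
  qed
  assume h: "h \<in> carrier cp"
  note gh = cp_plus_closed[OF g h] and fg = cp_plus_closed[OF f g]
  show "times_sa cp f (plus_sa cp g h) = plus_sa cp (times_sa cp f g) (times_sa cp f h)"
  proof (intro ext)
    fix u x show "times_sa cp f (plus_sa cp g h) u x = plus_sa cp (times_sa cp f g) (times_sa cp f h) u x"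
      using cp_times_closed_form[OF f g _ finite_supp[OF f] order.refl supp_carrier[OF f], of u x]
        cp_times_closed_form[OF f h _ finite_supp[OF f] order.refl supp_carrier[OF f], of u x]
        cp_times_closed_form[OF f gh _ finite_supp[OF f] order.refl supp_carrier[OF f], of u x]
        cp_times_off[OF f g, of u] cp_times_off[OF f h, of u] cp_times_off[OF f gh, of u]
      by (cases "u \<in> carrier F") (simp_all add: sum.distrib distrib_left)
  qed
  have S: "finite (supp f \<union> supp g)" "supp f \<union> supp g \<subseteq> carrier F"
    "supp f \<subseteq> supp f \<union> supp g" "supp g \<subseteq> supp f \<union> supp g" "supp (plus_sa cp f g) \<subseteq> supp f \<union> supp g"
    using finite_supp[OF f] finite_supp[OF g] supp_carrier[OF f] supp_carrier[OF g]
    by (auto simp: supp_def)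
  show "times_sa cp (plus_sa cp f g) h = plus_sa cp (times_sa cp f h) (times_sa cp g h)"
  proof (intro ext)
    fix u x show "times_sa cp (plus_sa cp f g) h u x = plus_sa cp (times_sa cp f h) (times_sa cp g h) u x"
      using cp_times_closed_form[OF f h _ S(1,3,2), of u x] cp_times_closed_form[OF g h _ S(1,4,2), of u x]
        cp_times_closed_form[OF fg h _ S(1,5,2), of u x]
        cp_times_off[OF f h, of u] cp_times_off[OF g h, of u] cp_times_off[OF fg h, of u]
      by (cases "u \<in> carrier F") (simp_all add: sum.distrib distrib_right)
  qed
next
  have "(\<lambda>t x. 0) \<in> carrier cp"
    by (simp add: carrier_cp supp_def C0_zero)
  then show "carrier cp \<noteq> {}" by blast
qed (auto simp: fun_eq_iff algebra_simps)

end

section \<open>The l1 norm dominates every C*-seminorm\<close>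

context crossed_algebra
begin

definition l1_norm :: "('a \<Rightarrow> 'x \<Rightarrow> complex) \<Rightarrow> real" where
  "l1_norm f = (\<Sum>t\<in>supp f. sup_norm (f t))"

lemma l1_norm_eq: "finite S \<Longrightarrow> supp f \<subseteq> S \<Longrightarrow> l1_norm f = (\<Sum>t\<in>S. sup_norm (f t))"
  unfolding l1_norm_def by (rule sum.mono_neutral_left) (auto simp: supp_def)

lemma l1_norm_plus:
  assumes f: "f \<in> carrier cp" and g: "g \<in> carrier cp"
  shows "l1_norm (plus_sa cp f g) \<le> l1_norm f + l1_norm g"
proof -
  define S where "S = supp f \<union> supp g"
  have S: "finite S" "supp f \<subseteq> S" "supp g \<subseteq> S" "supp (plus_sa cp f g) \<subseteq> S"
    using finite_supp[OF f] finite_supp[OF g] by (auto simp: S_def supp_def)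
  have "sup_norm (\<lambda>x. f t x + g t x) \<le> sup_norm (f t) + sup_norm (g t)" for t
    using sup_norm_upper[OF cp_bounded[OF f, of t]] sup_norm_upper[OF cp_bounded[OF g, of t]]
    by (intro sup_norm_least order.trans[OF norm_triangle_ineq] add_mono)
  then show ?thesis
    using S by (simp add: l1_norm_eq[OF S(1)] sum_mono flip: sum.distrib)
qed

lemma l1_norm_scale:
  assumes f: "f \<in> carrier cp"
  shows "l1_norm (scale_sa cp c f) = cmod c * l1_norm f"
proof -
  have "supp (scale_sa cp c f) \<subseteq> supp f"
    by (auto simp: supp_def)
  then show ?thesis
    using cp_bounded[OF f] by (simp add: l1_norm_eq[OF finite_supp[OF f]] sup_norm_scale sum_distrib_left)
qed

text \<open>Young's estimate for convolutions: bound each coefficient by a sum of products of sup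
  norms and exchange the sums. As \<open>u \<mapsto> inv s \<otimes> u\<close> is injective, the
  inner sum is part of \<open>l1_norm g\<close>.\<close>

lemma l1_norm_times:
  assumes f: "f \<in> carrier cp" and g: "g \<in> carrier cp"
  shows "l1_norm (times_sa cp f g) \<le> l1_norm f * l1_norm g"
proof -
  define U where "U = (\<lambda>(s, t). s \<otimes> t) ` (supp f \<times> supp g)"
  have U: "finite U" "U \<subseteq> carrier F" "supp (times_sa cp f g) \<subseteq> U"
    using finite_supp[OF f] finite_supp[OF g] supp_carrier[OF f] supp_carrier[OF g] supp_times[OF f g]
    by (auto simp: U_def)
  note bf = cp_bounded[OF f] and bg = cp_bounded[OF g]
  have "l1_norm (times_sa cp f g) = (\<Sum>u\<in>U. sup_norm (times_sa cp f g u))"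
    by (rule l1_norm_eq[OF U(1,3)])
  also have "\<dots> \<le> (\<Sum>u\<in>U. \<Sum>s\<in>supp f. sup_norm (f s) * sup_norm (g (inv s \<otimes> u)))"
  proof (intro sum_mono sup_norm_least)
    fix u x assume "u \<in> U"
    then have "u \<in> carrier F" using U by auto
    then have "cmod (times_sa cp f g u x) = cmod (\<Sum>s\<in>supp f. f s x * g (inv s \<otimes> u) (\<phi> (inv s) x))"
      using cp_times_closed_form[OF f g _ finite_supp[OF f] order.refl supp_carrier[OF f]] by simp
    also have "\<dots> \<le> (\<Sum>s\<in>supp f. cmod (f s x * g (inv s \<otimes> u) (\<phi> (inv s) x)))"
      by (rule norm_sum)
    also have "\<dots> \<le> (\<Sum>s\<in>supp f. sup_norm (f s) * sup_norm (g (inv s \<otimes> u)))"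
      unfolding norm_mult
      by (intro sum_mono mult_mono sup_norm_upper bf bg sup_norm_nonneg norm_ge_zero)
    finally show "cmod (times_sa cp f g u x) \<le> (\<Sum>s\<in>supp f. sup_norm (f s) * sup_norm (g (inv s \<otimes> u)))" .
  qed
  also have "\<dots> = (\<Sum>s\<in>supp f. sup_norm (f s) * (\<Sum>u\<in>U. sup_norm (g (inv s \<otimes> u))))"
    by (subst sum.swap) (simp add: sum_distrib_left)
  also have "\<dots> \<le> (\<Sum>s\<in>supp f. sup_norm (f s) * l1_norm g)"
  proof (intro sum_mono mult_left_mono sup_norm_nonneg bf)
    fix s assume "s \<in> supp f"
    then have s: "s \<in> carrier F"
      using supp_carrier[OF f] by auto
    have inj: "inj_on (\<lambda>u. inv s \<otimes> u) U"
      using inj_on_subset[OF inj_on_cmult[of "inv s"] U(2)] s by simp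
    have "(\<Sum>u\<in>U. sup_norm (g (inv s \<otimes> u))) = (\<Sum>t\<in>(\<lambda>u. inv s \<otimes> u) ` U. sup_norm (g t))"
      by (simp add: sum.reindex[OF inj])
    also have "\<dots> \<le> (\<Sum>t\<in>(\<lambda>u. inv s \<otimes> u) ` U \<union> supp g. sup_norm (g t))"
      using U finite_supp[OF g] by (intro sum_mono2) (auto intro: sup_norm_nonneg bg)
    also have "\<dots> = l1_norm g"
      using U finite_supp[OF g] by (intro l1_norm_eq[symmetric]) auto
    finally show "(\<Sum>u\<in>U. sup_norm (g (inv s \<otimes> u))) \<le> l1_norm g" .
  qed
  also have "\<dots> = l1_norm f * l1_norm g"
    by (simp add: l1_norm_def sum_distrib_right)
  finally show ?thesis .
qed

text \<open>Translation along \<open>\<phi>\<close> cannot increase a sup norm, which gives one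
  inequality; the other follows since the adjoint is an involution.\<close>

lemma l1_norm_star:
  assumes f: "f \<in> carrier cp"
  shows "l1_norm (star_sa cp f) = l1_norm f"
proof -
  have le: "l1_norm (star_sa cp f) \<le> l1_norm f" if f: "f \<in> carrier cp" for f
  proof -
    note bf = cp_bounded[OF f]
    have "l1_norm (star_sa cp f) = (\<Sum>u\<in>m_inv F ` supp f. sup_norm (star_sa cp f u))"
      using finite_supp[OF f] by (intro l1_norm_eq supp_star[OF f]) auto
    also have "\<dots> = (\<Sum>t\<in>supp f. sup_norm (star_sa cp f (inv t)))"
    proof -
      have "inj_on (m_inv F) (supp f)"
        using supp_carrier[OF f] by (intro inj_on_inverseI[where g = "m_inv F"]) auto
      then show ?thesis by (simp add: sum.reindex)
    qed
    also have "\<dots> \<le> (\<Sum>t\<in>supp f. sup_norm (f t))"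
    proof (intro sum_mono sup_norm_least)
      fix t x assume "t \<in> supp f"
      then have t: "t \<in> carrier F"
        using supp_carrier[OF f] by auto
      then show "cmod (star_sa cp f (inv t) x) \<le> sup_norm (f t)"
        using sup_norm_upper[OF bf] sup_norm_nonneg[OF bf] by (simp add: cp_star)
    qed
    finally show ?thesis by (simp add: l1_norm_def)
  qed
  show ?thesis
    using le[OF f] le[OF star_closed[OF f]] star_star[OF f] by simp
qed

lemma mono_plus: "plus_sa cp (mono t f) (mono t g) = mono t (\<lambda>x. f x + g x)"
  and mono_scale: "scale_sa cp c (mono t f) = mono t (\<lambda>x. c * f x)"
  by (auto simp: mono_def fun_eq_iff)

lemma mono_times:
  assumes s: "s \<in> carrier F" "t \<in> carrier F" and f: "f \<in> C0 T (V s)" and g: "g \<in> C0 T (V t)"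
  shows "times_sa cp (mono s f) (mono t g) = mono (s \<otimes> t) (\<lambda>x. f x * g (\<phi> (inv s) x))"
proof (intro ext)
  fix u x
  have c: "mono s f \<in> carrier cp" "mono t g \<in> carrier cp"
    using assms by auto
  show "times_sa cp (mono s f) (mono t g) u x = mono (s \<otimes> t) (\<lambda>x. f x * g (\<phi> (inv s) x)) u x"
  proof (cases "u \<in> carrier F")
    case True
    have "times_sa cp (mono s f) (mono t g) u x = (\<Sum>r\<in>{s}. mono s f r x * mono t g (inv r \<otimes> u) (\<phi> (inv r) x))"
      using s by (intro cp_times_closed_form[OF c True]) (auto simp: supp_def mono_def)
    moreover have "inv s \<otimes> u = t \<longleftrightarrow> u = s \<otimes> t"
      using s True inv_solve_left[of t s u] by auto
    ultimately show ?thesis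
      by (simp add: mono_def)
  next
    case False
    then show ?thesis
      using cp_times_off[OF c False] s by (auto simp: mono_def)
  qed
qed

lemma mono_star:
  assumes t: "t \<in> carrier F" and f: "f \<in> C0 T (V t)"
  shows "star_sa cp (mono t f) = mono (inv t) (\<lambda>x. if x \<in> V (inv t) then cnj (f (\<phi> t x)) else 0)"
proof (intro ext)
  fix u x
  have "u \<in> carrier F \<Longrightarrow> inv u = t \<longleftrightarrow> u = inv t"
    using t by auto
  then show "star_sa cp (mono t f) u x = mono (inv t) (\<lambda>x. if x \<in> V (inv t) then cnj (f (\<phi> t x)) else 0) u x"
    using t by (auto simp: cp_star mono_def)
qed

text \<open>The computation through which the C*-identity lowers an arbitrary degree to
  \<open>\<one>\<close>: the coefficient obtained is a squared modulus, so its sup norm is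
  controlled by that of \<open>f\<close>.\<close>

lemma star_mono_times_mono:
  assumes t: "t \<in> carrier F" and f: "f \<in> C0 T (V t)"
  shows "times_sa cp (star_sa cp (mono t f)) (mono t f) =
    mono \<one> (\<lambda>x. if x \<in> V (inv t) then of_real ((cmod (f (\<phi> t x)))\<^sup>2) else 0)"
proof -
  have "(\<lambda>x. if x \<in> V (inv t) then cnj (f (\<phi> t x)) else 0) \<in> C0 T (V (inv t))"
    using C0_adjoint[of "inv t" f] f by (simp only: inv_inv[OF t] inv_closed[OF t])
  then have "times_sa cp (star_sa cp (mono t f)) (mono t f) =
      mono \<one> (\<lambda>x. (if x \<in> V (inv t) then cnj (f (\<phi> t x)) else 0) * f (\<phi> t x))"
    using t f by (simp add: mono_star mono_times)
  also have "(\<lambda>x. (if x \<in> V (inv t) then cnj (f (\<phi> t x)) else 0) * f (\<phi> t x)) =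
      (\<lambda>x. if x \<in> V (inv t) then of_real ((cmod (f (\<phi> t x)))\<^sup>2) else 0)"
    by (intro ext) (simp add: complex_norm_square[symmetric] mult.commute[of "cnj _"])
  finally show ?thesis .
qed

text \<open>In degree \<open>\<one>\<close> the crossed product multiplies pointwise and its adjoint
  is complex conjugation, so \<open>cstar_seminorm_le_sup\<close> applies with \<open>C0 T X\<close>
  as the algebra of functions.\<close>

lemma cstar_seminorm_mono_one:
  assumes q: "cstar_seminorm cp q" and f: "f \<in> C0 T X" and M: "\<And>x. cmod (f x) \<le> M"
  shows "q (mono \<one> f) \<le> M"
proof -
  interpret q: cstar_seminormed cp q
    by unfold_locales (rule q)
  have car: "mono \<one> f \<in> carrier cp" if "f \<in> C0 T X" for f
    using that V_one by simp
  have adj: "(\<lambda>x. if x \<in> X then cnj (f (\<phi> \<one> x)) else 0) = (\<lambda>x. cnj (f x))" if f: "f \<in> C0 T X" for f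
    by (intro ext) (simp add: C0_off[OF f] \<phi>_one)
  have cnj: "(\<lambda>x. cnj (f x)) \<in> C0 T X" if f: "f \<in> C0 T X" for f
    using C0_adjoint[of \<one> f] f by (simp only: V_one inv_one one_closed adj[OF f])
  have times: "(\<lambda>x. f x * g x) \<in> C0 T X" and mono: "times_sa cp (mono \<one> f) (mono \<one> g) = mono \<one> (\<lambda>x. f x * g x)"
    if f: "f \<in> C0 T X" and g: "g \<in> C0 T X" for f g
  proof -
    have eq: "(\<lambda>x. f x * g (\<phi> (inv \<one>) x)) = (\<lambda>x. f x * g x)"
    proof
      fix x
      show "f x * g (\<phi> (inv \<one>) x) = f x * g x"
        by (cases "x \<in> X") (simp_all add: C0_off[OF f] \<phi>_one)
    qed
    show "(\<lambda>x. f x * g x) \<in> C0 T X"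
      using C0_transport[of \<one> \<one> f g] f g by (simp only: eq V_one one_closed r_one)
    show "times_sa cp (mono \<one> f) (mono \<one> g) = mono \<one> (\<lambda>x. f x * g x)"
      using mono_times[of \<one> \<one> f g] f g by (simp only: eq V_one one_closed r_one)
  qed
  have star: "star_sa cp (mono \<one> f) = mono \<one> (\<lambda>x. cnj (f x))" if f: "f \<in> C0 T X" for f
    using mono_star[of \<one> f] f by (simp add: V_one adj[OF f])
  show ?thesis
  proof (rule cstar_seminorm_le_sup[where p = "\<lambda>f. q (mono \<one> f)" and \<A> = "C0 T X"])
    show "f \<in> C0 T X" "\<And>x. cmod (f x) \<le> M"
      by (rule f, rule M)
  next
    fix f g :: "'x \<Rightarrow> complex" and c assume f: "f \<in> C0 T X"
    show "(\<lambda>x. c * f x) \<in> C0 T X"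
      using C0_scale[of \<one> f c] f by (simp add: V_one)
    show "0 \<le> q (mono \<one> f)"
      using car[OF f] by simp
    show "q (mono \<one> (\<lambda>x. c * f x)) = cmod c * q (mono \<one> f)"
      using q.p_scale[OF car[OF f], of c] by (simp add: mono_scale del: cp_simps)
    show "q (mono \<one> (\<lambda>x. cnj (f x) * f x)) = (q (mono \<one> f))\<^sup>2"
      using q.p_cstar[OF car[OF f]] f by (simp add: star mono cnj)
    assume g: "g \<in> C0 T X"
    show "(\<lambda>x. f x + g x) \<in> C0 T X"
      using C0_add[of \<one> f g] f g by (simp add: V_one)
    show "q (mono \<one> (\<lambda>x. f x + g x)) \<le> q (mono \<one> f) + q (mono \<one> g)"
      using q.p_plus[OF car[OF f] car[OF g]] by (simp add: mono_plus del: cp_simps)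
  qed (use cnj times C0_root in auto)
qed

lemma cstar_seminorm_mono:
  assumes q: "cstar_seminorm cp q" and t: "t \<in> carrier F" and f: "f \<in> C0 T (V t)"
  shows "q (mono t f) \<le> sup_norm f"
proof -
  interpret q: cstar_seminormed cp q
    by unfold_locales (rule q)
  let ?h = "\<lambda>x. if x \<in> V (inv t) then complex_of_real ((cmod (f (\<phi> t x)))\<^sup>2) else 0"
  have car: "mono t f \<in> carrier cp"
    using t f by simp
  have bf: "bounded (range f)"
    by (rule C0_bounded[OF t f])
  have "mono \<one> ?h \<in> carrier cp"
    using times_closed[OF star_closed[OF car] car] by (simp only: star_mono_times_mono[OF t f])
  then have h: "?h \<in> C0 T X"
    using cp_component[of "mono \<one> ?h" \<one>] by (simp add: mono_def V_one)
  have "(q (mono t f))\<^sup>2 = q (mono \<one> ?h)"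
    using q.p_cstar[OF car] by (simp only: star_mono_times_mono[OF t f])
  also have "\<dots> \<le> (sup_norm f)\<^sup>2"
  proof (rule cstar_seminorm_mono_one[OF q h])
    fix x
    show "cmod (?h x) \<le> (sup_norm f)\<^sup>2"
      using power_mono[OF sup_norm_upper[OF bf, of "\<phi> t x"] norm_ge_zero, of 2]
      by (simp add: norm_power)
  qed
  finally show ?thesis
    by (rule power2_le_imp_le[OF _ sup_norm_nonneg[OF bf]])
qed

lemma cstar_seminorm_le_l1_norm:
  assumes q: "cstar_seminorm cp q" and f: "f \<in> carrier cp"
  shows "q f \<le> l1_norm f"
proof -
  interpret q: cstar_seminormed cp q
    by unfold_locales (rule q)
  \<comment> \<open>The signature only offers binary sums, so \<open>f\<close> is rebuilt from its
    monomials by induction on the set of degrees.\<close>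
  let ?cut = "\<lambda>S t. if t \<in> S then f t else (\<lambda>x. 0)"
  have "?cut S \<in> carrier cp \<and> q (?cut S) \<le> (\<Sum>t\<in>S. sup_norm (f t))"
    if "finite S" "S \<subseteq> supp f" for S
    using that
  proof (induction S)
    case empty
    have eq: "?cut {} = scale_sa cp 0 f"
      by (auto simp: fun_eq_iff)
    show ?case
      unfolding eq using q.p_scale[OF f, of 0] scale_closed[OF f, of 0] by simp
  next
    case (insert t S)
    then have t: "t \<in> carrier F"
      using supp_carrier[OF f] by auto
    have eq: "?cut (insert t S) = plus_sa cp (mono t (f t)) (?cut S)"
      using insert by (auto simp: fun_eq_iff mono_def)
    have m: "mono t (f t) \<in> carrier cp"
      by (rule mono_carrier[OF t cp_component[OF f t]])
    have "q (mono t (f t)) \<le> sup_norm (f t)"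
      by (rule cstar_seminorm_mono[OF q t cp_component[OF f t]])
    moreover have c: "?cut S \<in> carrier cp" "q (?cut S) \<le> (\<Sum>t\<in>S. sup_norm (f t))"
      using insert by auto
    moreover have "q (plus_sa cp (mono t (f t)) (?cut S)) \<le> q (mono t (f t)) + q (?cut S)"
      by (rule q.p_plus[OF m c(1)])
    ultimately show ?case
      unfolding eq using plus_closed[OF m c(1)] insert by simp
  qed
  from this[OF finite_supp[OF f] order.refl]
  have "q (?cut (supp f)) \<le> l1_norm f"
    by (simp add: l1_norm_def)
  moreover have "?cut (supp f) = f"
    by (auto simp: supp_def fun_eq_iff)
  ultimately show ?thesis by simp
qed

end

section \<open>Free groups\<close>

lemma inv_letter_inv_letter [simp]: "inv_letter (inv_letter x) = x"
  by (cases x) auto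

lemma inv_letter_eq_iff [simp]: "inv_letter x = inv_letter y \<longleftrightarrow> x = y"
  by (metis inv_letter_inv_letter)

lemma reduced_iff_successively: "reduced t \<longleftrightarrow> successively (\<lambda>x y. x \<noteq> inv_letter y) t"
  by (simp add: reduced_def successively_conv_nth)

lemma reduced_Nil [simp]: "reduced []"
  and reduced_single [simp]: "reduced [x]"
  and reduced_Cons_Cons [simp]: "reduced (x # y # t) \<longleftrightarrow> x \<noteq> inv_letter y \<and> reduced (y # t)"
  by (simp_all add: reduced_iff_successively)

lemma reduced_ConsD: "reduced (x # t) \<Longrightarrow> reduced t"
  by (cases t) auto

definition inv_word :: "'a letter list \<Rightarrow> 'a letter list" where
  "inv_word t = rev (map inv_letter t)"

lemma inv_word_Nil [simp]: "inv_word [] = []"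
  and inv_word_Cons [simp]: "inv_word (x # t) = inv_word t @ [inv_letter x]"
  and inv_word_append [simp]: "inv_word (s @ t) = inv_word t @ inv_word s"
  and inv_word_inv_word [simp]: "inv_word (inv_word t) = t"
  by (simp_all add: inv_word_def rev_map o_def)

lemma reduced_inv_word [simp]: "reduced (inv_word t) \<longleftrightarrow> reduced t"
proof -
  have "(inv_letter x \<noteq> y) = (x \<noteq> inv_letter y)" for x y :: "'a letter"
    by auto
  then show ?thesis
    by (auto simp: reduced_iff_successively inv_word_def successively_map intro: successively_mono)
qed

lemma letter_mult_reduced: "reduced (x # t) \<Longrightarrow> letter_mult x t = x # t"
  by (cases t) auto

lemma reduced_letter_mult [simp]: "reduced t \<Longrightarrow> reduced (letter_mult x t)"
  by (cases t) (auto dest: reduced_ConsD)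

lemma letter_mult_cancel: "reduced t \<Longrightarrow> letter_mult x (letter_mult (inv_letter x) t) = t"
  by (cases t) (auto simp: letter_mult_reduced)

lemma reduced_foldr [simp]: "reduced t \<Longrightarrow> reduced (foldr letter_mult s t)"
  by (induction s) auto

text \<open>The two sides differ in form only if \<open>x\<close> cancels the head of
  \<open>s\<close>, and a cancelling pair acts trivially on reduced words. This is van der Waerden's
  action of the free group on reduced words; it yields associativity without a confluence
  argument.\<close>

lemma foldr_letter_mult:
  "reduced t \<Longrightarrow> foldr letter_mult (letter_mult x s) t = letter_mult x (foldr letter_mult s t)"
  using letter_mult_cancel[of "foldr letter_mult (tl s) t" x] by (cases s) auto

lemma foldr_foldr_letter_mult:
  "reduced u \<Longrightarrow> foldr letter_mult (foldr letter_mult s t) u = foldr letter_mult s (foldr letter_mult t u)"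
  by (induction s) (auto simp: foldr_letter_mult)

lemma foldr_inv_word: "foldr letter_mult (inv_word t) t = []"
  by (induction t) auto

lemma group_free_group: "group free_group"
proof (rule groupI)
  fix t :: "'a letter list" assume "t \<in> carrier free_group"
  then show "\<exists>s\<in>carrier free_group. s \<otimes>\<^bsub>free_group\<^esub> t = \<one>\<^bsub>free_group\<^esub>"
    by (intro bexI[of _ "inv_word t"]) (auto simp: free_group_def foldr_inv_word)
qed (auto simp: free_group_def foldr_foldr_letter_mult)

lemma inv_free_group: "reduced t \<Longrightarrow> inv\<^bsub>free_group\<^esub> t = inv_word t"
  by (rule group.inv_equality[OF group_free_group]) (auto simp: free_group_def foldr_inv_word)

section \<open>Relative ranges\<close>

context labelled_graph
begin

lemma relrange_Nil [simp]: "relrange A [] = A"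
  by (simp add: relrange_def)

lemma relrange_empty [simp]: "relrange {} \<alpha> = {}"
  by (simp add: relrange_def)

lemma relrange_mono: "A \<subseteq> C \<Longrightarrow> relrange A \<alpha> \<subseteq> relrange C \<alpha>"
  by (auto simp: relrange_def)

lemma relrange_Un: "relrange (A \<union> C) \<alpha> = relrange A \<alpha> \<union> relrange C \<alpha>"
  by (auto simp: relrange_def)

text \<open>A path is cut where its label \<open>\<alpha>\<close> ends, and conversely composable
  paths are joined. Empty words are separate because \<open>relrange\<close> fixes their value by
  convention and not by paths.\<close>

lemma relrange_append: "relrange A (\<alpha> @ \<beta>) = relrange (relrange A \<alpha>) \<beta>"
proof (cases "\<alpha> = [] \<or> \<beta> = []")
  case False
  define P where "P \<gamma> u v \<longleftrightarrow> (\<exists>\<pi>. awalk u \<pi> v \<and> map lab \<pi> = \<gamma>)" for \<gamma> u v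
  have split: "P (\<alpha> @ \<beta>) u v \<longleftrightarrow> (\<exists>w. P \<alpha> u w \<and> P \<beta> w v)" for u v
    unfolding P_def
  proof safe
    fix \<pi> assume "awalk u \<pi> v" "map lab \<pi> = \<alpha> @ \<beta>"
    moreover from this obtain \<pi>1 \<pi>2 where "\<pi> = \<pi>1 @ \<pi>2" "map lab \<pi>1 = \<alpha>" "map lab \<pi>2 = \<beta>"
      by (auto simp: map_eq_append_conv)
    ultimately show "\<exists>w. (\<exists>\<pi>. awalk u \<pi> w \<and> map lab \<pi> = \<alpha>) \<and> (\<exists>\<pi>. awalk w \<pi> v \<and> map lab \<pi> = \<beta>)"
      by auto
  next
    fix w \<pi>1 \<pi>2 assume w: "awalk u \<pi>1 w" "awalk w \<pi>2 v"
    then have "awalk u (\<pi>1 @ \<pi>2) v"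
      using awalk_ends by fastforce
    then show "\<exists>\<pi>. awalk u \<pi> v \<and> map lab \<pi> = map lab \<pi>1 @ map lab \<pi>2"
      by (intro exI[of _ "\<pi>1 @ \<pi>2"]) simp
  qed
  have mem: "v \<in> relrange C \<gamma> \<longleftrightarrow> (\<exists>u\<in>C. P \<gamma> u v)" if "\<gamma> \<noteq> []" for v C \<gamma>
    using that by (simp add: relrange_def P_def)
  show ?thesis
  proof (rule Set.set_eqI)
    fix v
    have "v \<in> relrange A (\<alpha> @ \<beta>) \<longleftrightarrow> (\<exists>w. (\<exists>u\<in>A. P \<alpha> u w) \<and> P \<beta> w v)"
      using False by (subst mem) (auto simp: split)
    also have "\<dots> \<longleftrightarrow> v \<in> relrange (relrange A \<alpha>) \<beta>"
      using False by (simp add: mem) (use mem[of \<alpha> _ A] False in blast)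
    finally show "v \<in> relrange A (\<alpha> @ \<beta>) \<longleftrightarrow> v \<in> relrange (relrange A \<alpha>) \<beta>" .
  qed
qed auto

lemma relrange_Cons: "relrange A (a # \<alpha>) = relrange (relrange A [a]) \<alpha>"
  using relrange_append[of A "[a]" \<alpha>] by simp

lemma range_of_Nil [simp]: "range_of [] = verts G"
  by (simp add: range_of_def)

lemma range_of_append: "range_of (\<alpha> @ \<beta>) = relrange (range_of \<alpha>) \<beta>"
  by (simp add: range_of_def relrange_append)

lemma relrange_verts: "A \<subseteq> verts G \<Longrightarrow> relrange A \<alpha> \<subseteq> verts G"
  by (auto simp: relrange_def)

lemma range_of_verts: "range_of \<alpha> \<subseteq> verts G"
  by (simp add: range_of_def relrange_verts)

lemma relrange_range_of: "A \<subseteq> verts G \<Longrightarrow> relrange A \<alpha> \<subseteq> range_of \<alpha>"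
  by (simp add: range_of_def relrange_mono)

lemma range_of_append_subset: "range_of (\<alpha> @ \<beta>) \<subseteq> range_of \<beta>"
  by (simp add: range_of_append relrange_range_of range_of_verts)

lemma relrange_path: "relrange A \<alpha> \<noteq> {} \<Longrightarrow> \<alpha> \<in> path_labels"
  by (auto simp: relrange_def path_labels_def path_labels1_def split: if_splits)

lemma range_of_path: "range_of \<alpha> \<noteq> {} \<Longrightarrow> \<alpha> \<in> path_labels"
  unfolding range_of_def by (rule relrange_path)

lemma letter_path [simp]: "[a] \<in> path_labels1"
proof -
  obtain e where "e \<in> arcs G" "lab e = a"
    using lab_surj by (metis UNIV_I imageE)
  then show ?thesis
    unfolding path_labels1_def using arc_implies_awalk[of e] by (auto intro!: exI[of _ "[e]"])
qed

text \<open>The reason why elements with longer words can never cover a set of sinks.\<close>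

lemma relrange_sinks:
  assumes "A \<subseteq> sinks" "\<alpha> \<noteq> []"
  shows "relrange A \<alpha> = {}"
proof -
  have False if v: "v \<in> relrange A \<alpha>" for v
  proof -
    from v assms(2) obtain u \<pi> where u: "u \<in> A" "awalk u \<pi> v" "map lab \<pi> = \<alpha>"
      by (auto simp: relrange_def)
    with assms(2) obtain e \<pi>' where "\<pi> = e # \<pi>'" by (cases \<pi>) auto
    with u assms(1) show False
      by (auto simp: awalk_Cons_iff sinks_def out_arcs_def)
  qed
  then show ?thesis by auto
qed

lemma out_labels_nonempty:
  assumes A: "A \<subseteq> verts G" and "\<not> A \<subseteq> sinks"
  shows "out_labels A \<noteq> {}"
proof -
  obtain u e where u: "u \<in> A" "e \<in> arcs G" "tail G e = u"
    using assms by (auto simp: sinks_def out_arcs_def)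
  then have "head G e \<in> relrange A [lab e]"
    using arc_implies_awalk[of e] by (auto simp: relrange_def intro!: bexI[of _ u] exI[of _ "[e]"])
  then show ?thesis
    by (auto simp: out_labels_def)
qed

end

context normal_labelled_space
begin

text \<open>The empty set is not among the closure conditions of a labelled space; relative
  complements produce it from the range of any letter.\<close>

lemma B_empty [simp]: "{} \<in> B"
  using B_Diff[OF B_range B_range, of "[undefined]" "[undefined]"] by simp

lemma B_relrange' [simp]: "A \<in> B \<Longrightarrow> relrange A \<alpha> \<in> B"
  by (cases "relrange A \<alpha> = {}") (simp_all add: B_relrange relrange_path)

lemma B_range' [simp]: "\<alpha> \<noteq> [] \<Longrightarrow> range_of \<alpha> \<in> B"
  using range_of_path[of \<alpha>] B_range[of \<alpha>] by (cases "range_of \<alpha> = {}") (auto simp: path_labels_def)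

lemma relrange_Int':
  assumes "A \<in> B" "C \<in> B"
  shows "relrange (A \<inter> C) \<alpha> = relrange A \<alpha> \<inter> relrange C \<alpha>"
proof (cases "\<alpha> \<in> path_labels1")
  case True
  then show ?thesis by (rule relrange_Int[OF assms])
next
  case False
  then show ?thesis
    using relrange_path[of _ \<alpha>] by (cases "\<alpha> = []") (auto simp: path_labels_def)
qed

section \<open>The semilattice of idempotents\<close>

text \<open>A pair \<open>(\<alpha>, A)\<close> with \<open>A = {}\<close> stands for \<open>0\<close>, so that meets are total.\<close>

definition elem :: "'c list \<times> 'a set \<Rightarrow> bool" where
  "elem e \<longleftrightarrow> snd e \<in> B \<and> snd e \<subseteq> range_of (fst e)"

definition ple :: "'c list \<times> 'a set \<Rightarrow> 'c list \<times> 'a set \<Rightarrow> bool" where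
  "ple e f \<longleftrightarrow> (\<exists>\<gamma>. fst e = fst f @ \<gamma> \<and> snd e \<subseteq> relrange (snd f) \<gamma>)"

text \<open>The longer of two comparable words survives. For incomparable words the first component
  is an arbitrary choice, so \<open>emeet\<close> is commutative only up to the identification of
  all pairs with empty second component.\<close>

definition emeet :: "'c list \<times> 'a set \<Rightarrow> 'c list \<times> 'a set \<Rightarrow> 'c list \<times> 'a set" where
  "emeet e f =
     (if prefix (fst f) (fst e) then (fst e, snd e \<inter> relrange (snd f) (drop (length (fst f)) (fst e)))
      else if prefix (fst e) (fst f) then (fst f, snd f \<inter> relrange (snd e) (drop (length (fst e)) (fst f)))
      else (fst e, {}))"

lemma emeet_left: "emeet (\<beta> @ \<gamma>, A) (\<beta>, C) = (\<beta> @ \<gamma>, A \<inter> relrange C \<gamma>)"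
  by (simp add: emeet_def)

lemma emeet_right: "emeet (\<beta>, C) (\<beta> @ \<gamma>, A) = (\<beta> @ \<gamma>, A \<inter> relrange C \<gamma>)"
  by (auto simp: emeet_def)

lemma emeet_incomparable: "\<not> prefix \<alpha> \<beta> \<Longrightarrow> \<not> prefix \<beta> \<alpha> \<Longrightarrow> emeet (\<alpha>, A) (\<beta>, C) = (\<alpha>, {})"
  by (simp add: emeet_def)

lemma emeet_cases:
  obtains (left) \<beta> \<gamma> A C where "e = (\<beta> @ \<gamma>, A)" "f = (\<beta>, C)" "emeet e f = (\<beta> @ \<gamma>, A \<inter> relrange C \<gamma>)"
    "emeet f e = (\<beta> @ \<gamma>, A \<inter> relrange C \<gamma>)"
  | (right) \<beta> \<gamma> A C where "e = (\<beta>, C)" "f = (\<beta> @ \<gamma>, A)" "emeet e f = (\<beta> @ \<gamma>, A \<inter> relrange C \<gamma>)"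
    "emeet f e = (\<beta> @ \<gamma>, A \<inter> relrange C \<gamma>)"
  | (incomparable) "\<not> prefix (fst e) (fst f)" "\<not> prefix (fst f) (fst e)" "emeet e f = (fst e, {})"
    "emeet f e = (fst f, {})"
proof -
  obtain \<alpha> A \<beta> C where ef: "e = (\<alpha>, A)" "f = (\<beta>, C)"
    by (cases e, cases f)
  consider \<gamma> where "\<alpha> = \<beta> @ \<gamma>" | \<gamma> where "\<beta> = \<alpha> @ \<gamma>" | "\<not> prefix \<alpha> \<beta>" "\<not> prefix \<beta> \<alpha>"
    by (auto simp: prefix_def)
  then show ?thesis
  proof cases
    case (1 \<gamma>)
    then show ?thesis
      using left ef emeet_left[of \<beta> \<gamma> A C] emeet_right[of \<beta> C \<gamma> A] by simp
  next
    case (2 \<gamma>)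
    then show ?thesis
      using right ef emeet_left[of \<alpha> \<gamma> C A] emeet_right[of \<alpha> A \<gamma> C] by simp
  next
    case 3
    then show ?thesis
      using incomparable ef by (simp add: emeet_incomparable)
  qed
qed

lemma elem_emeet [simp]:
  assumes "elem e" "elem f"
  shows "elem (emeet e f)"
  using assms by (cases e f rule: emeet_cases) (auto simp: elem_def intro: B_Int)

lemma ple_refl [simp]: "ple e e"
  by (simp add: ple_def)

lemma ple_trans: "ple e f \<Longrightarrow> ple f g \<Longrightarrow> ple e g"
proof -
  assume "ple e f" "ple f g"
  then obtain \<gamma> \<delta> where ef: "fst e = fst f @ \<gamma>" "snd e \<subseteq> relrange (snd f) \<gamma>"
    and fg: "fst f = fst g @ \<delta>" "snd f \<subseteq> relrange (snd g) \<delta>"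
    by (auto simp: ple_def)
  then have "fst e = fst g @ (\<delta> @ \<gamma>)" "snd e \<subseteq> relrange (snd g) (\<delta> @ \<gamma>)"
    using relrange_mono[OF fg(2), of \<gamma>] by (auto simp: relrange_append)
  then show "ple e g"
    unfolding ple_def by blast
qed

lemma ple_antisym: "ple e f \<Longrightarrow> ple f e \<Longrightarrow> e = f"
  by (cases e, cases f) (auto simp: ple_def)

lemma ple_nonempty: "ple e f \<Longrightarrow> snd e \<noteq> {} \<Longrightarrow> snd f \<noteq> {}"
  by (auto simp: ple_def)

text \<open>For comparable words this is weak left-resolution in the form
  \<open>relrange_Int'\<close>. For incomparable words nothing lies below both, because two prefixes
  of one word are comparable; the condition on \<open>l\<close> keeps out the pairs that stand for
  0.\<close>

lemma ple_emeet_iff: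
  assumes e: "elem e" and f: "elem f" and l: "snd l \<noteq> {}"
  shows "ple l (emeet e f) \<longleftrightarrow> ple l e \<and> ple l f"
proof -
  have comparable: "prefix (fst e) (fst f) \<or> prefix (fst f) (fst e)" if "ple l e" "ple l f"
  proof -
    obtain \<gamma> \<gamma>' where "fst l = fst e @ \<gamma>" "fst l = fst f @ \<gamma>'"
      using \<open>ple l e\<close> \<open>ple l f\<close> by (auto simp: ple_def)
    then have "prefix (fst e) (fst l)" "prefix (fst f) (fst l)"
      unfolding prefix_def by blast+
    then show ?thesis by (rule prefix_same_cases)
  qed
  have down: "ple l (\<beta> @ \<gamma>, A \<inter> relrange C \<gamma>) \<longleftrightarrow> ple l (\<beta> @ \<gamma>, A) \<and> ple l (\<beta>, C)"
    if "A \<in> B" "C \<in> B" for \<beta> \<gamma> A C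
    using that by (auto simp: ple_def relrange_Int' relrange_append)
  show ?thesis
  proof (cases e f rule: emeet_cases)
    case (left \<beta> \<gamma> A C)
    with e f down[of A C \<beta> \<gamma>] show ?thesis by (auto simp: elem_def)
  next
    case (right \<beta> \<gamma> A C)
    with e f down[of A C \<beta> \<gamma>] show ?thesis by (auto simp add: elem_def)
  next
    case incomparable
    with comparable l show ?thesis
      by (auto simp: ple_def)
  qed
qed

lemma emeet_nonempty:
  "elem e \<Longrightarrow> elem f \<Longrightarrow> snd l \<noteq> {} \<Longrightarrow> ple l e \<Longrightarrow> ple l f \<Longrightarrow> snd (emeet e f) \<noteq> {}"
  by (meson ple_emeet_iff ple_nonempty)

lemma emeet_ple:
  "elem e \<Longrightarrow> elem f \<Longrightarrow> snd (emeet e f) \<noteq> {} \<Longrightarrow> ple (emeet e f) e \<and> ple (emeet e f) f"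
  using ple_emeet_iff[of e f "emeet e f"] by simp

lemma idem_le_Some [simp]: "idem_le (Some e) (Some f) \<longleftrightarrow> ple e f"
  by (cases e, cases f) (simp add: ple_def)

lemma idem_le_None [simp]: "idem_le (Some e) None \<longleftrightarrow> False"
  by (cases e) simp

lemma idem_le_antisym: "idem_le x y \<Longrightarrow> idem_le y x \<Longrightarrow> x = y"
  using ple_antisym[of "the x" "the y"] by (cases x; cases y) (auto simp del: split_paired_All)

lemma Some_carrier_ES [simp]: "Some e \<in> carrier ES \<longleftrightarrow> elem e \<and> snd e \<noteq> {}"
  using range_of_path by (cases e) (auto simp: ES_def elem_def B_below_def)

lemma None_carrier_ES [simp]: "None \<in> carrier ES"
  by (simp add: ES_def)

lemma le_ES [simp]: "le ES = idem_le"
  by (simp add: ES_def)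

text \<open>The lattice meet is selected by \<open>SOME\<close> among the greatest lower bounds, so
  the explicit meet has to be shown to be the only one; antisymmetry of \<open>idem_le\<close> gives
  this.\<close>

lemma meet_ES:
  assumes e: "elem e" "snd e \<noteq> {}" and f: "elem f" "snd f \<noteq> {}"
  shows "Some e \<sqinter>\<^bsub>ES\<^esub> Some f = (if snd (emeet e f) = {} then None else Some (emeet e f))" (is "_ = ?m")
proof -
  let ?L = "Lower ES {Some e, Some f}"
  have L: "l \<in> ?L \<longleftrightarrow> l = None \<or> (\<exists>k. l = Some k \<and> elem k \<and> snd k \<noteq> {} \<and> ple k e \<and> ple k f)" for l
    using e f by (cases l) (auto simp: Lower_def)
  have m: "?m \<in> ?L"
    unfolding L using e f emeet_ple[of e f] elem_emeet[of e f]
    by (cases "snd (emeet e f) = {}") simp_all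
  have top: "idem_le l ?m" if "l \<in> ?L" for l
  proof (cases l)
    case (Some k)
    with that have k: "elem k" "snd k \<noteq> {}" "ple k e" "ple k f"
      by (auto simp: L)
    with emeet_nonempty[of e f k] ple_emeet_iff[of e f k] e f Some show ?thesis by simp
  qed simp
  have "greatest ES ?m ?L"
    using m top by (auto simp: greatest_def Lower_def)
  moreover have "x = ?m" if x: "greatest ES x ?L" for x
  proof -
    have "idem_le x ?m" "idem_le ?m x"
      using x m top by (auto simp: greatest_def)
    then show ?thesis by (rule idem_le_antisym)
  qed
  ultimately show ?thesis
    unfolding Lattice.meet_def inf_def by (rule some_equality)
qed

section \<open>Filters\<close>

lemma filterI:
  assumes "None \<notin> \<xi>" "\<xi> \<noteq> {}"
    and "\<And>e. Some e \<in> \<xi> \<Longrightarrow> elem e \<and> snd e \<noteq> {}"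
    and "\<And>e f. Some e \<in> \<xi> \<Longrightarrow> elem f \<Longrightarrow> ple e f \<Longrightarrow> Some f \<in> \<xi>"
    and "\<And>e f. Some e \<in> \<xi> \<Longrightarrow> Some f \<in> \<xi> \<Longrightarrow> Some (emeet e f) \<in> \<xi>"
  shows "is_filter ES None \<xi>"
  unfolding is_filter_def
proof (intro conjI ballI impI)
  show "\<xi> \<subseteq> carrier ES"
  proof
    fix x assume "x \<in> \<xi>"
    with assms(1,3) show "x \<in> carrier ES" by (cases x) auto
  qed
  fix x assume x: "x \<in> \<xi>"
  with assms(1) obtain e where e: "x = Some e" by (cases x) auto
  show "y \<in> \<xi>" if "y \<in> carrier ES" "x \<sqsubseteq>\<^bsub>ES\<^esub> y" for y
    using assms(4)[of e] x e that by (cases y) auto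
  fix y assume y: "y \<in> \<xi>"
  with assms(1) obtain f where f: "y = Some f" by (cases y) auto
  have e': "elem e" "snd e \<noteq> {}" and f': "elem f" "snd f \<noteq> {}" and m: "Some (emeet e f) \<in> \<xi>"
    using x y e f assms(3,5) by blast+
  from assms(3)[OF m] m show "x \<sqinter>\<^bsub>ES\<^esub> y \<in> \<xi>"
    unfolding e f meet_ES[OF e' f'] by simp
qed (use assms(1,2) in auto)

lemma filter_elem: "is_filter ES None \<xi> \<Longrightarrow> Some e \<in> \<xi> \<Longrightarrow> elem e \<and> snd e \<noteq> {}"
  using Some_carrier_ES[of e] unfolding is_filter_def by blast

lemma filter_None: "is_filter ES None \<xi> \<Longrightarrow> None \<notin> \<xi>"
  by (simp add: is_filter_def)

lemma filter_up:
  assumes "is_filter ES None \<xi>" "Some e \<in> \<xi>" "elem f" "ple e f"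
  shows "Some f \<in> \<xi>"
proof -
  have "Some f \<in> carrier ES"
    using assms filter_elem[OF assms(1,2)] ple_nonempty[OF assms(4)] by simp
  moreover have "Some e \<sqsubseteq>\<^bsub>ES\<^esub> Some f"
    using assms by simp
  ultimately show ?thesis
    using assms unfolding is_filter_def by blast
qed

lemma filter_emeet:
  assumes "is_filter ES None \<xi>" "Some e \<in> \<xi>" "Some f \<in> \<xi>"
  shows "Some (emeet e f) \<in> \<xi>"
proof -
  have "Some e \<sqinter>\<^bsub>ES\<^esub> Some f \<in> \<xi>" "None \<notin> \<xi>"
    using assms unfolding is_filter_def by blast+
  then show ?thesis
    using filter_elem[OF assms(1,2)] filter_elem[OF assms(1,3)]
    by (cases "snd (emeet e f) = {}") (simp_all add: meet_ES)
qed

lemma filter_emeet_iff: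
  assumes "is_filter ES None \<xi>" "elem e" "elem f"
  shows "Some (emeet e f) \<in> \<xi> \<longleftrightarrow> Some e \<in> \<xi> \<and> Some f \<in> \<xi>"
  using assms filter_emeet filter_up[OF assms(1)] emeet_ple[of e f] filter_elem[OF assms(1)] by blast

lemma filter_comparable:
  assumes "is_filter ES None \<xi>" "Some e \<in> \<xi>" "Some f \<in> \<xi>"
  shows "prefix (fst e) (fst f) \<or> prefix (fst f) (fst e)"
  using filter_elem[OF assms(1) filter_emeet[OF assms]]
  by (cases e f rule: emeet_cases) auto

lemma filter_left:
  assumes "is_filter ES None \<xi>" "Some (\<beta> @ \<gamma>, A) \<in> \<xi>" "Some (\<beta>, C) \<in> \<xi>"
  shows "Some (\<beta> @ \<gamma>, A \<inter> relrange C \<gamma>) \<in> \<xi>"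
  using filter_emeet[OF assms] by (simp add: emeet_left)

lemma filter_range_of:
  assumes "is_filter ES None \<xi>" "Some (\<beta> @ \<gamma>, A) \<in> \<xi>" "\<beta> \<noteq> []"
  shows "Some (\<beta>, range_of \<beta>) \<in> \<xi>"
  using filter_elem[OF assms(1,2)] assms
  by (intro filter_up[OF assms(1,2)]) (auto simp: elem_def ple_def range_of_append)

text \<open>As soon as a filter reaches the word \<open>\<beta> @ \<gamma>\<close>, its layer at
  \<open>\<beta>\<close> can be read off from the one at \<open>\<beta> @ \<gamma>\<close>: meeting
  pushes forward, upward closure pulls back. This is why gluing may prescribe lower layers through
  higher ones.\<close>

lemma filter_comp_iff:
  assumes "is_filter ES None \<xi>" "Some (\<beta> @ \<gamma>, A) \<in> \<xi>" "elem (\<beta>, C)"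
  shows "Some (\<beta>, C) \<in> \<xi> \<longleftrightarrow> Some (\<beta> @ \<gamma>, relrange C \<gamma>) \<in> \<xi>"
proof
  assume "Some (\<beta>, C) \<in> \<xi>"
  from filter_left[OF assms(1,2) this] show "Some (\<beta> @ \<gamma>, relrange C \<gamma>) \<in> \<xi>"
    by (rule filter_up[OF assms(1)])
      (use assms(3) in \<open>auto simp: elem_def ple_def range_of_append relrange_mono\<close>)
next
  assume "Some (\<beta> @ \<gamma>, relrange C \<gamma>) \<in> \<xi>"
  then show "Some (\<beta>, C) \<in> \<xi>"
    by (rule filter_up[OF assms(1)]) (use assms(3) in \<open>auto simp: ple_def\<close>)
qed

end

section \<open>Ultrafilters\<close>

lemma ultrafilter_extension:
  assumes "is_filter L z \<xi>"
  obtains \<eta> where "is_ultrafilter L z \<eta>" "\<xi> \<subseteq> \<eta>"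
proof -
  define \<A> where "\<A> = {\<eta>. is_filter L z \<eta> \<and> \<xi> \<subseteq> \<eta>}"
  have "\<exists>M\<in>\<A>. \<forall>X\<in>\<A>. M \<subseteq> X \<longrightarrow> X = M"
  proof (rule subset_Zorn_nonempty)
    fix \<C> assume ne: "\<C> \<noteq> {}" and ch: "subset.chain \<A> \<C>"
    then have sub: "\<And>\<eta>. \<eta> \<in> \<C> \<Longrightarrow> is_filter L z \<eta> \<and> \<xi> \<subseteq> \<eta>"
      unfolding subset_chain_def \<A>_def by blast
    have meet: "x \<sqinter>\<^bsub>L\<^esub> y \<in> \<Union>\<C>" if x: "x \<in> \<Union>\<C>" and y: "y \<in> \<Union>\<C>" for x y
    proof -
      obtain \<eta>1 \<eta>2 where \<eta>: "\<eta>1 \<in> \<C>" "\<eta>2 \<in> \<C>" "x \<in> \<eta>1" "y \<in> \<eta>2"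
        using x y by blast
      then have "\<eta>1 \<subseteq> \<eta>2 \<or> \<eta>2 \<subseteq> \<eta>1"
        using ch by (auto simp: subset_chain_def)
      with \<eta> obtain \<eta> where "\<eta> \<in> \<C>" "x \<in> \<eta>" "y \<in> \<eta>"
        by blast
      with sub[of \<eta>] have "x \<sqinter>\<^bsub>L\<^esub> y \<in> \<eta>"
        unfolding is_filter_def by blast
      with \<open>\<eta> \<in> \<C>\<close> show ?thesis by blast
    qed
    have "is_filter L z (\<Union>\<C>)"
      unfolding is_filter_def
    proof (intro conjI ballI impI)
      have "\<eta> \<subseteq> carrier L" "z \<notin> \<eta>" if "\<eta> \<in> \<C>" for \<eta>
        using sub[OF that] by (simp_all add: is_filter_def)
      then show "\<Union>\<C> \<subseteq> carrier L" "z \<notin> \<Union>\<C>"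
        by blast+
      obtain \<eta> where "\<eta> \<in> \<C>"
        using ne by blast
      moreover from sub[OF this] have "\<eta> \<noteq> {}"
        by (simp add: is_filter_def)
      ultimately show "\<Union>\<C> \<noteq> {}"
        by blast
      fix x y assume x: "x \<in> \<Union>\<C>" and y: "y \<in> carrier L" "x \<sqsubseteq>\<^bsub>L\<^esub> y"
      from x obtain \<eta> where \<eta>: "\<eta> \<in> \<C>" "x \<in> \<eta>" by blast
      with sub[OF \<eta>(1)] y have "y \<in> \<eta>"
        unfolding is_filter_def by blast
      with \<eta> show "y \<in> \<Union>\<C>" by blast
    qed (rule meet)
    then show "\<Union>\<C> \<in> \<A>"
      using ne sub unfolding \<A>_def by blast
  next
    show "\<A> \<noteq> {}"
      using assms unfolding \<A>_def by blast
  qed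
  then obtain M where M: "M \<in> \<A>" and max: "\<forall>X\<in>\<A>. M \<subseteq> X \<longrightarrow> X = M" ..
  from M have M': "is_filter L z M" "\<xi> \<subseteq> M"
    by (simp_all add: \<A>_def)
  have "\<eta> = M" if "is_filter L z \<eta>" "M \<subseteq> \<eta>" for \<eta>
  proof -
    have "\<eta> \<in> \<A>"
      using that M'(2) by (auto simp: \<A>_def)
    with max that(2) show ?thesis by simp
  qed
  then have "is_ultrafilter L z M"
    unfolding is_ultrafilter_def using M'(1) by simp
  then show ?thesis
    using M'(2) by (rule that)
qed

context normal_labelled_space
begin

lemma ultrafilter_exists:
  assumes "elem e" "snd e \<noteq> {}"
  obtains \<eta> where "is_ultrafilter ES None \<eta>" "Some e \<in> \<eta>"
proof -
  let ?\<xi> = "Some ` {f. elem f \<and> ple e f}"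
  have "is_filter ES None ?\<xi>"
  proof (rule filterI)
    show "?\<xi> \<noteq> {}"
      using assms ple_refl[of e] by blast
    fix f assume "Some f \<in> ?\<xi>"
    then have f: "elem f" "ple e f"
      by (auto simp del: split_paired_Ex)
    show "elem f \<and> snd f \<noteq> {}"
      using f ple_nonempty[OF _ assms(2)] by simp
    show "Some g \<in> ?\<xi>" if "elem g" "ple f g" for g
      using f(2) that ple_trans[of e f g] by simp
    fix g assume "Some g \<in> ?\<xi>"
    then have g: "elem g" "ple e g"
      by (auto simp del: split_paired_Ex)
    show "Some (emeet f g) \<in> ?\<xi>"
      using f g ple_emeet_iff[of f g e] assms by simp
  qed blast
  from ultrafilter_extension[OF this] obtain \<eta> where "is_ultrafilter ES None \<eta>" "?\<xi> \<subseteq> \<eta>" .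
  moreover have "Some e \<in> ?\<xi>"
    using assms ple_refl by blast
  ultimately show ?thesis
    using that by blast
qed

lemma ultrafilter_filter: "is_ultrafilter ES None \<eta> \<Longrightarrow> is_filter ES None \<eta>"
  by (simp add: is_ultrafilter_def)

text \<open>If \<open>f\<close> met every element of \<open>\<eta>\<close>, the elements above such
  meets would form a filter that contains both \<open>\<eta>\<close> and \<open>f\<close>, against
  maximality.\<close>

lemma ultrafilter_disjoint:
  assumes u: "is_ultrafilter ES None \<eta>" and f: "elem f" "Some f \<notin> \<eta>"
  obtains e where "Some e \<in> \<eta>" "snd (emeet e f) = {}"
proof -
  have fl: "is_filter ES None \<eta>"
    by (rule ultrafilter_filter[OF u])
  have False if ne: "\<And>e. Some e \<in> \<eta> \<Longrightarrow> snd (emeet e f) \<noteq> {}"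
  proof -
    let ?\<zeta> = "Some ` {g. elem g \<and> (\<exists>e. Some e \<in> \<eta> \<and> ple (emeet e f) g)}"
    have "\<eta> \<noteq> {}"
      using fl by (simp add: is_filter_def)
    then obtain e0 where e0: "Some e0 \<in> \<eta>"
      using filter_None[OF fl] by (metis all_not_in_conv option.exhaust)
    have below: "ple (emeet e f) e" "ple (emeet e f) f" if "Some e \<in> \<eta>" for e
      using emeet_ple[of e f] ne[OF that] filter_elem[OF fl that] f by auto
    have \<zeta>I: "Some g \<in> ?\<zeta>" if "elem g" "Some e \<in> \<eta>" "ple (emeet e f) g" for e g
      using that by blast
    have \<zeta>D: "elem g \<and> (\<exists>e. Some e \<in> \<eta> \<and> ple (emeet e f) g)" if "Some g \<in> ?\<zeta>" for g
      using that by (auto simp del: split_paired_Ex)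
    have "is_filter ES None ?\<zeta>"
    proof (rule filterI)
      show "?\<zeta> \<noteq> {}"
        using \<zeta>I[OF f(1) e0 below(2)[OF e0]] by blast
      fix g assume "Some g \<in> ?\<zeta>"
      then obtain d where g: "elem g" "Some d \<in> \<eta>" "ple (emeet d f) g"
        using \<zeta>D by blast
      show "elem g \<and> snd g \<noteq> {}"
        using g ple_nonempty[OF g(3) ne[OF g(2)]] by simp
      show "Some h \<in> ?\<zeta>" if "elem h" "ple g h" for h
        using \<zeta>I[OF that(1) g(2) ple_trans[OF g(3) that(2)]] .
      fix h assume "Some h \<in> ?\<zeta>"
      then obtain e where h: "elem h" "Some e \<in> \<eta>" "ple (emeet e f) h"
        using \<zeta>D by blast
      have de: "Some (emeet d e) \<in> \<eta>"
        by (rule filter_emeet[OF fl g(2) h(2)])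
      have el: "elem d" "elem e"
        using filter_elem[OF fl] g h by auto
      let ?l = "emeet (emeet d e) f"
      have l: "snd ?l \<noteq> {}"
        by (rule ne[OF de])
      have "ple (emeet d e) d" "ple (emeet d e) e"
        using emeet_ple[OF el] filter_elem[OF fl de] by auto
      then have "ple ?l d" "ple ?l e"
        using below(1)[OF de] ple_trans by blast+
      then have "ple ?l (emeet d f)" "ple ?l (emeet e f)"
        using ple_emeet_iff[OF el(1) f(1) l] ple_emeet_iff[OF el(2) f(1) l] below(2)[OF de] by auto
      then have "ple ?l (emeet g h)"
        using ple_emeet_iff[OF g(1) h(1) l] ple_trans[OF _ g(3)] ple_trans[OF _ h(3)] by simp
      then show "Some (emeet g h) \<in> ?\<zeta>"
        by (rule \<zeta>I[OF elem_emeet[OF g(1) h(1)] de])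
    qed blast
    moreover have "\<eta> \<subseteq> ?\<zeta>"
    proof
      fix x assume x: "x \<in> \<eta>"
      then obtain e where e: "x = Some e"
        using filter_None[OF fl] by (cases x) auto
      show "x \<in> ?\<zeta>"
        unfolding e using \<zeta>I[of e e] filter_elem[OF fl, of e] below(1)[of e] x e by simp
    qed
    ultimately have "?\<zeta> = \<eta>"
      using u unfolding is_ultrafilter_def by blast
    moreover have "Some f \<in> ?\<zeta>"
      by (rule \<zeta>I[OF f(1) e0 below(2)[OF e0]])
    ultimately show False
      using f(2) by simp
  qed
  then show ?thesis
    using that by blast
qed

end

section \<open>The space of tight filters\<close>

text \<open>Singletons are open in each factor, so prescribing finitely many coordinates gives a
  neighbourhood base. Openness becomes a statement about finite agreement, the form in which filters
  are compared.\<close>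

lemma openin_bool_product_iff:
  "openin (product_topology (\<lambda>_. discrete_topology (UNIV :: bool set)) I) U \<longleftrightarrow>
     U \<subseteq> PiE I (\<lambda>_. UNIV) \<and>
     (\<forall>u\<in>U. \<exists>F. finite F \<and> F \<subseteq> I \<and> (\<forall>u'\<in>PiE I (\<lambda>_. UNIV). (\<forall>i\<in>F. u' i = u i) \<longrightarrow> u' \<in> U))"
    (is "openin ?P U \<longleftrightarrow> ?R")
proof
  assume U: "openin ?P U"
  show ?R
  proof (intro conjI ballI)
    show "U \<subseteq> PiE I (\<lambda>_. UNIV)"
      using openin_subset[OF U] by simp
    fix u assume u: "u \<in> U"
    then obtain W where W: "finite {i \<in> I. W i \<noteq> UNIV}" "u \<in> PiE I W" "PiE I W \<subseteq> U"
      using U by (force simp: openin_product_topology_alt)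
    have "u' \<in> PiE I W" if "u' \<in> PiE I (\<lambda>_. UNIV)" "\<forall>i\<in>{i \<in> I. W i \<noteq> UNIV}. u' i = u i" for u'
    proof (rule PiE_I)
      fix i assume i: "i \<in> I"
      show "u' i \<in> W i"
      proof (cases "W i = UNIV")
        case False
        with i that(2) have "u' i = u i" by simp
        with W(2) i show ?thesis by (simp add: PiE_mem)
      qed simp
    qed (rule PiE_arb[OF that(1)])
    note box = this
    show "\<exists>F. finite F \<and> F \<subseteq> I \<and> (\<forall>u'\<in>PiE I (\<lambda>_. UNIV). (\<forall>i\<in>F. u' i = u i) \<longrightarrow> u' \<in> U)"
    proof (intro exI[of _ "{i \<in> I. W i \<noteq> UNIV}"] conjI ballI impI)
      fix u' assume "u' \<in> PiE I (\<lambda>_. UNIV)" "\<forall>i\<in>{i \<in> I. W i \<noteq> UNIV}. u' i = u i"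
      then have "u' \<in> PiE I W" by (rule box)
      with W(3) show "u' \<in> U" ..
    qed (use W(1) in simp_all)
  qed
next
  assume R: ?R
  show "openin ?P U"
    unfolding openin_product_topology_alt
  proof
    fix u assume u: "u \<in> U"
    from bspec[OF conjunct2[OF R] u] obtain F where F: "finite F" "F \<subseteq> I"
      "\<forall>u'\<in>PiE I (\<lambda>_. UNIV). (\<forall>i\<in>F. u' i = u i) \<longrightarrow> u' \<in> U"
      by (elim exE conjE)
    let ?W = "\<lambda>i. if i \<in> F then {u i} else UNIV"
    have "{i \<in> I. ?W i \<noteq> UNIV} \<subseteq> F"
      by auto
    then have "finite {i \<in> I. ?W i \<noteq> topspace (discrete_topology (UNIV :: bool set))}"
      using F(1) by (simp add: finite_subset)
    moreover have "u \<in> PiE I ?W"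
    proof (rule PiE_I)
      have "u \<in> PiE I (\<lambda>_. UNIV)"
        using u conjunct1[OF R] by (rule subsetD[rotated])
      then show "u i = undefined" if "i \<notin> I" for i
        using that by (rule PiE_arb)
    qed simp
    moreover have "PiE I ?W \<subseteq> U"
    proof
      fix u' assume u': "u' \<in> PiE I ?W"
      show "u' \<in> U"
      proof (rule F(3)[rule_format])
        show "u' \<in> PiE I (\<lambda>_. UNIV)"
          by (rule PiE_I) (simp_all add: PiE_arb[OF u'])
        show "u' i = u i" if i: "i \<in> F" for i
        proof -
          from i F(2) u' have "u' i \<in> ?W i"
            by (intro PiE_mem[OF u']) auto
          with i show "u' i = u i" by simp
        qed
      qed
    qed
    ultimately show "\<exists>W. finite {i \<in> I. W i \<noteq> topspace (discrete_topology (UNIV :: bool set))} \<and>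
        (\<forall>i\<in>I. openin (discrete_topology UNIV) (W i)) \<and> u \<in> PiE I W \<and> PiE I W \<subseteq> U"
      by (intro exI[of _ ?W]) simp
  qed
qed

lemma openin_bool_productE:
  assumes "openin (product_topology (\<lambda>_. discrete_topology (UNIV :: bool set)) I) U" "u \<in> U"
  obtains F where "finite F" "F \<subseteq> I"
    "\<forall>u'\<in>PiE I (\<lambda>_. UNIV). (\<forall>i\<in>F. u' i = u i) \<longrightarrow> u' \<in> U"
proof -
  note R = assms(1)[unfolded openin_bool_product_iff]
  from bspec[OF conjunct2[OF R] assms(2)] that show ?thesis
    by (elim exE conjE)
qed

lemma openin_bool_productI:
  assumes "U \<subseteq> PiE I (\<lambda>_. UNIV)"
    and "\<And>u. u \<in> U \<Longrightarrow> \<exists>F. finite F \<and> F \<subseteq> I \<and> (\<forall>u'\<in>PiE I (\<lambda>_. UNIV). (\<forall>i\<in>F. u' i = u i) \<longrightarrow> u' \<in> U)"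
  shows "openin (product_topology (\<lambda>_. discrete_topology (UNIV :: bool set)) I) U"
  unfolding openin_bool_product_iff by (rule conjI[OF assms(1) ballI[OF assms(2)]])

context labelled_space
begin

definition char_map :: "('a list \<times> 'v set) option set \<Rightarrow> ('a list \<times> 'v set) option \<Rightarrow> bool" where
  "char_map \<xi> = (\<lambda>e\<in>carrier ES. e \<in> \<xi>)"

abbreviation cantor :: "(('a list \<times> 'v set) option \<Rightarrow> bool) topology" where
  "cantor \<equiv> product_topology (\<lambda>_. discrete_topology UNIV) (carrier ES)"

lemma char_map_PiE [simp]: "char_map \<xi> \<in> PiE (carrier ES) (\<lambda>_. UNIV)"
  unfolding char_map_def by (rule restrict_PiE_iff[THEN iffD2]) simp

lemma char_map_apply [simp]: "e \<in> carrier ES \<Longrightarrow> char_map \<xi> e \<longleftrightarrow> e \<in> \<xi>"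
  by (simp add: char_map_def)

lemma filter_topology_char_map: "filter_topology = pullback_topology {\<xi>. is_filter ES None \<xi>} char_map cantor"
  by (simp add: filter_topology_def char_map_def[abs_def])

lemma topspace_filter_topology: "topspace filter_topology = {\<xi>. is_filter ES None \<xi>}"
  unfolding filter_topology_char_map topspace_pullback_topology by auto

lemma openin_filter_topologyE:
  assumes "openin filter_topology U" "\<xi> \<in> U"
  obtains F where "finite F" "F \<subseteq> carrier ES"
    "\<forall>\<eta>. is_filter ES None \<eta> \<longrightarrow> F \<inter> \<eta> = F \<inter> \<xi> \<longrightarrow> \<eta> \<in> U"
proof -
  obtain Q where Q: "openin cantor Q" "U = char_map -` Q \<inter> {\<xi>. is_filter ES None \<xi>}"
    using assms(1) unfolding filter_topology_char_map openin_pullback_topology by (elim exE conjE)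
  have "char_map \<xi> \<in> Q"
    using assms(2) by (simp add: Q(2))
  with Q(1) obtain F where F: "finite F" "F \<subseteq> carrier ES"
    "\<forall>u\<in>PiE (carrier ES) (\<lambda>_. UNIV). (\<forall>i\<in>F. u i = char_map \<xi> i) \<longrightarrow> u \<in> Q"
    by (rule openin_bool_productE)
  show ?thesis
  proof (rule that[OF F(1,2)], intro allI impI)
    fix \<eta> assume \<eta>: "is_filter ES None \<eta>" "F \<inter> \<eta> = F \<inter> \<xi>"
    have "char_map \<eta> \<in> Q"
    proof (rule F(3)[rule_format, OF char_map_PiE])
      fix i assume i: "i \<in> F"
      then have "i \<in> \<eta> \<longleftrightarrow> i \<in> \<xi>"
        using eqset_imp_iff[OF \<eta>(2), of i] by simp
      with i F(2) show "char_map \<eta> i = char_map \<xi> i"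
        by (simp add: subset_iff)
    qed
    with \<eta>(1) show "\<eta> \<in> U" by (simp add: Q(2))
  qed
qed

lemma openin_filter_topologyI:
  assumes U: "\<And>\<xi>. \<xi> \<in> U \<Longrightarrow> is_filter ES None \<xi>"
    and F: "\<And>\<xi>. \<xi> \<in> U \<Longrightarrow> finite (F \<xi>)" "\<And>\<xi>. \<xi> \<in> U \<Longrightarrow> F \<xi> \<subseteq> carrier ES"
    and mem: "\<And>\<xi> \<eta>. \<xi> \<in> U \<Longrightarrow> is_filter ES None \<eta> \<Longrightarrow> F \<xi> \<inter> \<eta> = F \<xi> \<inter> \<xi> \<Longrightarrow> \<eta> \<in> U"
  shows "openin filter_topology U"
proof -
  define Q where "Q = {u \<in> PiE (carrier ES) (\<lambda>_. UNIV). \<exists>\<xi>\<in>U. \<forall>e\<in>F \<xi>. u e \<longleftrightarrow> e \<in> \<xi>}"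
  have "openin cantor Q"
  proof (rule openin_bool_productI)
    show "Q \<subseteq> PiE (carrier ES) (\<lambda>_. UNIV)"
      unfolding Q_def by (rule Collect_restrict)
    fix u assume "u \<in> Q"
    then obtain \<xi> where \<xi>: "\<xi> \<in> U" "\<forall>e\<in>F \<xi>. u e \<longleftrightarrow> e \<in> \<xi>"
      unfolding Q_def by blast
    have "u' \<in> Q" if "u' \<in> PiE (carrier ES) (\<lambda>_. UNIV)" "\<forall>i\<in>F \<xi>. u' i = u i" for u'
      unfolding Q_def using that(1)
    proof (intro CollectI conjI bexI[OF _ \<xi>(1)] ballI)
      fix e assume "e \<in> F \<xi>"
      with that(2) \<xi>(2) show "u' e = (e \<in> \<xi>)" by simp
    qed
    then show "\<exists>F. finite F \<and> F \<subseteq> carrier ES \<and>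
        (\<forall>u'\<in>PiE (carrier ES) (\<lambda>_. UNIV). (\<forall>i\<in>F. u' i = u i) \<longrightarrow> u' \<in> Q)"
      by (intro exI[of _ "F \<xi>"] conjI F \<xi>(1) ballI impI)
  qed
  moreover have "U = char_map -` Q \<inter> {\<xi>. is_filter ES None \<xi>}"
  proof (intro Set.set_eqI iffI)
    fix \<xi> assume \<xi>: "\<xi> \<in> U"
    then have "\<forall>e\<in>F \<xi>. char_map \<xi> e \<longleftrightarrow> e \<in> \<xi>"
      using F(2)[OF \<xi>] by (simp add: subset_iff)
    then have "char_map \<xi> \<in> Q"
      unfolding Q_def by (intro CollectI conjI bexI[OF _ \<xi>] char_map_PiE)
    with U[OF \<xi>] show "\<xi> \<in> char_map -` Q \<inter> {\<xi>. is_filter ES None \<xi>}" by simp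
  next
    fix \<eta> assume \<eta>: "\<eta> \<in> char_map -` Q \<inter> {\<xi>. is_filter ES None \<xi>}"
    then obtain \<xi> where \<xi>: "\<xi> \<in> U" "\<forall>e\<in>F \<xi>. char_map \<eta> e \<longleftrightarrow> e \<in> \<xi>"
      unfolding Q_def by blast
    have "F \<xi> \<inter> \<eta> = F \<xi> \<inter> \<xi>"
    proof (intro Set.set_eqI)
      fix e show "e \<in> F \<xi> \<inter> \<eta> \<longleftrightarrow> e \<in> F \<xi> \<inter> \<xi>"
        using \<xi>(2) F(2)[OF \<xi>(1)] by (cases "e \<in> F \<xi>") (auto simp: subset_iff)
    qed
    with mem[OF \<xi>(1)] \<eta> show "\<eta> \<in> U" by simp
  qed
  ultimately show "openin filter_topology U"
    unfolding filter_topology_char_map openin_pullback_topology by (intro exI conjI)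
qed

text \<open>Closure for pointwise convergence means approximation by ultrafilters on finite subsets
  of \<open>E(S)\<close>; \<open>tight_approx\<close> is the converse.\<close>

lemma tightI:
  assumes "is_filter ES None \<xi>"
    and "\<And>F. finite F \<Longrightarrow> F \<subseteq> carrier ES \<Longrightarrow> \<exists>\<eta>. is_ultrafilter ES None \<eta> \<and> F \<inter> \<eta> = F \<inter> \<xi>"
  shows "\<xi> \<in> tight"
  unfolding tight_def in_closure_of
proof (intro conjI allI impI)
  show "\<xi> \<in> topspace filter_topology"
    using assms(1) by (simp add: topspace_filter_topology)
  fix U assume U: "\<xi> \<in> U \<and> openin filter_topology U"
  obtain F where F: "finite F" "F \<subseteq> carrier ES"
    "\<forall>\<eta>. is_filter ES None \<eta> \<longrightarrow> F \<inter> \<eta> = F \<inter> \<xi> \<longrightarrow> \<eta> \<in> U"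
    by (rule openin_filter_topologyE[OF conjunct2[OF U] conjunct1[OF U]])
  from assms(2)[OF F(1,2)] obtain \<eta> where "is_ultrafilter ES None \<eta>" "F \<inter> \<eta> = F \<inter> \<xi>"
    by (elim exE conjE)
  with F(3)[rule_format, of \<eta>] show "\<exists>y. y \<in> {\<xi>. is_ultrafilter ES None \<xi>} \<and> y \<in> U"
    by (intro exI[of _ \<eta>]) (simp add: is_ultrafilter_def)
qed

lemma tight_filter: "\<xi> \<in> tight \<Longrightarrow> is_filter ES None \<xi>"
  by (simp add: tight_def in_closure_of topspace_filter_topology)

lemma tight_approx:
  assumes "\<xi> \<in> tight" "finite F" "F \<subseteq> carrier ES"
  obtains \<eta> where "is_ultrafilter ES None \<eta>" "F \<inter> \<eta> = F \<inter> \<xi>"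
proof -
  let ?U = "{\<eta>. is_filter ES None \<eta> \<and> F \<inter> \<eta> = F \<inter> \<xi>}"
  have "openin filter_topology ?U"
    by (rule openin_filter_topologyI[where F = "\<lambda>_. F"]) (simp_all add: assms)
  moreover have "\<xi> \<in> ?U"
    using tight_filter[OF assms(1)] by simp
  moreover note conjunct2[OF assms(1)[unfolded tight_def in_closure_of], THEN spec, of ?U]
  ultimately have "\<exists>\<eta>. is_ultrafilter ES None \<eta> \<and> F \<inter> \<eta> = F \<inter> \<xi>"
    by auto
  then show ?thesis
    using that by (elim exE conjE)
qed

lemma ultrafilter_tight: "is_ultrafilter ES None \<xi> \<Longrightarrow> \<xi> \<in> tight"
  by (rule tightI) (auto simp: is_ultrafilter_def)

lemma topspace_tight_topology [simp]: "topspace tight_topology = tight"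
  using tight_filter by (auto simp: tight_topology_def topspace_filter_topology)

lemma openin_tight_topologyE:
  assumes "openin tight_topology U" "\<xi> \<in> U"
  obtains F where "finite F" "F \<subseteq> carrier ES" "\<forall>\<eta>\<in>tight. F \<inter> \<eta> = F \<inter> \<xi> \<longrightarrow> \<eta> \<in> U"
proof -
  obtain W where W: "openin filter_topology W" "U = W \<inter> tight"
    using assms(1) unfolding tight_topology_def openin_subtopology by (elim exE conjE)
  with assms(2) have "\<xi> \<in> W" by simp
  with W(1) obtain F where F: "finite F" "F \<subseteq> carrier ES"
    "\<forall>\<eta>. is_filter ES None \<eta> \<longrightarrow> F \<inter> \<eta> = F \<inter> \<xi> \<longrightarrow> \<eta> \<in> W"
    by (rule openin_filter_topologyE)
  show ?thesis
    by (rule that[OF F(1,2)]) (simp add: W(2) F(3) tight_filter)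
qed

lemma openin_tight_topologyI:
  assumes U: "U \<subseteq> tight"
    and F: "\<And>\<xi>. \<xi> \<in> U \<Longrightarrow> finite (F \<xi>)" "\<And>\<xi>. \<xi> \<in> U \<Longrightarrow> F \<xi> \<subseteq> carrier ES"
    and mem: "\<And>\<xi> \<eta>. \<xi> \<in> U \<Longrightarrow> \<eta> \<in> tight \<Longrightarrow> F \<xi> \<inter> \<eta> = F \<xi> \<inter> \<xi> \<Longrightarrow> \<eta> \<in> U"
  shows "openin tight_topology U"
proof -
  let ?W = "\<lambda>\<xi>. {\<eta>. is_filter ES None \<eta> \<and> F \<xi> \<inter> \<eta> = F \<xi> \<inter> \<xi>}"
  have "openin filter_topology (\<Union>\<xi>\<in>U. ?W \<xi>)"
  proof (rule openin_Union, clarify)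
    fix \<xi> assume "\<xi> \<in> U"
    then show "openin filter_topology (?W \<xi>)"
      by (intro openin_filter_topologyI[where F = "\<lambda>_. F \<xi>"]) (simp_all add: F)
  qed
  moreover have "U = (\<Union>\<xi>\<in>U. ?W \<xi>) \<inter> tight"
    using U mem tight_filter by blast
  ultimately show ?thesis
    unfolding tight_topology_def openin_subtopology by (intro exI conjI)
qed

end

lemma inter_eq_mem_iff: "F \<inter> \<eta> = F \<inter> \<xi> \<Longrightarrow> x \<in> F \<Longrightarrow> x \<in> \<eta> \<longleftrightarrow> x \<in> \<xi>"
  by blast

context normal_labelled_space
begin

definition cyl :: "'c list \<times> 'a set \<Rightarrow> ('c list \<times> 'a set) option set set" where
  "cyl e = {\<xi> \<in> tight. Some e \<in> \<xi>}"

lemma V_elem_cyl: "V_elem \<alpha> A = cyl (\<alpha>, A)"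
  by (simp add: V_elem_def cyl_def)

lemma cyl_subset: "cyl e \<subseteq> tight"
  by (auto simp: cyl_def)

lemma mem_cyl: "\<xi> \<in> cyl e \<longleftrightarrow> \<xi> \<in> tight \<and> Some e \<in> \<xi>"
  by (simp add: cyl_def)

lemma cyl_empty: "snd e = {} \<Longrightarrow> cyl e = {}"
  using filter_elem[OF tight_filter, of _ e] by (auto simp: cyl_def)

lemma cyl_emeet: "elem e \<Longrightarrow> elem f \<Longrightarrow> cyl (emeet e f) = cyl e \<inter> cyl f"
  using filter_emeet_iff[OF tight_filter, of _ e f] by (auto simp: cyl_def)

text \<open>Here \<open>\<xi>\<close> is any set of elements, not yet a filter. Were it inseparable
  from \<open>cyl e\<close>, each filter law, involving at most three elements, would be inherited
  from a member of \<open>cyl e\<close> agreeing with \<open>\<xi>\<close> on them, and so would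
  approximability by ultrafilters.\<close>

lemma separating_set:
  assumes \<xi>: "\<xi> \<subseteq> carrier ES" "\<xi> \<notin> cyl e" and e: "elem e" "snd e \<noteq> {}"
  shows "\<exists>F. finite F \<and> F \<subseteq> carrier ES \<and> (\<forall>\<eta>\<in>cyl e. F \<inter> \<eta> \<noteq> F \<inter> \<xi>)"
proof (rule ccontr)
  assume "\<not> ?thesis"
  then have sep: "\<exists>\<eta>\<in>cyl e. F \<inter> \<eta> = F \<inter> \<xi>" if "finite F" "F \<subseteq> carrier ES" for F
    using that by simp
  have e_mem: "Some e \<in> \<xi>"
  proof -
    obtain \<eta> where \<eta>: "\<eta> \<in> cyl e" "{Some e} \<inter> \<eta> = {Some e} \<inter> \<xi>"
      by (rule bexE[OF sep[of "{Some e}"]]) (simp_all add: e)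
    show ?thesis
      using inter_eq_mem_iff[OF \<eta>(2), of "Some e"] \<eta>(1) by (simp add: mem_cyl)
  qed
  have "is_filter ES None \<xi>"
  proof (rule filterI)
    show "\<xi> \<noteq> {}"
      using e_mem by blast
    show "None \<notin> \<xi>"
    proof
      assume n: "None \<in> \<xi>"
      obtain \<eta> where \<eta>: "\<eta> \<in> cyl e" "{None} \<inter> \<eta> = {None} \<inter> \<xi>"
        by (rule bexE[OF sep[of "{None}"]]) simp_all
      show False
        using n inter_eq_mem_iff[OF \<eta>(2), of None] filter_None[OF tight_filter, of \<eta>] \<eta>(1)
        by (simp add: mem_cyl)
    qed
    fix f assume f: "Some f \<in> \<xi>"
    with \<xi>(1) have fc: "elem f" "snd f \<noteq> {}"
      using Some_carrier_ES[of f] by blast+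
    then show "elem f \<and> snd f \<noteq> {}" by simp
    show "Some g \<in> \<xi>" if g: "elem g" "ple f g" for g
    proof -
      have gc: "Some g \<in> carrier ES"
        using g ple_nonempty[OF g(2) fc(2)] by simp
      obtain \<eta> where \<eta>: "\<eta> \<in> cyl e" "{Some f, Some g} \<inter> \<eta> = {Some f, Some g} \<inter> \<xi>"
        using gc fc by - (rule bexE[OF sep[of "{Some f, Some g}"]], simp_all)
      have "Some f \<in> \<eta>"
        using inter_eq_mem_iff[OF \<eta>(2), of "Some f"] f by simp
      then have "Some g \<in> \<eta>"
        using filter_up[OF tight_filter _ g, of \<eta>] \<eta>(1) by (simp add: mem_cyl)
      then show ?thesis
        using inter_eq_mem_iff[OF \<eta>(2), of "Some g"] by simp
    qed
    fix g assume g: "Some g \<in> \<xi>"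
    with \<xi>(1) have gc: "elem g" "snd g \<noteq> {}"
      using Some_carrier_ES[of g] by blast+
    \<comment> \<open>Intersecting with the carrier handles a meet that is 0 and hence not a
      legitimate test element.\<close>
    let ?F = "{Some f, Some g} \<union> ({Some (emeet f g)} \<inter> carrier ES)"
    obtain \<eta> where \<eta>: "\<eta> \<in> cyl e" "?F \<inter> \<eta> = ?F \<inter> \<xi>"
      using fc gc by - (rule bexE[OF sep[of ?F]], simp_all)
    have fl: "is_filter ES None \<eta>"
      using \<eta>(1) by (simp add: mem_cyl tight_filter)
    have "Some f \<in> \<eta>" "Some g \<in> \<eta>"
      using inter_eq_mem_iff[OF \<eta>(2), of "Some f"] inter_eq_mem_iff[OF \<eta>(2), of "Some g"] f g by simp_all
    then have m: "Some (emeet f g) \<in> \<eta>"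
      by (rule filter_emeet[OF fl])
    then show "Some (emeet f g) \<in> \<xi>"
      using filter_elem[OF fl m] inter_eq_mem_iff[OF \<eta>(2), of "Some (emeet f g)"] by simp
  qed
  moreover have "\<exists>\<eta>. is_ultrafilter ES None \<eta> \<and> F \<inter> \<eta> = F \<inter> \<xi>" if F: "finite F" "F \<subseteq> carrier ES" for F
  proof -
    obtain \<eta> where \<eta>: "\<eta> \<in> cyl e" "F \<inter> \<eta> = F \<inter> \<xi>"
      by (rule bexE[OF sep[OF F]])
    from \<eta>(1) have "\<eta> \<in> tight"
      by (simp add: mem_cyl)
    from tight_approx[OF this F] obtain \<zeta> where "is_ultrafilter ES None \<zeta>" "F \<inter> \<zeta> = F \<inter> \<eta>" .
    with \<eta>(2) show ?thesis by (intro exI[of _ \<zeta>]) simp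
  qed
  ultimately have "\<xi> \<in> tight"
    by (rule tightI)
  with e_mem \<xi>(2) show False
    by (simp add: mem_cyl)
qed

text \<open>By \<open>separating_set\<close> the characteristic functions of \<open>cyl e\<close>
  form a closed subset of the Cantor cube, which is compact, and the tight topology is induced from
  the cube. Requiring \<open>e\<close> to be a member keeps limits away from the empty set; the
  whole spectrum need not be compact.\<close>

lemma compactin_cyl:
  assumes e: "elem e" "snd e \<noteq> {}"
  shows "compactin tight_topology (cyl e)"
proof -
  define K where "K = char_map ` cyl e"
  have "openin cantor (PiE (carrier ES) (\<lambda>_. UNIV) - K)"
  proof (rule openin_bool_productI)
    fix u assume u: "u \<in> PiE (carrier ES) (\<lambda>_. UNIV) - K"
    define \<xi> where "\<xi> = {x \<in> carrier ES. u x}"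
    have "u = char_map \<xi>"
    proof
      fix x
      show "u x = char_map \<xi> x"
        using u by (cases "x \<in> carrier ES") (auto simp: \<xi>_def char_map_def intro: PiE_arb)
    qed
    with u have "\<xi> \<notin> cyl e"
      by (auto simp: K_def)
    moreover have "\<xi> \<subseteq> carrier ES"
      by (auto simp: \<xi>_def)
    ultimately have "\<exists>F. finite F \<and> F \<subseteq> carrier ES \<and> (\<forall>\<eta>\<in>cyl e. F \<inter> \<eta> \<noteq> F \<inter> \<xi>)"
      using e by (intro separating_set)
    then obtain F where F: "finite F" "F \<subseteq> carrier ES" "\<forall>\<eta>\<in>cyl e. F \<inter> \<eta> \<noteq> F \<inter> \<xi>"
      by (elim exE conjE)
    have "u' \<notin> K" if u': "\<forall>i\<in>F. u' i = u i" for u'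
    proof
      assume "u' \<in> K"
      then obtain \<eta> where \<eta>: "\<eta> \<in> cyl e" "u' = char_map \<eta>"
        by (auto simp: K_def)
      have "F \<inter> \<eta> = F \<inter> \<xi>"
      proof (rule Set.set_eqI)
        fix x
        show "x \<in> F \<inter> \<eta> \<longleftrightarrow> x \<in> F \<inter> \<xi>"
          using u' F(2) by (cases "x \<in> F") (auto simp: \<eta>(2) \<xi>_def subset_iff)
      qed
      with F(3) \<eta>(1) show False by blast
    qed
    with F(1,2) show "\<exists>F. finite F \<and> F \<subseteq> carrier ES \<and> (\<forall>u'\<in>PiE (carrier ES) (\<lambda>_. UNIV).
        (\<forall>i\<in>F. u' i = u i) \<longrightarrow> u' \<in> PiE (carrier ES) (\<lambda>_. UNIV) - K)"
      by (intro exI[of _ F]) simp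
  qed blast
  moreover have "K \<subseteq> PiE (carrier ES) (\<lambda>_. UNIV)"
    unfolding K_def by (rule image_subsetI) (rule char_map_PiE)
  ultimately have "closedin cantor K"
    by (simp add: closedin_def)
  then have K: "compactin cantor K"
    by (intro closedin_compact_space) (auto simp: compact_space_product_topology compact_space_discrete_topology)
  show ?thesis
    unfolding compactin_def
  proof (intro conjI allI impI)
    show "cyl e \<subseteq> topspace tight_topology"
      by (simp add: cyl_subset)
    fix \<U> assume \<U>: "(\<forall>U\<in>\<U>. openin tight_topology U) \<and> cyl e \<subseteq> \<Union> \<U>"
    have "\<exists>Q. openin cantor Q \<and> U = char_map -` Q \<inter> tight" if "U \<in> \<U>" for U
    proof -
      from \<U> that obtain W where W: "openin filter_topology W" "U = W \<inter> tight"
        by (auto simp: tight_topology_def openin_subtopology)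
      then obtain Q where "openin cantor Q" "W = char_map -` Q \<inter> {\<xi>. is_filter ES None \<xi>}"
        unfolding filter_topology_char_map openin_pullback_topology by (elim exE conjE)
      with W(2) tight_filter show ?thesis
        by (intro exI[of _ Q]) auto
    qed
    then obtain Q where Q: "\<And>U. U \<in> \<U> \<Longrightarrow> openin cantor (Q U)" "\<And>U. U \<in> \<U> \<Longrightarrow> U = char_map -` Q U \<inter> tight"
      by metis
    have cover: "\<forall>W\<in>Q ` \<U>. openin cantor W" "K \<subseteq> \<Union> (Q ` \<U>)"
    proof -
      show "\<forall>W\<in>Q ` \<U>. openin cantor W"
        using Q(1) by blast
      show "K \<subseteq> \<Union> (Q ` \<U>)"
      proof
        fix u assume "u \<in> K"
        then obtain \<xi> where \<xi>: "\<xi> \<in> cyl e" "u = char_map \<xi>"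
          by (auto simp: K_def)
        with \<U> obtain U where U: "U \<in> \<U>" "\<xi> \<in> U" by blast
        then have "\<xi> \<in> char_map -` Q U"
          using Q(2)[OF U(1)] by blast
        with U(1) \<xi>(2) show "u \<in> \<Union> (Q ` \<U>)" by auto
      qed
    qed
    with K obtain \<F> where \<F>: "finite \<F>" "\<F> \<subseteq> Q ` \<U>" "K \<subseteq> \<Union> \<F>"
      unfolding compactin_def by meson
    then obtain \<G> where \<G>: "\<G> \<subseteq> \<U>" "finite \<G>" "\<F> = Q ` \<G>"
      by (meson finite_subset_image)
    have "cyl e \<subseteq> \<Union> \<G>"
    proof
      fix \<xi> assume \<xi>: "\<xi> \<in> cyl e"
      then have "char_map \<xi> \<in> \<Union> \<F>"
        using \<F>(3) by (auto simp: K_def)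
      then obtain U where U: "U \<in> \<G>" "char_map \<xi> \<in> Q U"
        by (auto simp: \<G>(3))
      then have "U = char_map -` Q U \<inter> tight"
        using \<G>(1) Q(2) by blast
      with U \<xi> show "\<xi> \<in> \<Union> \<G>"
        by (auto simp: mem_cyl)
    qed
    with \<G> show "\<exists>\<F>. finite \<F> \<and> \<F> \<subseteq> \<U> \<and> cyl e \<subseteq> \<Union> \<F>"
      by blast
  qed
qed

section \<open>Locally constant functions with compact support\<close>

text \<open>The linear span of the indicators of cylinders. Cylinders are closed under intersection,
  so the span is an algebra; it will be the image under \<open>\<Psi>\<close> of the elements of
  degree \<open>\<omega>\<close>.\<close>

inductive_set simple_funs :: "(('c list \<times> 'a set) option set \<Rightarrow> complex) set" where
  basis: "elem e \<Longrightarrow> indicator (cyl e) \<in> simple_funs"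
| add: "f \<in> simple_funs \<Longrightarrow> g \<in> simple_funs \<Longrightarrow> (\<lambda>x. f x + g x) \<in> simple_funs"
| scale: "f \<in> simple_funs \<Longrightarrow> (\<lambda>x. c * f x) \<in> simple_funs"

lemma simple_zero: "(\<lambda>x. 0) \<in> simple_funs"
  using simple_funs.scale[OF simple_funs.basis[of "([], {})"], of 0] by (simp add: elem_def)

lemma simple_diff: "f \<in> simple_funs \<Longrightarrow> g \<in> simple_funs \<Longrightarrow> (\<lambda>x. f x - g x) \<in> simple_funs"
  using simple_funs.add[of f "\<lambda>x. - 1 * g x"] simple_funs.scale[of g "- 1"] by simp

lemma simple_sum:
  "(\<And>i. i \<in> I \<Longrightarrow> f i \<in> simple_funs) \<Longrightarrow> (\<lambda>x. \<Sum>i\<in>I. f i x) \<in> simple_funs"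
  by (induction I rule: infinite_finite_induct) (auto intro: simple_zero simple_funs.add)

lemma simple_times:
  assumes "f \<in> simple_funs" "g \<in> simple_funs"
  shows "(\<lambda>x. f x * g x) \<in> simple_funs"
  using assms(1)
proof induction
  case (basis e)
  note e = this
  show ?case
    using assms(2)
  proof induction
    case (basis f)
    have "(\<lambda>x. indicator (cyl e) x * indicator (cyl f) x) = (indicator (cyl (emeet e f)) :: _ \<Rightarrow> complex)"
      by (simp add: fun_eq_iff cyl_emeet e basis indicator_inter_arith)
    then show ?case
      using simple_funs.basis[OF elem_emeet[OF e basis]] by metis
  next
    case (add f g)
    from simple_funs.add[OF add.IH] show ?case
      by (simp add: distrib_left)
  next
    case (scale f c)
    from simple_funs.scale[OF scale.IH, of c] show ?case
      by (simp add: mult.left_commute)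
  qed
next
  case (add f g)
  from simple_funs.add[OF add.IH] show ?case
    by (simp add: distrib_right)
next
  case (scale f c)
  from simple_funs.scale[OF scale.IH, of c] show ?case
    by (simp add: mult.assoc)
qed

lemma simple_cnj: "f \<in> simple_funs \<Longrightarrow> (\<lambda>x. cnj (f x)) \<in> simple_funs"
proof (induction rule: simple_funs.induct)
  case (basis e)
  have "(\<lambda>x. cnj (indicator (cyl e) x)) = (indicator (cyl e) :: _ \<Rightarrow> complex)"
    by (auto simp: fun_eq_iff indicator_def)
  then show ?case
    using simple_funs.basis[OF basis] by metis
qed (auto intro: simple_funs.intros)

lemma simple_off: "f \<in> simple_funs \<Longrightarrow> x \<notin> tight \<Longrightarrow> f x = 0"
  by (induction rule: simple_funs.induct) (auto simp: cyl_def)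

lemma finite_range_simple: "f \<in> simple_funs \<Longrightarrow> finite (range f)"
proof (induction rule: simple_funs.induct)
  case (basis e)
  have "range (indicator (cyl e) :: _ \<Rightarrow> complex) \<subseteq> {0, 1}"
    by (auto simp: indicator_def)
  then show ?case by (rule finite_subset) simp
next
  case (add f g)
  have "range (\<lambda>x. f x + g x) \<subseteq> (\<lambda>(a, b). a + b) ` (range f \<times> range g)"
    by auto
  then show ?case by (rule finite_subset) (simp add: add.IH)
next
  case (scale f c)
  have "range (\<lambda>x. c * f x) \<subseteq> (\<lambda>a. c * a) ` range f"
    by auto
  then show ?case by (rule finite_subset) (simp add: scale.IH)
qed

lemma bounded_simple: "f \<in> simple_funs \<Longrightarrow> bounded (range f)"
  by (rule finite_imp_bounded) (rule finite_range_simple)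

text \<open>Lagrange interpolation: \<open>f\<close> has finitely many values, so
  \<open>F \<circ> f\<close> is a polynomial in \<open>f\<close>. There may be no unit, hence each
  term carries a factor \<open>f\<close> and its coefficient is divided by the value
  \<open>v\<close>; this is where \<open>F 0 = 0\<close> is required.\<close>

lemma simple_compose:
  assumes f: "f \<in> simple_funs" and F: "F 0 = 0"
  shows "(\<lambda>x. F (f x)) \<in> simple_funs"
proof -
  define S where "S = range f - {0}"
  have S: "finite S"
    by (simp add: S_def finite_range_simple[OF f])
  have prod: "(\<lambda>x. g x * (\<Prod>u\<in>U. f x - u)) \<in> simple_funs" if "finite U" "g \<in> simple_funs" for U g
    using that
  proof (induction U arbitrary: g)
    case (insert u U)
    have "(\<lambda>x. g x * (f x - u)) \<in> simple_funs"
      using simple_diff[OF simple_times[OF insert.prems f] simple_funs.scale[OF insert.prems, of u]]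
      by (simp add: algebra_simps)
    from insert.IH[OF this] show ?case
      using insert.hyps by (simp add: mult.assoc)
  qed simp
  define c where "c v = F v / (v * (\<Prod>u\<in>S - {v}. v - u))" for v
  have "F (f x) = (\<Sum>v\<in>S. c v * (f x * (\<Prod>u\<in>S - {v}. f x - u)))" for x
  proof (cases "f x = 0")
    case True
    then show ?thesis by (simp add: F)
  next
    case False
    then have v: "f x \<in> S" by (simp add: S_def)
    have "(\<Sum>v\<in>S. c v * (f x * (\<Prod>u\<in>S - {v}. f x - u))) =
        (\<Sum>v\<in>{f x}. c v * (f x * (\<Prod>u\<in>S - {v}. f x - u)))"
    proof (rule sum.mono_neutral_right[OF S])
      show "\<forall>v\<in>S - {f x}. c v * (f x * (\<Prod>u\<in>S - {v}. f x - u)) = 0"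
        using v S by (auto simp: prod_zero_iff)
    qed (use v in simp)
    moreover have "(\<Prod>u\<in>S - {f x}. f x - u) \<noteq> 0"
      using S by (auto simp: prod_zero_iff)
    ultimately show ?thesis
      using False by (simp add: c_def)
  qed
  moreover have "(\<lambda>x. \<Sum>v\<in>S. c v * (f x * (\<Prod>u\<in>S - {v}. f x - u))) \<in> simple_funs"
    using S f by (intro simple_sum simple_funs.scale prod) auto
  ultimately show ?thesis by simp
qed

text \<open>Encoded through indicators, so that Boolean operations on sets become algebraic
  identities between simple functions.\<close>

definition cylinder_sets :: "('c list \<times> 'a set) option set set set" where
  "cylinder_sets = {W. (indicator W :: _ \<Rightarrow> complex) \<in> simple_funs}"

lemma cylinder_cyl: "elem e \<Longrightarrow> cyl e \<in> cylinder_sets"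
  by (simp add: cylinder_sets_def simple_funs.basis)

lemma cylinder_empty: "{} \<in> cylinder_sets"
proof -
  have "(indicator {} :: ('c list \<times> 'a set) option set \<Rightarrow> complex) = (\<lambda>x. 0)"
    by (simp add: fun_eq_iff)
  then show ?thesis
    using simple_zero by (simp add: cylinder_sets_def)
qed

lemma cylinder_Int:
  assumes "W \<in> cylinder_sets" "W' \<in> cylinder_sets"
  shows "W \<inter> W' \<in> cylinder_sets"
proof -
  have "(indicator (W \<inter> W') :: _ \<Rightarrow> complex) = (\<lambda>x. indicator W x * indicator W' x)"
    by (simp add: fun_eq_iff indicator_inter_arith)
  then show ?thesis
    using simple_times assms by (simp add: cylinder_sets_def)
qed

lemma cylinder_Diff:
  assumes "W \<in> cylinder_sets" "W' \<in> cylinder_sets"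
  shows "W - W' \<in> cylinder_sets"
proof -
  have "(indicator (W - W') :: _ \<Rightarrow> complex) = (\<lambda>x. indicator W x - indicator W x * indicator W' x)"
    by (auto simp: fun_eq_iff indicator_def)
  then show ?thesis
    using simple_diff simple_times assms by (simp add: cylinder_sets_def)
qed

lemma cylinder_Un:
  assumes "W \<in> cylinder_sets" "W' \<in> cylinder_sets"
  shows "W \<union> W' \<in> cylinder_sets"
proof -
  have "(indicator (W \<union> W') :: _ \<Rightarrow> complex) = (\<lambda>x. indicator W x + indicator (W' - W) x)"
    by (auto simp: fun_eq_iff indicator_def)
  then show ?thesis
    using simple_funs.add cylinder_Diff[OF assms(2,1)] assms by (simp add: cylinder_sets_def)
qed

lemma cylinder_subset: "W \<in> cylinder_sets \<Longrightarrow> W \<subseteq> tight"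
proof
  fix x assume W: "W \<in> cylinder_sets" and x: "x \<in> W"
  show "x \<in> tight"
    using simple_off[of "indicator W" x] W x by (cases "x \<in> tight") (simp_all add: cylinder_sets_def)
qed

lemma openin_cyl:
  assumes "elem e" "snd e \<noteq> {}"
  shows "openin tight_topology (cyl e)"
proof (rule openin_tight_topologyI[where F = "\<lambda>_. {Some e}"])
  fix \<xi> \<eta> assume a: "\<xi> \<in> cyl e" "\<eta> \<in> tight" "{Some e} \<inter> \<eta> = {Some e} \<inter> \<xi>"
  show "\<eta> \<in> cyl e"
    using inter_eq_mem_iff[OF a(3), of "Some e"] a(1,2) by (simp add: mem_cyl)
qed (simp_all add: cyl_subset assms)

lemma openin_tight_minus_cyl:
  assumes "elem e" "snd e \<noteq> {}"
  shows "openin tight_topology (tight - cyl e)"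
proof (rule openin_tight_topologyI[where F = "\<lambda>_. {Some e}"])
  fix \<xi> \<eta> assume a: "\<xi> \<in> tight - cyl e" "\<eta> \<in> tight" "{Some e} \<inter> \<eta> = {Some e} \<inter> \<xi>"
  show "\<eta> \<in> tight - cyl e"
    using inter_eq_mem_iff[OF a(3), of "Some e"] a(1,2) by (simp add: mem_cyl)
qed (simp_all add: assms)

lemma openin_level_simple:
  assumes "g \<in> simple_funs"
  shows "openin tight_topology {\<eta> \<in> tight. g \<eta> = c}"
  using assms
proof (induction arbitrary: c)
  case (basis e)
  have "openin tight_topology {\<eta> \<in> tight. (indicator (cyl e) \<eta> :: complex) = c}"
  proof (cases "snd e = {}")
    case True
    then show ?thesis
      using openin_topspace[of tight_topology] by (cases "c = 0") (simp_all add: cyl_empty)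
  next
    case False
    consider "c = 1" | "c = 0" | "c \<noteq> 0" "c \<noteq> 1" by blast
    then show ?thesis
    proof cases
      case 1
      then have "{\<eta> \<in> tight. (indicator (cyl e) \<eta> :: complex) = c} = cyl e"
        by (auto simp: indicator_def mem_cyl)
      then show ?thesis
        using openin_cyl[OF basis False] by simp
    next
      case 2
      then have "{\<eta> \<in> tight. (indicator (cyl e) \<eta> :: complex) = c} = tight - cyl e"
        by (auto simp: indicator_def)
      then show ?thesis
        using openin_tight_minus_cyl[OF basis False] by simp
    next
      case 3
      then have "{\<eta> \<in> tight. (indicator (cyl e) \<eta> :: complex) = c} = {}"
        by (auto simp: indicator_def)
      then show ?thesis by (simp only: openin_empty)
    qed
  qed
  then show ?case .
next
  case (add f g)
  have "{\<eta> \<in> tight. f \<eta> + g \<eta> = c} = (\<Union>d. {\<eta> \<in> tight. f \<eta> = d} \<inter> {\<eta> \<in> tight. g \<eta> = c - d})"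
    by auto
  moreover have "openin tight_topology (\<Union>d. {\<eta> \<in> tight. f \<eta> = d} \<inter> {\<eta> \<in> tight. g \<eta> = c - d})"
    by (intro openin_Union) (auto intro: openin_Int add.IH)
  ultimately show ?case by simp
next
  case (scale f d)
  have "{\<eta> \<in> tight. d * f \<eta> = c} = (\<Union>b\<in>{b. d * b = c}. {\<eta> \<in> tight. f \<eta> = b})"
    by auto
  moreover have "openin tight_topology (\<Union>b\<in>{b. d * b = c}. {\<eta> \<in> tight. f \<eta> = b})"
    by (intro openin_Union) (auto intro: scale.IH)
  ultimately show ?case by simp
qed

lemma openin_cylinder:
  assumes "W \<in> cylinder_sets"
  shows "openin tight_topology W"
proof -
  have "{\<eta> \<in> tight. (indicator W \<eta> :: complex) = 1} = W"
    using cylinder_subset[OF assms] by (auto simp: indicator_def)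
  then show ?thesis
    using openin_level_simple[of "indicator W" 1] assms by (simp add: cylinder_sets_def)
qed

lemma compact_support_simple:
  "g \<in> simple_funs \<Longrightarrow> \<exists>K. compactin tight_topology K \<and> (\<forall>x. x \<notin> K \<longrightarrow> g x = 0)"
proof (induction rule: simple_funs.induct)
  case (basis e)
  show ?case
  proof (cases "snd e = {}")
    case True
    then show ?thesis
      by (intro exI[of _ "{}"]) (simp add: cyl_empty)
  next
    case False
    then show ?thesis
      using compactin_cyl[OF basis] by (intro exI[of _ "cyl e"]) simp
  qed
next
  case (add f g)
  then obtain K L where "compactin tight_topology K" "\<forall>x. x \<notin> K \<longrightarrow> f x = 0"
    "compactin tight_topology L" "\<forall>x. x \<notin> L \<longrightarrow> g x = 0"
    by (elim exE conjE)
  then show ?case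
    by (intro exI[of _ "K \<union> L"]) (simp add: compactin_Un)
next
  case (scale f c)
  then obtain K where "compactin tight_topology K" "\<forall>x. x \<notin> K \<longrightarrow> f x = 0"
    by (elim exE conjE)
  then show ?case
    by (intro exI[of _ K]) simp
qed

text \<open>A filter has some element \<open>e0\<close>. Starting from its cylinder, each of the
  finitely many prescribed memberships is enforced by intersecting with, or subtracting, one more
  cylinder.\<close>

lemma cylinder_basis:
  assumes U: "openin tight_topology U" and \<xi>: "\<xi> \<in> U"
  obtains W where "W \<in> cylinder_sets" "\<xi> \<in> W" "W \<subseteq> U"
proof -
  obtain F where F: "finite F" "F \<subseteq> carrier ES" "\<forall>\<eta>\<in>tight. F \<inter> \<eta> = F \<inter> \<xi> \<longrightarrow> \<eta> \<in> U"
    by (rule openin_tight_topologyE[OF U \<xi>])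
  have \<xi>t: "\<xi> \<in> tight"
    using openin_subset[OF U] \<xi> by auto
  note fl = tight_filter[OF \<xi>t]
  have "\<xi> \<noteq> {}"
    using fl by (simp add: is_filter_def)
  then obtain x where "x \<in> \<xi>" by blast
  with filter_None[OF fl] obtain e0 where e0: "Some e0 \<in> \<xi>"
    by (cases x) auto
  have "\<exists>W\<in>cylinder_sets. \<xi> \<in> W \<and> (\<forall>\<eta>\<in>W. F' \<inter> \<eta> = F' \<inter> \<xi>)" if "finite F'" "F' \<subseteq> carrier ES" for F'
    using that
  proof (induction F')
    case empty
    have "cyl e0 \<in> cylinder_sets"
      using filter_elem[OF fl e0] by (simp add: cylinder_cyl)
    moreover have "\<xi> \<in> cyl e0"
      using e0 \<xi>t by (simp add: mem_cyl)
    ultimately show ?case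
      by (intro bexI[of _ "cyl e0"]) simp_all
  next
    case (insert x F')
    then have "\<exists>W\<in>cylinder_sets. \<xi> \<in> W \<and> (\<forall>\<eta>\<in>W. F' \<inter> \<eta> = F' \<inter> \<xi>)"
      by simp
    then obtain W where W: "W \<in> cylinder_sets" "\<xi> \<in> W" "\<forall>\<eta>\<in>W. F' \<inter> \<eta> = F' \<inter> \<xi>"
      by (elim bexE conjE)
    have step: "insert x F' \<inter> \<eta> = insert x F' \<inter> \<xi>" if "\<eta> \<in> W" "x \<in> \<eta> \<longleftrightarrow> x \<in> \<xi>" for \<eta>
      using bspec[OF W(3) that(1)] that(2) by blast
    have sub: "\<eta> \<in> tight" if "\<eta> \<in> W" for \<eta>
      using cylinder_subset[OF W(1)] that by blast
    show ?case
    proof (cases x)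
      case None
      have "x \<in> \<eta> \<longleftrightarrow> x \<in> \<xi>" if "\<eta> \<in> W" for \<eta>
        using filter_None[OF tight_filter[OF sub[OF that]]] filter_None[OF fl] by (simp add: None)
      then show ?thesis
        by (intro bexI[OF _ W(1)] conjI ballI W(2) step)
    next
      case (Some e)
      then have e: "elem e"
        using insert.prems by simp
      show ?thesis
      proof (cases "x \<in> \<xi>")
        case True
        have "W \<inter> cyl e \<in> cylinder_sets"
          using W(1) e by (intro cylinder_Int cylinder_cyl)
        moreover have "\<xi> \<in> W \<inter> cyl e"
          using W(2) True Some \<xi>t by (simp add: mem_cyl)
        moreover have "insert x F' \<inter> \<eta> = insert x F' \<inter> \<xi>" if "\<eta> \<in> W \<inter> cyl e" for \<eta>
          using that True by (intro step) (simp_all add: mem_cyl Some)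
        ultimately show ?thesis
          by (intro bexI[of _ "W \<inter> cyl e"] conjI ballI)
      next
        case False
        have "W - cyl e \<in> cylinder_sets"
          using W(1) e by (intro cylinder_Diff cylinder_cyl)
        moreover have "\<xi> \<in> W - cyl e"
          using W(2) False Some by (simp add: mem_cyl)
        moreover have "insert x F' \<inter> \<eta> = insert x F' \<inter> \<xi>" if "\<eta> \<in> W - cyl e" for \<eta>
          using that False sub by (intro step) (simp_all add: mem_cyl Some)
        ultimately show ?thesis
          by (intro bexI[of _ "W - cyl e"] conjI ballI)
      qed
    qed
  qed
  from this[OF F(1,2)] obtain W where W: "W \<in> cylinder_sets" "\<xi> \<in> W" "\<forall>\<eta>\<in>W. F \<inter> \<eta> = F \<inter> \<xi>"
    by (elim bexE conjE)
  show ?thesis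
  proof (rule that[OF W(1,2)])
    show "W \<subseteq> U"
    proof
      fix \<eta> assume "\<eta> \<in> W"
      moreover from this have "\<eta> \<in> tight"
        using cylinder_subset[OF W(1)] by blast
      ultimately show "\<eta> \<in> U"
        using bspec[OF W(3)] bspec[OF F(3)] by simp
    qed
  qed
qed

section \<open>Uniform limits of simple functions\<close>

text \<open>The uniform closure of the simple functions. For open \<open>U\<close> it describes
  \<open>C0\<close> once vanishing off \<open>U\<close> is added, and closure under products and
  under translation by the partial action is direct in this form.\<close>

definition approximable :: "(('c list \<times> 'a set) option set \<Rightarrow> complex) \<Rightarrow> bool" where
  "approximable f \<longleftrightarrow> (\<forall>e>0. \<exists>g\<in>simple_funs. \<forall>x. cmod (f x - g x) < e)"

lemma approximableI:
  "(\<And>e. e > 0 \<Longrightarrow> \<exists>g\<in>simple_funs. \<forall>x. cmod (f x - g x) < e) \<Longrightarrow> approximable f"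
  by (simp add: approximable_def)

lemma approximableE:
  assumes "approximable f" "e > 0"
  obtains g where "g \<in> simple_funs" "\<And>x. cmod (f x - g x) < e"
  using assms unfolding approximable_def by blast

lemma approximable_simple: "g \<in> simple_funs \<Longrightarrow> approximable g"
  by (rule approximableI) (auto intro!: bexI[of _ g])

lemma approximable_bounded:
  assumes "approximable f"
  shows "bounded (range f)"
proof -
  obtain g where g: "g \<in> simple_funs" "\<And>x. cmod (f x - g x) < 1"
    using approximableE[OF assms, of 1] by auto
  obtain M where M: "\<And>x. cmod (g x) \<le> M"
    using bounded_simple[OF g(1)] by (auto simp: bounded_iff)
  have "cmod (f x) \<le> 1 + M" for x
    using norm_triangle_ineq[of "f x - g x" "g x"] g(2)[of x] M[of x] by simp
  then show ?thesis
    by (intro boundedI[of _ "1 + M"]) auto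
qed

lemma approximable_add:
  assumes "approximable f" "approximable f'"
  shows "approximable (\<lambda>x. f x + f' x)"
proof (rule approximableI)
  fix e :: real assume "e > 0"
  then have e: "e / 2 > 0" by simp
  obtain g where g: "g \<in> simple_funs" "\<And>x. cmod (f x - g x) < e / 2"
    using approximableE[OF assms(1) e] by blast
  obtain g' where g': "g' \<in> simple_funs" "\<And>x. cmod (f' x - g' x) < e / 2"
    using approximableE[OF assms(2) e] by blast
  have "cmod (f x + f' x - (g x + g' x)) < e" for x
    using norm_triangle_ineq[of "f x - g x" "f' x - g' x"] g(2)[of x] g'(2)[of x]
    by (simp add: algebra_simps)
  then show "\<exists>g\<in>simple_funs. \<forall>x. cmod (f x + f' x - g x) < e"
    by (intro bexI[OF _ simple_funs.add[OF g(1) g'(1)]] allI)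
qed

lemma approximable_times:
  assumes "approximable f" "approximable f'"
  shows "approximable (\<lambda>x. f x * f' x)"
proof (rule approximableI)
  fix e :: real assume e: "e > 0"
  obtain M where M: "M > 0" "\<And>x. cmod (f x) \<le> M"
    using approximable_bounded[OF assms(1)] by (auto simp: bounded_pos)
  from e M obtain g' where g': "g' \<in> simple_funs" "\<And>x. cmod (f' x - g' x) < e / (2 * M)"
    using approximableE[OF assms(2), of "e / (2 * M)"] by auto
  obtain M' where M': "M' > 0" "\<And>x. cmod (g' x) \<le> M'"
    using bounded_simple[OF g'(1)] by (auto simp: bounded_pos)
  from e M' obtain g where g: "g \<in> simple_funs" "\<And>x. cmod (f x - g x) < e / (2 * M')"
    using approximableE[OF assms(1), of "e / (2 * M')"] by auto
  have "cmod (f x * f' x - g x * g' x) < e" for x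
  proof -
    have "f x * f' x - g x * g' x = f x * (f' x - g' x) + (f x - g x) * g' x"
      by (simp add: algebra_simps)
    then have "cmod (f x * f' x - g x * g' x) \<le> cmod (f x) * cmod (f' x - g' x) + cmod (f x - g x) * cmod (g' x)"
      using norm_triangle_ineq[of "f x * (f' x - g' x)" "(f x - g x) * g' x"] by (simp add: norm_mult)
    also have "\<dots> \<le> M * cmod (f' x - g' x) + cmod (f x - g x) * M'"
      using M M' by (intro add_mono mult_mono) (auto simp: less_imp_le)
    also have "\<dots> < M * (e / (2 * M)) + e / (2 * M') * M'"
      using M M' g g' by (intro add_strict_mono mult_strict_left_mono mult_strict_right_mono) auto
    also have "\<dots> = e"
      using M M' by simp
    finally show ?thesis .
  qed
  then show "\<exists>g\<in>simple_funs. \<forall>x. cmod (f x * f' x - g x) < e"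
    by (intro bexI[OF _ simple_times[OF g(1) g'(1)]] allI)
qed

lemma approximable_scale:
  assumes "approximable f"
  shows "approximable (\<lambda>x. c * f x)"
proof (rule approximableI)
  fix e :: real assume e: "e > 0"
  have c: "cmod c + 1 > 0"
    by (simp add: add_nonneg_pos)
  with e obtain g where g: "g \<in> simple_funs" "\<And>x. cmod (f x - g x) < e / (cmod c + 1)"
    using approximableE[OF assms, of "e / (cmod c + 1)"] by auto
  have "cmod (c * f x - c * g x) < e" for x
  proof -
    have "cmod (c * f x - c * g x) = cmod c * cmod (f x - g x)"
      by (simp add: norm_mult flip: right_diff_distrib)
    also have "\<dots> \<le> (cmod c + 1) * cmod (f x - g x)"
      by (intro mult_right_mono) auto
    also have "\<dots> < e"
      using g(2)[of x] c by (simp add: field_simps)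
    finally show ?thesis .
  qed
  then show "\<exists>g\<in>simple_funs. \<forall>x. cmod (c * f x - g x) < e"
    by (intro bexI[OF _ simple_funs.scale[OF g(1), of c]] allI)
qed

lemma approximable_cnj:
  assumes "approximable f"
  shows "approximable (\<lambda>x. cnj (f x))"
proof (rule approximableI)
  fix e :: real assume e: "e > 0"
  then obtain g where g: "g \<in> simple_funs" "\<And>x. cmod (f x - g x) < e"
    using approximableE[OF assms] by blast
  have "cmod (cnj (f x) - cnj (g x)) < e" for x
    using g(2)[of x] by (simp flip: complex_cnj_diff)
  then show "\<exists>g\<in>simple_funs. \<forall>x. cmod (cnj (f x) - g x) < e"
    by (intro bexI[OF _ simple_cnj[OF g(1)]] allI)
qed

text \<open>The root function is uniformly continuous on \<open>{-1..1}\<close>. An approximant of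
  \<open>h\<close> may be complex or leave this interval, so its real part is clipped to it, which
  brings it no further from \<open>h\<close>. The root function vanishes at 0, so
  \<open>simple_compose\<close> applies.\<close>

lemma approximable_root:
  assumes h: "approximable (\<lambda>x. complex_of_real (h x))" and h1: "\<And>x. \<bar>h x\<bar> \<le> 1"
  shows "approximable (\<lambda>x. complex_of_real (sqrt (1 - (h x)\<^sup>2) - 1))"
proof (rule approximableI)
  fix e :: real assume e: "e > 0"
  let ?s = "\<lambda>t :: real. sqrt (1 - t\<^sup>2) - 1"
  have "uniformly_continuous_on {-1..1} ?s"
    by (intro compact_uniformly_continuous continuous_intros compact_Icc)
  with e obtain d where d: "d > 0" "\<And>s t. s \<in> {-1..1} \<Longrightarrow> t \<in> {-1..1} \<Longrightarrow> dist t s < d \<Longrightarrow> dist (?s t) (?s s) < e"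
    unfolding uniformly_continuous_on_def by meson
  obtain g where g: "g \<in> simple_funs" "\<And>x. cmod (complex_of_real (h x) - g x) < d"
    using approximableE[OF h d(1)] by blast
  define clip where "clip z = max (-1) (min 1 (Re z))" for z
  have "(\<lambda>x. complex_of_real (?s (clip (g x)))) \<in> simple_funs"
    by (rule simple_compose[OF g(1), of "\<lambda>z. complex_of_real (?s (clip z))"]) (simp add: clip_def)
  moreover have "cmod (complex_of_real (?s (h x)) - complex_of_real (?s (clip (g x)))) < e" for x
  proof -
    have "\<bar>h x - clip (g x)\<bar> \<le> \<bar>h x - Re (g x)\<bar>"
      using h1[of x] by (auto simp: clip_def)
    also have "\<dots> \<le> cmod (complex_of_real (h x) - g x)"
      using abs_Re_le_cmod[of "complex_of_real (h x) - g x"] by simp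
    also have "\<dots> < d" by (rule g(2))
    finally have "dist (?s (h x)) (?s (clip (g x))) < e"
      using h1[of x] by (intro d(2)) (auto simp: dist_real_def clip_def)
    then show ?thesis
      by (simp only: dist_real_def norm_of_real flip: of_real_diff)
  qed
  ultimately show "\<exists>g\<in>simple_funs. \<forall>x. cmod (complex_of_real (?s (h x)) - g x) < e"
    by (intro bexI[where x = "\<lambda>x. complex_of_real (?s (clip (g x)))"] allI)
qed

text \<open>The set \<open>K\<close> where \<open>f\<close> is not small is compact, so finitely
  many cylinder sets on which \<open>f\<close> varies by less than \<open>e\<close> cover it. The
  approximant takes on each the value of \<open>f\<close> at its centre, and 0 elsewhere, where
  \<open>f\<close> is small.\<close>

lemma C0_approximable:
  assumes U: "openin tight_topology U" and f: "f \<in> C0 tight_topology U"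
  shows "approximable f"
proof (rule approximableI)
  fix e :: real assume e: "e > 0"
  define K where "K = {x \<in> U. e \<le> cmod (f x)}"
  have cont: "continuous_map (subtopology tight_topology U) euclidean f"
    and off: "\<And>x. x \<notin> U \<Longrightarrow> f x = 0"
    and K: "compactin (subtopology tight_topology U) K"
    using f e by (auto simp: C0_def K_def)
  have UT: "U \<subseteq> tight"
    using openin_subset[OF U] by simp
  have near: "\<exists>W\<in>cylinder_sets. x \<in> W \<and> W \<subseteq> U \<and> (\<forall>y\<in>W. cmod (f y - f x) < e)" if x: "x \<in> U" for x
  proof -
    have "openin (subtopology tight_topology U) {y \<in> U. f y \<in> ball (f x) e}"
      using openin_continuous_map_preimage[OF cont, of "ball (f x) e"] UT by (simp add: Int_absorb1)
    then have "openin tight_topology {y \<in> U. f y \<in> ball (f x) e}"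
      using openin_trans_full[OF _ U] by blast
    moreover have "x \<in> {y \<in> U. f y \<in> ball (f x) e}"
      using x e by simp
    ultimately obtain W where W: "W \<in> cylinder_sets" "x \<in> W" "W \<subseteq> {y \<in> U. f y \<in> ball (f x) e}"
      by (rule cylinder_basis)
    have "\<forall>y\<in>W. cmod (f y - f x) < e"
    proof
      fix y assume "y \<in> W"
      with W(3) have "f y \<in> ball (f x) e" by blast
      then show "cmod (f y - f x) < e"
        by (simp add: dist_norm norm_minus_commute)
    qed
    with W show ?thesis by blast
  qed
  then obtain W where W: "\<And>x. x \<in> U \<Longrightarrow> W x \<in> cylinder_sets" "\<And>x. x \<in> U \<Longrightarrow> x \<in> W x"
    "\<And>x. x \<in> U \<Longrightarrow> W x \<subseteq> U" "\<And>x y. x \<in> U \<Longrightarrow> y \<in> W x \<Longrightarrow> cmod (f y - f x) < e"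
    by metis
  have KU: "K \<subseteq> U" by (auto simp: K_def)
  have "compactin tight_topology K"
    using K by (simp add: compactin_subtopology)
  moreover have "\<forall>V\<in>W ` K. openin tight_topology V"
    using W(1) KU openin_cylinder by blast
  moreover have "K \<subseteq> \<Union> (W ` K)"
    using W(2) KU by blast
  ultimately have "\<exists>\<F>. finite \<F> \<and> \<F> \<subseteq> W ` K \<and> K \<subseteq> \<Union> \<F>"
    unfolding compactin_def by blast
  then obtain S where S: "finite S" "S \<subseteq> K" "K \<subseteq> \<Union> (W ` S)"
    by (metis finite_subset_image)
  have "\<exists>g\<in>simple_funs. \<exists>A\<in>cylinder_sets. (\<Union>x\<in>S. W x) \<subseteq> A \<and>
      (\<forall>y\<in>A. cmod (f y - g y) < e) \<and> (\<forall>y. y \<notin> A \<longrightarrow> g y = 0)"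
    using S(1,2)
  proof (induction S)
    case empty
    show ?case
      using simple_zero cylinder_empty by (intro bexI[of _ "\<lambda>x. 0"] bexI[of _ "{}"]) auto
  next
    case (insert x S)
    then obtain g A where gA: "g \<in> simple_funs" "A \<in> cylinder_sets" "(\<Union>x\<in>S. W x) \<subseteq> A"
      "\<And>y. y \<in> A \<Longrightarrow> cmod (f y - g y) < e" "\<And>y. y \<notin> A \<Longrightarrow> g y = 0"
      by auto
    have x: "x \<in> U"
      using insert.prems KU by blast
    \<comment> \<open>The new value is used only off \<open>A\<close>, so earlier choices stand and
      the pieces stay disjoint.\<close>
    let ?g = "\<lambda>y. g y + f x * indicator (W x - A) y"
    have "W x - A \<in> cylinder_sets"
      by (rule cylinder_Diff[OF W(1)[OF x] gA(2)])
    then have "?g \<in> simple_funs"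
      using gA(1) by (intro simple_funs.add simple_funs.scale) (simp_all add: cylinder_sets_def)
    moreover have "A \<union> W x \<in> cylinder_sets"
      by (rule cylinder_Un[OF gA(2) W(1)[OF x]])
    moreover have "cmod (f y - ?g y) < e" if "y \<in> A \<union> W x" for y
      using that gA(4,5) W(4)[OF x] by (cases "y \<in> A") auto
    moreover have "?g y = 0" if "y \<notin> A \<union> W x" for y
      using that gA(5) by auto
    ultimately show ?case
      using gA(3) by (intro bexI[of _ ?g] bexI[of _ "A \<union> W x"]) auto
  qed
  then obtain g A where g: "g \<in> simple_funs" "(\<Union>x\<in>S. W x) \<subseteq> A"
    "\<And>y. y \<in> A \<Longrightarrow> cmod (f y - g y) < e" "\<And>y. y \<notin> A \<Longrightarrow> g y = 0"
    by auto
  have "cmod (f y - g y) < e" for y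
  proof (cases "y \<in> A")
    case False
    then have "y \<notin> K"
      using S(3) g(2) by auto
    then have "cmod (f y) < e"
      using off[of y] e by (cases "y \<in> U") (auto simp: K_def)
    with g(4)[OF False] show ?thesis by simp
  qed (rule g(3))
  with g(1) show "\<exists>g\<in>simple_funs. \<forall>x. cmod (f x - g x) < e"
    by blast
qed

text \<open>Simple functions are locally constant, so a uniform limit is continuous. An approximant
  within \<open>e\<close> cannot vanish where \<open>f\<close> has modulus at least
  \<open>e\<close>, so that set lies in the compact support of the approximant.\<close>

lemma approximable_C0:
  assumes U: "U \<subseteq> tight" and off: "\<And>x. x \<notin> U \<Longrightarrow> f x = 0" and f: "approximable f"
  shows "f \<in> C0 tight_topology U"
proof -
  have cont: "continuous_map tight_topology euclidean f"
    unfolding continuous_map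
  proof (intro conjI allI impI)
    fix V :: "complex set" assume "openin euclidean V"
    then have V: "open V" by simp
    show "openin tight_topology {x \<in> topspace tight_topology. f x \<in> V}"
    proof (subst openin_subopen, intro ballI)
      fix x assume x: "x \<in> {x \<in> topspace tight_topology. f x \<in> V}"
      then obtain e where e: "e > 0" "ball (f x) e \<subseteq> V"
        using V openE by blast
      obtain g where g: "g \<in> simple_funs" "\<And>x. cmod (f x - g x) < e / 2"
        using approximableE[OF f, of "e / 2"] e by auto
      have "f y \<in> V" if "g y = g x" for y
      proof -
        have "cmod (f x - f y) \<le> cmod (f x - g x) + cmod (f y - g y)"
          using norm_triangle_ineq4[of "f x - g x" "f y - g y"] that by simp
        then have "dist (f x) (f y) < e"
          using g(2)[of x] g(2)[of y] by (simp add: dist_norm)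
        with e(2) show ?thesis by auto
      qed
      then show "\<exists>T. openin tight_topology T \<and> x \<in> T \<and> T \<subseteq> {x \<in> topspace tight_topology. f x \<in> V}"
        using openin_level_simple[OF g(1), of "g x"] x
        by (intro exI[of _ "{\<eta> \<in> tight. g \<eta> = g x}"]) auto
    qed
  qed auto
  have "compactin (subtopology tight_topology U) {x \<in> U. e \<le> cmod (f x)}" if e: "e > 0" for e
  proof -
    obtain g where g: "g \<in> simple_funs" "\<And>x. cmod (f x - g x) < e"
      using approximableE[OF f e] by blast
    obtain K where K: "compactin tight_topology K" "\<And>x. x \<notin> K \<Longrightarrow> g x = 0"
      using compact_support_simple[OF g(1)] by blast
    \<comment> \<open>As \<open>f\<close> is 0 off \<open>U\<close> and \<open>e\<close> is
      positive, the set is a preimage in the whole spectrum, hence closed there and not merely in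
      \<open>U\<close>.\<close>
    have eq: "{x \<in> U. e \<le> cmod (f x)} = {x \<in> topspace tight_topology. f x \<in> {z. e \<le> cmod z}}"
      using off U e by auto (metis norm_zero not_less)
    have "closedin tight_topology {x \<in> U. e \<le> cmod (f x)}"
      unfolding eq by (intro closedin_continuous_map_preimage[OF cont]) (simp add: closed_Collect_le continuous_on_norm_id)
    moreover have "{x \<in> U. e \<le> cmod (f x)} \<subseteq> K"
    proof
      fix x assume "x \<in> {x \<in> U. e \<le> cmod (f x)}"
      with g(2)[of x] K(2)[of x] show "x \<in> K" by (cases "x \<in> K") auto
    qed
    ultimately have "compactin tight_topology {x \<in> U. e \<le> cmod (f x)}"
      using closed_compactin[OF K(1)] by blast
    then show ?thesis
      by (simp add: compactin_subtopology)
  qed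
  then show ?thesis
    using continuous_map_from_subtopology[OF cont] off by (auto simp: C0_def)
qed

lemma C0_tight_iff:
  assumes "openin tight_topology U"
  shows "f \<in> C0 tight_topology U \<longleftrightarrow> (\<forall>x. x \<notin> U \<longrightarrow> f x = 0) \<and> approximable f"
  using C0_approximable[OF assms] approximable_C0[of U f] openin_subset[OF assms] by (auto simp: C0_def)

end

section \<open>The word of a filter\<close>

lemma length_beginning: "enat n \<le> word_length \<alpha> \<Longrightarrow> length (beginning n \<alpha>) = n"
  by (cases \<alpha>) auto

lemma beginning_over: "\<not> enat n \<le> word_length \<alpha> \<Longrightarrow> \<exists>m. enat m \<le> word_length \<alpha> \<and> beginning n \<alpha> = beginning m \<alpha>"
  by (cases \<alpha>) auto

text \<open>If lengths are bounded, a longest element is the word. Otherwise there is exactly one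
  element of each length, and these fit together to an infinite word.\<close>

lemma chain_word:
  assumes Nil: "[] \<in> W" and pre: "\<And>\<alpha> \<beta>. \<alpha> \<in> W \<Longrightarrow> prefix \<beta> \<alpha> \<Longrightarrow> \<beta> \<in> W"
    and chain: "\<And>\<alpha> \<beta>. \<alpha> \<in> W \<Longrightarrow> \<beta> \<in> W \<Longrightarrow> prefix \<alpha> \<beta> \<or> prefix \<beta> \<alpha>"
  shows "\<exists>\<alpha>. W = range (\<lambda>n. beginning n \<alpha>)"
proof (cases "\<exists>N. \<forall>\<beta>\<in>W. length \<beta> \<le> N")
  case True
  then obtain N where "\<forall>\<beta>\<in>W. length \<beta> \<le> N" by blast
  then have "\<exists>\<beta>\<in>W. \<forall>\<beta>'\<in>W. length \<beta>' \<le> length \<beta>"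
    using ex_has_greatest_nat[of "\<lambda>\<beta>. \<beta> \<in> W" "[]" length "Suc N"] Nil by (auto simp: less_Suc_eq_le)
  then obtain \<beta> where \<beta>: "\<beta> \<in> W" "\<And>\<beta>'. \<beta>' \<in> W \<Longrightarrow> length \<beta>' \<le> length \<beta>"
    by blast
  have "W = range (\<lambda>n. take n \<beta>)"
  proof (intro Set.set_eqI iffI)
    fix \<beta>' assume \<beta>': "\<beta>' \<in> W"
    then have "prefix \<beta>' \<beta>"
      using chain[OF \<beta>(1) \<beta>'] \<beta>(2)[OF \<beta>'] by (auto simp: prefix_def)
    then have "\<beta>' = take (length \<beta>') \<beta>"
      by (auto simp: prefix_def)
    then show "\<beta>' \<in> range (\<lambda>n. take n \<beta>)" by blast
  qed (auto intro: pre[OF \<beta>(1)] take_is_prefix)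
  then show ?thesis
    by (intro exI[of _ "Fin \<beta>"]) simp
next
  case False
  have "\<exists>\<beta>\<in>W. length \<beta> = n" for n
  proof -
    obtain \<beta> where "\<beta> \<in> W" "length \<beta> > n"
      using False by (meson not_less)
    then have "take n \<beta> \<in> W" "length (take n \<beta>) = n"
      by (auto intro: pre take_is_prefix)
    then show ?thesis by blast
  qed
  then obtain w where w: "\<And>n. w n \<in> W" "\<And>n. length (w n) = n"
    by metis
  have same: "\<beta> = \<beta>'" if "\<beta> \<in> W" "\<beta>' \<in> W" "length \<beta> = length \<beta>'" for \<beta> \<beta>'
    using chain[OF that(1,2)] that(3) by (auto simp: prefix_def)
  have w_take: "w m = take m (w n)" if "m \<le> n" for m n
    by (rule same[OF w(1) pre[OF w(1) take_is_prefix]]) (simp add: w(2) that)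
  \<comment> \<open>The letter at position \<open>n\<close> is the last letter of the element of
    length \<open>n + 1\<close>.\<close>
  define s where "s = smap (\<lambda>n. w (Suc n) ! n) nats"
  have stake: "stake n s = w n" for n
  proof (rule nth_equalityI)
    fix i assume "i < length (stake n s)"
    then have i: "i < n" by simp
    then have "w (Suc i) ! i = w n ! i"
      using w_take[of "Suc i" n] by simp
    with i show "stake n s ! i = w n ! i"
      by (simp add: s_def)
  qed (simp add: w)
  have "W = range w"
  proof
    show "range w \<subseteq> W"
      using w(1) by auto
    show "W \<subseteq> range w"
    proof
      fix \<beta> assume "\<beta> \<in> W"
      then have "\<beta> = w (length \<beta>)"
        by (intro same w(1)) (simp_all add: w(2))
      then show "\<beta> \<in> range w" by blast
    qed
  qed
  then show ?thesis
    by (intro exI[of _ "Inf s"]) (simp add: stake)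
qed

lemma beginning_inject:
  assumes eq: "range (\<lambda>n. beginning n \<alpha>) = range (\<lambda>n. beginning n \<alpha>')"
  shows "\<alpha> = \<alpha>'"
proof -
  have ex: "\<exists>m. beginning n \<alpha> = beginning m \<alpha>'" "\<exists>m. beginning n \<alpha>' = beginning m \<alpha>" for n
  proof -
    have "beginning n \<alpha> \<in> range (\<lambda>n. beginning n \<alpha>')" "beginning n \<alpha>' \<in> range (\<lambda>n. beginning n \<alpha>)"
      using rangeI[of "\<lambda>n. beginning n \<alpha>" n] rangeI[of "\<lambda>n. beginning n \<alpha>'" n] by (simp_all only: eq)
    then show "\<exists>m. beginning n \<alpha> = beginning m \<alpha>'" "\<exists>m. beginning n \<alpha>' = beginning m \<alpha>"
      by (auto elim!: rangeE)
  qed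
  \<comment> \<open>An infinite word has a beginning longer than all beginnings of
    \<open>\<beta>\<close>, so it is never confused with a finite word.\<close>
  have absurd: False if "stake (Suc (length \<beta>)) s = take m \<beta>" for m \<beta> and s :: "'a stream"
    using arg_cong[OF that, of length] by simp
  show ?thesis
  proof (cases \<alpha>)
    case (Fin \<beta>)
    show ?thesis
    proof (cases \<alpha>')
      case (Fin \<beta>')
      obtain n n' where "take (length \<beta>) \<beta> = take n \<beta>'" "take (length \<beta>') \<beta>' = take n' \<beta>"
        using ex[of "length \<beta>"] ex[of "length \<beta>'"] by (auto simp: Fin \<open>\<alpha> = Fin \<beta>\<close>)
      then have "prefix \<beta> \<beta>'" "prefix \<beta>' \<beta>"
        using take_is_prefix[of n \<beta>'] take_is_prefix[of n' \<beta>] by simp_all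
      then have "\<beta> = \<beta>'"
        by (rule prefix_order.antisym)
      then show ?thesis
        by (simp add: Fin \<open>\<alpha> = Fin \<beta>\<close>)
    next
      case (Inf s)
      then show ?thesis
        using ex(2)[of "Suc (length \<beta>)"] absurd[of \<beta> s] by (auto simp: Fin simp del: stake.simps)
    qed
  next
    case (Inf s)
    show ?thesis
    proof (cases \<alpha>')
      case (Fin \<beta>)
      then show ?thesis
        using ex(1)[of "Suc (length \<beta>)"] absurd[of \<beta> s] by (auto simp: Inf simp del: stake.simps)
    next
      case (Inf s')
      have "stake n s = stake n s'" for n
      proof -
        obtain m where m: "stake n s = stake m s'"
          using ex(1)[of n] by (auto simp: Inf \<open>\<alpha> = Inf s\<close>)
        have "n = m"
          using arg_cong[OF m, of length] by (simp only: length_stake)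
        with m show ?thesis by simp
      qed
      then have "s !! n = s' !! n" for n
        using stake_nth[of n "Suc n" s] stake_nth[of n "Suc n" s'] by (simp del: stake.simps)
      then have "s = s'"
        using stream_smap_nats[of s] stream_smap_nats[of s'] by presburger
      then show ?thesis
        by (simp add: Inf \<open>\<alpha> = Inf s\<close>)
    qed
  qed
qed

context normal_labelled_space
begin

lemma Nil_path [simp]: "[] \<in> path_labels"
  by (simp add: path_labels_def)

lemma filter_word_spec:
  assumes \<xi>: "is_filter ES None \<xi>"
  shows "insert [] {\<beta>. \<exists>A. Some (\<beta>, A) \<in> \<xi>} = range (\<lambda>n. beginning n (filter_word \<xi>))"
proof -
  let ?W = "insert [] {\<beta>. \<exists>A. Some (\<beta>, A) \<in> \<xi>}"
  have "\<exists>\<alpha>. ?W = range (\<lambda>n. beginning n \<alpha>)"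
  proof (rule chain_word)
    fix \<alpha> \<beta> assume \<alpha>: "\<alpha> \<in> ?W"
    show "\<beta> \<in> ?W" if "prefix \<beta> \<alpha>"
    proof (cases "\<beta> = []")
      case False
      with that \<alpha> obtain \<gamma> A where "\<alpha> = \<beta> @ \<gamma>" "Some (\<beta> @ \<gamma>, A) \<in> \<xi>"
        by (auto simp: prefix_def)
      with filter_range_of[OF \<xi> _ False] show ?thesis by blast
    qed simp
    show "prefix \<alpha> \<beta> \<or> prefix \<beta> \<alpha>" if "\<beta> \<in> ?W"
    proof (cases "\<alpha> = [] \<or> \<beta> = []")
      case False
      with that \<alpha> obtain A C where "Some (\<alpha>, A) \<in> \<xi>" "Some (\<beta>, C) \<in> \<xi>"
        by blast
      from filter_comparable[OF \<xi> this] show ?thesis by simp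
    qed auto
  qed simp
  then obtain \<alpha> where \<alpha>: "?W = range (\<lambda>n. beginning n \<alpha>)" ..
  have path: "?W \<subseteq> path_labels"
  proof
    fix \<beta> assume "\<beta> \<in> ?W"
    then consider "\<beta> = []" | A where "Some (\<beta>, A) \<in> \<xi>"
      by blast
    then show "\<beta> \<in> path_labels"
    proof cases
      case (2 A)
      from filter_elem[OF \<xi> this] show ?thesis
        by (intro range_of_path) (auto simp: elem_def)
    qed simp
  qed
  have mem: "beginning n \<alpha> \<in> path_labels" for n
    using path rangeI[of "\<lambda>n. beginning n \<alpha>" n] unfolding \<alpha> by blast
  have "\<alpha> \<in> words_le_infinity"
  proof (cases \<alpha>)
    case (Fin \<beta>)
    with mem[of "length \<beta>"] show ?thesis
      by (simp add: words_le_infinity_def)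
  next
    case (Inf s)
    with mem show ?thesis
      by (simp add: words_le_infinity_def)
  qed
  with \<alpha> have "\<exists>!\<alpha>. \<alpha> \<in> words_le_infinity \<and> ?W = range (\<lambda>n. beginning n \<alpha>)"
    using beginning_inject by (intro ex1I[of _ \<alpha>]) auto
  from theI'[OF this] show ?thesis
    unfolding filter_word_def by blast
qed

lemma filter_word_beginning:
  assumes \<xi>: "is_filter ES None \<xi>" and e: "Some (\<beta>, A) \<in> \<xi>"
  shows "enat (length \<beta>) \<le> word_length (filter_word \<xi>)" "beginning (length \<beta>) (filter_word \<xi>) = \<beta>"
proof -
  have "\<beta> \<in> range (\<lambda>n. beginning n (filter_word \<xi>))"
    using e unfolding filter_word_spec[OF \<xi>, symmetric] by blast
  then obtain n where "\<beta> = beginning n (filter_word \<xi>)"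
    by blast
  then obtain m where m: "\<beta> = beginning m (filter_word \<xi>)" "enat m \<le> word_length (filter_word \<xi>)"
    using beginning_over by metis
  then show "enat (length \<beta>) \<le> word_length (filter_word \<xi>)" "beginning (length \<beta>) (filter_word \<xi>) = \<beta>"
    using length_beginning[OF m(2)] by simp_all
qed

lemma beginning_filter_word:
  assumes \<xi>: "is_filter ES None \<xi>" and n: "enat n \<le> word_length (filter_word \<xi>)" "n > 0"
  shows "\<exists>A. Some (beginning n (filter_word \<xi>), A) \<in> \<xi>"
proof -
  have "beginning n (filter_word \<xi>) \<in> insert [] {\<beta>. \<exists>A. Some (\<beta>, A) \<in> \<xi>}"
    unfolding filter_word_spec[OF \<xi>] by (rule rangeI)
  moreover have "beginning n (filter_word \<xi>) \<noteq> []"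
    using length_beginning[OF n(1)] n(2) by auto
  ultimately show ?thesis by blast
qed

section \<open>Gluing a letter\<close>

text \<open>The case distinction on the word of \<open>\<xi>\<close> in the gluing map disappears when the map is described
  on the elements of the filter instead of its layers.\<close>

definition glue1 :: "'c \<Rightarrow> ('c list \<times> 'a set) option set \<Rightarrow> ('c list \<times> 'a set) option set" where
  "glue1 a \<xi> = {Some (a # \<beta>, C) |\<beta> C. C \<subseteq> range_of (a # \<beta>) \<and> Some (\<beta>, C) \<in> \<xi>} \<union>
     {Some ([], D) |D. D \<in> B \<and> Some ([], relrange D [a]) \<in> \<xi>}"

text \<open>The cutting map. Its upward closure \<open>D \<subseteq> C\<close> becomes a test on
  \<open>C \<inter> range_of (a # \<beta>)\<close>, because the layer of a filter at
  \<open>a # \<beta>\<close> is an up-set among the subsets of that range.\<close>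

definition unglue1 :: "'c \<Rightarrow> ('c list \<times> 'a set) option set \<Rightarrow> ('c list \<times> 'a set) option set" where
  "unglue1 a \<eta> = {Some (\<beta>, C) |\<beta> C. elem (\<beta>, C) \<and> Some (a # \<beta>, C \<inter> range_of (a # \<beta>)) \<in> \<eta>}"

lemma glue1_simps [simp]:
  "None \<notin> glue1 a \<xi>"
  "Some ([], D) \<in> glue1 a \<xi> \<longleftrightarrow> D \<in> B \<and> Some ([], relrange D [a]) \<in> \<xi>"
  "Some (b # \<beta>, C) \<in> glue1 a \<xi> \<longleftrightarrow> b = a \<and> C \<subseteq> range_of (a # \<beta>) \<and> Some (\<beta>, C) \<in> \<xi>"
  by (auto simp: glue1_def)

lemma unglue1_simps [simp]:
  "None \<notin> unglue1 a \<eta>"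
  "Some (\<beta>, C) \<in> unglue1 a \<eta> \<longleftrightarrow> elem (\<beta>, C) \<and> Some (a # \<beta>, C \<inter> range_of (a # \<beta>)) \<in> \<eta>"
  by (auto simp: unglue1_def)

lemma range_of_Cons: "range_of (a # \<beta>) = relrange (range_of [a]) \<beta>"
  using range_of_append[of "[a]" \<beta>] by simp

lemma filter_restrict_range:
  assumes \<xi>: "is_filter ES None \<xi>" and a: "Some ([], range_of [a]) \<in> \<xi>" and C: "Some (\<beta>, C) \<in> \<xi>"
  shows "Some (\<beta>, C \<inter> range_of (a # \<beta>)) \<in> \<xi>"
  using filter_left[OF \<xi>, of "[]" \<beta> C "range_of [a]"] a C by (simp add: range_of_Cons[of a \<beta>])

text \<open>For a non-empty word with first letter \<open>b\<close>, gluing computes layers 0 and 1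
  by pushing forward along \<open>b\<close> into the next layer. \<open>filter_comp_iff\<close>
  shows that this agrees with reading layer 0 of \<open>\<xi>\<close> directly, which is the rule
  for the empty word.\<close>

lemma glue_layers_eq:
  assumes \<xi>: "is_filter ES None \<xi>" and a: "Some ([], range_of [a]) \<in> \<xi>"
    and w: "w = filter_word \<xi>"
  shows "glue_layers [a] w \<xi> 0 = {D \<in> B. Some ([], relrange D [a]) \<in> \<xi>}"
    and "enat m \<le> word_length w \<Longrightarrow>
      glue_layers [a] w \<xi> (Suc m) = {C. C \<subseteq> range_of (a # beginning m w) \<and> Some (beginning m w, C) \<in> \<xi>}"
proof -
  have B_mem: "A \<in> B" if "Some (\<beta>, A) \<in> \<xi>" for \<beta> A
    using filter_elem[OF \<xi> that] by (simp add: elem_def)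
  have sub: "relrange D \<alpha> \<subseteq> range_of \<alpha>" if "D \<in> B" for D \<alpha>
    by (rule relrange_range_of[OF B_verts[OF that]])
  have B_belowNil: "D \<in> B_below [] \<longleftrightarrow> D \<in> B" for D
    using B_verts by (auto simp: B_below_def)
  \<comment> \<open>Restricting to the range stays inside the filter since
    \<open>range_of [a]\<close> belongs to it; conversely a set inside the range is its own
    restriction.\<close>
  have upper: "{C \<inter> range_of (a # beginning n w) |C. C \<in> layer \<xi> n} =
      {C. C \<subseteq> range_of (a # beginning n w) \<and> Some (beginning n w, C) \<in> \<xi>}" for n
  proof (intro Set.set_eqI iffI)
    fix C assume "C \<in> {C \<inter> range_of (a # beginning n w) |C. C \<in> layer \<xi> n}"
    then obtain C' where "C = C' \<inter> range_of (a # beginning n w)" "Some (beginning n w, C') \<in> \<xi>"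
      by (auto simp: layer_def w)
    with filter_restrict_range[OF \<xi> a] show "C \<in> {C. C \<subseteq> range_of (a # beginning n w) \<and> Some (beginning n w, C) \<in> \<xi>}"
      by simp
  next
    fix C assume "C \<in> {C. C \<subseteq> range_of (a # beginning n w) \<and> Some (beginning n w, C) \<in> \<xi>}"
    then have "C \<in> layer \<xi> n" "C = C \<inter> range_of (a # beginning n w)"
      by (auto simp: layer_def w B_mem)
    then show "C \<in> {C \<inter> range_of (a # beginning n w) |C. C \<in> layer \<xi> n}"
      by blast
  qed
  have w0: "beginning 0 w = []"
    by (cases w) auto
  have both: "glue_layers [a] w \<xi> 0 = {D \<in> B. Some ([], relrange D [a]) \<in> \<xi>} \<and>
    (enat m \<le> word_length w \<longrightarrow>
      glue_layers [a] w \<xi> (Suc m) = {C. C \<subseteq> range_of (a # beginning m w) \<and> Some (beginning m w, C) \<in> \<xi>})"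
  proof (cases "w = Fin []")
    case True
    have "{C \<inter> range_of [a] |C. C \<in> layer \<xi> 0} = {C. C \<subseteq> range_of [a] \<and> Some ([], C) \<in> \<xi>}"
      using upper[of 0] by (simp add: w0)
    then have layers: "glue_layers [a] w \<xi> i =
        (if i = 0 then {D \<in> B_below []. relrange D [a] \<subseteq> range_of [a] \<and> Some ([], relrange D [a]) \<in> \<xi>}
         else {C. C \<subseteq> range_of [a] \<and> Some ([], C) \<in> \<xi>})" for i
      by (simp add: glue_layers_def True)
    show ?thesis
      unfolding layers by (simp add: True B_belowNil sub cong: conj_cong)
  next
    case False
    then have "enat 1 \<le> word_length w"
      by (cases w) (auto simp: Suc_le_eq)
    then obtain b where b: "beginning 1 w = [b]"
      using length_beginning[of 1 w] by (cases "beginning 1 w") auto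
    \<comment> \<open>Witnesses that the filter reaches the word \<open>[b]\<close>, the condition
      under which \<open>filter_comp_iff\<close> can move between \<open>[]\<close> and
      \<open>[b]\<close>.\<close>
    obtain A1 where A1: "Some ([b], A1) \<in> \<xi>"
      using beginning_filter_word[OF \<xi>, of 1] \<open>enat 1 \<le> word_length w\<close> b by (auto simp: w)
    have layers: "glue_layers [a] w \<xi> i =
        (if i \<le> 1 then {D \<in> B_below (take i [a]). relrange D (drop i [a] @ [b]) \<subseteq> range_of [a, b] \<and>
            Some ([b], relrange D (drop i [a] @ [b])) \<in> \<xi>}
         else {C. C \<subseteq> range_of (a # beginning (i - 1) w) \<and> Some (beginning (i - 1) w, C) \<in> \<xi>})" for i
      using False upper b by (simp add: glue_layers_def)
    have iff: "Some ([b], relrange C [b]) \<in> \<xi> \<longleftrightarrow> Some ([], C) \<in> \<xi>" if "C \<in> B" for C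
      using filter_comp_iff[OF \<xi>, of "[]" "[b]" A1 C] A1 that B_verts by (simp add: elem_def)
    have zero: "glue_layers [a] w \<xi> 0 = {D \<in> B. Some ([], relrange D [a]) \<in> \<xi>}"
    proof -
      have "relrange D [a, b] = relrange (relrange D [a]) [b]" for D
        using relrange_append[of D "[a]" "[b]"] by simp
      then show ?thesis
        unfolding layers using iff sub[of _ "[a, b]"] by (simp add: B_belowNil cong: conj_cong)
    qed
    have one: "glue_layers [a] w \<xi> (Suc 0) = {C. C \<subseteq> range_of [a] \<and> Some ([], C) \<in> \<xi>}"
    proof -
      have "relrange D [b] \<subseteq> range_of [a, b]" if "D \<subseteq> range_of [a]" for D
        using relrange_mono[OF that, of "[b]"] range_of_append[of "[a]" "[b]"] by simp
      then show ?thesis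
        unfolding layers using iff B_mem by (auto simp: B_below_def cong: conj_cong)
    qed
    have more: "glue_layers [a] w \<xi> (Suc m) =
        {C. C \<subseteq> range_of (a # beginning m w) \<and> Some (beginning m w, C) \<in> \<xi>}" if "m > 0"
      unfolding layers using that by simp
    show ?thesis
    proof (cases "m > 0")
      case True
      show ?thesis
        by (intro conjI impI zero more[OF True])
    next
      case False
      then have "m = 0" by simp
      show ?thesis
        unfolding \<open>m = 0\<close> w0 by (intro conjI impI zero one)
    qed
  qed
  show "glue_layers [a] w \<xi> 0 = {D \<in> B. Some ([], relrange D [a]) \<in> \<xi>}"
    by (rule conjunct1[OF both])
  show "enat m \<le> word_length w \<Longrightarrow>
      glue_layers [a] w \<xi> (Suc m) = {C. C \<subseteq> range_of (a # beginning m w) \<and> Some (beginning m w, C) \<in> \<xi>}"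
    by (rule conjunct2[OF both, rule_format])
qed

lemma phi_gen_eq_glue1:
  assumes \<xi>: "is_filter ES None \<xi>" and a: "Some ([], range_of [a]) \<in> \<xi>"
  shows "phi_gen a \<xi> = glue1 a \<xi>"
proof -
  define w where "w = filter_word \<xi>"
  note layers = glue_layers_eq[OF \<xi> a w_def]
  have beg: "beginning 0 (append_word [a] w) = []" "beginning (Suc m) (append_word [a] w) = a # beginning m w" for m
    by (cases w; simp)+
  have len: "enat (Suc m) \<le> word_length (append_word [a] w) \<longleftrightarrow> enat m \<le> word_length w" for m
    by (cases w) auto
  have "phi_gen a \<xi> = {Some (beginning n (append_word [a] w), A) |n A.
      enat n \<le> word_length (append_word [a] w) \<and> A \<in> glue_layers [a] w \<xi> n}"
    by (simp add: phi_gen_def glue_def filter_of_def w_def)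
  also have "\<dots> = glue1 a \<xi>"
  proof (intro Set.set_eqI iffI)
    fix x assume "x \<in> {Some (beginning n (append_word [a] w), A) |n A.
      enat n \<le> word_length (append_word [a] w) \<and> A \<in> glue_layers [a] w \<xi> n}"
    then obtain n A where x: "x = Some (beginning n (append_word [a] w), A)"
      "enat n \<le> word_length (append_word [a] w)" "A \<in> glue_layers [a] w \<xi> n"
      by blast
    show "x \<in> glue1 a \<xi>"
    proof (cases n)
      case 0
      with x layers(1) show ?thesis by (simp add: beg)
    next
      case (Suc m)
      with x layers(2)[of m] show ?thesis by (simp add: beg len)
    qed
  next
    fix x assume x: "x \<in> glue1 a \<xi>"
    then obtain \<gamma> C where xC: "x = Some (\<gamma>, C)"
      by (cases x) auto
    show "x \<in> {Some (beginning n (append_word [a] w), A) |n A.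
      enat n \<le> word_length (append_word [a] w) \<and> A \<in> glue_layers [a] w \<xi> n}"
    proof (cases \<gamma>)
      case Nil
      with x xC layers(1) have "C \<in> glue_layers [a] w \<xi> 0" by simp
      moreover have "x = Some (beginning 0 (append_word [a] w), C)"
        by (simp add: xC Nil beg)
      moreover have "enat 0 \<le> word_length (append_word [a] w)"
        by (simp add: zero_enat_def[symmetric])
      ultimately show ?thesis by blast
    next
      case (Cons b \<beta>)
      with x xC have b: "b = a" "C \<subseteq> range_of (a # \<beta>)" "Some (\<beta>, C) \<in> \<xi>"
        by simp_all
      note beta = filter_word_beginning[OF \<xi> b(3), folded w_def]
      have "C \<in> glue_layers [a] w \<xi> (Suc (length \<beta>))"
        using layers(2)[OF beta(1)] b beta(2) by simp
      moreover have "x = Some (beginning (Suc (length \<beta>)) (append_word [a] w), C)"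
        by (simp add: xC Cons beg b beta)
      moreover have "enat (Suc (length \<beta>)) \<le> word_length (append_word [a] w)"
        using beta by (simp add: len)
      ultimately show ?thesis by blast
    qed
  qed
  finally show ?thesis .
qed

section \<open>Gluing and cutting as inverse maps between tight filters\<close>

abbreviation dom_elem :: "'c \<Rightarrow> 'c list \<times> 'a set" where
  "dom_elem a \<equiv> ([], range_of [a])"

abbreviation ran_elem :: "'c \<Rightarrow> 'c list \<times> 'a set" where
  "ran_elem a \<equiv> ([a], range_of [a])"

lemma elem_dom_ran [simp]: "elem (dom_elem a)" "elem (ran_elem a)"
  by (simp_all add: elem_def range_of_verts)

lemma relrange_range_of' : "D \<in> B \<Longrightarrow> relrange D \<alpha> \<subseteq> range_of \<alpha>"
  by (rule relrange_range_of) (rule B_verts)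

lemma elem_relrange [simp]: "elem ([], D) \<Longrightarrow> elem ([], relrange D \<alpha>)"
  by (simp add: elem_def relrange_verts)

lemma elem_Nil_iff: "elem ([], D) \<longleftrightarrow> D \<in> B"
  using B_verts by (auto simp: elem_def)

lemma elem_ConsD: "elem (a # \<beta>, C) \<Longrightarrow> elem (\<beta>, C)"
  using range_of_append_subset[of "[a]" \<beta>] by (auto simp: elem_def)

lemma elem_Cons_range: "elem (\<beta>, C) \<Longrightarrow> elem (a # \<beta>, C \<inter> range_of (a # \<beta>))"
  by (simp add: elem_def B_Int)

lemma ple_Cons_iff: "ple (a # \<beta>, C) (b # \<beta>', C') \<longleftrightarrow> a = b \<and> ple (\<beta>, C) (\<beta>', C')"
  by (auto simp: ple_def)

lemma ple_Nil_iff: "ple (\<beta>, C) ([], D) \<longleftrightarrow> C \<subseteq> relrange D \<beta>"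
  by (simp add: ple_def)

lemma ple_Nil_left_iff: "ple ([], C) (\<beta>, D) \<longleftrightarrow> \<beta> = [] \<and> C \<subseteq> D"
  by (auto simp: ple_def)

lemma emeet_Cons: "emeet (a # \<beta>, C) (a # \<beta>', C') = (a # fst (emeet (\<beta>, C) (\<beta>', C')), snd (emeet (\<beta>, C) (\<beta>', C')))"
  by (simp add: emeet_def)

lemma emeet_Nil_right: "emeet (\<beta>, C) ([], D) = (\<beta>, C \<inter> relrange D \<beta>)"
  using emeet_left[of "[]" \<beta> C D] by simp

lemma emeet_Nil_left: "emeet ([], D) (\<beta>, C) = (\<beta>, C \<inter> relrange D \<beta>)"
  using emeet_right[of "[]" D \<beta> C] by simp

lemma filter_glue1:
  assumes \<xi>: "is_filter ES None \<xi>" and a: "Some (dom_elem a) \<in> \<xi>"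
  shows "is_filter ES None (glue1 a \<xi>)"
proof (rule filterI)
  show "glue1 a \<xi> \<noteq> {}"
  proof -
    have "Some (ran_elem a) \<in> glue1 a \<xi>"
      using a by simp
    then show ?thesis by blast
  qed
  fix e assume e: "Some e \<in> glue1 a \<xi>"
  obtain \<alpha> A where e_eq: "e = (\<alpha>, A)" by (cases e)
  show "elem e \<and> snd e \<noteq> {}"
  proof (cases \<alpha>)
    case Nil
    with e filter_elem[OF \<xi>, of "([], relrange A [a])"] show ?thesis
      by (auto simp: e_eq elem_Nil_iff)
  next
    case (Cons b \<beta>)
    with e filter_elem[OF \<xi>, of "(\<beta>, A)"] show ?thesis
      by (simp add: e_eq elem_def)
  qed
  show "Some f \<in> glue1 a \<xi>" if f: "elem f" "ple e f" for f
  proof -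
    obtain \<beta> C where f_eq: "f = (\<beta>, C)" by (cases f)
    show ?thesis
    proof (cases \<alpha>)
      case Nil
      with f have "\<beta> = []" "A \<subseteq> C" "C \<in> B"
        by (simp_all add: e_eq f_eq ple_Nil_left_iff elem_def)
      moreover have "Some ([], relrange C [a]) \<in> \<xi>"
      proof (rule filter_up[OF \<xi>])
        show "Some ([], relrange A [a]) \<in> \<xi>"
          using e Nil by (simp add: e_eq)
        show "elem ([], relrange C [a])"
          using \<open>C \<in> B\<close> by (simp add: elem_Nil_iff)
        show "ple ([], relrange A [a]) ([], relrange C [a])"
          using relrange_mono[OF \<open>A \<subseteq> C\<close>] by (simp add: ple_def)
      qed
      ultimately show ?thesis by (simp add: f_eq)
    next
      case (Cons b \<alpha>')
      with e have b: "b = a" "A \<subseteq> range_of (a # \<alpha>')" "Some (\<alpha>', A) \<in> \<xi>"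
        by (simp_all add: e_eq)
      show ?thesis
      proof (cases \<beta>)
        case Nil
        with f have "A \<subseteq> relrange (relrange C [a]) \<alpha>'" "C \<in> B"
          using relrange_Cons[of C a \<alpha>'] by (simp_all add: e_eq f_eq \<open>\<alpha> = b # \<alpha>'\<close> b ple_Nil_iff elem_def)
        then have "Some ([], relrange C [a]) \<in> \<xi>"
          by - (rule filter_up[OF \<xi> b(3)], simp_all add: ple_Nil_iff elem_Nil_iff)
        with \<open>C \<in> B\<close> Nil show ?thesis by (simp add: f_eq)
      next
        case (Cons c \<beta>')
        with f b have c: "c = a" "ple (\<alpha>', A) (\<beta>', C)" "elem (a # \<beta>', C)"
          by (auto simp: e_eq f_eq \<open>\<alpha> = b # \<alpha>'\<close> ple_Cons_iff)
        have "Some (\<beta>', C) \<in> \<xi>"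
          by (rule filter_up[OF \<xi> b(3) elem_ConsD[OF c(3)] c(2)])
        with c Cons show ?thesis by (simp add: f_eq elem_def)
      qed
    qed
  qed
  fix f assume f: "Some f \<in> glue1 a \<xi>"
  obtain \<beta> C where f_eq: "f = (\<beta>, C)" by (cases f)
  \<comment> \<open>Meeting with an element of word \<open>[]\<close> means restricting to its
    relative range, and the range along \<open>a # \<gamma>\<close> is the range along
    \<open>\<gamma>\<close> of the set already pushed along \<open>a\<close>.\<close>
  have mixed: "Some (a # \<gamma>, L \<inter> relrange D (a # \<gamma>)) \<in> glue1 a \<xi>"
    if "Some ([], D) \<in> glue1 a \<xi>" "Some (a # \<gamma>, L) \<in> glue1 a \<xi>" for D \<gamma> L
    using that filter_left[OF \<xi>, of "[]" \<gamma> L "relrange D [a]"] relrange_Cons[of D a \<gamma>] by auto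
  show "Some (emeet e f) \<in> glue1 a \<xi>"
  proof (cases \<alpha>)
    case Nil
    show ?thesis
    proof (cases \<beta>)
      case Nil
      have "Some ([], relrange A [a]) \<in> \<xi>" "Some ([], relrange C [a]) \<in> \<xi>" "A \<in> B" "C \<in> B"
        using e f Nil \<open>\<alpha> = []\<close> by (simp_all add: e_eq f_eq)
      then show ?thesis
        using filter_left[OF \<xi>, of "[]" "[]" "relrange C [a]" "relrange A [a]"] Nil \<open>\<alpha> = []\<close>
        by (simp add: e_eq f_eq emeet_Nil_left relrange_Int' B_Int)
    next
      case (Cons c \<beta>')
      then show ?thesis
        using e f mixed[of A \<beta>' C] Nil by (simp add: e_eq f_eq emeet_Nil_left)
    qed
  next
    case (Cons b \<alpha>')
    show ?thesis
    proof (cases \<beta>)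
      case Nil
      then show ?thesis
        using e f mixed[of C \<alpha>' A] Cons by (simp add: e_eq f_eq emeet_Nil_right)
    next
      case (Cons c \<beta>')
      with e f \<open>\<alpha> = b # \<alpha>'\<close> have b: "b = a" "c = a" "Some (\<alpha>', A) \<in> \<xi>" "Some (\<beta>', C) \<in> \<xi>"
        and el: "elem (a # \<alpha>', A)" "elem (a # \<beta>', C)"
        using filter_elem[OF \<xi>] by (auto simp: e_eq f_eq elem_def)
      have m: "Some (emeet (\<alpha>', A) (\<beta>', C)) \<in> \<xi>"
        by (rule filter_emeet[OF \<xi> b(3,4)])
      have "elem (emeet (a # \<alpha>', A) (a # \<beta>', C))"
        using el by simp
      then have "snd (emeet (\<alpha>', A) (\<beta>', C)) \<subseteq> range_of (a # fst (emeet (\<alpha>', A) (\<beta>', C)))"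
        by (simp add: emeet_Cons elem_def)
      with m show ?thesis
        by (simp add: e_eq f_eq Cons \<open>\<alpha> = b # \<alpha>'\<close> b emeet_Cons)
    qed
  qed
qed simp

lemma filter_unglue1:
  assumes \<eta>: "is_filter ES None \<eta>" and a: "Some (ran_elem a) \<in> \<eta>"
  shows "is_filter ES None (unglue1 a \<eta>)"
proof (rule filterI)
  have "Some (dom_elem a) \<in> unglue1 a \<eta>"
    using a by simp
  then show "unglue1 a \<eta> \<noteq> {}" by blast
  fix e assume e: "Some e \<in> unglue1 a \<eta>"
  obtain \<alpha> A where e_eq: "e = (\<alpha>, A)" by (cases e)
  have eA: "elem (\<alpha>, A)" "Some (a # \<alpha>, A \<inter> range_of (a # \<alpha>)) \<in> \<eta>"
    using e by (simp_all add: e_eq)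
  show "elem e \<and> snd e \<noteq> {}"
    using eA filter_elem[OF \<eta> eA(2)] by (auto simp: e_eq)
  show "Some f \<in> unglue1 a \<eta>" if f: "elem f" "ple e f" for f
  proof -
    obtain \<beta> C where f_eq: "f = (\<beta>, C)" by (cases f)
    obtain \<gamma> where \<gamma>: "\<alpha> = \<beta> @ \<gamma>" "A \<subseteq> relrange C \<gamma>"
      using f by (auto simp: e_eq f_eq ple_def)
    have CB: "C \<in> B"
      using f by (simp add: f_eq elem_def)
    have "relrange (C \<inter> range_of (a # \<beta>)) \<gamma> = relrange C \<gamma> \<inter> range_of (a # \<alpha>)"
      using CB range_of_append[of "a # \<beta>" \<gamma>] by (simp add: \<gamma> relrange_Int')
    with \<gamma> have "ple (a # \<alpha>, A \<inter> range_of (a # \<alpha>)) (a # \<beta>, C \<inter> range_of (a # \<beta>))"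
      by (auto simp: ple_def)
    then have "Some (a # \<beta>, C \<inter> range_of (a # \<beta>)) \<in> \<eta>"
      using f by - (rule filter_up[OF \<eta> eA(2)], simp_all add: f_eq elem_Cons_range)
    with f show ?thesis by (simp add: f_eq)
  qed
  fix f assume f: "Some f \<in> unglue1 a \<eta>"
  obtain \<beta> C where f_eq: "f = (\<beta>, C)" by (cases f)
  have fC: "elem (\<beta>, C)" "Some (a # \<beta>, C \<inter> range_of (a # \<beta>)) \<in> \<eta>"
    using f by (simp_all add: f_eq)
  \<comment> \<open>By weak left-resolution, restricting to ranges commutes with
    \<open>relrange\<close>, so the restriction of a meet is the meet of the restrictions.\<close>
  have meet: "Some (\<beta> @ \<gamma>, A \<inter> relrange C \<gamma>) \<in> unglue1 a \<eta>"
    if el: "elem (\<beta> @ \<gamma>, A)" "elem (\<beta>, C)"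
      and m: "Some (a # \<beta> @ \<gamma>, A \<inter> range_of (a # \<beta> @ \<gamma>)) \<in> \<eta>" "Some (a # \<beta>, C \<inter> range_of (a # \<beta>)) \<in> \<eta>"
    for \<beta> \<gamma> A C
  proof -
    have CB: "C \<in> B"
      using el by (simp add: elem_def)
    have "relrange (C \<inter> range_of (a # \<beta>)) \<gamma> = relrange C \<gamma> \<inter> range_of (a # \<beta> @ \<gamma>)"
      using CB range_of_append[of "a # \<beta>" \<gamma>] by (simp add: relrange_Int')
    then have "(A \<inter> range_of (a # \<beta> @ \<gamma>)) \<inter> relrange (C \<inter> range_of (a # \<beta>)) \<gamma> =
        (A \<inter> relrange C \<gamma>) \<inter> range_of (a # \<beta> @ \<gamma>)"
      by blast
    then have "Some (a # \<beta> @ \<gamma>, (A \<inter> relrange C \<gamma>) \<inter> range_of (a # \<beta> @ \<gamma>)) \<in> \<eta>"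
      using filter_left[OF \<eta>, of "a # \<beta>" \<gamma>] m by fastforce
    moreover have "elem (\<beta> @ \<gamma>, A \<inter> relrange C \<gamma>)"
      using elem_emeet[OF el] by (simp add: emeet_left)
    ultimately show ?thesis by simp
  qed
  show "Some (emeet e f) \<in> unglue1 a \<eta>"
  proof (rule emeet_cases[of e f])
    fix \<delta> \<gamma> A' C' assume l: "e = (\<delta> @ \<gamma>, A')" "f = (\<delta>, C')" "emeet e f = (\<delta> @ \<gamma>, A' \<inter> relrange C' \<gamma>)"
    show ?thesis
      unfolding l(3) by (rule meet) (use eA fC l(1,2) e_eq f_eq in simp_all)
  next
    fix \<delta> \<gamma> A' C' assume r: "e = (\<delta>, C')" "f = (\<delta> @ \<gamma>, A')" "emeet e f = (\<delta> @ \<gamma>, A' \<inter> relrange C' \<gamma>)"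
    show ?thesis
      unfolding r(3) by (rule meet) (use eA fC r(1,2) e_eq f_eq in simp_all)
  next
    assume "\<not> prefix (fst e) (fst f)" "\<not> prefix (fst f) (fst e)"
    with filter_comparable[OF \<eta> eA(2) fC(2)] show ?thesis by (simp add: e_eq f_eq)
  qed
qed simp

lemma unglue1_glue1:
  assumes \<xi>: "is_filter ES None \<xi>" and a: "Some (dom_elem a) \<in> \<xi>"
  shows "unglue1 a (glue1 a \<xi>) = \<xi>"
proof (rule Set.set_eqI)
  fix x show "x \<in> unglue1 a (glue1 a \<xi>) \<longleftrightarrow> x \<in> \<xi>"
  proof (cases x)
    case None
    then show ?thesis using filter_None[OF \<xi>] by simp
  next
    case (Some e)
    obtain \<beta> C where e: "e = (\<beta>, C)" by (cases e)
    show ?thesis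
    proof
      assume "x \<in> unglue1 a (glue1 a \<xi>)"
      then have m: "elem (\<beta>, C)" "Some (\<beta>, C \<inter> range_of (a # \<beta>)) \<in> \<xi>"
        by (simp_all add: Some e)
      show "x \<in> \<xi>"
        unfolding Some e by (rule filter_up[OF \<xi> m(2,1)]) (simp add: ple_def)
    next
      assume "x \<in> \<xi>"
      then show "x \<in> unglue1 a (glue1 a \<xi>)"
        using filter_restrict_range[OF \<xi> a, of \<beta> C] filter_elem[OF \<xi>, of "(\<beta>, C)"] by (simp add: Some e)
    qed
  qed
qed

lemma filter_Cons_head:
  assumes \<eta>: "is_filter ES None \<eta>" and a: "Some (ran_elem a) \<in> \<eta>" and e: "Some (b # \<beta>, C) \<in> \<eta>"
  shows "b = a"
  using filter_comparable[OF \<eta> a e] by auto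

lemma glue1_unglue1:
  assumes \<eta>: "is_filter ES None \<eta>" and a: "Some (ran_elem a) \<in> \<eta>"
  shows "glue1 a (unglue1 a \<eta>) = \<eta>"
proof (rule Set.set_eqI)
  fix x show "x \<in> glue1 a (unglue1 a \<eta>) \<longleftrightarrow> x \<in> \<eta>"
  proof (cases x)
    case None
    then show ?thesis using filter_None[OF \<eta>] by simp
  next
    case (Some e)
    obtain \<alpha> C where e: "e = (\<alpha>, C)" by (cases e)
    show ?thesis
    proof (cases \<alpha>)
      case Nil
      have "C \<in> B \<and> Some ([a], relrange C [a]) \<in> \<eta> \<longleftrightarrow> Some ([], C) \<in> \<eta>"
        using filter_comp_iff[OF \<eta>, of "[]" "[a]" "range_of [a]" C] a filter_elem[OF \<eta>, of "([], C)"]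
        by (auto simp: elem_Nil_iff)
      moreover have "relrange C [a] \<inter> range_of [a] = relrange C [a]" if "C \<in> B"
        using relrange_range_of'[OF that, of "[a]"] by blast
      ultimately show ?thesis
        by (auto simp: Some e Nil elem_Nil_iff)
    next
      case (Cons b \<beta>)
      show ?thesis
      proof
        assume "x \<in> glue1 a (unglue1 a \<eta>)"
        then have "b = a" "C \<subseteq> range_of (a # \<beta>)" "Some (a # \<beta>, C \<inter> range_of (a # \<beta>)) \<in> \<eta>"
          by (simp_all add: Some e Cons)
        then show "x \<in> \<eta>"
          by (simp add: Some e Cons Int_absorb2)
      next
        assume x: "x \<in> \<eta>"
        then have "Some (b # \<beta>, C) \<in> \<eta>"
          by (simp add: Some e Cons)
        with filter_Cons_head[OF \<eta> a this] filter_elem[OF \<eta> this]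
        have "b = a" "elem (a # \<beta>, C)" "Some (a # \<beta>, C) \<in> \<eta>" by simp_all
        then show "x \<in> glue1 a (unglue1 a \<eta>)"
          using elem_ConsD[of a \<beta> C] by (simp add: Some e Cons Int_absorb2 elem_def)
      qed
    qed
  qed
qed

lemma glue1_mono: "\<xi> \<subseteq> \<xi>' \<Longrightarrow> glue1 a \<xi> \<subseteq> glue1 a \<xi>'"
  unfolding glue1_def by blast

lemma unglue1_mono: "\<eta> \<subseteq> \<eta>' \<Longrightarrow> unglue1 a \<eta> \<subseteq> unglue1 a \<eta>'"
  unfolding unglue1_def by blast

lemma ran_elem_glue1: "Some (dom_elem a) \<in> \<xi> \<Longrightarrow> Some (ran_elem a) \<in> glue1 a \<xi>"
  by simp

lemma dom_elem_unglue1: "Some (ran_elem a) \<in> \<eta> \<Longrightarrow> Some (dom_elem a) \<in> unglue1 a \<eta>"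
  by simp

text \<open>\<open>glue1 a\<close> and \<open>unglue1 a\<close> are mutually inverse and monotone
  between the filters containing \<open>dom_elem a\<close> and those containing
  \<open>ran_elem a\<close>, so they preserve maximality.\<close>

lemma ultrafilter_glue1:
  assumes u: "is_ultrafilter ES None \<xi>" and a: "Some (dom_elem a) \<in> \<xi>"
  shows "is_ultrafilter ES None (glue1 a \<xi>)"
  unfolding is_ultrafilter_def
proof (intro conjI allI impI)
  note \<xi> = ultrafilter_filter[OF u]
  show "is_filter ES None (glue1 a \<xi>)"
    by (rule filter_glue1[OF \<xi> a])
  fix \<eta> assume \<eta>: "is_filter ES None \<eta> \<and> glue1 a \<xi> \<subseteq> \<eta>"
  then have r: "Some (ran_elem a) \<in> \<eta>"
    using ran_elem_glue1[OF a] by (blast intro: subsetD)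
  have "\<xi> \<subseteq> unglue1 a \<eta>"
    using unglue1_mono[of "glue1 a \<xi>" \<eta> a] \<eta> unglue1_glue1[OF \<xi> a] by simp
  then have "unglue1 a \<eta> = \<xi>"
    using u filter_unglue1[OF _ r] \<eta> unfolding is_ultrafilter_def by simp
  then show "\<eta> = glue1 a \<xi>"
    using glue1_unglue1[OF _ r] \<eta> by simp
qed

lemma ultrafilter_unglue1:
  assumes u: "is_ultrafilter ES None \<eta>" and a: "Some (ran_elem a) \<in> \<eta>"
  shows "is_ultrafilter ES None (unglue1 a \<eta>)"
  unfolding is_ultrafilter_def
proof (intro conjI allI impI)
  note \<eta> = ultrafilter_filter[OF u]
  show "is_filter ES None (unglue1 a \<eta>)"
    by (rule filter_unglue1[OF \<eta> a])
  fix \<xi> assume \<xi>: "is_filter ES None \<xi> \<and> unglue1 a \<eta> \<subseteq> \<xi>"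
  then have r: "Some (dom_elem a) \<in> \<xi>"
    using dom_elem_unglue1[OF a] by (blast intro: subsetD)
  have "\<eta> \<subseteq> glue1 a \<xi>"
    using glue1_mono[of "unglue1 a \<eta>" \<xi> a] \<xi> glue1_unglue1[OF \<eta> a] by simp
  then have "glue1 a \<xi> = \<eta>"
    using u filter_glue1[OF _ r] \<xi> unfolding is_ultrafilter_def by simp
  then show "\<xi> = unglue1 a \<eta>"
    using unglue1_glue1[OF _ r] \<xi> by simp
qed

text \<open>Membership of \<open>x\<close> in a glued filter is decided by the single element
  \<open>glue_pre a x\<close> of the original filter, with \<open>None\<close>, which no filter
  contains, for impossible cases. This is continuity of gluing in coordinates.\<close>

fun glue_pre :: "'c \<Rightarrow> ('c list \<times> 'a set) option \<Rightarrow> ('c list \<times> 'a set) option" where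
  "glue_pre a (Some ([], D)) = Some ([], relrange D [a])"
| "glue_pre a (Some (b # \<beta>, C)) = (if b = a then Some (\<beta>, C) else None)"
| "glue_pre a None = None"

fun unglue_pre :: "'c \<Rightarrow> ('c list \<times> 'a set) option \<Rightarrow> ('c list \<times> 'a set) option" where
  "unglue_pre a (Some (\<beta>, C)) = Some (a # \<beta>, C \<inter> range_of (a # \<beta>))"
| "unglue_pre a None = None"

lemma glue_pre:
  assumes "is_filter ES None \<xi>" "x \<in> carrier ES"
  shows "x \<in> glue1 a \<xi> \<longleftrightarrow> glue_pre a x \<in> \<xi>"
  using assms filter_None[OF assms(1)]
  by (cases "(a, x)" rule: glue_pre.cases) (auto simp: elem_def)

lemma unglue_pre:
  assumes "is_filter ES None \<eta>" "x \<in> carrier ES"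
  shows "x \<in> unglue1 a \<eta> \<longleftrightarrow> unglue_pre a x \<in> \<eta>"
  using assms filter_None[OF assms(1)]
  by (cases "(a, x)" rule: unglue_pre.cases) auto

lemma filter_carrier: "is_filter ES None \<xi> \<Longrightarrow> \<xi> \<subseteq> carrier ES"
  by (simp add: is_filter_def)

lemma tight_glue1:
  assumes \<xi>: "\<xi> \<in> tight" and a: "Some (dom_elem a) \<in> \<xi>"
  shows "glue1 a \<xi> \<in> tight"
proof (rule tightI)
  note fl = tight_filter[OF \<xi>]
  show "is_filter ES None (glue1 a \<xi>)"
    by (rule filter_glue1[OF fl a])
  fix F :: "('c list \<times> 'a set) option set" assume F: "finite F" "F \<subseteq> carrier ES"
  \<comment> \<open>Agreement on these elements forces agreement of the glued filters on
    \<open>F\<close>. Elements outside the carrier lie in no filter, and \<open>dom_elem a\<close>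
    makes sure that the approximating ultrafilter can be glued.\<close>
  let ?F = "insert (Some (dom_elem a)) (glue_pre a ` F \<inter> carrier ES)"
  have sub: "?F \<subseteq> carrier ES"
    using filter_carrier[OF fl] a by blast
  obtain \<zeta> where \<zeta>: "is_ultrafilter ES None \<zeta>" "?F \<inter> \<zeta> = ?F \<inter> \<xi>"
    by (rule tight_approx[OF \<xi> _ sub]) (use F in simp)
  note \<zeta>f = ultrafilter_filter[OF \<zeta>(1)]
  have a\<zeta>: "Some (dom_elem a) \<in> \<zeta>"
    using inter_eq_mem_iff[OF \<zeta>(2), of "Some (dom_elem a)"] a by simp
  have "x \<in> glue1 a \<zeta> \<longleftrightarrow> x \<in> glue1 a \<xi>" if x: "x \<in> F" for x
  proof -
    have "glue_pre a x \<in> \<zeta> \<longleftrightarrow> glue_pre a x \<in> \<xi>"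
    proof (cases "glue_pre a x \<in> carrier ES")
      case True
      then show ?thesis
        using x by (intro inter_eq_mem_iff[OF \<zeta>(2)]) simp
    next
      case False
      then show ?thesis
        using filter_carrier[OF fl] filter_carrier[OF \<zeta>f] by blast
    qed
    then show ?thesis
      using glue_pre[OF fl, of x a] glue_pre[OF \<zeta>f, of x a] x F(2) by blast
  qed
  then have "F \<inter> glue1 a \<zeta> = F \<inter> glue1 a \<xi>"
    by blast
  then show "\<exists>\<eta>. is_ultrafilter ES None \<eta> \<and> F \<inter> \<eta> = F \<inter> glue1 a \<xi>"
    by (intro exI[of _ "glue1 a \<zeta>"] conjI ultrafilter_glue1[OF \<zeta>(1) a\<zeta>])
qed

lemma tight_unglue1:
  assumes \<eta>: "\<eta> \<in> tight" and a: "Some (ran_elem a) \<in> \<eta>"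
  shows "unglue1 a \<eta> \<in> tight"
proof (rule tightI)
  note fl = tight_filter[OF \<eta>]
  show "is_filter ES None (unglue1 a \<eta>)"
    by (rule filter_unglue1[OF fl a])
  fix F :: "('c list \<times> 'a set) option set" assume F: "finite F" "F \<subseteq> carrier ES"
  let ?F = "insert (Some (ran_elem a)) (unglue_pre a ` F \<inter> carrier ES)"
  have sub: "?F \<subseteq> carrier ES"
    using filter_carrier[OF fl] a by blast
  obtain \<zeta> where \<zeta>: "is_ultrafilter ES None \<zeta>" "?F \<inter> \<zeta> = ?F \<inter> \<eta>"
    by (rule tight_approx[OF \<eta> _ sub]) (use F in simp)
  note \<zeta>f = ultrafilter_filter[OF \<zeta>(1)]
  have a\<zeta>: "Some (ran_elem a) \<in> \<zeta>"
    using inter_eq_mem_iff[OF \<zeta>(2), of "Some (ran_elem a)"] a by simp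
  have "x \<in> unglue1 a \<zeta> \<longleftrightarrow> x \<in> unglue1 a \<eta>" if x: "x \<in> F" for x
  proof -
    have "unglue_pre a x \<in> \<zeta> \<longleftrightarrow> unglue_pre a x \<in> \<eta>"
    proof (cases "unglue_pre a x \<in> carrier ES")
      case True
      then show ?thesis
        using x by (intro inter_eq_mem_iff[OF \<zeta>(2)]) simp
    next
      case False
      then show ?thesis
        using filter_carrier[OF fl] filter_carrier[OF \<zeta>f] by blast
    qed
    then show ?thesis
      using unglue_pre[OF fl, of x a] unglue_pre[OF \<zeta>f, of x a] x F(2) by blast
  qed
  then have "F \<inter> unglue1 a \<zeta> = F \<inter> unglue1 a \<eta>"
    by blast
  then show "\<exists>\<zeta>. is_ultrafilter ES None \<zeta> \<and> F \<inter> \<zeta> = F \<inter> unglue1 a \<eta>"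
    by (intro exI[of _ "unglue1 a \<zeta>"] conjI ultrafilter_unglue1[OF \<zeta>(1) a\<zeta>])
qed

end

section \<open>The partial action\<close>

lemma carrier_free_group [simp]: "t \<in> carrier free_group \<longleftrightarrow> reduced t"
  and mult_free_group [simp]: "s \<otimes>\<^bsub>free_group\<^esub> t = foldr letter_mult s t"
  and one_free_group [simp]: "\<one>\<^bsub>free_group\<^esub> = []"
  by (simp_all add: free_group_def)

context normal_labelled_space
begin

lemma V_letter_cyl: "V_letter (Pos a) = cyl (ran_elem a)" "V_letter (Neg a) = cyl (dom_elem a)"
  by (simp_all add: V_elem_cyl)

declare V_letter.simps [simp del] phi_letter.simps [simp del]

lemma phi_letter_Pos: "\<xi> \<in> cyl (dom_elem a) \<Longrightarrow> phi_letter (Pos a) \<xi> = glue1 a \<xi>"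
  by (simp add: phi_letter.simps phi_gen_eq_glue1 tight_filter mem_cyl)

lemma phi_letter_Neg:
  assumes \<eta>: "\<eta> \<in> cyl (ran_elem a)"
  shows "phi_letter (Neg a) \<eta> = unglue1 a \<eta>"
proof -
  have inj: "inj_on (phi_gen a) (V_letter (Neg a))"
  proof (rule inj_on_inverseI[where g = "unglue1 a"])
    fix \<xi> assume "\<xi> \<in> V_letter (Neg a)"
    then show "unglue1 a (phi_gen a \<xi>) = \<xi>"
      using unglue1_glue1[of \<xi> a] phi_gen_eq_glue1[of \<xi> a] tight_filter[of \<xi>]
      by (simp add: V_letter_cyl mem_cyl del: unglue1_simps)
  qed
  have \<eta>': "\<eta> \<in> tight" "Some (ran_elem a) \<in> \<eta>"
    using \<eta> by (simp_all add: mem_cyl)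
  have u: "unglue1 a \<eta> \<in> tight" "Some (dom_elem a) \<in> unglue1 a \<eta>"
    using tight_unglue1[OF \<eta>'] dom_elem_unglue1[OF \<eta>'(2)] by blast+
  have "phi_gen a (unglue1 a \<eta>) = \<eta>"
    using phi_gen_eq_glue1[OF tight_filter[OF u(1)] u(2)] glue1_unglue1[OF tight_filter[OF \<eta>'(1)] \<eta>'(2)]
    by (simp del: unglue1_simps)
  moreover have "unglue1 a \<eta> \<in> V_letter (Neg a)"
    using u by (simp add: V_letter_cyl mem_cyl del: unglue1_simps)
  ultimately show ?thesis
    unfolding phi_letter.simps by (intro inv_into_f_eq[OF inj])
qed

lemma V_letter_tight: "V_letter x \<subseteq> tight"
  by (cases x) (simp_all add: V_letter_cyl cyl_subset)

lemma phi_letter_mem: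
  assumes "\<xi> \<in> V_letter (inv_letter x)"
  shows "phi_letter x \<xi> \<in> V_letter x"
proof (cases x)
  case (Pos a)
  then have \<xi>: "\<xi> \<in> cyl (dom_elem a)"
    using assms by (simp add: V_letter_cyl)
  then have "\<xi> \<in> tight" "Some (dom_elem a) \<in> \<xi>"
    by (simp_all add: mem_cyl)
  with tight_glue1[OF this] ran_elem_glue1[OF this(2)] show ?thesis
    by (simp add: Pos phi_letter_Pos[OF \<xi>] V_letter_cyl mem_cyl del: glue1_simps)
next
  case (Neg a)
  then have \<xi>: "\<xi> \<in> cyl (ran_elem a)"
    using assms by (simp add: V_letter_cyl)
  then have "\<xi> \<in> tight" "Some (ran_elem a) \<in> \<xi>"
    by (simp_all add: mem_cyl)
  with tight_unglue1[OF this] dom_elem_unglue1[OF this(2)] show ?thesis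
    by (simp add: Neg phi_letter_Neg[OF \<xi>] V_letter_cyl mem_cyl del: unglue1_simps)
qed

lemma phi_letter_inverse:
  assumes "\<xi> \<in> V_letter (inv_letter x)"
  shows "phi_letter (inv_letter x) (phi_letter x \<xi>) = \<xi>"
proof (cases x)
  case (Pos a)
  then have \<xi>: "\<xi> \<in> cyl (dom_elem a)"
    using assms by (simp add: V_letter_cyl)
  have "glue1 a \<xi> \<in> cyl (ran_elem a)"
    using phi_letter_mem[OF assms] by (simp add: Pos phi_letter_Pos[OF \<xi>] V_letter_cyl)
  with \<xi> unglue1_glue1[of \<xi> a] tight_filter[of \<xi>] show ?thesis
    by (simp add: Pos phi_letter_Pos[OF \<xi>] phi_letter_Neg mem_cyl del: glue1_simps unglue1_simps)
next
  case (Neg a)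
  then have \<xi>: "\<xi> \<in> cyl (ran_elem a)"
    using assms by (simp add: V_letter_cyl)
  have "unglue1 a \<xi> \<in> cyl (dom_elem a)"
    using phi_letter_mem[OF assms] by (simp add: Neg phi_letter_Neg[OF \<xi>] V_letter_cyl)
  with \<xi> glue1_unglue1[of \<xi> a] tight_filter[of \<xi>] show ?thesis
    by (simp add: Neg phi_letter_Neg[OF \<xi>] phi_letter_Pos mem_cyl del: glue1_simps unglue1_simps)
qed

text \<open>The clause for one-letter words coincides with the general one because
  \<open>V_letter\<close> consists of tight filters; induction on words thus has no special
  case.\<close>

lemma action_dom_Cons: "action_dom (x # t) = {\<xi> \<in> action_dom t. phi t \<xi> \<in> V_letter (inv_letter x)}"
  using V_letter_tight[of "inv_letter x"] by (cases t) auto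

declare action_dom.simps(2,3) [simp del] action_dom_Cons [simp]

lemma phi_append: "phi (s @ t) \<xi> = phi s (phi t \<xi>)"
  by (induction s) auto

text \<open>\<open>phi\<close> and \<open>action_dom\<close> make sense for unreduced words too,
  where concatenation is exactly composition; cancellation is treated separately in
  \<open>action_dom_mult\<close>.\<close>

lemma action_dom_append: "\<xi> \<in> action_dom (s @ t) \<longleftrightarrow> \<xi> \<in> action_dom t \<and> phi t \<xi> \<in> action_dom s"
proof (induction s)
  case Nil
  have "phi t \<xi> \<in> tight" if "\<xi> \<in> action_dom t"
    using that
  proof (cases t)
    case (Cons x u)
    with that have "phi_letter x (phi u \<xi>) \<in> V_letter x"
      by (intro phi_letter_mem) simp
    with Cons V_letter_tight[of x] show ?thesis by auto
  qed simp
  then show ?case by auto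
qed (auto simp: phi_append)

lemma action_dom_tight: "action_dom t \<subseteq> tight"
  by (induction t) auto

lemma action_dom_inv_word:
  "\<xi> \<in> action_dom t \<Longrightarrow> phi t \<xi> \<in> action_dom (inv_word t) \<and> phi (inv_word t) (phi t \<xi>) = \<xi>"
proof (induction t)
  case (Cons x t)
  then have v: "phi t \<xi> \<in> V_letter (inv_letter x)" and IH: "phi t \<xi> \<in> action_dom (inv_word t)"
    "phi (inv_word t) (phi t \<xi>) = \<xi>"
    by auto
  have "phi (x # t) \<xi> \<in> V_letter x"
    using phi_letter_mem[OF v] by simp
  then show ?case
    using IH phi_letter_inverse[OF v] V_letter_tight[of x] by (auto simp: action_dom_append phi_append)
qed simp

lemma action_dom_letter_mult:
  assumes "\<xi> \<in> action_dom (x # t)"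
  shows "\<xi> \<in> action_dom (letter_mult x t) \<and> phi (letter_mult x t) \<xi> = phi (x # t) \<xi>"
proof (cases t)
  case (Cons y u)
  show ?thesis
  proof (cases "x = inv_letter y")
    case True
    then show ?thesis
      using assms Cons phi_letter_inverse[of "phi u \<xi>" y] by simp
  next
    case False
    then show ?thesis
      using assms Cons by simp
  qed
qed (use assms in simp)

text \<open>Each cancelling pair of letters acts as a restriction of the identity, so removing it
  can only enlarge the domain.\<close>

lemma action_dom_mult:
  "\<xi> \<in> action_dom (s @ t) \<Longrightarrow>
    \<xi> \<in> action_dom (foldr letter_mult s t) \<and> phi (foldr letter_mult s t) \<xi> = phi (s @ t) \<xi>"
proof (induction s)
  case (Cons x s)
  then have "\<xi> \<in> action_dom (x # foldr letter_mult s t)"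
    by simp
  from action_dom_letter_mult[OF this] Cons show ?case by simp
qed simp

lemma V_action_eq: "reduced t \<Longrightarrow> V_action t = action_dom (inv_word t)"
  by (simp add: V_action_def inv_free_group)

lemma V_action_Nil [simp]: "V_action [] = tight"
  by (simp add: V_action_eq)

lemma V_action_Cons:
  assumes "reduced (x # t)"
  shows "V_action (x # t) = {\<xi> \<in> V_letter x. phi_letter (inv_letter x) \<xi> \<in> V_action t}"
  using V_letter_tight[of x]
  by (auto simp: V_action_eq[OF assms] V_action_eq[OF reduced_ConsD[OF assms]] action_dom_append)

lemma partial_action_tight: "partial_action free_group tight V_action phi"
proof -
  interpret group "free_group :: 'c letter list monoid"
    by (rule group_free_group)
  show ?thesis
  proof
    show "V_action \<one>\<^bsub>free_group\<^esub> = tight"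
      by simp
    show "phi \<one>\<^bsub>free_group\<^esub> \<xi> = \<xi>" for \<xi>
      by simp
    fix t :: "'c letter list" assume "t \<in> carrier free_group"
    then have t: "reduced t" by simp
    then show "V_action t \<subseteq> tight"
      by (simp add: V_action_eq action_dom_tight)
    show "phi (inv\<^bsub>free_group\<^esub> t) \<xi> \<in> V_action (inv\<^bsub>free_group\<^esub> t)" if "\<xi> \<in> V_action t" for \<xi>
      using that t action_dom_inv_word[of \<xi> "inv_word t"] by (simp add: inv_free_group V_action_eq)
    show "phi t (phi (inv\<^bsub>free_group\<^esub> t) \<xi>) = \<xi>" if "\<xi> \<in> V_action t" for \<xi>
      using that t action_dom_inv_word[of \<xi> "inv_word t"] by (simp add: inv_free_group V_action_eq)
    fix s :: "'c letter list" and \<xi>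
    assume "s \<in> carrier free_group" and \<xi>: "\<xi> \<in> V_action s" "phi (inv\<^bsub>free_group\<^esub> s) \<xi> \<in> V_action t"
    then have s: "reduced s" by simp
    have d: "\<xi> \<in> action_dom (inv_word t @ inv_word s)"
      using \<xi> s t by (simp add: action_dom_append V_action_eq inv_free_group)
    have st: "reduced (foldr letter_mult s t)"
      using t by simp
    have "inv\<^bsub>free_group\<^esub> (s \<otimes>\<^bsub>free_group\<^esub> t) = inv\<^bsub>free_group\<^esub> t \<otimes>\<^bsub>free_group\<^esub> inv\<^bsub>free_group\<^esub> s"
      using s t by (intro inv_mult_group) simp_all
    then have iw: "inv_word (foldr letter_mult s t) = foldr letter_mult (inv_word t) (inv_word s)"
      using s t st by (simp add: inv_free_group)
    show "\<xi> \<in> V_action (s \<otimes>\<^bsub>free_group\<^esub> t)"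
      using action_dom_mult[OF d] by (simp add: V_action_eq[OF st] iw)
    show "phi (inv\<^bsub>free_group\<^esub> (s \<otimes>\<^bsub>free_group\<^esub> t)) \<xi> =
        phi (inv\<^bsub>free_group\<^esub> t) (phi (inv\<^bsub>free_group\<^esub> s) \<xi>)"
      using action_dom_mult[OF d] by (simp add: inv_free_group s t iw phi_append)
  qed
qed

text \<open>Whether a glued or cut filter contains \<open>e\<close> is a membership condition on the
  original filter, so the preimage is a cylinder, an intersection of two cylinders, or
  empty.\<close>

lemma cylinder_preimage:
  assumes e: "elem e"
  shows "{\<xi> \<in> V_letter x. phi_letter (inv_letter x) \<xi> \<in> cyl e} \<in> cylinder_sets"
proof -
  obtain \<beta> C where eq: "e = (\<beta>, C)" by (cases e)
  show ?thesis
  proof (cases x)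
    case (Pos a)
    have "{\<xi> \<in> V_letter x. phi_letter (inv_letter x) \<xi> \<in> cyl e} = cyl (a # \<beta>, C \<inter> range_of (a # \<beta>))"
    proof (intro Set.set_eqI iffI)
      fix \<xi> assume "\<xi> \<in> {\<xi> \<in> V_letter x. phi_letter (inv_letter x) \<xi> \<in> cyl e}"
      then have \<xi>: "\<xi> \<in> cyl (ran_elem a)" "phi_letter (Neg a) \<xi> \<in> cyl e"
        by (simp_all add: Pos V_letter_cyl)
      then show "\<xi> \<in> cyl (a # \<beta>, C \<inter> range_of (a # \<beta>))"
        by (simp add: phi_letter_Neg mem_cyl eq)
    next
      fix \<xi> assume \<xi>: "\<xi> \<in> cyl (a # \<beta>, C \<inter> range_of (a # \<beta>))"
      then have t: "\<xi> \<in> tight" and m: "Some (a # \<beta>, C \<inter> range_of (a # \<beta>)) \<in> \<xi>"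
        by (simp_all add: mem_cyl)
      have "Some (ran_elem a) \<in> \<xi>"
        using filter_range_of[OF tight_filter[OF t], of "[a]" \<beta>] m by simp
      then have r: "\<xi> \<in> cyl (ran_elem a)"
        using t by (simp add: mem_cyl)
      then have "unglue1 a \<xi> \<in> tight"
        using phi_letter_mem[of \<xi> "Neg a"] by (simp add: V_letter_cyl phi_letter_Neg mem_cyl)
      then show "\<xi> \<in> {\<xi> \<in> V_letter x. phi_letter (inv_letter x) \<xi> \<in> cyl e}"
        using r m e by (simp add: Pos V_letter_cyl phi_letter_Neg mem_cyl eq)
    qed
    then show ?thesis
      using e by (simp add: eq cylinder_cyl elem_Cons_range)
  next
    case (Neg a)
    have mem: "\<xi> \<in> {\<xi> \<in> V_letter x. phi_letter (inv_letter x) \<xi> \<in> cyl e} \<longleftrightarrow>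
        \<xi> \<in> cyl (dom_elem a) \<and> Some (\<beta>, C) \<in> glue1 a \<xi>" for \<xi>
      using phi_letter_mem[of \<xi> "Pos a"]
      by (auto simp: Neg V_letter_cyl phi_letter_Pos mem_cyl eq simp del: glue1_simps)
    show ?thesis
    proof (cases \<beta>)
      case Nil
      have "{\<xi> \<in> V_letter x. phi_letter (inv_letter x) \<xi> \<in> cyl e} = cyl (dom_elem a) \<inter> cyl ([], relrange C [a])"
        using e unfolding Set.set_eq_iff mem by (auto simp: Nil mem_cyl eq elem_def)
      moreover have "cyl (dom_elem a) \<inter> cyl ([], relrange C [a]) \<in> cylinder_sets"
        using e by (intro cylinder_Int cylinder_cyl) (simp_all add: eq Nil)
      ultimately show ?thesis by simp
    next
      case (Cons b \<gamma>)
      show ?thesis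
      proof (cases "b = a")
        case True
        have "{\<xi> \<in> V_letter x. phi_letter (inv_letter x) \<xi> \<in> cyl e} = cyl (dom_elem a) \<inter> cyl (\<gamma>, C)"
          using e unfolding Set.set_eq_iff mem by (auto simp: Cons True mem_cyl eq elem_def)
        moreover have "cyl (dom_elem a) \<inter> cyl (\<gamma>, C) \<in> cylinder_sets"
          using e elem_ConsD[of b \<gamma> C] by (intro cylinder_Int cylinder_cyl) (simp_all add: eq Cons)
        ultimately show ?thesis by simp
      next
        case False
        then have "{\<xi> \<in> V_letter x. phi_letter (inv_letter x) \<xi> \<in> cyl e} = {}"
          unfolding Set.set_eq_iff mem by (simp add: Cons)
        then show ?thesis
          by (simp only: cylinder_empty)
      qed
    qed
  qed
qed

lemma simple_transport_letter:
  "f \<in> simple_funs \<Longrightarrow> (\<lambda>\<xi>. if \<xi> \<in> V_letter x then f (phi_letter (inv_letter x) \<xi>) else 0) \<in> simple_funs"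
proof (induction rule: simple_funs.induct)
  case (basis e)
  have "(\<lambda>\<xi>. if \<xi> \<in> V_letter x then indicator (cyl e) (phi_letter (inv_letter x) \<xi>) else 0) =
      (indicator {\<xi> \<in> V_letter x. phi_letter (inv_letter x) \<xi> \<in> cyl e} :: _ \<Rightarrow> complex)"
    by (auto simp: fun_eq_iff indicator_def)
  with cylinder_preimage[OF basis, of x] show ?case
    by (simp add: cylinder_sets_def)
next
  case (add f g)
  have "(\<lambda>\<xi>. if \<xi> \<in> V_letter x then f (phi_letter (inv_letter x) \<xi>) + g (phi_letter (inv_letter x) \<xi>) else 0) =
    (\<lambda>\<xi>. (if \<xi> \<in> V_letter x then f (phi_letter (inv_letter x) \<xi>) else 0) +
      (if \<xi> \<in> V_letter x then g (phi_letter (inv_letter x) \<xi>) else 0))"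
    by auto
  with simple_funs.add[OF add.IH] show ?case by (simp only:)
next
  case (scale f c)
  have "(\<lambda>\<xi>. if \<xi> \<in> V_letter x then c * f (phi_letter (inv_letter x) \<xi>) else 0) =
    (\<lambda>\<xi>. c * (if \<xi> \<in> V_letter x then f (phi_letter (inv_letter x) \<xi>) else 0))"
    by auto
  with simple_funs.scale[OF scale.IH, of c] show ?case by (simp only:)
qed

lemma simple_transport:
  "reduced t \<Longrightarrow> f \<in> simple_funs \<Longrightarrow>
    (\<lambda>\<xi>. if \<xi> \<in> V_action t then f (phi (inv_word t) \<xi>) else 0) \<in> simple_funs"
proof (induction t)
  case Nil
  have "(\<lambda>\<xi>. if \<xi> \<in> V_action [] then f (phi (inv_word []) \<xi>) else 0) = f"
    using simple_off[OF Nil(2)] by auto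
  with Nil show ?case by (simp only:)
next
  case (Cons x t)
  note t = reduced_ConsD[OF Cons.prems(1)]
  have "(\<lambda>\<xi>. if \<xi> \<in> V_action (x # t) then f (phi (inv_word (x # t)) \<xi>) else 0) =
    (\<lambda>\<xi>. if \<xi> \<in> V_letter x then (\<lambda>\<xi>. if \<xi> \<in> V_action t then f (phi (inv_word t) \<xi>) else 0)
      (phi_letter (inv_letter x) \<xi>) else 0)"
    by (auto simp: fun_eq_iff V_action_Cons[OF Cons.prems(1)] phi_append)
  with simple_transport_letter[OF Cons.IH[OF t Cons.prems(2)], of x] show ?case by (simp only:)
qed

lemma cylinder_V_letter: "V_letter x \<in> cylinder_sets"
  by (cases x) (simp_all add: V_letter_cyl cylinder_cyl)

text \<open>The empty word is excluded: its set is the whole spectrum, which need not be compact, so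
  its indicator need not be simple.\<close>

lemma cylinder_V_action: "reduced t \<Longrightarrow> t \<noteq> [] \<Longrightarrow> V_action t \<in> cylinder_sets"
proof (induction t)
  case (Cons x t)
  show ?case
  proof (cases "t = []")
    case True
    have "V_action [x] = V_letter x"
      using V_action_Cons[of x "[]"] phi_letter_mem[of _ "inv_letter x"] V_letter_tight[of "inv_letter x"] by auto
    then show ?thesis
      using True cylinder_V_letter by simp
  next
    case False
    have "(indicator (V_action (x # t)) :: _ \<Rightarrow> complex) =
        (\<lambda>\<xi>. if \<xi> \<in> V_letter x then indicator (V_action t) (phi_letter (inv_letter x) \<xi>) else 0)"
      by (auto simp: fun_eq_iff V_action_Cons[OF Cons.prems(1)] indicator_def)
    with simple_transport_letter[of "indicator (V_action t)" x] Cons.IH[OF reduced_ConsD[OF Cons.prems(1)] False]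
    show ?thesis
      by (simp add: cylinder_sets_def)
  qed
qed simp

lemma openin_V_action: "reduced t \<Longrightarrow> openin tight_topology (V_action t)"
  using openin_topspace[of tight_topology] cylinder_V_action[of t] openin_cylinder[of "V_action t"]
  by (cases "t = []") auto

lemma approximable_transport:
  assumes t: "reduced t" and f: "approximable f"
  shows "approximable (\<lambda>\<xi>. if \<xi> \<in> V_action t then f (phi (inv_word t) \<xi>) else 0)"
proof (rule approximableI)
  fix e :: real assume e: "e > 0"
  then obtain g where g: "g \<in> simple_funs" "\<And>x. cmod (f x - g x) < e"
    using approximableE[OF f] by blast
  have "cmod ((if \<xi> \<in> V_action t then f (phi (inv_word t) \<xi>) else 0) -
      (if \<xi> \<in> V_action t then g (phi (inv_word t) \<xi>) else 0)) < e" for \<xi>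
    using g(2) e by simp
  then show "\<exists>g\<in>simple_funs. \<forall>\<xi>. cmod ((if \<xi> \<in> V_action t then f (phi (inv_word t) \<xi>) else 0) - g \<xi>) < e"
    by (intro bexI[OF _ simple_transport[OF t g(1)]] allI)
qed

lemma C0_V_action:
  "reduced t \<Longrightarrow> f \<in> C0 tight_topology (V_action t) \<longleftrightarrow> (\<forall>x. x \<notin> V_action t \<longrightarrow> f x = 0) \<and> approximable f"
  by (rule C0_tight_iff) (rule openin_V_action)

lemma crossed_algebra_tight: "crossed_algebra free_group tight V_action phi tight_topology"
proof -
  interpret partial_action free_group tight V_action phi
    by (rule partial_action_tight)
  show ?thesis
  proof
    fix t :: "'c letter list" assume "t \<in> carrier free_group"
    then have t: "reduced t" by simp
    show "(\<lambda>x. 0) \<in> C0 tight_topology (V_action t)"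
      using t by (simp add: C0_V_action approximable_simple simple_zero)
    show "(\<lambda>x. f x + g x) \<in> C0 tight_topology (V_action t)"
      if "f \<in> C0 tight_topology (V_action t)" "g \<in> C0 tight_topology (V_action t)" for f g
      using that t by (simp add: C0_V_action approximable_add)
    show "(\<lambda>x. c * f x) \<in> C0 tight_topology (V_action t)" if "f \<in> C0 tight_topology (V_action t)" for f c
      using that t by (simp add: C0_V_action approximable_scale)
    show "bounded (range f)" if "f \<in> C0 tight_topology (V_action t)" for f
      using that t by (simp add: C0_V_action approximable_bounded)
    show "(\<lambda>x. if x \<in> V_action t then cnj (f (phi (inv\<^bsub>free_group\<^esub> t) x)) else 0) \<in> C0 tight_topology (V_action t)"
      if f: "f \<in> C0 tight_topology (V_action (inv\<^bsub>free_group\<^esub> t))" for f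
    proof -
      have "approximable f"
        using f t by (simp add: inv_free_group C0_V_action)
      from approximable_transport[OF t approximable_cnj[OF this]] t show ?thesis
        by (simp add: inv_free_group C0_V_action cong: if_cong)
    qed
    fix s :: "'c letter list" and f g
    assume sc: "s \<in> carrier free_group" and f: "f \<in> C0 tight_topology (V_action s)"
      and g: "g \<in> C0 tight_topology (V_action t)"
    then have s: "reduced s" by simp
    note f' = f[unfolded C0_V_action[OF s]] and g' = g[unfolded C0_V_action[OF t]]
    have off: "f x * g (phi (inv\<^bsub>free_group\<^esub> s) x) = 0" if "x \<notin> V_action (s \<otimes>\<^bsub>free_group\<^esub> t)" for x
      using that V_mult[OF sc \<open>t \<in> carrier free_group\<close>, of x] f' g' by auto
    \<comment> \<open>Since \<open>f\<close> vanishes off \<open>V_action s\<close>, the translate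
      of \<open>g\<close> may be cut off there, which brings it into the form of
      \<open>approximable_transport\<close>.\<close>
    have "(\<lambda>x. f x * g (phi (inv\<^bsub>free_group\<^esub> s) x)) =
        (\<lambda>x. f x * (if x \<in> V_action s then g (phi (inv_word s) x) else 0))"
      using f' by (auto simp: fun_eq_iff inv_free_group[OF s])
    moreover have "approximable (\<lambda>x. f x * (if x \<in> V_action s then g (phi (inv_word s) x) else 0))"
      using f' g' by (intro approximable_times approximable_transport[OF s]) simp_all
    ultimately have "approximable (\<lambda>x. f x * g (phi (inv\<^bsub>free_group\<^esub> s) x))"
      by (simp only:)
    with off show "(\<lambda>x. f x * g (phi (inv\<^bsub>free_group\<^esub> s) x)) \<in> C0 tight_topology (V_action (s \<otimes>\<^bsub>free_group\<^esub> t))"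
      using t by (simp add: C0_V_action)
  next
    fix h :: "('c list \<times> 'a set) option set \<Rightarrow> real"
    assume h: "(\<lambda>x. complex_of_real (h x)) \<in> C0 tight_topology tight" and h1: "\<And>x. \<bar>h x\<bar> \<le> 1"
    have T: "openin tight_topology tight"
      using openin_topspace[of tight_topology] by simp
    show "(\<lambda>x. complex_of_real (sqrt (1 - (h x)\<^sup>2) - 1)) \<in> C0 tight_topology tight"
      using h approximable_root[OF _ h1] unfolding C0_tight_iff[OF T] by simp
  qed
qed

end

section \<open>Words in the generators\<close>

abbreviation conv :: "'g star_poly \<Rightarrow> 'g star_poly \<Rightarrow> 'g star_poly" where
  "conv f g \<equiv> (\<lambda>w. \<Sum>i\<le>length w. f (take i w) * g (drop i w))"

definition word :: "('g \<times> bool) list \<Rightarrow> 'g star_poly" where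
  "word w = (\<lambda>v. if v = w then 1 else 0)"

definition flip :: "'g \<times> bool \<Rightarrow> 'g \<times> bool" where
  "flip x = (fst x, \<not> snd x)"

definition word_star :: "('g \<times> bool) list \<Rightarrow> ('g \<times> bool) list" where
  "word_star w = rev (map flip w)"

lemma flip_simps [simp]: "flip (g, b) = (g, \<not> b)" "flip (flip x) = x" "fst (flip x) = fst x"
  by (simp_all add: flip_def)

lemma word_star_simps [simp]:
  "word_star [] = []" "word_star (x # w) = word_star w @ [flip x]"
  "word_star (u @ v) = word_star v @ word_star u" "word_star (word_star w) = w"
  "word_star w = [] \<longleftrightarrow> w = []" "fst ` set (word_star w) = fst ` set w"
  by (simp_all add: word_star_def rev_map image_image o_def)

lemma word_star_eq_iff: "word_star v = w \<longleftrightarrow> v = word_star w"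
  by (metis word_star_simps(4))

lemma free_star_algebra_simps [simp]:
  "plus_sa (free_star_algebra \<Gamma>) f g = (\<lambda>w. f w + g w)"
  "scale_sa (free_star_algebra \<Gamma>) c f = (\<lambda>w. c * f w)"
  "times_sa (free_star_algebra \<Gamma>) f g = conv f g"
  by (simp_all add: free_star_algebra_def)

lemma free_star_algebra_star:
  fixes f :: "'g star_poly"
  shows "star_sa (free_star_algebra \<Gamma>) f = (\<lambda>w. cnj (f (word_star w)))"
proof -
  have "(\<lambda>(g, b). (g, \<not> b)) = (flip :: 'g \<times> bool \<Rightarrow> _)"
    by (auto simp: fun_eq_iff)
  then show ?thesis
    by (simp add: free_star_algebra_def word_star_def)
qed

lemma free_star_algebra_diff [simp]: "diff_sa (free_star_algebra \<Gamma>) f g = (\<lambda>w. f w - g w)"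
  by (simp add: diff_sa_def)

lemma carrier_free_star_algebra: "f \<in> carrier (free_star_algebra \<Gamma>) \<longleftrightarrow>
    finite {w. f w \<noteq> 0} \<and> (\<forall>w. f w \<noteq> 0 \<longrightarrow> w \<noteq> [] \<and> fst ` set w \<subseteq> \<Gamma>)"
  by (simp add: free_star_algebra_def)

lemma word_carrier: "w \<noteq> [] \<Longrightarrow> fst ` set w \<subseteq> \<Gamma> \<Longrightarrow> word w \<in> carrier (free_star_algebra \<Gamma>)"
  by (auto simp: carrier_free_star_algebra word_def)

lemma free_gen_word: "free_gen g = word [(g, False)]"
  by (simp add: free_gen_def word_def)

text \<open>The cut positions of \<open>w\<close> correspond to the factorisations
  \<open>w = u @ v\<close>; turning one index set into the other exhibits the convolution as a
  combination of words.\<close>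

lemma conv_eq_sum:
  assumes "finite S" "finite S'" "\<And>u. f u \<noteq> 0 \<Longrightarrow> u \<in> S" "\<And>v. g v \<noteq> 0 \<Longrightarrow> v \<in> S'"
  shows "conv f g w = (\<Sum>(u, v)\<in>S \<times> S'. f u * g v * word (u @ v) w)"
proof -
  let ?P = "{p \<in> S \<times> S'. fst p @ snd p = w}" and ?I = "{i. i \<le> length w \<and> take i w \<in> S \<and> drop i w \<in> S'}"
  have "conv f g w = (\<Sum>i\<in>?I. f (take i w) * g (drop i w))"
    using assms(3,4) by (intro sum.mono_neutral_right) auto
  also have "\<dots> = (\<Sum>(u, v)\<in>?P. f u * g v * word (u @ v) w)"
    by (rule sum.reindex_bij_witness[of _ "\<lambda>p. length (fst p)" "\<lambda>i. (take i w, drop i w)"])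
      (auto simp: word_def)
  also have "\<dots> = (\<Sum>(u, v)\<in>S \<times> S'. f u * g v * word (u @ v) w)"
    using assms(1,2) by (intro sum.mono_neutral_left) (auto simp: word_def split: if_splits)
  finally show ?thesis .
qed

lemma conv_word_word: "conv (word u) (word v) = word (u @ v)"
  by (rule ext) (subst conv_eq_sum[of "{u}" "{v}"], auto simp: word_def split: if_splits)

lemma star_word: "star_sa (free_star_algebra \<Gamma>) (word w) = word (word_star w)"
  by (auto simp: free_star_algebra_star word_def fun_eq_iff word_star_eq_iff)

lemma conv_word_left:
  "conv (word u) f w = (if take (length u) w = u \<and> length u \<le> length w then f (drop (length u) w) else 0)"
proof -
  have "conv (word u) f w = (\<Sum>i\<in>{i. i \<le> length w \<and> take i w = u}. f (drop i w))"
    unfolding word_def by (simp add: sum.If_cases if_distrib[of "\<lambda>x. x * _"] Collect_conj_eq atMost_def cong: if_cong)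
  moreover have "{i. i \<le> length w \<and> take i w = u} =
      (if take (length u) w = u \<and> length u \<le> length w then {length u} else {})"
    by auto
  ultimately show ?thesis by simp
qed

text \<open>Both sides sum over the ways to cut \<open>w\<close> into three pieces. No finiteness or
  carrier condition enters, so \<open>word []\<close> may later occur as a factor.\<close>

lemma conv_assoc:
  fixes f g h :: "'g star_poly"
  shows "conv (conv f g) h = conv f (conv g h)"
proof
  fix w :: "('g \<times> bool) list"
  let ?n = "length w"
  have "conv (conv f g) h w =
      (\<Sum>i\<le>?n. \<Sum>j\<le>i. f (take j w) * g (take (i - j) (drop j w)) * h (drop i w))"
  proof (rule sum.cong[OF refl])
    fix i assume "i \<in> {..?n}"
    then show "conv f g (take i w) * h (drop i w) =
        (\<Sum>j\<le>i. f (take j w) * g (take (i - j) (drop j w)) * h (drop i w))"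
      by (simp add: sum_distrib_right min_def drop_take)
  qed
  also have "\<dots> = (\<Sum>(i, j)\<in>(SIGMA i:{..?n}. {..i}). f (take j w) * g (take (i - j) (drop j w)) * h (drop i w))"
    by (simp add: sum.Sigma)
  also have "\<dots> = (\<Sum>(j, k)\<in>(SIGMA j:{..?n}. {..?n - j}). f (take j w) * (g (take k (drop j w)) * h (drop k (drop j w))))"
    by (rule sum.reindex_bij_witness[of _ "\<lambda>(j, k). (j + k, j)" "\<lambda>(i, j). (j, i - j)"]) (auto simp: add.commute)
  also have "\<dots> = (\<Sum>j\<le>?n. f (take j w) * conv g h (drop j w))"
    by (simp add: sum.Sigma[symmetric] sum_distrib_left)
  finally show "conv (conv f g) h w = conv f (conv g h) w" .
qed

lemma star_alg_free: "star_alg (free_star_algebra \<Gamma>)"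
proof
  let ?R = "free_star_algebra \<Gamma>"
  fix f g h :: "'a star_poly" and c d :: complex
  have inj: "inj (word_star :: ('a \<times> bool) list \<Rightarrow> _)"
    by (rule inj_on_inverseI[where g = word_star]) simp
  assume f: "f \<in> carrier ?R"
  show "scale_sa ?R c f \<in> carrier ?R"
    using f by (auto simp: carrier_free_star_algebra intro: rev_finite_subset)
  show "star_sa ?R f \<in> carrier ?R"
  proof -
    have "{w. cnj (f (word_star w)) \<noteq> 0} = word_star ` {w. f w \<noteq> 0}"
      by (force simp: image_iff)
    then have "finite {w. cnj (f (word_star w)) \<noteq> 0}"
      using f by (simp add: carrier_free_star_algebra)
    moreover have "w \<noteq> [] \<and> fst ` set w \<subseteq> \<Gamma>" if "cnj (f (word_star w)) \<noteq> 0" for w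
      using f that word_star_simps(5,6)[of w] unfolding carrier_free_star_algebra by force
    ultimately show ?thesis
      by (simp add: carrier_free_star_algebra free_star_algebra_star)
  qed
  show "star_sa ?R (star_sa ?R f) = f"
    by (simp add: free_star_algebra_star)
  show "star_sa ?R (scale_sa ?R c f) = scale_sa ?R (cnj c) (star_sa ?R f)"
    by (simp add: free_star_algebra_star)
  assume g: "g \<in> carrier ?R"
  show "plus_sa ?R f g \<in> carrier ?R"
  proof -
    have "{w. f w + g w \<noteq> 0} \<subseteq> {w. f w \<noteq> 0} \<union> {w. g w \<noteq> 0}"
      by auto
    then have "finite {w. f w + g w \<noteq> 0}"
      by (rule finite_subset) (use f g in \<open>simp add: carrier_free_star_algebra\<close>)
    moreover have "w \<noteq> [] \<and> fst ` set w \<subseteq> \<Gamma>" if "f w + g w \<noteq> 0" for w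
      using f g that by (cases "f w = 0") (simp_all add: carrier_free_star_algebra)
    ultimately show ?thesis
      by (simp add: carrier_free_star_algebra)
  qed
  show "times_sa ?R f g \<in> carrier ?R"
  proof -
    let ?S = "{w. f w \<noteq> 0}" and ?S' = "{w. g w \<noteq> 0}"
    have conv: "\<exists>u\<in>?S. \<exists>v\<in>?S'. w = u @ v" if "conv f g w \<noteq> 0" for w
    proof -
      from that obtain i where "f (take i w) * g (drop i w) \<noteq> 0"
        by (rule sum.not_neutral_contains_not_neutral)
      then show ?thesis
        by (intro bexI[of _ "take i w"] bexI[of _ "drop i w"]) simp_all
    qed
    then have "{w. conv f g w \<noteq> 0} \<subseteq> (\<lambda>(u, v). u @ v) ` (?S \<times> ?S')"
      by force
    then have "finite {w. conv f g w \<noteq> 0}"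
      by (rule finite_subset) (use f g in \<open>simp add: carrier_free_star_algebra\<close>)
    moreover have "w \<noteq> [] \<and> fst ` set w \<subseteq> \<Gamma>" if "conv f g w \<noteq> 0" for w
    proof -
      obtain u v where "f u \<noteq> 0" "g v \<noteq> 0" "w = u @ v"
        using conv[OF \<open>conv f g w \<noteq> 0\<close>] by blast
      with f g show ?thesis
        by (simp add: carrier_free_star_algebra image_Un)
    qed
    ultimately show ?thesis
      unfolding carrier_free_star_algebra free_star_algebra_simps by blast
  qed
next
  have "(\<lambda>w. 0) \<in> carrier (free_star_algebra \<Gamma>)"
    by (simp add: carrier_free_star_algebra)
  then show "carrier (free_star_algebra \<Gamma>) \<noteq> {}" by blast
qed (simp_all add: free_star_algebra_star algebra_simps sum.distrib sum_distrib_left)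

text \<open>Each generator is sent to the indicator of \<open>gset g\<close> in degree
  \<open>gdeg g\<close>. Monomials with indicator coefficients are closed under product and adjoint,
  so the image of a word is recorded by its degree and its set alone, computed by
  \<open>wdeg\<close> and \<open>wset\<close>.\<close>

locale crossed_generators = crossed_algebra F X V \<phi> T
  for F (structure) and X :: "'x set" and V :: "'a \<Rightarrow> 'x set" and \<phi> :: "'a \<Rightarrow> 'x \<Rightarrow> 'x" and T :: "'x topology" +
  fixes \<Gamma> :: "'g set" and gdeg :: "'g \<Rightarrow> 'a" and gset :: "'g \<Rightarrow> 'x set"
  assumes gdeg_closed: "g \<in> \<Gamma> \<Longrightarrow> gdeg g \<in> carrier F"
    and gset_C0: "g \<in> \<Gamma> \<Longrightarrow> indicator (gset g) \<in> C0 T (V (gdeg g))"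
begin

definition ldeg :: "'g \<times> bool \<Rightarrow> 'a" where
  "ldeg x = (if snd x then inv (gdeg (fst x)) else gdeg (fst x))"

definition lset :: "'g \<times> bool \<Rightarrow> 'x set" where
  "lset x = (if snd x then {\<xi> \<in> V (inv (gdeg (fst x))). \<phi> (gdeg (fst x)) \<xi> \<in> gset (fst x)} else gset (fst x))"

fun wdeg :: "('g \<times> bool) list \<Rightarrow> 'a" where
  "wdeg [] = \<one>"
| "wdeg (x # w) = ldeg x \<otimes> wdeg w"

fun wset :: "('g \<times> bool) list \<Rightarrow> 'x set" where
  "wset [] = X"
| "wset (x # w) = {\<xi> \<in> lset x. \<phi> (inv (ldeg x)) \<xi> \<in> wset w}"

abbreviation letters :: "('g \<times> bool) list \<Rightarrow> bool" where
  "letters w \<equiv> fst ` set w \<subseteq> \<Gamma>"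

lemma indicator_C0_subset:
  assumes "indicator A \<in> C0 T U"
  shows "A \<subseteq> U"
proof
  fix x assume "x \<in> A"
  then show "x \<in> U"
    using C0_off[OF assms, of x] by (cases "x \<in> U") auto
qed

lemma ldeg_closed [simp]: "fst x \<in> \<Gamma> \<Longrightarrow> ldeg x \<in> carrier F"
  by (simp add: ldeg_def gdeg_closed)

lemma lset_C0: "fst x \<in> \<Gamma> \<Longrightarrow> (indicator (lset x) :: 'x \<Rightarrow> complex) \<in> C0 T (V (ldeg x))"
proof (cases "snd x")
  case True
  assume x: "fst x \<in> \<Gamma>"
  note d = gdeg_closed[OF x]
  have "(\<lambda>\<xi>. if \<xi> \<in> V (inv (gdeg (fst x))) then cnj (indicator (gset (fst x)) (\<phi> (gdeg (fst x)) \<xi>)) else 0)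
      \<in> C0 T (V (inv (gdeg (fst x))))"
    using C0_adjoint[of "inv (gdeg (fst x))" "indicator (gset (fst x))"] gset_C0[OF x]
    by (simp only: inv_inv[OF d] inv_closed[OF d])
  moreover have "(\<lambda>\<xi>. if \<xi> \<in> V (inv (gdeg (fst x))) then cnj (indicator (gset (fst x)) (\<phi> (gdeg (fst x)) \<xi>)) else 0) =
      (indicator (lset x) :: 'x \<Rightarrow> complex)"
    using True by (auto simp: fun_eq_iff lset_def indicator_def)
  ultimately show ?thesis
    using True by (simp add: ldeg_def)
next
  case False
  assume "fst x \<in> \<Gamma>"
  with False show ?thesis
    by (simp add: lset_def ldeg_def gset_C0)
qed

lemma lset_subset: "fst x \<in> \<Gamma> \<Longrightarrow> lset x \<subseteq> V (ldeg x)"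
  by (rule indicator_C0_subset[OF lset_C0])

lemma ldeg_flip: "fst x \<in> \<Gamma> \<Longrightarrow> ldeg (flip x) = inv (ldeg x)"
  by (simp add: ldeg_def flip_def gdeg_closed)

lemma lset_flip:
  assumes x: "fst x \<in> \<Gamma>"
  shows "lset (flip x) = {\<xi> \<in> V (inv (ldeg x)). \<phi> (ldeg x) \<xi> \<in> lset x}"
proof (cases "snd x")
  case True
  note d = gdeg_closed[OF x]
  have sub: "gset (fst x) \<subseteq> V (gdeg (fst x))"
    by (rule indicator_C0_subset[OF gset_C0[OF x]])
  have "\<phi> (inv (gdeg (fst x))) \<xi> \<in> V (inv (gdeg (fst x)))" "\<phi> (gdeg (fst x)) (\<phi> (inv (gdeg (fst x))) \<xi>) = \<xi>"
    if "\<xi> \<in> V (gdeg (fst x))" for \<xi>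
    using \<phi>_closed[OF d that] \<phi>_inverse[OF d that] by simp_all
  with True sub d show ?thesis
    by (auto simp: lset_def ldeg_def flip_def)
qed (simp add: lset_def ldeg_def flip_def)

lemma wdeg_closed [simp]: "letters w \<Longrightarrow> wdeg w \<in> carrier F"
  by (induction w) auto

lemma wset_X: "letters w \<Longrightarrow> wset w \<subseteq> X"
proof (cases w)
  case (Cons x u)
  assume "letters w"
  with Cons have x: "fst x \<in> \<Gamma>" by simp
  show ?thesis
    using Cons lset_subset[OF x] V_subset[OF ldeg_closed[OF x]] by auto
qed simp

lemma wset_subset: "letters w \<Longrightarrow> wset w \<subseteq> V (wdeg w)"
proof (induction w)
  case Nil
  then show ?case by (simp add: V_one)
next
  case (Cons x w)
  then have x: "fst x \<in> \<Gamma>" and w: "letters w" by auto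
  show ?case
  proof
    fix \<xi> assume "\<xi> \<in> wset (x # w)"
    then have "\<xi> \<in> lset x" "\<phi> (inv (ldeg x)) \<xi> \<in> wset w" by auto
    with Cons.IH[OF w] lset_subset[OF x] show "\<xi> \<in> V (wdeg (x # w))"
      using V_mult[of "ldeg x" "wdeg w" \<xi>] x w by auto
  qed
qed

lemma wset_C0: "letters w \<Longrightarrow> w \<noteq> [] \<Longrightarrow> (indicator (wset w) :: 'x \<Rightarrow> complex) \<in> C0 T (V (wdeg w))"
proof (induction w)
  case (Cons x w)
  then have x: "fst x \<in> \<Gamma>" and w: "letters w" by auto
  show ?case
  proof (cases "w = []")
    case True
    have "lset x \<subseteq> V (ldeg x)"
      by (rule lset_subset[OF x])
    then have "\<phi> (inv (ldeg x)) \<xi> \<in> X" if "\<xi> \<in> lset x" for \<xi>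
      using \<phi>_closed[of "ldeg x" \<xi>] V_subset[of "inv (ldeg x)"] x that by auto
    then have "wset [x] = lset x"
      by auto
    then show ?thesis
      using True lset_C0[OF x] x by simp
  next
    case False
    have "(indicator (wset (x # w)) :: 'x \<Rightarrow> complex) =
        (\<lambda>\<xi>. indicator (lset x) \<xi> * indicator (wset w) (\<phi> (inv (ldeg x)) \<xi>))"
      by (auto simp: fun_eq_iff indicator_def)
    with C0_transport[OF ldeg_closed[OF x] wdeg_closed[OF w] lset_C0[OF x] Cons.IH[OF w False]]
    show ?thesis by simp
  qed
qed simp

lemma wdeg_append: "letters u \<Longrightarrow> letters v \<Longrightarrow> wdeg (u @ v) = wdeg u \<otimes> wdeg v"
  by (induction u) (auto simp: m_assoc)

lemma wset_append:
  "letters u \<Longrightarrow> letters v \<Longrightarrow> wset (u @ v) = {\<xi> \<in> wset u. \<phi> (inv (wdeg u)) \<xi> \<in> wset v}"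
proof (induction u)
  case Nil
  then show ?case
    using wset_X[of v] \<phi>_one by auto
next
  case (Cons x u)
  then have x: "fst x \<in> \<Gamma>" and u: "letters u" by auto
  have "\<phi> (inv (ldeg x \<otimes> wdeg u)) \<xi> = \<phi> (inv (wdeg u)) (\<phi> (inv (ldeg x)) \<xi>)"
    if "\<xi> \<in> lset x" "\<phi> (inv (ldeg x)) \<xi> \<in> wset u" for \<xi>
    using that x u lset_subset[OF x] wset_subset[OF u] by (intro \<phi>_mult) auto
  with Cons.IH[OF u Cons.prems(2)] show ?case
    by auto
qed

lemma letters_word_star [simp]: "letters (word_star w) \<longleftrightarrow> letters w"
  by (simp only: word_star_simps)

lemma wdeg_word_star: "letters w \<Longrightarrow> wdeg (word_star w) = inv (wdeg w)"
  by (induction w) (auto simp: wdeg_append ldeg_flip inv_mult_group)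

text \<open>Reversing and flipping a word inverts the composite of its partial maps, so its set is
  \<open>wset w\<close> carried over by \<open>\<phi> (inv (wdeg w))\<close>.\<close>

lemma wset_word_star:
  "letters w \<Longrightarrow> wset (word_star w) = {\<xi> \<in> V (inv (wdeg w)). \<phi> (wdeg w) \<xi> \<in> wset w}"
proof (induction w)
  case Nil
  then show ?case by (auto simp: V_one \<phi>_one)
next
  case (Cons x w)
  then have x: "fst x \<in> \<Gamma>" and w: "letters w" by auto
  let ?d = "ldeg x" and ?e = "wdeg w"
  have d: "?d \<in> carrier F" and e: "?e \<in> carrier F"
    using x w by auto
  have single: "wset [flip x] = lset (flip x)"
    using lset_subset[of "flip x"] \<phi>_closed[of "ldeg (flip x)"] V_subset[of "inv (ldeg (flip x))"] x by auto
  have "wset (word_star (x # w)) = {\<xi> \<in> wset (word_star w). \<phi> (inv (wdeg (word_star w))) \<xi> \<in> wset [flip x]}"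
    using wset_append[of "word_star w" "[flip x]"] x w by (simp del: wset.simps)
  also have "\<dots> = {\<xi>. \<xi> \<in> V (inv ?e) \<and> \<phi> ?e \<xi> \<in> wset w \<and> \<phi> ?e \<xi> \<in> V (inv ?d) \<and> \<phi> ?d (\<phi> ?e \<xi>) \<in> lset x}"
    using Cons.IH[OF w] e unfolding wdeg_word_star[OF w] single lset_flip[OF x] by auto
  also have "\<dots> = {\<xi> \<in> V (inv (?d \<otimes> ?e)). \<phi> (?d \<otimes> ?e) \<xi> \<in> lset x \<and> \<phi> (inv ?d) (\<phi> (?d \<otimes> ?e) \<xi>) \<in> wset w}"
  proof (intro Set.set_eqI iffI)
    fix \<xi> assume a: "\<xi> \<in> {\<xi>. \<xi> \<in> V (inv ?e) \<and> \<phi> ?e \<xi> \<in> wset w \<and> \<phi> ?e \<xi> \<in> V (inv ?d) \<and> \<phi> ?d (\<phi> ?e \<xi>) \<in> lset x}"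
    have "\<xi> \<in> V (inv ?e \<otimes> inv ?d)" "\<phi> (inv (inv ?e \<otimes> inv ?d)) \<xi> = \<phi> (inv (inv ?d)) (\<phi> (inv (inv ?e)) \<xi>)"
      using V_mult[of "inv ?e" "inv ?d" \<xi>] \<phi>_mult[of "inv ?e" "inv ?d" \<xi>] a d e by auto
    then have "\<xi> \<in> V (inv (?d \<otimes> ?e))" "\<phi> (?d \<otimes> ?e) \<xi> = \<phi> ?d (\<phi> ?e \<xi>)"
      using d e by (simp_all add: inv_mult_group)
    moreover have "\<phi> (inv ?d) (\<phi> ?d (\<phi> ?e \<xi>)) = \<phi> ?e \<xi>"
      using \<phi>_inverse[of "inv ?d" "\<phi> ?e \<xi>"] a d by simp
    ultimately show "\<xi> \<in> {\<xi> \<in> V (inv (?d \<otimes> ?e)). \<phi> (?d \<otimes> ?e) \<xi> \<in> lset x \<and> \<phi> (inv ?d) (\<phi> (?d \<otimes> ?e) \<xi>) \<in> wset w}"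
      using a by simp
  next
    fix \<xi> assume a: "\<xi> \<in> {\<xi> \<in> V (inv (?d \<otimes> ?e)). \<phi> (?d \<otimes> ?e) \<xi> \<in> lset x \<and> \<phi> (inv ?d) (\<phi> (?d \<otimes> ?e) \<xi>) \<in> wset w}"
    \<comment> \<open>The points visited on the way: \<open>z\<close> is the image under the whole
      composite, and \<open>y\<close> undoes only the letter \<open>x\<close>.\<close>
    define z where "z = \<phi> (?d \<otimes> ?e) \<xi>"
    define y where "y = \<phi> (inv ?d) z"
    have z: "z \<in> V ?d" and y: "y \<in> wset w" "y \<in> V ?e"
      using a lset_subset[OF x] wset_subset[OF w] by (auto simp: z_def y_def)
    have "\<xi> = \<phi> (inv (?d \<otimes> ?e)) z"
      using \<phi>_inverse[of "inv (?d \<otimes> ?e)" \<xi>] a d e by (simp add: z_def)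
    also have "\<dots> = \<phi> (inv ?e) y"
      using \<phi>_mult[OF d e z] y by (simp add: y_def)
    finally have \<xi>: "\<xi> = \<phi> (inv ?e) y" .
    have "\<xi> \<in> V (inv ?e)" "\<phi> ?e \<xi> = y"
      using \<phi>_closed[OF e y(2)] \<phi>_inverse[OF e y(2)] by (simp_all add: \<xi>)
    moreover have "y \<in> V (inv ?d)" "\<phi> ?d y = z"
      using \<phi>_closed[OF d z] \<phi>_inverse[OF d z] by (simp_all add: y_def)
    ultimately show "\<xi> \<in> {\<xi>. \<xi> \<in> V (inv ?e) \<and> \<phi> ?e \<xi> \<in> wset w \<and> \<phi> ?e \<xi> \<in> V (inv ?d) \<and> \<phi> ?d (\<phi> ?e \<xi>) \<in> lset x}"
      using y a by (simp add: z_def)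
  qed
  finally show ?case by auto
qed

abbreviation fr :: "'g star_poly star_algebra" where
  "fr \<equiv> free_star_algebra \<Gamma>"

definition ind :: "('g \<times> bool) list \<Rightarrow> 'a \<Rightarrow> 'x \<Rightarrow> complex" where
  "ind w t \<xi> = (if t = wdeg w \<and> \<xi> \<in> wset w then 1 else 0)"

text \<open>The homomorphism \<open>\<Psi>\<close> of the overview.\<close>

definition rep :: "'g star_poly \<Rightarrow> 'a \<Rightarrow> 'x \<Rightarrow> complex" where
  "rep f = (\<lambda>t \<xi>. \<Sum>w | f w \<noteq> 0. f w * ind w t \<xi>)"

lemma rep_eq: "finite S \<Longrightarrow> (\<And>w. f w \<noteq> 0 \<Longrightarrow> w \<in> S) \<Longrightarrow> rep f t \<xi> = (\<Sum>w\<in>S. f w * ind w t \<xi>)"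
  unfolding rep_def by (intro sum.mono_neutral_left) auto

lemma fr_letters: "f \<in> carrier fr \<Longrightarrow> f w \<noteq> 0 \<Longrightarrow> letters w \<and> w \<noteq> []"
  by (simp add: carrier_free_star_algebra)

lemma fr_finite: "f \<in> carrier fr \<Longrightarrow> finite {w. f w \<noteq> 0}"
  by (simp add: carrier_free_star_algebra)

lemma ind_mono: "ind w = mono (wdeg w) (indicator (wset w))"
  by (auto simp: fun_eq_iff ind_def mono_def indicator_def)

lemma rep_word: "rep (word w) = mono (wdeg w) (indicator (wset w))"
proof -
  have "rep (word w) = ind w"
    by (intro ext) (subst rep_eq[of "{w}"], auto simp: word_def split: if_splits)
  then show ?thesis by (simp add: ind_mono)
qed

lemma rep_word_ind: "rep (word w) = ind w"
  by (simp add: rep_word ind_mono)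

text \<open>The words \<open>u i\<close> may repeat, so the coefficients are first collected over
  the set of distinct words.\<close>

lemma rep_sum_words:
  assumes I: "finite I"
  shows "rep (\<lambda>w. \<Sum>i\<in>I. c i * word (u i) w) t \<xi> = (\<Sum>i\<in>I. c i * ind (u i) t \<xi>)"
proof -
  have "rep (\<lambda>w. \<Sum>i\<in>I. c i * word (u i) w) t \<xi> = (\<Sum>w\<in>u ` I. (\<Sum>i\<in>I. c i * word (u i) w) * ind w t \<xi>)"
  proof (rule rep_eq)
    fix w assume "(\<Sum>i\<in>I. c i * word (u i) w) \<noteq> 0"
    then obtain i where "i \<in> I" "c i * word (u i) w \<noteq> 0"
      by (rule sum.not_neutral_contains_not_neutral)
    then show "w \<in> u ` I"
      by (auto simp: word_def split: if_splits)
  qed (simp add: I)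
  also have "\<dots> = (\<Sum>i\<in>I. \<Sum>w\<in>u ` I. if w = u i then c i * ind (u i) t \<xi> else 0)"
    by (subst sum.swap) (auto simp: sum_distrib_right word_def intro!: sum.cong)
  also have "\<dots> = (\<Sum>i\<in>I. c i * ind (u i) t \<xi>)"
    by (intro sum.cong refl) (simp add: I)
  finally show ?thesis .
qed

lemma rep_supp: "supp (rep f) \<subseteq> wdeg ` {w. f w \<noteq> 0}"
proof
  fix t assume "t \<in> supp (rep f)"
  then obtain \<xi> where "rep f t \<xi> \<noteq> 0"
    by (auto simp: supp_def)
  then obtain w where "f w \<noteq> 0" "f w * ind w t \<xi> \<noteq> 0"
    unfolding rep_def by (auto elim: sum.not_neutral_contains_not_neutral)
  then show "t \<in> wdeg ` {w. f w \<noteq> 0}"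
    by (auto simp: ind_def split: if_splits)
qed

lemma rep_closed:
  assumes f: "f \<in> carrier fr"
  shows "rep f \<in> carrier cp"
  unfolding carrier_cp
proof (intro conjI ballI allI impI)
  show "finite (supp (rep f))"
    by (rule finite_subset[OF rep_supp]) (simp add: fr_finite[OF f])
  fix t assume t: "t \<in> carrier F"
  have "(\<lambda>\<xi>. \<Sum>w | f w \<noteq> 0. f w * ind w t \<xi>) \<in> C0 T (V t)"
  proof (rule C0_sum[OF t fr_finite[OF f]])
    fix w assume "w \<in> {w. f w \<noteq> 0}"
    then have "letters w" "w \<noteq> []"
      using fr_letters[OF f] by auto
    note c = wset_C0[OF this]
    show "(\<lambda>\<xi>. f w * ind w t \<xi>) \<in> C0 T (V t)"
    proof (cases "t = wdeg w")
      case True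
      then have "(\<lambda>\<xi>. f w * ind w t \<xi>) = (\<lambda>\<xi>. f w * indicator (wset w) \<xi>)"
        by (auto simp: ind_def indicator_def)
      with C0_scale[OF t, of "indicator (wset w)" "f w"] c True show ?thesis by simp
    next
      case False
      then have "(\<lambda>\<xi>. f w * ind w t \<xi>) = (\<lambda>\<xi>. 0)"
        by (simp add: ind_def)
      with C0_zero[OF t] show ?thesis by simp
    qed
  qed
  then show "rep f t \<in> C0 T (V t)"
    by (simp add: rep_def)
next
  fix t assume t: "t \<notin> carrier F"
  have "ind w t \<xi> = 0" if "f w \<noteq> 0" for w \<xi>
    using fr_letters[OF f that] wdeg_closed[of w] t by (auto simp: ind_def)
  then show "rep f t = (\<lambda>\<xi>. 0)"
    by (simp add: rep_def)
qed

lemma ind_append: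
  assumes "letters u" "letters v" "t \<in> carrier F"
  shows "ind (u @ v) t \<xi> = (if \<xi> \<in> wset u then ind v (inv (wdeg u) \<otimes> t) (\<phi> (inv (wdeg u)) \<xi>) else 0)"
proof -
  have "inv (wdeg u) \<otimes> t = wdeg v \<longleftrightarrow> t = wdeg u \<otimes> wdeg v"
    using assms inv_solve_left[of "wdeg v" "wdeg u" t] by auto
  then show ?thesis
    using assms by (auto simp: ind_def wdeg_append wset_append)
qed

text \<open>On words multiplicativity is \<open>ind_append\<close>. The rest regroups a finite sum,
  from products of words to pairs of words and then by the degree of the left factor, until it reads
  as \<open>cp_times_closed_form\<close>.\<close>

lemma rep_times:
  assumes f: "f \<in> carrier fr" and g: "g \<in> carrier fr"
  shows "rep (times_sa fr f g) = times_sa cp (rep f) (rep g)"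
proof (intro ext)
  fix t \<xi>
  interpret fr: star_alg fr
    by (rule star_alg_free)
  note cfg = fr.times_closed[OF f g]
  show "rep (times_sa fr f g) t \<xi> = times_sa cp (rep f) (rep g) t \<xi>"
  proof (cases "t \<in> carrier F")
    case False
    then show ?thesis
      using rep_closed[OF cfg] cp_times_off[OF rep_closed[OF f] rep_closed[OF g] False]
      by (simp add: carrier_cp)
  next
    case True
    let ?S = "{w. f w \<noteq> 0}" and ?S' = "{w. g w \<noteq> 0}"
    note fin = fr_finite[OF f] fr_finite[OF g]
    let ?Z = "(\<lambda>(u, v). u @ v) ` (?S \<times> ?S')"
    have conv: "conv f g w = (\<Sum>(u, v)\<in>?S \<times> ?S'. f u * g v * word (u @ v) w)" for w
      by (rule conv_eq_sum) (simp_all add: fin)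
    have Z: "w \<in> ?Z" if "conv f g w \<noteq> 0" for w
    proof -
      have "(\<Sum>(u, v)\<in>?S \<times> ?S'. f u * g v * word (u @ v) w) \<noteq> 0"
        using that by (simp only: conv[of w] not_False_eq_True)
      then obtain p where "p \<in> ?S \<times> ?S'" "(case p of (u, v) \<Rightarrow> f u * g v * word (u @ v) w) \<noteq> 0"
        by (rule sum.not_neutral_contains_not_neutral)
      then show ?thesis
        by (auto simp: word_def split: if_splits)
    qed
    have "rep (times_sa fr f g) t \<xi> = (\<Sum>w\<in>?Z. conv f g w * ind w t \<xi>)"
      by (simp only: free_star_algebra_simps, rule rep_eq) (use fin Z in auto)
    also have "\<dots> = (\<Sum>w\<in>?Z. \<Sum>(u, v)\<in>?S \<times> ?S'. f u * g v * word (u @ v) w * ind w t \<xi>)"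
      unfolding conv by (simp add: sum_distrib_right case_prod_unfold)
    also have "\<dots> = (\<Sum>(u, v)\<in>?S \<times> ?S'. \<Sum>w\<in>?Z. f u * g v * word (u @ v) w * ind w t \<xi>)"
      by (subst sum.swap) (simp add: case_prod_unfold)
    also have "\<dots> = (\<Sum>(u, v)\<in>?S \<times> ?S'. f u * g v * ind (u @ v) t \<xi>)"
    proof (rule sum.cong[OF refl], clarify)
      fix u v assume uv: "f u \<noteq> 0" "g v \<noteq> 0"
      have "(\<Sum>w\<in>?Z. f u * g v * word (u @ v) w * ind w t \<xi>) =
          (\<Sum>w\<in>?Z. if w = u @ v then f u * g v * ind (u @ v) t \<xi> else 0)"
        by (intro sum.cong) (auto simp: word_def)
      also have "\<dots> = f u * g v * ind (u @ v) t \<xi>"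
        using fin uv by (subst sum.delta) auto
      finally show "(\<Sum>w\<in>?Z. f u * g v * word (u @ v) w * ind w t \<xi>) = f u * g v * ind (u @ v) t \<xi>" .
    qed
    also have "\<dots> = (\<Sum>u\<in>?S. \<Sum>v\<in>?S'. f u * g v * ind (u @ v) t \<xi>)"
      by (simp add: sum.cartesian_product)
    also have "\<dots> = (\<Sum>u\<in>?S. if \<xi> \<in> wset u then f u * rep g (inv (wdeg u) \<otimes> t) (\<phi> (inv (wdeg u)) \<xi>) else 0)"
    proof (rule sum.cong[OF refl])
      fix u assume "u \<in> ?S"
      then have u: "letters u"
        using fr_letters[OF f] by simp
      have "(\<Sum>v\<in>?S'. f u * g v * ind (u @ v) t \<xi>) = (\<Sum>v\<in>?S'. f u * (g v *
          (if \<xi> \<in> wset u then ind v (inv (wdeg u) \<otimes> t) (\<phi> (inv (wdeg u)) \<xi>) else 0)))"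
        using fr_letters[OF g] u True by (intro sum.cong) (simp_all add: ind_append)
      also have "\<dots> = (if \<xi> \<in> wset u then f u * rep g (inv (wdeg u) \<otimes> t) (\<phi> (inv (wdeg u)) \<xi>) else 0)"
        by (simp add: rep_def sum_distrib_left)
      finally show "(\<Sum>v\<in>?S'. f u * g v * ind (u @ v) t \<xi>) =
          (if \<xi> \<in> wset u then f u * rep g (inv (wdeg u) \<otimes> t) (\<phi> (inv (wdeg u)) \<xi>) else 0)" .
    qed
    also have "\<dots> = (\<Sum>u\<in>?S. \<Sum>s\<in>wdeg ` ?S. f u * ind u s \<xi> * rep g (inv s \<otimes> t) (\<phi> (inv s) \<xi>))"
    proof (rule sum.cong[OF refl])
      fix u assume u: "u \<in> ?S"
      have "(\<Sum>s\<in>wdeg ` ?S. f u * ind u s \<xi> * rep g (inv s \<otimes> t) (\<phi> (inv s) \<xi>)) =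
          (\<Sum>s\<in>wdeg ` ?S. if s = wdeg u then
            (if \<xi> \<in> wset u then f u * rep g (inv (wdeg u) \<otimes> t) (\<phi> (inv (wdeg u)) \<xi>) else 0) else 0)"
        by (intro sum.cong) (auto simp: ind_def)
      also have "\<dots> = (if \<xi> \<in> wset u then f u * rep g (inv (wdeg u) \<otimes> t) (\<phi> (inv (wdeg u)) \<xi>) else 0)"
        using fin u by (subst sum.delta) auto
      finally show "(if \<xi> \<in> wset u then f u * rep g (inv (wdeg u) \<otimes> t) (\<phi> (inv (wdeg u)) \<xi>) else 0) =
          (\<Sum>s\<in>wdeg ` ?S. f u * ind u s \<xi> * rep g (inv s \<otimes> t) (\<phi> (inv s) \<xi>))" by simp
    qed
    also have "\<dots> = (\<Sum>s\<in>wdeg ` ?S. rep f s \<xi> * rep g (inv s \<otimes> t) (\<phi> (inv s) \<xi>))"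
      by (subst sum.swap) (simp add: rep_def[of f] sum_distrib_right)
    also have "\<dots> = times_sa cp (rep f) (rep g) t \<xi>"
      using fin fr_letters[OF f]
      by (intro cp_times_closed_form[symmetric] rep_closed f g True rep_supp) auto
    finally show ?thesis .
  qed
qed

lemma rep_star:
  assumes f: "f \<in> carrier fr"
  shows "rep (star_sa fr f) = star_sa cp (rep f)"
proof (intro ext)
  fix t \<xi>
  let ?S = "{w. f w \<noteq> 0}"
  have inj: "inj_on word_star ?S"
    by (rule inj_on_inverseI[where g = word_star]) simp
  have "rep (star_sa fr f) t \<xi> = (\<Sum>w\<in>word_star ` ?S. cnj (f (word_star w)) * ind w t \<xi>)"
    unfolding free_star_algebra_star
  proof (rule rep_eq)
    show "finite (word_star ` ?S)"
      by (simp add: fr_finite[OF f])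
    fix w assume "cnj (f (word_star w)) \<noteq> 0"
    then have "word_star w \<in> ?S" by simp
    then have "word_star (word_star w) \<in> word_star ` ?S" by (rule imageI)
    then show "w \<in> word_star ` ?S" by simp
  qed
  also have "\<dots> = (\<Sum>w\<in>?S. cnj (f w) * ind (word_star w) t \<xi>)"
    by (simp add: sum.reindex[OF inj])
  also have "\<dots> = (\<Sum>w\<in>?S. if t \<in> carrier F \<and> \<xi> \<in> V t then cnj (f w * ind w (inv t) (\<phi> (inv t) \<xi>)) else 0)"
  proof (rule sum.cong[OF refl])
    fix w assume "w \<in> ?S"
    then have w: "letters w"
      using fr_letters[OF f] by simp
    have "t \<in> carrier F \<Longrightarrow> inv t = wdeg w \<longleftrightarrow> t = inv (wdeg w)"
      using wdeg_closed[OF w] by (metis inv_inv)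
    then show "cnj (f w) * ind (word_star w) t \<xi> =
        (if t \<in> carrier F \<and> \<xi> \<in> V t then cnj (f w * ind w (inv t) (\<phi> (inv t) \<xi>)) else 0)"
      using wdeg_closed[OF w] by (auto simp: ind_def wdeg_word_star[OF w] wset_word_star[OF w])
  qed
  also have "\<dots> = star_sa cp (rep f) t \<xi>"
    by (cases "t \<in> carrier F \<and> \<xi> \<in> V t") (auto simp: cp_star rep_def)
  finally show "rep (star_sa fr f) t \<xi> = star_sa cp (rep f) t \<xi>" .
qed

lemma rep_plus:
  assumes f: "f \<in> carrier fr" and g: "g \<in> carrier fr"
  shows "rep (plus_sa fr f g) = plus_sa cp (rep f) (rep g)"
proof (intro ext)
  fix t \<xi>
  let ?S = "{w. f w \<noteq> 0} \<union> {w. g w \<noteq> 0}"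
  have S: "finite ?S"
    using fr_finite[OF f] fr_finite[OF g] by simp
  have "rep (\<lambda>w. f w + g w) t \<xi> = (\<Sum>w\<in>?S. (f w + g w) * ind w t \<xi>)"
    by (rule rep_eq[OF S]) auto
  moreover have "rep f t \<xi> = (\<Sum>w\<in>?S. f w * ind w t \<xi>)" "rep g t \<xi> = (\<Sum>w\<in>?S. g w * ind w t \<xi>)"
    by (rule rep_eq[OF S]; simp)+
  ultimately show "rep (plus_sa fr f g) t \<xi> = plus_sa cp (rep f) (rep g) t \<xi>"
    by (simp add: distrib_right sum.distrib)
qed

lemma rep_scale:
  assumes f: "f \<in> carrier fr"
  shows "rep (scale_sa fr c f) = scale_sa cp c (rep f)"
proof (intro ext)
  fix t \<xi>
  have "rep (\<lambda>w. c * f w) t \<xi> = (\<Sum>w | f w \<noteq> 0. (c * f w) * ind w t \<xi>)"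
    by (rule rep_eq[OF fr_finite[OF f]]) auto
  then show "rep (scale_sa fr c f) t \<xi> = scale_sa cp c (rep f) t \<xi>"
    by (simp add: rep_def sum_distrib_left mult.assoc)
qed

sublocale hom: star_hom_pair fr cp rep
proof -
  interpret fr: star_alg fr
    by (rule star_alg_free)
  show "star_hom_pair fr cp rep"
    by unfold_locales (auto simp: star_hom_def rep_closed rep_plus rep_scale rep_times rep_star
        simp del: cp_simps free_star_algebra_simps)
qed

text \<open>The trivial-degree part of the grading of the free algebra by \<open>F\<close>; products
  \<open>x\<^sup>* x\<close> with \<open>x\<close> homogeneous land here.\<close>

definition fr_one :: "'g star_poly set" where
  "fr_one = {f \<in> carrier fr. \<forall>w. f w \<noteq> 0 \<longrightarrow> wdeg w = \<one>}"

lemma star_times_fr_one: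
  assumes f: "f \<in> carrier fr" and t: "\<And>w. f w \<noteq> 0 \<Longrightarrow> wdeg w = t" and tF: "t \<in> carrier F"
  shows "times_sa fr (star_sa fr f) f \<in> fr_one"
  unfolding fr_one_def
proof (intro CollectI conjI allI impI)
  show "times_sa fr (star_sa fr f) f \<in> carrier fr"
    using f by (intro hom.R.times_closed hom.R.star_closed)
  fix w assume "times_sa fr (star_sa fr f) f w \<noteq> 0"
  then have "(\<Sum>i\<le>length w. cnj (f (word_star (take i w))) * f (drop i w)) \<noteq> 0"
    by (simp add: free_star_algebra_star)
  then obtain i where "cnj (f (word_star (take i w))) * f (drop i w) \<noteq> 0"
    by (rule sum.not_neutral_contains_not_neutral)
  then have nz: "f (word_star (take i w)) \<noteq> 0" "f (drop i w) \<noteq> 0"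
    by auto
  then have l: "letters (take i w)" "letters (drop i w)"
    using fr_letters[OF f nz(1)] fr_letters[OF f nz(2)] by (simp_all only: letters_word_star)
  have "inv (wdeg (take i w)) = t" "wdeg (drop i w) = t"
    using t[OF nz(1)] t[OF nz(2)] wdeg_word_star[OF l(1)] by simp_all
  moreover from this(1) have "wdeg (take i w) = inv t"
    using wdeg_closed[OF l(1)] by auto
  ultimately have "wdeg (take i w @ drop i w) = inv t \<otimes> t"
    using wdeg_append[OF l] by simp
  then show "wdeg w = \<one>"
    using tF by simp
qed

text \<open>The counterpart of \<open>cstar_seminorm_le_l1_norm\<close> on the free algebra, which
  is graded by \<open>wdeg\<close>. The trivial-degree case is left as the hypothesis
  \<open>one\<close>, because the relations have to be used there.\<close>

lemma seminorm_le_l1_norm: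
  assumes p: "cstar_seminorm fr p"
    and one: "\<And>f M. f \<in> fr_one \<Longrightarrow> (\<And>\<xi>. cmod (rep f \<one> \<xi>) \<le> M) \<Longrightarrow> p f \<le> M"
    and f: "f \<in> carrier fr"
  shows "p f \<le> l1_norm (rep f)"
proof -
  interpret p: cstar_seminormed fr p
    by unfold_locales (rule p)
  define part where "part t = (\<lambda>w. if wdeg w = t then f w else 0)" for t
  have part_nz: "f w \<noteq> 0 \<and> wdeg w = t" if "part t w \<noteq> 0" for t w
    using that by (auto simp: part_def split: if_splits)
  have part_carrier: "part t \<in> carrier fr" for t
  proof -
    have "{w. part t w \<noteq> 0} \<subseteq> {w. f w \<noteq> 0}"
      using part_nz by blast
    then have "finite {w. part t w \<noteq> 0}"
      using fr_finite[OF f] by (rule finite_subset)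
    then show ?thesis
      using fr_letters[OF f] part_nz by (auto simp: carrier_free_star_algebra)
  qed
  have rep_part: "rep (part t) = mono t (rep f t)" for t
  proof (intro ext)
    fix s \<xi>
    have "rep (part t) s \<xi> = (\<Sum>w | f w \<noteq> 0. part t w * ind w s \<xi>)"
      by (rule rep_eq[OF fr_finite[OF f]]) (use part_nz in blast)
    also have "\<dots> = (\<Sum>w | f w \<noteq> 0. if s = t then f w * ind w t \<xi> else 0)"
      by (intro sum.cong) (auto simp: part_def ind_def)
    also have "\<dots> = mono t (rep f t) s \<xi>"
      by (simp add: mono_def rep_def)
    finally show "rep (part t) s \<xi> = mono t (rep f t) s \<xi>" .
  qed
  have p_part: "p (part t) \<le> sup_norm (rep f t)" if t: "t \<in> carrier F" for t
  proof -
    have b: "bounded (range (rep f t))"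
      by (rule cp_bounded[OF rep_closed[OF f]])
    have "(p (part t))\<^sup>2 = p (times_sa fr (star_sa fr (part t)) (part t))"
      using p.p_cstar[OF part_carrier] by simp
    also have "\<dots> \<le> (sup_norm (rep f t))\<^sup>2"
    proof (rule one)
      show "times_sa fr (star_sa fr (part t)) (part t) \<in> fr_one"
        using part_nz t by (intro star_times_fr_one part_carrier) auto
      fix \<xi>
      have "rep (times_sa fr (star_sa fr (part t)) (part t)) =
          times_sa cp (star_sa cp (mono t (rep f t))) (mono t (rep f t))"
        using hom.hom_times[OF hom.R.star_closed[OF part_carrier] part_carrier, of t t]
          hom.hom_star[OF part_carrier, of t] by (simp only: rep_part)
      also have "\<dots> = mono \<one> (\<lambda>x. if x \<in> V (inv t) then of_real ((cmod (rep f t (\<phi> t x)))\<^sup>2) else 0)"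
        by (rule star_mono_times_mono[OF t cp_component[OF rep_closed[OF f] t]])
      finally have "cmod (rep (times_sa fr (star_sa fr (part t)) (part t)) \<one> \<xi>) \<le> (cmod (rep f t (\<phi> t \<xi>)))\<^sup>2"
        by (simp add: mono_def norm_power)
      also have "\<dots> \<le> (sup_norm (rep f t))\<^sup>2"
        by (intro power_mono sup_norm_upper[OF b]) simp
      finally show "cmod (rep (times_sa fr (star_sa fr (part t)) (part t)) \<one> \<xi>) \<le> (sup_norm (rep f t))\<^sup>2" .
    qed
    finally show ?thesis
      by (rule power2_le_imp_le[OF _ sup_norm_nonneg[OF b]])
  qed
  let ?cut = "\<lambda>S w. if wdeg w \<in> S then f w else 0"
  have "?cut S \<in> carrier fr \<and> p (?cut S) \<le> (\<Sum>t\<in>S. sup_norm (rep f t))"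
    if "finite S" "S \<subseteq> carrier F" for S
    using that
  proof (induction S)
    case empty
    have eq: "?cut {} = scale_sa fr 0 f"
      by (auto simp: fun_eq_iff)
    show ?case
      unfolding eq using p.p_scale[OF f, of 0] hom.R.scale_closed[OF f, of 0] by simp
  next
    case (insert t S)
    have eq: "?cut (insert t S) = plus_sa fr (part t) (?cut S)"
      using insert.hyps by (auto simp: fun_eq_iff part_def)
    have c: "?cut S \<in> carrier fr" "p (?cut S) \<le> (\<Sum>t\<in>S. sup_norm (rep f t))"
      using insert by auto
    have "p (plus_sa fr (part t) (?cut S)) \<le> p (part t) + p (?cut S)"
      by (rule p.p_plus[OF part_carrier c(1)])
    moreover have "p (part t) \<le> sup_norm (rep f t)"
      using insert.prems by (intro p_part) simp
    ultimately show ?case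
      unfolding eq using hom.R.plus_closed[OF part_carrier c(1)] c insert.hyps by simp
  qed
  note cut = this
  let ?S = "wdeg ` {w. f w \<noteq> 0}"
  have S: "finite ?S" "?S \<subseteq> carrier F"
    using fr_finite[OF f] fr_letters[OF f] by auto
  have "?cut ?S = f"
    by (auto simp: fun_eq_iff)
  then have "p f \<le> (\<Sum>t\<in>?S. sup_norm (rep f t))"
    using cut[OF S] by simp
  also have "\<dots> = l1_norm (rep f)"
    by (rule l1_norm_eq[OF S(1) rep_supp, symmetric])
  finally show ?thesis .
qed

end

section \<open>Representing the generators in the crossed product\<close>

abbreviation Pl :: "'v set \<Rightarrow> ('v, 'a) generator \<times> bool" where "Pl A \<equiv> (Proj A, False)"
abbreviation Sl :: "'a \<Rightarrow> ('v, 'a) generator \<times> bool" where "Sl a \<equiv> (Isom a, False)"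
abbreviation Sl' :: "'a \<Rightarrow> ('v, 'a) generator \<times> bool" where "Sl' a \<equiv> (Isom a, True)"

primrec gen_deg :: "('v, 'a) generator \<Rightarrow> 'a letter list" where
  "gen_deg (Proj A) = []"
| "gen_deg (Isom a) = [Pos a]"

context normal_labelled_space
begin

primrec gen_set :: "('a, 'c) generator \<Rightarrow> ('c list \<times> 'a set) option set set" where
  "gen_set (Proj A) = cyl ([], A)"
| "gen_set (Isom a) = cyl (ran_elem a)"

lemma V_action_single: "V_action [x] = V_letter x"
  using phi_letter_mem[of _ "inv_letter x"] V_letter_tight[of "inv_letter x"]
  by (auto simp: V_action_Cons)

lemma indicator_cyl_C0: "elem e \<Longrightarrow> cyl e \<subseteq> U \<Longrightarrow> U \<subseteq> tight \<Longrightarrow> indicator (cyl e) \<in> C0 tight_topology U"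
  by (rule approximable_C0) (auto intro: approximable_simple simple_funs.basis indicator_simps(2))

lemma generators_iff: "Proj A \<in> generators \<longleftrightarrow> A \<in> B" "Isom a \<in> generators"
  by (auto simp: generators_def)

sublocale gen: crossed_generators free_group tight V_action phi tight_topology generators gen_deg gen_set
proof (intro crossed_generators.intro crossed_algebra_tight crossed_generators_axioms.intro)
  fix g :: "('a, 'c) generator"
  assume g: "g \<in> generators"
  show "gen_deg g \<in> carrier free_group"
    by (cases g) auto
  show "indicator (gen_set g) \<in> C0 tight_topology (V_action (gen_deg g))"
  proof (cases g)
    case (Proj A)
    then have "elem ([], A)"
      using g by (simp add: generators_iff elem_Nil_iff)
    then show ?thesis
      using indicator_cyl_C0[of "([], A)" tight] by (simp add: Proj cyl_subset)
  next
    case (Isom a)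
    then show ?thesis
      using indicator_cyl_C0[of "ran_elem a" "V_letter (Pos a)"] V_letter_tight[of "Pos a"]
      by (simp add: V_action_single V_letter_cyl)
  qed
qed

abbreviation gw :: "(('a, 'c) generator \<times> bool) list \<Rightarrow> bool" where
  "gw w \<equiv> fst ` set w \<subseteq> generators"

lemma inv_free_group_simps [simp]:
  "inv\<^bsub>free_group\<^esub> [] = []" "inv\<^bsub>free_group\<^esub> [x] = [inv_letter x]"
  by (simp_all add: inv_free_group)

text \<open>With the following rules the set of a word is evaluated letter by letter without
  unfolding degrees: \<open>Sl a\<close> pulls back along cutting and \<open>Sl' a\<close> along
  gluing. They replace the recursion equation, which leaves the simpset below.\<close>

lemma wset_Pl [simp]: "gen.wset (Pl A # w) = cyl ([], A) \<inter> gen.wset w"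
  by (auto simp: gen.lset_def gen.ldeg_def)

lemma wset_Pl_star [simp]: "gen.wset ((Proj A, True) # w) = cyl ([], A) \<inter> gen.wset w"
  using cyl_subset by (auto simp: gen.lset_def gen.ldeg_def)

lemma wset_Sl [simp]: "gen.wset (Sl a # w) = {\<xi> \<in> V_letter (Pos a). phi_letter (Neg a) \<xi> \<in> gen.wset w}"
  by (auto simp: gen.lset_def gen.ldeg_def V_letter_cyl)

lemma wset_Sl' [simp]: "gen.wset (Sl' a # w) = {\<xi> \<in> V_letter (Neg a). phi_letter (Pos a) \<xi> \<in> gen.wset w}"
  using phi_letter_mem[of _ "Pos a"] by (auto simp: gen.lset_def gen.ldeg_def V_action_single V_letter_cyl)

lemma ldeg_simps [simp]:
  "gen.ldeg (Proj A, b) = []" "gen.ldeg (Sl a) = [Pos a]" "gen.ldeg (Sl' a) = [Neg a]"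
  by (simp_all add: gen.ldeg_def)

declare gen.wset.simps(2) [simp del]

lemma phi_Neg_mem: "\<xi> \<in> V_letter (Pos a) \<Longrightarrow> phi_letter (Neg a) \<xi> \<in> V_letter (Neg a)"
  and phi_Pos_mem: "\<xi> \<in> V_letter (Neg a) \<Longrightarrow> phi_letter (Pos a) \<xi> \<in> V_letter (Pos a)"
  using phi_letter_mem[of \<xi> "Neg a"] phi_letter_mem[of \<xi> "Pos a"] by simp_all

lemma phi_Neg_tight: "\<xi> \<in> V_letter (Pos a) \<Longrightarrow> phi_letter (Neg a) \<xi> \<in> tight"
  and phi_Pos_tight: "\<xi> \<in> V_letter (Neg a) \<Longrightarrow> phi_letter (Pos a) \<xi> \<in> tight"
  using phi_Neg_mem phi_Pos_mem V_letter_tight by blast+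

lemmas phi_mem = phi_Neg_mem phi_Pos_mem phi_Neg_tight phi_Pos_tight

lemma V_letter_disjoint: "a \<noteq> b \<Longrightarrow> V_letter (Pos a) \<inter> V_letter (Pos b) = {}"
  using filter_comparable[OF tight_filter, of _ "ran_elem a" "ran_elem b"]
  by (auto simp: V_letter_cyl mem_cyl)

text \<open>Relation (ii) on the level of sets. It is the rule for layer 0 in the definition of
  gluing: \<open>A\<close> lies there exactly if \<open>relrange A [a]\<close> lies in layer 0 of
  the filter being glued.\<close>

lemma wset_proj_isom:
  assumes "A \<in> B"
  shows "gen.wset [Pl A, Sl a] = gen.wset [Sl a, Pl (relrange A [a])]"
proof -
  have "phi_letter (Neg a) \<xi> \<in> cyl ([], relrange A [a]) \<longleftrightarrow> \<xi> \<in> cyl ([], A)"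
    if \<xi>: "\<xi> \<in> V_letter (Pos a)" for \<xi>
  proof -
    let ?\<zeta> = "phi_letter (Neg a) \<xi>"
    have \<zeta>: "?\<zeta> \<in> cyl (dom_elem a)"
      using phi_Neg_mem[OF \<xi>] by (simp add: V_letter_cyl)
    have "\<xi> = glue1 a ?\<zeta>"
      using phi_letter_inverse[of \<xi> "Neg a"] \<xi> phi_letter_Pos[OF \<zeta>] by simp
    then have "Some ([], A) \<in> \<xi> \<longleftrightarrow> Some ([], relrange A [a]) \<in> ?\<zeta>"
      using glue1_simps(2)[of A a ?\<zeta>] assms by simp
    then show ?thesis
      using \<zeta> \<xi> V_letter_tight[of "Pos a"] by (auto simp: mem_cyl)
  qed
  then show ?thesis
    using V_letter_tight[of "Neg a"] phi_Neg_mem[of _ a] V_letter_tight[of "Pos a"] by auto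
qed

text \<open>The word for the projection \<open>s_\<alpha> p_A s_\<alpha>^*\<close> attached to the
  idempotent \<open>(\<alpha>, A, \<alpha>)\<close>.\<close>

definition pe :: "'c list \<times> 'a set \<Rightarrow> (('a, 'c) generator \<times> bool) list" where
  "pe e = map Sl (fst e) @ [Pl (snd e)] @ map Sl' (rev (fst e))"

lemma gw_pe: "elem e \<Longrightarrow> gw (pe e)"
  by (auto simp: pe_def elem_def generators_iff)

lemma wdeg_Sl: "gen.wdeg (map Sl \<alpha>) = map Pos \<alpha>"
proof (induction \<alpha>)
  case (Cons a \<alpha>)
  have "reduced (Pos a # map Pos \<alpha>)"
    by (induction \<alpha> arbitrary: a) auto
  with Cons show ?case by (simp add: letter_mult_reduced)
qed simp

lemma gw_Sl [simp]: "gw (map Sl \<alpha>)" "gw (map Sl' \<alpha>)"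
  by (auto simp: generators_iff)

lemma word_star_Sl: "word_star (map Sl \<alpha>) = map Sl' (rev \<alpha>)"
  by (simp add: word_star_def rev_map)

text \<open>The degree is \<open>\<alpha>\<close> times the inverse of \<open>\<beta>\<close> in the
  free group, and positive words embed injectively.\<close>

lemma wdeg_nf:
  assumes A: "A \<in> B"
  shows "gen.wdeg (map Sl \<alpha> @ [Pl A] @ map Sl' (rev \<beta>)) = [] \<longleftrightarrow> \<alpha> = \<beta>"
proof -
  let ?u = "gen.wdeg (map Sl \<alpha>)" and ?v = "gen.wdeg (map Sl \<beta>)"
  have Pl: "gw [Pl A]" "gw ([Pl A] @ map Sl' (rev \<beta>))"
    using A by (auto simp: generators_iff)
  have u: "?u \<in> carrier free_group" and v: "?v \<in> carrier free_group"
    by (simp_all only: gen.wdeg_closed gw_Sl)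
  have "gen.wdeg ([Pl A] @ map Sl' (rev \<beta>)) = \<one>\<^bsub>free_group\<^esub> \<otimes>\<^bsub>free_group\<^esub> gen.wdeg (map Sl' (rev \<beta>))"
    unfolding gen.wdeg_append[OF Pl(1) gw_Sl(2)] by simp
  also have "\<dots> = inv\<^bsub>free_group\<^esub> ?v"
    using gen.wdeg_word_star[OF gw_Sl(1), of \<beta>] v by (simp only: word_star_Sl gen.l_one gen.inv_closed)
  finally have "gen.wdeg (map Sl \<alpha> @ [Pl A] @ map Sl' (rev \<beta>)) = ?u \<otimes>\<^bsub>free_group\<^esub> inv\<^bsub>free_group\<^esub> ?v"
    using gen.wdeg_append[OF gw_Sl(1) Pl(2), of \<alpha>] by (simp only:)
  moreover have "?u \<otimes>\<^bsub>free_group\<^esub> inv\<^bsub>free_group\<^esub> ?v = \<one>\<^bsub>free_group\<^esub> \<longleftrightarrow> ?u = ?v"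
    using gen.inv_equality[of ?u "inv\<^bsub>free_group\<^esub> ?v"] gen.inv_inv[OF v] gen.inv_closed[OF v] gen.r_inv[OF v] u
    by metis
  moreover have "?u = ?v \<longleftrightarrow> \<alpha> = \<beta>"
    by (simp add: wdeg_Sl inj_map_eq_map inj_def)
  ultimately show ?thesis by simp
qed

text \<open>Conjugating by \<open>s_a\<close> on words corresponds to prefixing \<open>a\<close> on
  idempotents, since cutting \<open>a\<close> off a filter turns membership of
  \<open>(a # \<alpha>, A)\<close> into membership of \<open>(\<alpha>, A)\<close>.\<close>

lemma wset_pe:
  assumes "elem e"
  shows "gen.wset (pe e) = cyl e"
proof -
  have "gen.wset (pe (\<alpha>, A)) = cyl (\<alpha>, A)" if "elem (\<alpha>, A)" for \<alpha> A
    using that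
  proof (induction \<alpha>)
    case Nil
    then show ?case
      using cyl_subset by (auto simp: pe_def)
  next
    case (Cons a \<alpha>)
    have e: "elem (\<alpha>, A)" and A: "A \<in> B" "A \<inter> range_of (a # \<alpha>) = A"
      using elem_ConsD[OF Cons.prems] Cons.prems by (auto simp: elem_def)
    have w: "pe (a # \<alpha>, A) = Sl a # (pe (\<alpha>, A) @ [Sl' a])"
      by (simp add: pe_def)
    have "gen.wdeg (pe (\<alpha>, A)) = []"
      unfolding pe_def fst_conv snd_conv by (simp only: wdeg_nf[OF A(1)])
    then have "gen.wset (pe (\<alpha>, A) @ [Sl' a]) = cyl (\<alpha>, A) \<inter> V_letter (Neg a)"
      using gen.wset_append[OF gw_pe[OF e], of "[Sl' a]"] Cons.IH[OF e] phi_Pos_mem[of _ a] V_letter_tight[of "Pos a"]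
      by (auto simp: generators_iff)
    then have "gen.wset (pe (a # \<alpha>, A)) = {\<xi> \<in> V_letter (Pos a). phi_letter (Neg a) \<xi> \<in> cyl (\<alpha>, A)}"
      using phi_Neg_mem[of _ a] by (auto simp: w)
    also have "\<dots> = cyl (a # \<alpha>, A)"
    proof (rule Set.set_eqI)
      fix \<xi>
      have "\<xi> \<in> V_letter (Pos a)" if "\<xi> \<in> cyl (a # \<alpha>, A)"
        using that filter_range_of[of \<xi> "[a]" \<alpha> A] tight_filter[of \<xi>] by (simp add: V_letter_cyl mem_cyl)
      moreover have "phi_letter (Neg a) \<xi> \<in> cyl (\<alpha>, A) \<longleftrightarrow> \<xi> \<in> cyl (a # \<alpha>, A)" if \<xi>: "\<xi> \<in> V_letter (Pos a)"
      proof -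
        have \<zeta>: "phi_letter (Neg a) \<xi> \<in> tight"
          using phi_Neg_mem[OF \<xi>] V_letter_tight by blast
        have "phi_letter (Neg a) \<xi> = unglue1 a \<xi>"
          using \<xi> by (intro phi_letter_Neg) (simp add: V_letter_cyl)
        then have "Some (\<alpha>, A) \<in> phi_letter (Neg a) \<xi> \<longleftrightarrow> Some (a # \<alpha>, A) \<in> \<xi>"
          using unglue1_simps(2)[of \<alpha> A a \<xi>] e A by simp
        then show ?thesis
          using \<zeta> \<xi> V_letter_tight by (auto simp: mem_cyl)
      qed
      ultimately show "\<xi> \<in> {\<xi> \<in> V_letter (Pos a). phi_letter (Neg a) \<xi> \<in> cyl (\<alpha>, A)} \<longleftrightarrow> \<xi> \<in> cyl (a # \<alpha>, A)"
        by blast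
    qed
    finally show ?case .
  qed
  from this[of "fst e" "snd e"] assms show ?thesis by simp
qed

text \<open>Elements with second component \<open>{}\<close> stand for \<open>0\<close>, so this is a cover in the sense of Exel.\<close>

definition covers :: "('c list \<times> 'a set) set \<Rightarrow> 'c list \<times> 'a set \<Rightarrow> bool" where
  "covers Z e \<longleftrightarrow> (\<forall>g. elem g \<longrightarrow> snd g \<noteq> {} \<longrightarrow> ple g e \<longrightarrow> (\<exists>z\<in>Z. snd (emeet g z) \<noteq> {}))"

lemma coversD: "covers Z e \<Longrightarrow> elem g \<Longrightarrow> snd g \<noteq> {} \<Longrightarrow> ple g e \<Longrightarrow> \<exists>z\<in>Z. snd (emeet g z) \<noteq> {}"
  unfolding covers_def by (drule spec[of _ g]) simp

text \<open>If no \<open>z\<close> belonged to \<open>\<eta>\<close>, each would be disjoint from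
  some element of \<open>\<eta>\<close>. Meeting these finitely many elements with \<open>e\<close>
  gives a nonzero \<open>g\<close> below \<open>e\<close> disjoint from all of
  \<open>Z\<close>.\<close>

lemma ultrafilter_covers:
  assumes u: "is_ultrafilter ES None \<eta>" and Z: "finite Z" "\<forall>z\<in>Z. elem z"
    and e: "Some e \<in> \<eta>" and c: "covers Z e"
  shows "\<exists>z\<in>Z. Some z \<in> \<eta>"
proof (rule ccontr)
  assume n: "\<not> (\<exists>z\<in>Z. Some z \<in> \<eta>)"
  note f = ultrafilter_filter[OF u]
  have "\<exists>g. Some g \<in> \<eta> \<and> ple g e \<and> (\<forall>z\<in>Z. snd (emeet g z) = {})"
    using Z n
  proof (induction Z)
    case empty
    then show ?case
      using e by (intro exI[of _ e]) simp
  next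
    case (insert z Z)
    then obtain g where g: "Some g \<in> \<eta>" "ple g e" "\<forall>z\<in>Z. snd (emeet g z) = {}"
      by auto
    obtain h where h: "Some h \<in> \<eta>" "snd (emeet h z) = {}"
      using ultrafilter_disjoint[OF u, of z] insert.prems by auto
    let ?k = "emeet g h"
    have k: "Some ?k \<in> \<eta>"
      by (rule filter_emeet[OF f g(1) h(1)])
    have el: "elem g" "elem h" "elem ?k" "snd ?k \<noteq> {}"
      using filter_elem[OF f g(1)] filter_elem[OF f h(1)] filter_elem[OF f k] by auto
    then have le: "ple ?k g" "ple ?k h"
      using emeet_ple[of g h] by auto
    have disj: "snd (emeet ?k y) = {}" if y: "elem y" and x: "elem x" "ple ?k x" "snd (emeet x y) = {}" for x y
    proof (rule ccontr)
      assume ne: "snd (emeet ?k y) \<noteq> {}"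
      then have "ple (emeet ?k y) x" "ple (emeet ?k y) y"
        using emeet_ple[OF el(3) y ne] ple_trans[OF _ x(2)] by auto
      with emeet_nonempty[OF x(1) y ne] x(3) show False by blast
    qed
    have "ple ?k e"
      by (rule ple_trans[OF le(1) g(2)])
    moreover have "snd (emeet ?k y) = {}" if "y \<in> insert z Z" for y
      using that disj[of z h] disj[of y g] le el h(2) g(3) insert.prems by auto
    ultimately show ?case
      using k by blast
  qed
  then obtain g where g: "Some g \<in> \<eta>" "ple g e" "\<forall>z\<in>Z. snd (emeet g z) = {}"
    by auto
  then show False
    using coversD[OF c, of g] filter_elem[OF f g(1)] by auto
qed

text \<open>Only finitely many memberships are involved, so what \<open>ultrafilter_covers\<close>
  says of ultrafilters passes to their limits.\<close>

lemma cyl_covers: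
  assumes e: "elem e" and Z: "finite Z" "\<forall>z\<in>Z. elem z" and c: "covers Z e"
  shows "cyl e \<subseteq> (\<Union>z\<in>Z. cyl z)"
proof
  fix \<xi> assume "\<xi> \<in> cyl e"
  then have \<xi>: "\<xi> \<in> tight" "Some e \<in> \<xi>"
    by (simp_all add: mem_cyl)
  \<comment> \<open>Pairs with empty second component stand for 0 and are not test elements; no
    filter contains them.\<close>
  let ?F = "Some ` {z \<in> insert e Z. snd z \<noteq> {}}"
  have "finite ?F" "?F \<subseteq> carrier ES"
    using e Z by auto
  then obtain \<eta> where u: "is_ultrafilter ES None \<eta>" and \<eta>: "?F \<inter> \<eta> = ?F \<inter> \<xi>"
    using tight_approx[OF \<xi>(1)] by blast
  have mem: "Some z \<in> \<eta> \<longleftrightarrow> Some z \<in> \<xi>" if "z \<in> insert e Z" "snd z \<noteq> {}" for z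
    using that by (intro inter_eq_mem_iff[OF \<eta>]) blast
  have "Some e \<in> \<eta>"
    using mem[of e] \<xi> filter_elem[OF tight_filter[OF \<xi>(1)] \<xi>(2)] by simp
  then obtain z where z: "z \<in> Z" "Some z \<in> \<eta>"
    using ultrafilter_covers[OF u Z _ c] by blast
  then have "Some z \<in> \<xi>"
    using mem[of z] filter_elem[OF ultrafilter_filter[OF u] z(2)] by simp
  then show "\<xi> \<in> (\<Union>z\<in>Z. cyl z)"
    using z \<xi> by (auto simp: mem_cyl)
qed

lemma cyl_mono:
  assumes "elem f" "ple e f"
  shows "cyl e \<subseteq> cyl f"
  using filter_up[OF tight_filter _ assms] by (auto simp: mem_cyl)

text \<open>The two pieces cover the union: relative ranges are additive, so a nonempty set inside
  the range of the union meets one of the two ranges.\<close>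

lemma cyl_Nil_Un:
  assumes A: "A \<in> B" and A': "A' \<in> B"
  shows "cyl ([], A \<union> A') = cyl ([], A) \<union> cyl ([], A')"
proof
  have el: "elem ([], A \<union> A')" "elem ([], A)" "elem ([], A')"
    using A A' by (simp_all add: elem_Nil_iff B_Un)
  show "cyl ([], A) \<union> cyl ([], A') \<subseteq> cyl ([], A \<union> A')"
    using cyl_mono[OF el(1), of "([], A)"] cyl_mono[OF el(1), of "([], A')"] by (simp add: ple_Nil_iff)
  have "covers {([], A), ([], A')} ([], A \<union> A')"
    unfolding covers_def
  proof (intro allI impI)
    fix g assume "elem g" "snd g \<noteq> {}" "ple g ([], A \<union> A')"
    then have "snd g \<inter> relrange A (fst g) \<noteq> {} \<or> snd g \<inter> relrange A' (fst g) \<noteq> {}"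
      using ple_Nil_iff[of "fst g" "snd g" "A \<union> A'"] relrange_Un[of A A' "fst g"] by auto
    then show "\<exists>z\<in>{([], A), ([], A')}. snd (emeet g z) \<noteq> {}"
      using emeet_Nil_right[of "fst g" "snd g" A] emeet_Nil_right[of "fst g" "snd g" A'] by auto
  qed
  from cyl_covers[OF el(1) _ _ this] el show "cyl ([], A \<union> A') \<subseteq> cyl ([], A) \<union> cyl ([], A')"
    by auto
qed

text \<open>The one-letter extensions cover \<open>([], A)\<close>: an element with word
  \<open>[]\<close> is not made of sinks and so emits a label, and an element with a longer word
  begins with a label emitted by \<open>A\<close>.\<close>

lemma cyl_cuntz_krieger:
  assumes A: "A \<in> B" and fin: "finite (out_labels A)" and sinks: "\<not> (\<exists>A'\<in>B. A' \<noteq> {} \<and> A' \<subseteq> A \<inter> sinks)"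
  shows "cyl ([], A) = (\<Union>a\<in>out_labels A. cyl ([a], relrange A [a]))"
proof
  have elA: "elem ([], A)"
    using A by (simp add: elem_Nil_iff)
  have el: "elem ([a], relrange A [a])" for a
    using A by (simp add: elem_def relrange_range_of')
  show "(\<Union>a\<in>out_labels A. cyl ([a], relrange A [a])) \<subseteq> cyl ([], A)"
    by (intro UN_least cyl_mono[OF elA]) (simp add: ple_Nil_iff)
  let ?Z = "(\<lambda>a. ([a], relrange A [a])) ` out_labels A"
  have "covers ?Z ([], A)"
    unfolding covers_def
  proof (intro allI impI)
    fix g assume g: "elem g" "snd g \<noteq> {}" "ple g ([], A)"
    then have le: "snd g \<subseteq> relrange A (fst g)"
      using ple_Nil_iff[of "fst g" "snd g" A] by simp
    show "\<exists>z\<in>?Z. snd (emeet g z) \<noteq> {}"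
    proof (cases "fst g")
      case Nil
      then have "snd g \<in> B" "snd g \<subseteq> A"
        using g le by (auto simp: elem_def)
      then have "out_labels (snd g) \<noteq> {}"
        using sinks g(2) by (intro out_labels_nonempty B_verts) auto
      then obtain a where "relrange (snd g) [a] \<noteq> {}"
        by (auto simp: out_labels_def)
      moreover have "relrange (snd g) [a] \<subseteq> relrange A [a]"
        using \<open>snd g \<subseteq> A\<close> by (rule relrange_mono)
      moreover have "emeet g ([a], relrange A [a]) = ([a], relrange A [a] \<inter> relrange (snd g) [a])"
        using emeet_Nil_left[of "snd g" "[a]" "relrange A [a]"] Nil by (cases g) simp
      ultimately show ?thesis
        by (intro bexI[of _ "([a], relrange A [a])"]) (auto simp: out_labels_def)
    next
      case (Cons b \<beta>)
      have "snd g \<subseteq> relrange (relrange A [b]) \<beta>"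
        using le by (simp add: Cons relrange_Cons[of A b \<beta>])
      moreover from this have "relrange A [b] \<noteq> {}"
        using g(2) by auto
      moreover have "emeet g ([b], relrange A [b]) = (b # \<beta>, snd g \<inter> relrange (relrange A [b]) \<beta>)"
        using emeet_left[of "[b]" \<beta> "snd g" "relrange A [b]"] Cons by (cases g) simp
      ultimately show ?thesis
        using g(2) by (intro bexI[of _ "([b], relrange A [b])"]) (auto simp: out_labels_def)
    qed
  qed
  from cyl_covers[OF elA _ _ this] fin el show "cyl ([], A) \<subseteq> (\<Union>a\<in>out_labels A. cyl ([a], relrange A [a]))"
    by auto
qed

lemma cyl_letter_disjoint: "cyl ([a], A) \<inter> cyl ([b], C) = {}" if "a \<noteq> b"
  using that filter_comparable[OF tight_filter, of _ "([a], A)" "([b], C)"] by (auto simp: mem_cyl)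

section \<open>The relations hold in the crossed product\<close>

lemma free_proj_word: "free_proj A = word [Pl A]"
  and free_isom_word: "free_isom a = word [Sl a]"
  by (simp_all add: free_proj_def free_isom_def free_gen_word)

lemmas relation_words = free_proj_word free_isom_word free_star_algebra_simps star_word conv_word_word

lemma relations_carrier:
  assumes "(x, y) \<in> relations"
  shows "x \<in> carrier gen.fr \<and> y \<in> carrier gen.fr"
proof -
  have w: "word w \<in> carrier gen.fr" if "w \<noteq> []" "gw w" for w
    using that by (rule word_carrier)
  from assms show ?thesis
  proof cases
    case (proj_Un A A')
    have "(\<lambda>w. word [Pl A] w + word [Pl A'] w - word [Pl (A \<inter> A')] w) =
        diff_sa gen.fr (plus_sa gen.fr (word [Pl A]) (word [Pl A'])) (word [Pl (A \<inter> A')])"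
      by simp
    also have "\<dots> \<in> carrier gen.fr"
      using proj_Un by (intro gen.hom.R.diff_closed gen.hom.R.plus_closed w) (auto simp: generators_iff B_Int)
    finally show ?thesis
      using proj_Un by (simp add: relation_words w generators_iff B_Un)
  next
    case (cuntz_krieger A)
    have "(\<lambda>w. \<Sum>a\<in>I. word [Sl a, Pl (relrange A [a]), Sl' a] w) \<in> carrier gen.fr" if "finite I" for I
      using that
    proof induction
      case empty
      then show ?case by (simp add: carrier_free_star_algebra)
    next
      case (insert a I)
      have "plus_sa gen.fr (word [Sl a, Pl (relrange A [a]), Sl' a]) (\<lambda>w. \<Sum>a\<in>I. word [Sl a, Pl (relrange A [a]), Sl' a] w)
          \<in> carrier gen.fr"
        using cuntz_krieger by (intro gen.hom.R.plus_closed w insert.IH) (auto simp: generators_iff)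
      then show ?case
        using insert by simp
    qed
    then show ?thesis
      using cuntz_krieger by (simp add: relation_words w generators_iff)
  qed (auto simp: relation_words w generators_iff B_Int carrier_free_star_algebra[of "\<lambda>w. 0"])
qed

lemma relations_rep:
  assumes "(x, y) \<in> relations"
  shows "gen.rep x = gen.rep y"
proof -
  have eq: "gen.rep (word u) = gen.rep (word v)" if "gen.wdeg u = gen.wdeg v" "gen.wset u = gen.wset v" for u v
    using that by (simp add: gen.rep_word)
  have zero: "gen.rep (word u) = gen.rep (\<lambda>w. 0)" if "gen.wset u = {}" for u
    using that unfolding gen.rep_word_ind by (simp add: fun_eq_iff gen.ind_def gen.rep_def)
  from assms show ?thesis
  proof cases
    case (proj_idem A)
    then show ?thesis
      by (simp add: relation_words eq)
  next
    case (proj_selfadj A)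
    then show ?thesis
      by (simp add: relation_words eq)
  next
    case (partial_isometry a)
    then show ?thesis
      by (auto simp: relation_words phi_mem intro!: eq)
  next
    case (proj_Int A A')
    then have "cyl ([], A \<inter> A') = cyl ([], A) \<inter> cyl ([], A')"
      using cyl_emeet[of "([], A)" "([], A')"] by (simp add: elem_Nil_iff emeet_Nil_right)
    with proj_Int show ?thesis
      by (auto simp: relation_words intro!: eq)
  next
    case (proj_Un A A')
    have int: "cyl ([], A \<inter> A') = cyl ([], A) \<inter> cyl ([], A')"
      using proj_Un cyl_emeet[of "([], A)" "([], A')"] by (simp add: elem_Nil_iff emeet_Nil_right)
    let ?I = "{Pl A, Pl A', Pl (A \<inter> A')}"
    \<comment> \<open>The right-hand side is rewritten as an indexed combination of words, the shape
      treated by \<open>rep_sum_words\<close>.\<close>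
    have y: "y = (\<lambda>w. \<Sum>i\<in>{0, 1, 2 :: nat}. [1, 1, -1] ! i * word ([[Pl A], [Pl A'], [Pl (A \<inter> A')]] ! i) w)"
      using proj_Un by (simp add: relation_words algebra_simps)
    have "gen.rep y t \<xi> = gen.ind [Pl A] t \<xi> + gen.ind [Pl A'] t \<xi> - gen.ind [Pl (A \<inter> A')] t \<xi>" for t \<xi>
      unfolding y by (subst gen.rep_sum_words) simp_all
    moreover have "gen.ind [Pl A] t \<xi> + gen.ind [Pl A'] t \<xi> - gen.ind [Pl (A \<inter> A')] t \<xi> = gen.ind [Pl (A \<union> A')] t \<xi>" for t \<xi>
      using cyl_Nil_Un[of A A'] proj_Un int cyl_subset by (auto simp: gen.ind_def)
    ultimately show ?thesis
      unfolding proj_Un(1) free_proj_word gen.rep_word_ind by (simp add: fun_eq_iff)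
  next
    case proj_empty
    then show ?thesis
      using zero[of "[Pl {}]"] cyl_empty[of "([], {})"] by (simp add: relation_words)
  next
    case (proj_isom A a)
    then show ?thesis
      using wset_proj_isom[of A a] by (simp add: relation_words eq del: wset_Pl wset_Sl)
  next
    case (isom_isom a)
    then show ?thesis
      by (auto simp: relation_words V_letter_cyl(2)[symmetric] phi_mem V_letter_tight[THEN subsetD] intro!: eq)
  next
    case (isom_orth b a)
    then show ?thesis
      using V_letter_disjoint[of b a, unfolded disjoint_iff] phi_Pos_mem[of _ b]
      by (auto simp: relation_words intro!: zero)
  next
    case (cuntz_krieger A)
    let ?w = "\<lambda>a. [Sl a, Pl (relrange A [a]), Sl' a]"
    have w: "?w a = pe ([a], relrange A [a])" for a
      by (simp add: pe_def)
    have ws: "gen.wset (?w a) = cyl ([a], relrange A [a])" "gen.wdeg (?w a) = []" for a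
      using wset_pe[of "([a], relrange A [a])"] cuntz_krieger
      by (simp_all add: w[symmetric] elem_def relrange_range_of')
    have "gen.rep y t \<xi> = (\<Sum>a\<in>out_labels A. 1 * gen.ind (?w a) t \<xi>)" for t \<xi>
      using cuntz_krieger gen.rep_sum_words[of "out_labels A" "\<lambda>a. 1" ?w t \<xi>] by (simp add: relation_words)
    moreover have "(\<Sum>a\<in>out_labels A. 1 * gen.ind (?w a) t \<xi>) = gen.ind [Pl A] t \<xi>" for t \<xi>
    proof -
      have "gen.ind (?w a) t \<xi> = (if t = [] \<and> \<xi> \<in> cyl ([a], relrange A [a]) then 1 else 0)" for a
        unfolding gen.ind_def ws ..
      moreover have "gen.ind [Pl A] t \<xi> = (if t = [] \<and> (\<exists>a\<in>out_labels A. \<xi> \<in> cyl ([a], relrange A [a])) then 1 else 0)"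
        using cyl_cuntz_krieger[of A] cuntz_krieger cyl_subset[of "([], A)"] by (auto simp: gen.ind_def)
      \<comment> \<open>Cylinders of different letters are disjoint, so at most one summand is
        nonzero and the sum of indicators is the indicator of the union.\<close>
      moreover have "(\<Sum>a\<in>out_labels A. 1 * (if t = [] \<and> \<xi> \<in> cyl ([a], relrange A [a]) then 1 else 0)) =
          (if t = [] \<and> (\<exists>a\<in>out_labels A. \<xi> \<in> cyl ([a], relrange A [a])) then 1 else (0 :: complex))"
      proof (cases "t = [] \<and> (\<exists>a\<in>out_labels A. \<xi> \<in> cyl ([a], relrange A [a]))")
        case True
        then obtain b where b: "b \<in> out_labels A" "\<xi> \<in> cyl ([b], relrange A [b])"
          by blast
        have "\<xi> \<in> cyl ([a], relrange A [a]) \<longleftrightarrow> a = b" for a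
          using cyl_letter_disjoint[of a b] b(2) by blast
        with True b cuntz_krieger show ?thesis by simp
      qed auto
      ultimately show ?thesis by (simp only:)
    qed
    ultimately show ?thesis
      unfolding cuntz_krieger(1) free_proj_word gen.rep_word_ind by (simp add: fun_eq_iff)
  qed
qed

end

section \<open>Words modulo the relations\<close>

text \<open>One C*-seminorm respecting the relations takes the place of a representation; being zero
  in the quotient becomes \<open>null\<close>.\<close>

locale relation_seminorm = normal_labelled_space +
  fixes p :: "('a, 'c) generator star_poly \<Rightarrow> real"
  assumes seminorm: "cstar_seminorm (free_star_algebra generators) p"
    and rel: "(x, y) \<in> relations \<Longrightarrow> p (diff_sa (free_star_algebra generators) x y) = 0"
begin

sublocale p: cstar_seminormed "free_star_algebra generators" p
proof -
  interpret star_alg "free_star_algebra generators"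
    by (rule star_alg_free)
  show "cstar_seminormed (free_star_algebra generators) p"
    by unfold_locales (rule seminorm)
qed

definition null :: "('a, 'c) generator star_poly \<Rightarrow> bool" where
  "null x \<longleftrightarrow> x \<in> carrier gen.fr \<and> p x = 0"

text \<open>A separate constant keeps the simplifier from unfolding products into convolution
  sums.\<close>

definition mul ::
    "('a, 'c) generator star_poly \<Rightarrow> ('a, 'c) generator star_poly \<Rightarrow> ('a, 'c) generator star_poly" where
  "mul x y = times_sa gen.fr x y"

abbreviation act :: "(('a, 'c) generator \<times> bool) list \<Rightarrow> ('a, 'c) generator star_poly \<Rightarrow> ('a, 'c) generator star_poly" where
  "act u x \<equiv> mul (word u) x"

lemma null_le: "x \<in> carrier gen.fr \<Longrightarrow> p x \<le> 0 \<Longrightarrow> null x"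
  unfolding null_def using p.p_nonneg[of x] by (intro conjI antisym)

lemma null_add: "null x \<Longrightarrow> null y \<Longrightarrow> null (\<lambda>w. x w + y w)"
  using p.p_plus[of x y] gen.hom.R.plus_closed[of x y] by (intro null_le) (simp_all add: null_def)

lemma null_scale: "null x \<Longrightarrow> null (\<lambda>w. c * x w)"
  using p.p_scale[of x c] gen.hom.R.scale_closed[of x c] by (simp add: null_def)

lemma null_diff: "null x \<Longrightarrow> null y \<Longrightarrow> null (\<lambda>w. x w - y w)"
  using null_add[OF _ null_scale[of y "- 1"], of x] by simp

lemma zero_carrier: "(\<lambda>w. 0) \<in> carrier gen.fr"
  by (simp add: carrier_free_star_algebra)

lemma null_zero: "null (\<lambda>w. 0)"
  using p.p_scale[OF zero_carrier, of 0] by (simp add: null_def zero_carrier)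

lemma null_sum: "(\<And>i. i \<in> I \<Longrightarrow> null (x i)) \<Longrightarrow> null (\<lambda>w. \<Sum>i\<in>I. x i w)"
  by (induction I rule: infinite_finite_induct) (auto intro: null_zero null_add)

lemma null_right: "null x \<Longrightarrow> z \<in> carrier gen.fr \<Longrightarrow> null (mul x z)"
  using p.p_times[of x z] gen.hom.R.times_closed[of x z] unfolding mul_def by (intro null_le) (simp_all add: null_def)

lemma null_left: "z \<in> carrier gen.fr \<Longrightarrow> null x \<Longrightarrow> null (mul z x)"
  using p.p_times[of z x] gen.hom.R.times_closed[of z x] unfolding mul_def by (intro null_le) (simp_all add: null_def)

lemma null_star: "null x \<Longrightarrow> null (star_sa gen.fr x)"
  by (simp add: null_def)

text \<open>The algebra has no unit: \<open>word []\<close> lies outside its carrier.\<close>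

lemma act_Nil [simp]: "act [] x = x"
  by (rule ext) (simp add: mul_def conv_word_left)

lemma mul_word_word: "mul (word u) (word v) = word (u @ v)"
  by (simp add: mul_def conv_word_word)

lemma mul_assoc: "mul (mul x y) z = mul x (mul y z)"
  unfolding mul_def free_star_algebra_simps by (rule conv_assoc)

lemma mul_closed: "x \<in> carrier gen.fr \<Longrightarrow> y \<in> carrier gen.fr \<Longrightarrow> mul x y \<in> carrier gen.fr"
  unfolding mul_def by (rule gen.hom.R.times_closed)

lemma act_append: "act (u @ v) x = act u (act v x)"
  by (simp only: mul_word_word[symmetric] mul_assoc)

lemma word_closed: "w \<noteq> [] \<Longrightarrow> gw w \<Longrightarrow> word w \<in> carrier gen.fr"
  by (rule word_carrier)

lemma act_closed: "gw u \<Longrightarrow> x \<in> carrier gen.fr \<Longrightarrow> act u x \<in> carrier gen.fr"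
  using mul_closed[OF word_closed, of u x] act_Nil[of x] by (cases "u = []") (simp_all del: act_Nil)

lemma null_act: "gw u \<Longrightarrow> null x \<Longrightarrow> null (act u x)"
  using null_left[OF word_closed, of u x] act_Nil[of x] by (cases "u = []") (simp_all del: act_Nil)

text \<open>Being congruent for \<open>p\<close> does not imply having the same image under \<open>\<Psi>\<close>, so degree and support
  are compared as well.\<close>

definition weq :: "(('a, 'c) generator \<times> bool) list \<Rightarrow> (('a, 'c) generator \<times> bool) list \<Rightarrow> bool"
    (infix "\<doteq>" 50) where
  "u \<doteq> v \<longleftrightarrow> u \<noteq> [] \<and> v \<noteq> [] \<and> gw u \<and> gw v \<and> gen.wdeg u = gen.wdeg v \<and> gen.wset u = gen.wset v \<and>
     null (\<lambda>w. word u w - word v w)"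

definition wz :: "(('a, 'c) generator \<times> bool) list \<Rightarrow> bool" where
  "wz u \<longleftrightarrow> u \<noteq> [] \<and> gw u \<and> gen.wset u = {} \<and> null (word u)"

lemma weq_refl: "u \<noteq> [] \<Longrightarrow> gw u \<Longrightarrow> u \<doteq> u"
  by (simp add: weq_def null_zero)

lemma weq_sym: "u \<doteq> v \<Longrightarrow> v \<doteq> u"
  using null_scale[of "\<lambda>w. word u w - word v w" "- 1"] by (simp add: weq_def)

lemma weq_trans [trans]: "u \<doteq> v \<Longrightarrow> v \<doteq> w \<Longrightarrow> u \<doteq> w"
  using null_add[of "\<lambda>x. word u x - word v x" "\<lambda>x. word v x - word w x"] by (simp add: weq_def)

lemma mul_diff_left: "mul (\<lambda>w. x w - y w) z = (\<lambda>w. mul x z w - mul y z w)"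
  by (simp add: mul_def fun_eq_iff left_diff_distrib sum_subtractf)

lemma mul_diff_right: "mul z (\<lambda>w. x w - y w) = (\<lambda>w. mul z x w - mul z y w)"
  by (simp add: mul_def fun_eq_iff right_diff_distrib sum_subtractf)

lemma mul_sum_left: "mul (\<lambda>w. \<Sum>i\<in>I. x i w) z = (\<lambda>w. \<Sum>i\<in>I. mul (x i) z w)"
  by (auto simp: mul_def fun_eq_iff sum_distrib_right intro: sum.swap)

lemma mul_sum_right: "mul z (\<lambda>w. \<Sum>i\<in>I. x i w) = (\<lambda>w. \<Sum>i\<in>I. mul z (x i) w)"
  by (auto simp: mul_def fun_eq_iff sum_distrib_left intro: sum.swap)

lemma weq_left:
  assumes c: "gw c" and uv: "u \<doteq> v"
  shows "c @ u \<doteq> c @ v"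
proof -
  have "null (act c (\<lambda>w. word u w - word v w))"
    using uv by (intro null_act c) (simp add: weq_def)
  then have "null (\<lambda>w. word (c @ u) w - word (c @ v) w)"
    by (simp only: mul_diff_right mul_word_word)
  with uv c show ?thesis
    by (simp add: weq_def gen.wdeg_append gen.wset_append image_Un)
qed

lemma weq_star:
  assumes "u \<doteq> v"
  shows "word_star u \<doteq> word_star v"
proof -
  have u: "gw u" "word u \<in> carrier gen.fr" and v: "gw v" "word v \<in> carrier gen.fr"
    using assms by (auto simp: weq_def word_closed)
  have "null (star_sa gen.fr (\<lambda>w. word u w - word v w))"
    using assms by (intro null_star) (simp add: weq_def)
  moreover have "star_sa gen.fr (\<lambda>w. word u w - word v w) = (\<lambda>w. word (word_star u) w - word (word_star v) w)"
    using gen.hom.R.star_diff[OF u(2) v(2)] by (simp add: star_word)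
  ultimately show ?thesis
    using assms u v by (simp add: weq_def gen.wdeg_word_star gen.wset_word_star)
qed

text \<open>Deduced from \<open>weq_left\<close> by passing to adjoints and back.\<close>

lemma weq_right:
  assumes c: "gw c" and uv: "u \<doteq> v"
  shows "u @ c \<doteq> v @ c"
  using weq_star[OF weq_left[OF _ weq_star[OF uv], of "word_star c"]] c
  by simp

lemma weq_context: "gw c \<Longrightarrow> gw d \<Longrightarrow> u \<doteq> v \<Longrightarrow> c @ u @ d \<doteq> c @ v @ d"
  by (intro weq_left weq_right)

lemma wz_left:
  assumes c: "gw c" and u: "wz u"
  shows "wz (c @ u)"
  using u c null_act[OF c, of "word u"] by (simp add: wz_def mul_word_word gen.wset_append image_Un)

lemma wz_right:
  assumes c: "gw c" and u: "wz u"
  shows "wz (u @ c)"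
proof (cases "c = []")
  case False
  with u c null_right[of "word u" "word c"] word_closed[of c] show ?thesis
    by (simp add: wz_def mul_word_word gen.wset_append image_Un)
qed (use u in simp)

lemma wz_weq:
  assumes "u \<doteq> v" "wz v"
  shows "wz u"
  using assms null_add[of "\<lambda>w. word u w - word v w" "word v"] by (simp add: wz_def weq_def)

text \<open>Equality of sets is read off from \<open>relations_rep\<close>. The degrees are assumed
  to agree, since a word with empty set is represented by 0 whatever its degree, so its degree
  cannot be recovered.\<close>

lemma weq_relation:
  assumes r: "(word u, word v) \<in> relations" and deg: "gen.wdeg u = gen.wdeg v"
  shows "u \<doteq> v"
proof -
  have c: "word u \<in> carrier gen.fr" "word v \<in> carrier gen.fr"
    using relations_carrier[OF r] by auto
  have w: "u \<noteq> [] \<and> gw u" "v \<noteq> [] \<and> gw v"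
    using c gen.fr_letters[of "word u" u] gen.fr_letters[of "word v" v] by (auto simp: word_def)
  have "null (\<lambda>w. word u w - word v w)"
    using rel[OF r] gen.hom.R.diff_closed[OF c] by (simp add: null_def)
  moreover have "\<xi> \<in> gen.wset u \<longleftrightarrow> \<xi> \<in> gen.wset v" for \<xi>
    using fun_cong[OF fun_cong[OF relations_rep[OF r]], of "gen.wdeg u" \<xi>] deg
    by (auto simp: gen.rep_word_ind gen.ind_def split: if_splits)
  ultimately show ?thesis
    using w deg by (auto simp: weq_def)
qed

lemma wz_relation:
  assumes r: "(word u, \<lambda>w. 0) \<in> relations"
  shows "wz u"
proof -
  have c: "word u \<in> carrier gen.fr"
    using relations_carrier[OF r] by auto
  have w: "u \<noteq> [] \<and> gw u"
    using c gen.fr_letters[of "word u" u] by (auto simp: word_def)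
  have "\<xi> \<notin> gen.wset u" for \<xi>
    using fun_cong[OF fun_cong[OF relations_rep[OF r]], of "gen.wdeg u" \<xi>]
    by (auto simp: gen.rep_word_ind gen.ind_def gen.rep_def[of "\<lambda>w. 0"] split: if_splits)
  then show ?thesis
    using w c rel[OF r] by (auto simp: wz_def null_def)
qed

lemma Pl_Pl: "A \<in> B \<Longrightarrow> C \<in> B \<Longrightarrow> [Pl A, Pl C] \<doteq> [Pl (A \<inter> C)]"
  using proj_Int[of A C] by (intro weq_sym[OF weq_relation]) (simp_all add: relation_words)

lemma Pl_star: "A \<in> B \<Longrightarrow> [(Proj A, True)] \<doteq> [Pl A]"
  using proj_selfadj[of A] by (intro weq_relation) (simp_all add: relation_words)

lemma Pl_Sl: "A \<in> B \<Longrightarrow> [Pl A, Sl a] \<doteq> [Sl a, Pl (relrange A [a])]"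
  using proj_isom[of A a] by (intro weq_relation) (simp_all add: relation_words)

lemma Sl'_Sl: "[Sl' a, Sl a] \<doteq> [Pl (range_of [a])]"
  using isom_isom[of a] by (intro weq_relation) (simp_all add: relation_words)

lemma Sl'_Sl_orth: "b \<noteq> a \<Longrightarrow> wz [Sl' b, Sl a]"
  using isom_orth[of b a] by (intro wz_relation) (simp add: relation_words)

lemma Pl_empty: "wz [Pl {}]"
  using proj_empty by (intro wz_relation) (simp add: relation_words)

lemma Sl_range: "[Sl a] \<doteq> [Sl a, Pl (range_of [a])]"
proof -
  have "[Sl a] \<doteq> [Sl a, Sl' a, Sl a]"
    using partial_isometry[of a] by (intro weq_sym[OF weq_relation]) (simp_all add: relation_words)
  also have "\<dots> \<doteq> [Sl a, Pl (range_of [a])]"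
    using weq_left[OF _ Sl'_Sl[of a], of "[Sl a]"] by (simp add: generators_iff)
  finally show ?thesis .
qed

lemma gw_Pl: "A \<in> B \<Longrightarrow> gw [Pl A]"
  by (simp add: generators_iff)

lemma gw_append: "gw (u @ v) \<longleftrightarrow> gw u \<and> gw v"
  by (simp add: image_Un)

lemma Pl_push: "A \<in> B \<Longrightarrow> [Pl A] @ map Sl \<alpha> \<doteq> map Sl \<alpha> @ [Pl (relrange A \<alpha>)]"
proof (induction \<alpha> arbitrary: A)
  case Nil
  then show ?case
    using weq_refl[of "[Pl A]"] gw_Pl by simp
next
  case (Cons a \<alpha>)
  have "[Pl A] @ map Sl (a # \<alpha>) \<doteq> [Sl a] @ [Pl (relrange A [a])] @ map Sl \<alpha>"
    using weq_right[OF gw_Sl(1) Pl_Sl[OF Cons.prems], of a \<alpha>] by simp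
  also have "\<dots> \<doteq> [Sl a] @ map Sl \<alpha> @ [Pl (relrange (relrange A [a]) \<alpha>)]"
    using Cons.prems by (intro weq_left Cons.IH) (simp_all add: generators_iff)
  finally show ?case
    by (simp add: relrange_Cons[of A a \<alpha>])
qed

lemma Pl_push_star:
  assumes A: "A \<in> B"
  shows "map Sl' (rev \<alpha>) @ [Pl A] \<doteq> [Pl (relrange A \<alpha>)] @ map Sl' (rev \<alpha>)"
proof -
  have "map Sl' (rev \<alpha>) @ [Pl A] \<doteq> map Sl' (rev \<alpha>) @ [(Proj A, True)]"
    by (intro weq_left gw_Sl weq_sym[OF Pl_star] A)
  also have "\<dots> \<doteq> [(Proj (relrange A \<alpha>), True)] @ map Sl' (rev \<alpha>)"
    using weq_star[OF Pl_push[OF A, of \<alpha>]] by (simp add: word_star_Sl)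
  also have "\<dots> \<doteq> [Pl (relrange A \<alpha>)] @ map Sl' (rev \<alpha>)"
    by (intro weq_right gw_Sl Pl_star B_relrange' A)
  finally show ?thesis .
qed

text \<open>The first letter carries its own range projection, which is pushed through the remaining
  letters and arrives as the projection of \<open>range_of \<alpha>\<close>.\<close>

lemma range_absorb:
  assumes A: "A \<in> B"
  shows "map Sl \<alpha> @ [Pl A] \<doteq> map Sl \<alpha> @ [Pl (A \<inter> range_of \<alpha>)]"
proof (cases \<alpha>)
  case Nil
  then show ?thesis
    using A B_verts[OF A] weq_refl[of "[Pl A]"] gw_Pl by (simp add: Int_absorb2)
next
  case (Cons a \<beta>)
  have ra: "range_of [a] \<in> B" "range_of \<alpha> \<in> B"
    by (simp_all add: Cons)
  have r\<alpha>: "range_of \<alpha> = relrange (range_of [a]) \<beta>"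
    using range_of_append[of "[a]" \<beta>] by (simp add: Cons)
  have "map Sl \<alpha> @ [Pl A] \<doteq> [Sl a] @ ([Pl (range_of [a])] @ map Sl \<beta>) @ [Pl A]"
    using weq_right[OF _ Sl_range, of "map Sl \<beta> @ [Pl A]" a] A gw_Sl(1)[of \<beta>]
    by (simp add: Cons generators_iff)
  also have "\<dots> \<doteq> [Sl a] @ (map Sl \<beta> @ [Pl (range_of \<alpha>)]) @ [Pl A]"
    unfolding r\<alpha> using ra A by (intro weq_context Pl_push gw_Pl) (simp_all add: generators_iff)
  also have "\<dots> = map Sl \<alpha> @ [Pl (range_of \<alpha>), Pl A]"
    by (simp add: Cons)
  also have "\<dots> \<doteq> map Sl \<alpha> @ [Pl (range_of \<alpha> \<inter> A)]"
    by (intro weq_left gw_Sl Pl_Pl ra A)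
  finally show ?thesis
    by (simp add: Int_commute)
qed

text \<open>Splitting off the last letter leaves the product for the shorter word in the middle; by
  induction it is a projection, which can be pushed through the new letter.\<close>

lemma Sl'_Sl_cancel:
  assumes "\<alpha> \<noteq> []"
  shows "map Sl' (rev \<alpha>) @ map Sl \<alpha> \<doteq> [Pl (range_of \<alpha>)]"
  using assms
proof (induction \<alpha> rule: rev_nonempty_induct)
  case (single a)
  then show ?case using Sl'_Sl[of a] by simp
next
  case (snoc a \<alpha>)
  have r: "range_of \<alpha> \<in> B" "range_of [a] \<in> B"
    using snoc.hyps by simp_all
  have "map Sl' (rev (\<alpha> @ [a])) @ map Sl (\<alpha> @ [a]) = [Sl' a] @ (map Sl' (rev \<alpha>) @ map Sl \<alpha>) @ [Sl a]"
    by simp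
  also have "\<dots> \<doteq> [Sl' a] @ [Pl (range_of \<alpha>)] @ [Sl a]"
    by (intro weq_context snoc.IH) (simp_all add: generators_iff)
  also have "\<dots> \<doteq> [Sl' a] @ ([Sl a, Pl (relrange (range_of \<alpha>) [a])])"
    using weq_left[OF _ Pl_Sl[OF r(1)], of "[Sl' a]" a] by (simp add: generators_iff)
  also have "\<dots> = [Sl' a, Sl a] @ [Pl (relrange (range_of \<alpha>) [a])]"
    by simp
  also have "\<dots> \<doteq> [Pl (range_of [a])] @ [Pl (relrange (range_of \<alpha>) [a])]"
    using r by (intro weq_right Sl'_Sl gw_Pl) simp
  also have "\<dots> = [Pl (range_of [a]), Pl (relrange (range_of \<alpha>) [a])]"
    by simp
  also have "\<dots> \<doteq> [Pl (range_of [a] \<inter> relrange (range_of \<alpha>) [a])]"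
    using r by (intro Pl_Pl) simp_all
  also have "range_of [a] \<inter> relrange (range_of \<alpha>) [a] = range_of (\<alpha> @ [a])"
    using range_of_append[of \<alpha> "[a]"] range_of_append_subset[of \<alpha> "[a]"] by auto
  finally show ?case .
qed

text \<open>Equal first letters cancel to a range projection, which is pushed out to the right. At
  the first difference the two isometries have orthogonal ranges.\<close>

lemma Sl'_Sl_incomparable:
  "\<not> prefix \<alpha> \<beta> \<Longrightarrow> \<not> prefix \<beta> \<alpha> \<Longrightarrow> wz (map Sl' (rev \<alpha>) @ map Sl \<beta>)"
proof (induction \<alpha> arbitrary: \<beta>)
  case (Cons a \<alpha>)
  then obtain b \<beta>' where \<beta>: "\<beta> = b # \<beta>'"
    by (cases \<beta>) auto
  show ?case
  proof (cases "b = a")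
    case False
    have "wz (map Sl' (rev \<alpha>) @ [Sl' a, Sl b] @ map Sl \<beta>')"
      using False by (intro wz_left wz_right gw_Sl Sl'_Sl_orth) simp
    then show ?thesis by (simp add: \<beta>)
  next
    case True
    then have "wz (map Sl' (rev \<alpha>) @ map Sl \<beta>')"
      using Cons by (auto simp: \<beta>)
    then have z: "wz (map Sl' (rev \<alpha>) @ map Sl \<beta>' @ [Pl (relrange (range_of [a]) \<beta>')])"
      using wz_right[OF gw_Pl, of "relrange (range_of [a]) \<beta>'" "map Sl' (rev \<alpha>) @ map Sl \<beta>'"] by simp
    have "map Sl' (rev (a # \<alpha>)) @ map Sl \<beta> = map Sl' (rev \<alpha>) @ [Sl' a, Sl a] @ map Sl \<beta>'"
      using True by (simp add: \<beta>)
    also have "\<dots> \<doteq> map Sl' (rev \<alpha>) @ [Pl (range_of [a])] @ map Sl \<beta>'"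
      by (intro weq_context gw_Sl Sl'_Sl)
    also have "\<dots> \<doteq> map Sl' (rev \<alpha>) @ map Sl \<beta>' @ [Pl (relrange (range_of [a]) \<beta>')]"
      by (intro weq_left gw_Sl Pl_push) simp
    finally show ?thesis
      using z by (rule wz_weq)
  qed
qed simp

abbreviation nf :: "'c list \<Rightarrow> 'a set \<Rightarrow> 'c list \<Rightarrow> (('a, 'c) generator \<times> bool) list" where
  "nf \<alpha> A \<beta> \<equiv> map Sl \<alpha> @ [Pl A] @ map Sl' (rev \<beta>)"

lemma gw_nf: "A \<in> B \<Longrightarrow> gw (nf \<alpha> A \<beta>)"
  by (simp only: gw_append gw_Sl gw_Pl simp_thms)

lemma Pl_nf:
  assumes A: "A \<in> B" and C: "C \<in> B"
  shows "Pl C # nf \<alpha> A \<beta> \<doteq> nf \<alpha> (relrange C \<alpha> \<inter> A) \<beta>"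
proof -
  have "Pl C # nf \<alpha> A \<beta> = ([Pl C] @ map Sl \<alpha>) @ [Pl A] @ map Sl' (rev \<beta>)"
    by simp
  also have "\<dots> \<doteq> (map Sl \<alpha> @ [Pl (relrange C \<alpha>)]) @ [Pl A] @ map Sl' (rev \<beta>)"
    using A C gw_nf[OF A, of "[]" \<beta>] by (intro weq_right Pl_push) simp_all
  also have "\<dots> = map Sl \<alpha> @ [Pl (relrange C \<alpha>), Pl A] @ map Sl' (rev \<beta>)"
    by simp
  also have "\<dots> \<doteq> nf \<alpha> (relrange C \<alpha> \<inter> A) \<beta>"
    using A C by (intro weq_context gw_Sl Pl_Pl) simp_all
  finally show ?thesis .
qed

text \<open>Prepend a letter to \<open>s_\<alpha> p_A s_\<beta>^*\<close>: a projection is pushed to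
  the middle, and \<open>s_a\<close> lengthens \<open>\<alpha>\<close>. The adjoint of
  \<open>s_a\<close> cancels the first letter of \<open>\<alpha>\<close>, annihilates everything if
  that letter differs, or, for empty \<open>\<alpha>\<close>, passes \<open>p_A\<close> and
  lengthens \<open>\<beta>\<close>.\<close>

lemma normal_form:
  assumes "w \<noteq> []" "gw w"
  shows "wz w \<or> (\<exists>\<alpha> A \<beta>. A \<in> B \<and> w \<doteq> nf \<alpha> A \<beta>)"
  using assms
proof (induction w)
  case (Cons x w)
  have letter: "(\<exists>C\<in>B. x = Pl C \<or> x = (Proj C, True)) \<or> (\<exists>a. x = Sl a \<or> x = Sl' a)"
    using Cons.prems by (cases x rule: prod.exhaust[case_product generator.exhaust[of "fst x"]])
      (auto simp: generators_def)
  have x: "gw [x]"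
    using Cons.prems by simp
  show ?case
  proof (cases "w = []")
    case True
    have "[Pl C] \<doteq> nf [] C []" if "C \<in> B" for C
      using that weq_refl[of "[Pl C]"] gw_Pl by simp
    moreover have "[Sl a] \<doteq> nf [a] (range_of [a]) []" for a
      using Sl_range[of a] by simp
    moreover have "[Sl' a] \<doteq> nf [] (range_of [a]) [a]" for a
    proof -
      have "[Sl' a] \<doteq> [(Proj (range_of [a]), True)] @ [Sl' a]"
        using weq_star[OF Sl_range, of a] by simp
      also have "\<dots> \<doteq> [Pl (range_of [a])] @ [Sl' a]"
        by (intro weq_right Pl_star) (simp_all add: generators_iff)
      finally show ?thesis by simp
    qed
    ultimately show ?thesis
      using letter True B_range'[of "[_]"] Pl_star by (blast intro: weq_trans)
  next
    case False
    with Cons consider "wz w" | \<alpha> A \<beta> where "A \<in> B" "w \<doteq> nf \<alpha> A \<beta>"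
      by auto
    then show ?thesis
    proof cases
      case 1
      then show ?thesis
        using wz_left[OF x] by simp
    next
      case (2 \<alpha> A \<beta>)
      have w: "x # w \<doteq> x # nf \<alpha> A \<beta>"
        using weq_left[OF x 2(2)] by simp
      have Pl: "\<exists>\<alpha> A \<beta>. A \<in> B \<and> x # w \<doteq> nf \<alpha> A \<beta>" if "C \<in> B" "x # w \<doteq> Pl C # nf \<alpha>' A \<beta>" for C \<alpha>'
        using weq_trans[OF that(2) Pl_nf[OF 2(1) that(1)]] B_Int[OF B_relrange'[OF that(1)] 2(1), of \<alpha>'] by blast
      from letter consider C where "C \<in> B" "x = Pl C \<or> x = (Proj C, True)" | a where "x = Sl a" | a where "x = Sl' a"
        by blast
      then show ?thesis
      proof cases
        case (1 C)
        have "x # nf \<alpha> A \<beta> \<doteq> Pl C # nf \<alpha> A \<beta>"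
        proof (cases "x = Pl C")
          case True
          then show ?thesis
            using gw_nf[OF 2(1), of \<alpha> \<beta>] x weq_refl[of "x # nf \<alpha> A \<beta>"] by simp
        next
          case False
          with 1 have "x = (Proj C, True)" by simp
          then show ?thesis
            using weq_right[OF gw_nf[OF 2(1)] Pl_star[OF 1(1)], of \<alpha> \<beta>] by simp
        qed
        with weq_trans[OF w this] Pl[OF 1(1)] show ?thesis by blast
      next
        case (2 a)
        with w \<open>A \<in> B\<close> have "x # w \<doteq> nf (a # \<alpha>) A \<beta>" by simp
        with \<open>A \<in> B\<close> show ?thesis by blast
      next
        case (3 a)
        show ?thesis
        proof (cases \<alpha>)
          case Nil
          have "x # w \<doteq> [Sl' a, Pl A] @ map Sl' (rev \<beta>)"
            using w by (simp add: Nil 3)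
          also have "\<dots> \<doteq> [Pl (relrange A [a]), Sl' a] @ map Sl' (rev \<beta>)"
            using Pl_push_star[OF \<open>A \<in> B\<close>, of "[a]"] by (intro weq_right gw_Sl) simp
          also have "\<dots> = nf [] (relrange A [a]) (\<beta> @ [a])"
            by simp
          finally show ?thesis
            using B_relrange'[OF \<open>A \<in> B\<close>] by blast
        next
          case (Cons b \<alpha>')
          show ?thesis
          proof (cases "b = a")
            case True
            have "x # w \<doteq> [Sl' a, Sl a] @ nf \<alpha>' A \<beta>"
              using w by (simp add: Cons 3 True)
            also have "\<dots> \<doteq> [Pl (range_of [a])] @ nf \<alpha>' A \<beta>"
              by (intro weq_right gw_nf \<open>A \<in> B\<close> Sl'_Sl)
            finally show ?thesis
              using Pl[of "range_of [a]" \<alpha>'] by simp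
          next
            case False
            have "wz ([Sl' a, Sl b] @ nf \<alpha>' A \<beta>)"
              using False by (intro wz_right gw_nf \<open>A \<in> B\<close> Sl'_Sl_orth) simp
            then show ?thesis
              using wz_weq[OF w] by (simp add: Cons 3)
          qed
        qed
      qed
    qed
  qed
qed simp

lemma pe_nf: "pe e = nf (fst e) (snd e) (fst e)"
  by (simp add: pe_def)

lemma pe_empty: "snd e = {} \<Longrightarrow> wz (pe e)"
  using wz_left[OF gw_Sl(1) wz_right[OF gw_Sl(2) Pl_empty]] by (simp add: pe_nf)

text \<open>Trivial degree forces \<open>\<beta> = \<alpha>\<close> by \<open>wdeg_nf\<close>;
  cutting the set down to \<open>range_of \<alpha>\<close>, which does not change the word modulo
  the relations, makes the pair an \<open>elem\<close>.\<close>

lemma degree_one_form: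
  assumes "w \<noteq> []" "gw w" "gen.wdeg w = []"
  shows "wz w \<or> (\<exists>e. elem e \<and> snd e \<noteq> {} \<and> w \<doteq> pe e)"
proof (cases "wz w")
  case False
  then obtain \<alpha> A \<beta> where A: "A \<in> B" and w: "w \<doteq> nf \<alpha> A \<beta>"
    using normal_form[OF assms(1,2)] by blast
  have "gen.wdeg (nf \<alpha> A \<beta>) = []"
    using w assms(3) unfolding weq_def by (elim conjE) (simp only:)
  then have \<beta>: "\<beta> = \<alpha>"
    using wdeg_nf[OF A, of \<alpha> \<beta>] by simp
  let ?e = "(\<alpha>, A \<inter> range_of \<alpha>)"
  have w: "w \<doteq> pe ?e"
    using weq_trans[OF w] weq_right[OF gw_Sl(2) range_absorb[OF A, of \<alpha>], of "rev \<alpha>"] by (simp add: pe_nf \<beta>)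
  moreover have "A \<inter> range_of \<alpha> \<in> B"
    using A B_verts[OF A] by (cases "\<alpha> = []") (auto simp: B_Int Int_absorb2)
  then have "elem ?e"
    by (simp add: elem_def)
  moreover have "snd ?e \<noteq> {}"
    using wz_weq[OF w pe_empty] False by blast
  ultimately show ?thesis by blast
qed simp

lemma pe_star: "elem e \<Longrightarrow> word_star (pe e) \<doteq> pe e"
  using weq_context[OF gw_Sl(1) gw_Sl(2) Pl_star, of "snd e" "fst e" "rev (fst e)"]
  by (simp add: pe_nf word_star_Sl elem_def) (simp add: word_star_def rev_map o_def)

text \<open>The inner \<open>s_\<beta>^* s_\<beta>\<close> collapses to a projection above
  \<open>p_C\<close>, and \<open>p_C\<close> then moves left through \<open>s_\<gamma>^*\<close> and
  becomes the projection of \<open>relrange C \<gamma>\<close>.\<close>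

lemma pe_meet_left:
  assumes e: "elem (\<beta> @ \<gamma>, A)" and f: "elem (\<beta>, C)"
  shows "pe (\<beta> @ \<gamma>, A) @ pe (\<beta>, C) \<doteq> pe (\<beta> @ \<gamma>, A \<inter> relrange C \<gamma>)"
proof -
  have A: "A \<in> B" and C: "C \<in> B" "C \<subseteq> range_of \<beta>"
    using e f by (simp_all add: elem_def)
  note gwA = gw_nf[OF A, of "\<beta> @ \<gamma>" \<gamma>, unfolded gw_append[symmetric] append_assoc]
  have "map Sl' (rev \<beta>) @ pe (\<beta>, C) \<doteq> [Pl C] @ map Sl' (rev \<beta>)"
  \<comment> \<open>For the empty word no range projection is available, as \<open>verts G\<close>
    need not belong to \<open>B\<close>; there is also nothing to cancel.\<close>
  proof (cases "\<beta> = []")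
    case True
    then show ?thesis
      using weq_refl[OF _ gw_Pl[OF C(1)]] by (simp add: pe_nf)
  next
    case False
    have "map Sl' (rev \<beta>) @ pe (\<beta>, C) = (map Sl' (rev \<beta>) @ map Sl \<beta>) @ [Pl C] @ map Sl' (rev \<beta>)"
      by (simp add: pe_nf)
    also have "\<dots> \<doteq> [Pl (range_of \<beta>)] @ [Pl C] @ map Sl' (rev \<beta>)"
      using gw_nf[OF C(1), of "[]" \<beta>] by (intro weq_right Sl'_Sl_cancel False) simp
    also have "\<dots> = [Pl (range_of \<beta>), Pl C] @ map Sl' (rev \<beta>)"
      by simp
    also have "\<dots> \<doteq> [Pl (range_of \<beta> \<inter> C)] @ map Sl' (rev \<beta>)"
      using False C by (intro weq_right gw_Sl Pl_Pl) simp_all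
    finally show ?thesis
      using C(2) by (simp add: Int_absorb1)
  qed
  from weq_left[OF gw_nf[OF A, of "\<beta> @ \<gamma>" \<gamma>] this]
  have "pe (\<beta> @ \<gamma>, A) @ pe (\<beta>, C) \<doteq> map Sl (\<beta> @ \<gamma>) @ [Pl A] @ (map Sl' (rev \<gamma>) @ [Pl C]) @ map Sl' (rev \<beta>)"
    by (simp add: pe_nf)
  also have "\<dots> = (map Sl (\<beta> @ \<gamma>) @ [Pl A]) @ (map Sl' (rev \<gamma>) @ [Pl C]) @ map Sl' (rev \<beta>)"
    by simp
  also have "\<dots> \<doteq> (map Sl (\<beta> @ \<gamma>) @ [Pl A]) @ ([Pl (relrange C \<gamma>)] @ map Sl' (rev \<gamma>)) @ map Sl' (rev \<beta>)"
    using gw_nf[OF A, of "\<beta> @ \<gamma>" "[]"] by (intro weq_context gw_Sl Pl_push_star C) simp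
  also have "\<dots> = map Sl (\<beta> @ \<gamma>) @ [Pl A, Pl (relrange C \<gamma>)] @ map Sl' (rev (\<beta> @ \<gamma>))"
    by simp
  also have "\<dots> \<doteq> map Sl (\<beta> @ \<gamma>) @ [Pl (A \<inter> relrange C \<gamma>)] @ map Sl' (rev (\<beta> @ \<gamma>))"
    using A C by (intro weq_context gw_Sl Pl_Pl) simp_all
  finally show ?thesis
    by (simp add: pe_nf)
qed

lemma wz_wz: "wz u \<Longrightarrow> wz v \<Longrightarrow> null (\<lambda>w. word u w - word v w)"
  by (intro null_diff) (simp_all add: wz_def)

lemma weq_null: "u \<doteq> v \<Longrightarrow> null (\<lambda>w. word u w - word v w)"
  by (simp add: weq_def)

text \<open>When the first word is the shorter one, the product is the adjoint of the case already
  computed; incomparable words give 0 on both sides.\<close>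

lemma pe_meet:
  assumes e: "elem e" and f: "elem f"
  shows "null (\<lambda>w. word (pe e @ pe f) w - word (pe (emeet e f)) w)"
proof (cases rule: emeet_cases[where e = e and f = f])
  case (left \<beta> \<gamma> A C)
  then show ?thesis
    using pe_meet_left[of \<beta> \<gamma> A C] e f by (simp add: weq_null)
next
  case (right \<beta> \<gamma> A C)
  then have m: "pe f @ pe e \<doteq> pe (emeet e f)"
    using pe_meet_left[of \<beta> \<gamma> A C] e f by simp
  have gw: "gw (pe e)" "gw (word_star (pe f))"
    using gw_pe e f by simp_all
  have "pe e @ pe f \<doteq> word_star (pe e) @ pe f"
    using weq_right[OF gw_pe[OF f] weq_sym[OF pe_star[OF e]]] .
  also have "\<dots> \<doteq> word_star (pe e) @ word_star (pe f)"
    using gw(1) by (intro weq_left weq_sym[OF pe_star] f) simp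
  also have "\<dots> \<doteq> word_star (pe (emeet e f))"
    using weq_star[OF m] by simp
  also have "\<dots> \<doteq> pe (emeet e f)"
    by (intro pe_star elem_emeet e f)
  finally show ?thesis
    by (rule weq_null)
next
  case incomparable
  have A: "snd e \<in> B" "snd f \<in> B"
    using e f by (simp_all add: elem_def)
  have "wz ((map Sl (fst e) @ [Pl (snd e)]) @ (map Sl' (rev (fst e)) @ map Sl (fst f)) @ [Pl (snd f)] @ map Sl' (rev (fst f)))"
    using incomparable(1,2) gw_nf[OF A(1), of "fst e" "[]"] gw_nf[OF A(2), of "[]" "fst f"]
    by (intro wz_left wz_right Sl'_Sl_incomparable) simp_all
  then have "wz (pe e @ pe f)"
    by (simp add: pe_nf)
  then show ?thesis
    using wz_wz pe_empty[of "emeet e f"] incomparable(3) by simp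
qed

end

section \<open>Covers and annihilation modulo the relations\<close>

context normal_labelled_space
begin

lemma covers_mono: "covers Z e \<Longrightarrow> ple f e \<Longrightarrow> covers Z f"
  unfolding covers_def by (simp only: split_paired_All) (blast intro: ple_trans)

lemma emeet_self [simp]: "emeet e e = e"
  using emeet_left[of "fst e" "[]" "snd e" "snd e"] by simp

end

context relation_seminorm
begin

text \<open>Without a unit the complement of a projection is not an element, so lying under a
  projection or under its complement is expressed by the left action on \<open>y\<close>.\<close>

definition ann :: "'c list \<times> 'a set \<Rightarrow> ('a, 'c) generator star_poly \<Rightarrow> bool" where
  "ann e y \<longleftrightarrow> null (act (pe e) y)"

definition fixedby :: "'c list \<times> 'a set \<Rightarrow> ('a, 'c) generator star_poly \<Rightarrow> bool" where
  "fixedby e y \<longleftrightarrow> null (\<lambda>w. act (pe e) y w - y w)"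

lemma null_cong: "null (\<lambda>w. x w - y w) \<Longrightarrow> null y \<Longrightarrow> null x"
  using null_add[of "\<lambda>w. x w - y w" y] by simp

lemma null_swap: "null (\<lambda>w. x w - y w) \<Longrightarrow> null (\<lambda>w. y w - x w)"
  using null_scale[of "\<lambda>w. x w - y w" "- 1"] by simp

lemma null_trans: "null (\<lambda>w. x w - y w) \<Longrightarrow> null (\<lambda>w. y w - z w) \<Longrightarrow> null (\<lambda>w. x w - z w)"
  using null_add[of "\<lambda>w. x w - y w" "\<lambda>w. y w - z w"] by simp

lemma null_act_diff:
  assumes "gw u" "null (\<lambda>w. x w - y w)"
  shows "null (\<lambda>w. act u x w - act u y w)"
  using null_act[OF assms] by (simp only: mul_diff_right)

lemma null_diff_act:
  assumes "null (\<lambda>w. word u w - word v w)" "y \<in> carrier gen.fr"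
  shows "null (\<lambda>w. act u y w - act v y w)"
  using null_right[OF assms] by (simp only: mul_diff_left)

lemma act_meet:
  assumes "elem e" "elem f" "y \<in> carrier gen.fr"
  shows "null (\<lambda>w. act (pe e) (act (pe f) y) w - act (pe (emeet e f)) y w)"
  using null_diff_act[OF pe_meet[OF assms(1,2)] assms(3)] by (simp only: act_append)

lemma act_commute:
  assumes e: "elem e" and f: "elem f" and y: "y \<in> carrier gen.fr"
  shows "null (\<lambda>w. act (pe e) (act (pe f) y) w - act (pe f) (act (pe e) y) w)"
proof -
  have "null (\<lambda>w. word (pe (emeet e f)) w - word (pe (emeet f e)) w)"
  proof (cases rule: emeet_cases[where e = e and f = f])
    case left
    then show ?thesis by (simp add: null_zero)
  next
    case right
    then show ?thesis by (simp add: null_zero)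
  next
    case incomparable
    then show ?thesis
      by (intro wz_wz pe_empty) simp_all
  qed
  then show ?thesis
    by (intro null_trans[OF act_meet[OF e f y] null_trans[OF null_diff_act null_swap[OF act_meet[OF f e y]]]] y)
qed

lemma ann_meet:
  assumes "elem e" "elem f" "y \<in> carrier gen.fr" "ann f y"
  shows "ann (emeet e f) y"
  unfolding ann_def
  by (rule null_cong[OF null_swap[OF act_meet]]) (use assms null_act[OF gw_pe] in \<open>simp_all add: ann_def\<close>)

lemma ann_empty: "snd e = {} \<Longrightarrow> y \<in> carrier gen.fr \<Longrightarrow> ann e y"
  unfolding ann_def using pe_empty[of e] by (intro null_right) (simp_all add: wz_def)

lemma act_pe: "act (pe (\<alpha>, A)) y = act (map Sl \<alpha>) (act [Pl A] (act (map Sl' (rev \<alpha>)) y))"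
  by (simp only: pe_def fst_conv snd_conv act_append)

text \<open>Inclusion-exclusion from relation (i), conjugated by \<open>s_\<alpha>\<close>; the term
  for \<open>A \<inter> C\<close> is annihilated because it is a meet.\<close>

lemma ann_Un:
  assumes A: "elem (\<alpha>, A)" "ann (\<alpha>, A) y" and C: "elem (\<alpha>, C)" "ann (\<alpha>, C) y" and y: "y \<in> carrier gen.fr"
  shows "ann (\<alpha>, A \<union> C) y"
proof -
  let ?z = "act (map Sl' (rev \<alpha>)) y"
  have z: "?z \<in> carrier gen.fr"
    by (intro act_closed gw_Sl y)
  have AC: "A \<in> B" "C \<in> B"
    using A C by (simp_all add: elem_def)
  have "ann (\<alpha>, A \<inter> C) y"
    using ann_meet[OF A(1) C(1) y C(2)] emeet_left[of \<alpha> "[]" A C] by simp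
  \<comment> \<open>The bracketing into differences lets \<open>mul_diff_left\<close> and
    \<open>mul_diff_right\<close> distribute the multiplication.\<close>
  moreover have "null (\<lambda>w. (word [Pl (A \<union> C)] w - word [Pl A] w) - (word [Pl C] w - word [Pl (A \<inter> C)] w))"
    using rel[OF proj_Un[OF AC]] relations_carrier[OF proj_Un[OF AC]]
      gen.hom.R.diff_closed[of "free_proj (A \<union> C)" "\<lambda>w. free_proj A w + free_proj C w - free_proj (A \<inter> C) w"]
    by (simp add: null_def free_proj_word algebra_simps)
  from null_act[OF gw_Sl(1) null_right[OF this z], of \<alpha>]
  have "null (\<lambda>w. (act (pe (\<alpha>, A \<union> C)) y w - act (pe (\<alpha>, A)) y w) - (act (pe (\<alpha>, C)) y w - act (pe (\<alpha>, A \<inter> C)) y w))"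
    by (simp only: mul_diff_left mul_diff_right act_pe)
  ultimately show ?thesis
    using A(2) C(2) null_add[OF null_diff[of "act (pe (\<alpha>, C)) y" "act (pe (\<alpha>, A \<inter> C)) y"], of "act (pe (\<alpha>, A)) y"]
      null_cong[of "act (pe (\<alpha>, A \<union> C)) y" "act (pe (\<alpha>, A)) y"]
      null_cong[of "\<lambda>w. act (pe (\<alpha>, A \<union> C)) y w - act (pe (\<alpha>, A)) y w"]
      null_diff[of "act (pe (\<alpha>, C)) y" "act (pe (\<alpha>, A \<inter> C)) y"]
    by (simp add: ann_def)
qed

lemma ann_Union:
  assumes "finite \<C>" "y \<in> carrier gen.fr" "\<And>C. C \<in> \<C> \<Longrightarrow> elem (\<alpha>, C) \<and> ann (\<alpha>, C) y"
  shows "elem (\<alpha>, \<Union>\<C>) \<and> ann (\<alpha>, \<Union>\<C>) y"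
  using assms(1,3)
proof induction
  case empty
  then show ?case
    using ann_empty assms(2) by (simp add: elem_def)
next
  case (insert C \<C>)
  then have "elem (\<alpha>, C)" "ann (\<alpha>, C) y" "elem (\<alpha>, \<Union>\<C>)" "ann (\<alpha>, \<Union>\<C>) y"
    by simp_all
  with ann_Un[OF this assms(2)] show ?case
    by (simp add: elem_def B_Un)
qed

text \<open>Conjugating relation (iv) by \<open>s_\<alpha>\<close> writes the projection of
  \<open>(\<alpha>, A)\<close> as the sum of those of its one-letter extensions.\<close>

lemma ann_cuntz_krieger:
  assumes A: "elem (\<alpha>, A)" and y: "y \<in> carrier gen.fr"
    and fin: "finite (out_labels A)" and ne: "out_labels A \<noteq> {}"
    and sinks: "\<not> (\<exists>A'\<in>B. A' \<noteq> {} \<and> A' \<subseteq> A \<inter> sinks)"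
    and ann: "\<And>a. a \<in> out_labels A \<Longrightarrow> ann (\<alpha> @ [a], relrange A [a]) y"
  shows "ann (\<alpha>, A) y"
proof -
  let ?z = "act (map Sl' (rev \<alpha>)) y" and ?w = "\<lambda>a. [Sl a, Pl (relrange A [a]), Sl' a]"
  have z: "?z \<in> carrier gen.fr"
    by (intro act_closed gw_Sl y)
  have "A \<in> B"
    using A by (simp add: elem_def)
  note r = cuntz_krieger[OF this fin ne sinks]
  have y': "(\<lambda>w. \<Sum>a\<in>out_labels A. (free_isom a \<cdot> free_proj (relrange A [a]) \<cdot> (free_isom a)\<^sup>\<star>) w) =
      (\<lambda>w. \<Sum>a\<in>out_labels A. word (?w a) w)"
    by (simp add: relation_words)
  have "null (\<lambda>w. word [Pl A] w - (\<Sum>a\<in>out_labels A. word (?w a) w))"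
    using rel[OF r] gen.hom.R.diff_closed[of "word [Pl A]" "\<lambda>w. \<Sum>a\<in>out_labels A. word (?w a) w"] relations_carrier[OF r]
    unfolding y' by (simp add: null_def free_proj_word)
  from null_act[OF gw_Sl(1) null_right[OF this z], of \<alpha>]
  have "null (\<lambda>w. act (pe (\<alpha>, A)) y w - (\<Sum>a\<in>out_labels A. act (map Sl \<alpha>) (act (?w a) ?z) w))"
    by (simp only: mul_diff_left mul_diff_right mul_sum_left mul_sum_right act_pe)
  moreover have "act (map Sl \<alpha>) (act (?w a) ?z) = act (pe (\<alpha> @ [a], relrange A [a])) y" for a
  proof -
    have "map Sl \<alpha> @ ?w a @ map Sl' (rev \<alpha>) = pe (\<alpha> @ [a], relrange A [a])"
      by (simp add: pe_def)
    then show ?thesis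
      by (simp only: act_append[symmetric])
  qed
  ultimately have "null (\<lambda>w. act (pe (\<alpha>, A)) y w - (\<Sum>a\<in>out_labels A. act (pe (\<alpha> @ [a], relrange A [a])) y w))"
    by (simp only:)
  then show ?thesis
    unfolding ann_def
    by (rule null_cong) (use ann in \<open>intro null_sum, simp add: ann_def\<close>)
qed

text \<open>Induction on the excess length of the words in \<open>Z\<close>. Let \<open>A'\<close> be what remains of \<open>A\<close> after removing
  the parts covered by elements of \<open>Z\<close> with words no longer than \<open>\<alpha>\<close>. The remaining elements of \<open>Z\<close>
  cover \<open>A'\<close>, so \<open>A'\<close> contains no sinks and emits finitely many labels, and the Cuntz-Krieger
  relation passes to words longer by one letter.\<close>

lemma ann_covers_aux:
  assumes y: "y \<in> carrier gen.fr" and Z: "finite Z" "\<forall>z\<in>Z. elem z \<and> ann z y"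
  shows "elem (\<alpha>, A) \<Longrightarrow> covers Z (\<alpha>, A) \<Longrightarrow> \<forall>z\<in>Z. length (fst z) \<le> length \<alpha> + n \<Longrightarrow> ann (\<alpha>, A) y"
proof (induction n arbitrary: \<alpha> A rule: less_induct)
  case (less n \<alpha> A)
  note el = less.prems(1) and cov = less.prems(2) and len = less.prems(3)
  have A: "A \<in> B" "A \<subseteq> range_of \<alpha>"
    using el by (simp_all add: elem_def)
  \<comment> \<open>The traces on \<open>A\<close> of those \<open>z\<close> whose word is a prefix
    of \<open>\<alpha>\<close>. Each trace is a meet with an annihilating \<open>z\<close>, hence
    annihilates \<open>y\<close> itself.\<close>
  define \<C> where "\<C> = (\<lambda>z. snd (emeet (\<alpha>, A) z)) ` {z \<in> Z. prefix (fst z) \<alpha>}"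
  have mem: "emeet (\<alpha>, A) z = (\<alpha>, snd (emeet (\<alpha>, A) z))" if "prefix (fst z) \<alpha>" for z
    using that by (simp add: emeet_def)
  have "elem (\<alpha>, C) \<and> ann (\<alpha>, C) y" if C: "C \<in> \<C>" for C
  proof -
    obtain z where z: "z \<in> Z" "prefix (fst z) \<alpha>" "C = snd (emeet (\<alpha>, A) z)"
      using C unfolding \<C>_def by blast
    have "elem z" "ann z y"
      using Z(2) z(1) by blast+
    with mem[OF z(2)] z(3) elem_emeet[OF el] ann_meet[OF el _ y] show ?thesis
      by simp
  qed
  then have C0: "elem (\<alpha>, \<Union>\<C>)" "ann (\<alpha>, \<Union>\<C>) y"
    using ann_Union[of \<C> y \<alpha>] Z(1) y by (simp_all add: \<C>_def)
  define A' where "A' = A - \<Union>\<C>"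
  have A': "A' \<in> B" "A' \<subseteq> A"
    using A C0 by (auto simp: A'_def elem_def intro: B_Diff)
  then have el': "elem (\<alpha>, A')"
    using A by (simp add: elem_def)
  \<comment> \<open>A \<open>z\<close> whose word is a prefix of \<open>\<alpha>\<close> has its
    trace inside \<open>\<Union>\<C>\<close>, which was removed from \<open>A'\<close>. Whatever
    covers a piece of \<open>A'\<close> must therefore have a word that properly extends
    \<open>\<alpha>\<close>.\<close>
  have longer: "\<exists>z\<in>Z. snd (emeet (\<alpha> @ \<delta>, D) z) \<noteq> {} \<and> \<not> prefix (fst z) \<alpha> \<and> (prefix (fst z) (\<alpha> @ \<delta>) \<or> prefix (\<alpha> @ \<delta>) (fst z))"
    if g: "elem (\<alpha> @ \<delta>, D)" "D \<noteq> {}" "D \<subseteq> relrange A' \<delta>" for \<delta> D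
  proof -
    have "ple (\<alpha> @ \<delta>, D) (\<alpha>, A)"
      using g(3) relrange_mono[OF A'(2), of \<delta>] by (auto simp: ple_def)
    then obtain z where z: "z \<in> Z" "snd (emeet (\<alpha> @ \<delta>, D) z) \<noteq> {}"
      using coversD[OF cov g(1)] g(2) by auto
    have comp: "prefix (fst z) (\<alpha> @ \<delta>) \<or> prefix (\<alpha> @ \<delta>) (fst z)"
      using z(2) by (auto simp: emeet_def split: if_splits)
    have "\<not> prefix (fst z) \<alpha>"
    proof
      assume pr: "prefix (fst z) \<alpha>"
      obtain \<gamma> where \<gamma>: "\<alpha> = fst z @ \<gamma>"
        using pr by (auto simp: prefix_def)
      have zB: "snd z \<in> B"
        using Z(2) z(1) by (auto simp: elem_def)
      have C: "A \<inter> relrange (snd z) \<gamma> \<in> \<C>"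
        using emeet_left[of "fst z" \<gamma> A "snd z"] z(1) pr by (force simp: \<C>_def \<gamma>)
      have "snd (emeet (\<alpha> @ \<delta>, D) z) = D \<inter> relrange (snd z) (\<gamma> @ \<delta>)"
        using emeet_left[of "fst z" "\<gamma> @ \<delta>" D "snd z"] by (simp add: \<gamma>)
      also have "\<dots> \<subseteq> relrange A' \<delta> \<inter> relrange (relrange (snd z) \<gamma>) \<delta>"
        using g(3) by (auto simp: relrange_append)
      also have "\<dots> = relrange (A' \<inter> relrange (snd z) \<gamma>) \<delta>"
        using A'(1) zB by (simp add: relrange_Int')
      also have "A' \<inter> relrange (snd z) \<gamma> = {}"
        using C by (auto simp: A'_def)
      finally show False
        using z(2) by simp
    qed
    with z comp show ?thesis by blast
  qed
  have "ann (\<alpha>, A') y"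
  proof (cases "A' = {}")
    case True
    then show ?thesis by (intro ann_empty y) simp
  next
    case False
    obtain z where z: "z \<in> Z" "\<not> prefix (fst z) \<alpha>" "prefix (fst z) \<alpha> \<or> prefix \<alpha> (fst z)"
      using longer[of "[]" A'] el' False by auto
    then have "length \<alpha> < length (fst z)"
      by (metis prefix_length_le prefix_order.antisym not_equal_is_parallel not_less prefix_length_prefix prefix_order.refl)
    with len z(1) have "n \<noteq> 0" by auto
    then obtain m where n: "n = Suc m"
      by (cases n) auto
    \<comment> \<open>A set of sinks would have to meet some \<open>z\<close> with a word properly
      extending \<open>\<alpha>\<close>, but its relative ranges along non-empty words are
      empty.\<close>
    have sinks: "\<not> (\<exists>D\<in>B. D \<noteq> {} \<and> D \<subseteq> A' \<inter> sinks)"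
    proof
      assume "\<exists>D\<in>B. D \<noteq> {} \<and> D \<subseteq> A' \<inter> sinks"
      then obtain D where D: "D \<in> B" "D \<noteq> {}" "D \<subseteq> A'" "D \<subseteq> sinks"
        by auto
      have "elem (\<alpha>, D)"
        using D A A'(2) by (auto simp: elem_def)
      then have "\<exists>z\<in>Z. snd (emeet (\<alpha>, D) z) \<noteq> {} \<and> \<not> prefix (fst z) \<alpha> \<and> (prefix (fst z) \<alpha> \<or> prefix \<alpha> (fst z))"
        using longer[of "[]" D] D by simp
      then obtain z where z: "snd (emeet (\<alpha>, D) z) \<noteq> {}" "\<not> prefix (fst z) \<alpha>" "prefix \<alpha> (fst z)"
        by blast
      then obtain \<delta> C where \<delta>: "z = (\<alpha> @ \<delta>, C)" "\<delta> \<noteq> []"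
        by (cases z) (auto simp: prefix_def)
      then show False
        using z(1) emeet_right[of \<alpha> D \<delta> C] relrange_sinks[OF D(4) \<delta>(2)] by simp
    qed
    have ext: "elem (\<alpha> @ [a], relrange A' [a])" for a
      using A'(1) relrange_mono[of A' "range_of \<alpha>" "[a]"] A(2) A'(2) range_of_append[of \<alpha> "[a]"] by (simp add: elem_def)
    \<comment> \<open>Every emitted label is the next letter after \<open>\<alpha>\<close> of some
      member of the finite set \<open>Z\<close>.\<close>
    have "a \<in> (\<lambda>z. fst z ! length \<alpha>) ` Z" if "a \<in> out_labels A'" for a
    proof -
      have "relrange A' [a] \<noteq> {}"
        using that by (simp add: out_labels_def)
      then obtain z where z: "z \<in> Z" "\<not> prefix (fst z) \<alpha>" "prefix (fst z) (\<alpha> @ [a]) \<or> prefix (\<alpha> @ [a]) (fst z)"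
        using longer[OF ext] by blast
      then have "prefix (\<alpha> @ [a]) (fst z)"
        by auto
      then have "fst z ! length \<alpha> = a"
        by (auto simp: prefix_def)
      with z(1) show ?thesis by blast
    qed
    then have "finite (out_labels A')"
      using finite_subset[of "out_labels A'"] Z(1) by blast
    moreover have "out_labels A' \<noteq> {}"
      using sinks A' False B_verts[OF A'(1)] by (intro out_labels_nonempty) auto
    moreover have "ann (\<alpha> @ [a], relrange A' [a]) y" for a
    proof (rule less.IH[OF _ ext])
      show "m < n"
        by (simp add: n)
      have "ple (\<alpha> @ [a], relrange A' [a]) (\<alpha>, A)"
        using relrange_mono[OF A'(2)] by (auto simp: ple_def)
      then show "covers Z (\<alpha> @ [a], relrange A' [a])"
        by (rule covers_mono[OF cov])
    qed (use len n in simp)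
    ultimately show ?thesis
      using ann_cuntz_krieger[OF el' y _ _ sinks] by blast
  qed
  moreover have "A' \<union> \<Union>\<C> = A"
    by (auto simp: A'_def \<C>_def emeet_def)
  ultimately show "ann (\<alpha>, A) y"
    using ann_Un[OF el' _ C0 y] by simp
qed

lemma ann_covers:
  assumes e: "elem e" and y: "y \<in> carrier gen.fr" and Z: "finite Z" "\<forall>z\<in>Z. elem z \<and> ann z y" and c: "covers Z e"
  shows "ann e y"
proof -
  have "length (fst z) \<le> length (fst e) + (\<Sum>z\<in>Z. length (fst z))" if "z \<in> Z" for z
    using member_le_sum[OF that, of "\<lambda>z. length (fst z)"] Z(1) by simp
  then show ?thesis
    using ann_covers_aux[OF y Z, of "fst e" "snd e" "\<Sum>z\<in>Z. length (fst z)"] e c by simp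
qed

text \<open>\<open>m\<close> is the meet of all \<open>e u\<close>; its projection fixes
  \<open>y\<close> as a product of projections that do. Stating through filters that
  \<open>m\<close> lies below every \<open>e u\<close> remains correct when the meet is 0, for then
  no filter contains \<open>m\<close>.\<close>

lemma fixed_meet:
  assumes "finite U" "U \<noteq> {}" and y: "y \<in> carrier gen.fr" and "\<And>u. u \<in> U \<Longrightarrow> elem (e u) \<and> fixedby (e u) y"
  shows "\<exists>m. elem m \<and> fixedby m y \<and> (\<forall>\<xi>. is_filter ES None \<xi> \<longrightarrow> Some m \<in> \<xi> \<longrightarrow> (\<forall>u\<in>U. Some (e u) \<in> \<xi>))"
  using assms(1,2,4)
proof (induction rule: finite_ne_induct)
  case (singleton u)
  then show ?case
    by (intro exI[of _ "e u"]) simp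
next
  case (insert u U)
  then obtain m where m: "elem m" "fixedby m y" "\<And>\<xi>. is_filter ES None \<xi> \<Longrightarrow> Some m \<in> \<xi> \<Longrightarrow> \<forall>u\<in>U. Some (e u) \<in> \<xi>"
    by auto
  have u: "elem (e u)" "fixedby (e u) y"
    using insert.prems by auto
  have "fixedby (emeet (e u) m) y"
    unfolding fixedby_def
    by (rule null_trans[OF null_swap[OF act_meet[OF u(1) m(1) y]]])
      (rule null_trans[OF null_act_diff[OF gw_pe[OF u(1)]]], use m(2) u(2) in \<open>simp_all add: fixedby_def\<close>)
  moreover have "\<forall>v\<in>insert u U. Some (e v) \<in> \<xi>" if "is_filter ES None \<xi>" "Some (emeet (e u) m) \<in> \<xi>" for \<xi>
    using filter_emeet_iff[OF that(1) u(1) m(1)] that m(3)[OF that(1)] by simp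
  ultimately show ?case
    using elem_emeet[OF u(1) m(1)] by blast
qed

text \<open>Splitting \<open>y\<close> as \<open>p\<^sub>k y + (y - p\<^sub>k y)\<close> for each \<open>k\<close> in turn reduces to the case that every
  projection either fixes or annihilates \<open>y\<close>.\<close>

lemma null_combination:
  assumes I: "finite I" and e: "\<And>i. i \<in> I \<Longrightarrow> elem (e i)"
    and zero: "\<And>\<xi>. \<xi> \<in> tight \<Longrightarrow> (\<Sum>i\<in>{i\<in>I. Some (e i) \<in> \<xi>}. c i) = 0"
    and y: "y \<in> carrier gen.fr"
  shows "null (\<lambda>w. \<Sum>i\<in>I. c i * act (pe (e i)) y w)"
proof -
  \<comment> \<open>Generalised for the induction: the projections indexed by \<open>U\<close> fix
    \<open>y\<close>, those indexed by \<open>W\<close> annihilate it, and those in \<open>K\<close>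
    are still undecided.\<close>
  have "null (\<lambda>w. \<Sum>i\<in>I. c i * act (pe (e i)) y w)"
    if "finite K" "K \<subseteq> I" "U \<union> W \<union> K = I" "U \<inter> W = {}" "y \<in> carrier gen.fr"
      "\<forall>u\<in>U. fixedby (e u) y" "\<forall>w\<in>W. ann (e w) y" for K U W y
    using that
  proof (induction K arbitrary: U W y)
    case empty
    have UW: "U \<subseteq> I" "W \<subseteq> I" "finite U" "finite W"
      using empty.prems(2) by (auto intro: finite_subset[OF _ I])
    have "null y" if c: "(\<Sum>u\<in>U. c u) \<noteq> 0"
    proof -
      have "U \<noteq> {}" using c by auto
      moreover have "elem (e u) \<and> fixedby (e u) y" if "u \<in> U" for u
        using that UW(1) e empty.prems(5) by blast
      ultimately obtain m where m: "elem m" "fixedby m y" "\<And>\<xi>. is_filter ES None \<xi> \<Longrightarrow> Some m \<in> \<xi> \<Longrightarrow> \<forall>u\<in>U. Some (e u) \<in> \<xi>"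
        using fixed_meet[OF UW(3) _ empty.prems(4), of e] by blast
      have "covers (e ` W) m"
        unfolding covers_def
      proof (intro allI impI)
        fix g assume g: "elem g" "snd g \<noteq> {}" "ple g m"
        show "\<exists>z\<in>e ` W. snd (emeet g z) \<noteq> {}"
        proof (rule ccontr)
          assume no: "\<not> (\<exists>z\<in>e ` W. snd (emeet g z) \<noteq> {})"
          obtain \<eta> where \<eta>: "is_ultrafilter ES None \<eta>" "Some g \<in> \<eta>"
            using ultrafilter_exists[OF g(1,2)] by blast
          note f = ultrafilter_filter[OF \<eta>(1)]
          have "Some m \<in> \<eta>"
            by (rule filter_up[OF f \<eta>(2) m(1) g(3)])
          then have "\<forall>u\<in>U. Some (e u) \<in> \<eta>"
            by (rule m(3)[OF f])
          moreover have "Some (e w) \<notin> \<eta>" if "w \<in> W" for w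
            using filter_emeet[OF f \<eta>(2), of "e w"] filter_elem[OF f, of "emeet g (e w)"] no that by auto
          ultimately have "{i \<in> I. Some (e i) \<in> \<eta>} = U"
            using empty UW by auto
          with zero[OF ultrafilter_tight[OF \<eta>(1)]] c show False by simp
        qed
      qed
      then have "ann m y"
        using ann_covers[OF m(1) empty.prems(4), of "e ` W"] UW empty.prems e by auto
      then show "null y"
        using m(2) null_cong[OF null_swap] unfolding ann_def fixedby_def by blast
    qed
    then have "null (\<lambda>w. (\<Sum>u\<in>U. c u) * y w)"
      using null_scale[of y] null_zero by (cases "(\<Sum>u\<in>U. c u) = 0") simp_all
    moreover have "null (\<lambda>w. \<Sum>u\<in>U. c u * (act (pe (e u)) y w - y w))"
      using empty.prems by (intro null_sum null_scale) (simp add: fixedby_def)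
    moreover have "null (\<lambda>v. \<Sum>w\<in>W. c w * act (pe (e w)) y v)"
      using empty.prems by (intro null_sum null_scale) (simp add: ann_def)
    ultimately have "null (\<lambda>w. (\<Sum>u\<in>U. c u * (act (pe (e u)) y w - y w)) + (\<Sum>u\<in>U. c u) * y w +
        (\<Sum>i\<in>W. c i * act (pe (e i)) y w))"
      by (intro null_add)
    moreover have "(\<Sum>u\<in>U. c u * (act (pe (e u)) y w - y w)) + (\<Sum>u\<in>U. c u) * y w + (\<Sum>i\<in>W. c i * act (pe (e i)) y w) =
        (\<Sum>i\<in>I. c i * act (pe (e i)) y w)" for w
    proof -
      have "(\<Sum>i\<in>I. c i * act (pe (e i)) y w) = (\<Sum>i\<in>U. c i * act (pe (e i)) y w) + (\<Sum>i\<in>W. c i * act (pe (e i)) y w)"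
        using empty.prems(2,3) UW by (subst sum.union_disjoint[symmetric]) auto
      then show ?thesis
        by (simp add: right_diff_distrib sum_subtractf sum_distrib_right)
    qed
    ultimately show ?case by simp
  next
    case (insert k K)
    have k: "elem (e k)" "gw (pe (e k))"
      using insert.prems e gw_pe by auto
    let ?y1 = "act (pe (e k)) y"
    define y2 where "y2 = (\<lambda>w. y w - ?y1 w)"
    have y1: "?y1 \<in> carrier gen.fr"
      using insert.prems k by (intro act_closed)
    have y2: "y2 \<in> carrier gen.fr"
      using gen.hom.R.diff_closed[OF insert.prems(4) y1] by (simp add: y2_def)
    have act2: "act u y2 = (\<lambda>w. act u y w - act u ?y1 w)" for u
      by (simp add: y2_def mul_diff_right)
    have com: "null (\<lambda>w. act (pe (e i)) ?y1 w - act (pe (e k)) (act (pe (e i)) y) w)" if "i \<in> I" for i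
      using act_commute[OF e[OF that] k(1) insert.prems(4)] .
    have fix1: "fixedby (e i) ?y1" if "fixedby (e i) y" "i \<in> I" for i
      using null_trans[OF com[OF that(2)] null_act_diff[OF k(2)]] that(1) by (simp add: fixedby_def)
    have ann1: "ann (e i) ?y1" if "ann (e i) y" "i \<in> I" for i
      using null_cong[OF com[OF that(2)] null_act[OF k(2)]] that(1) by (simp add: ann_def)
    have fixk: "fixedby (e k) ?y1"
      using act_meet[OF k(1) k(1) insert.prems(4)] by (simp add: fixedby_def)
    have fix2: "fixedby (e i) y2" if "fixedby (e i) y" "i \<in> I" for i
      using null_diff[OF that(1)[unfolded fixedby_def] fix1[OF that, unfolded fixedby_def]]
      by (simp add: fixedby_def act2) (simp add: y2_def algebra_simps)
    have ann2: "ann (e i) y2" if "ann (e i) y" "i \<in> I" for i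
      using null_diff[OF that(1)[unfolded ann_def] ann1[OF that, unfolded ann_def]] by (simp add: ann_def act2)
    have annk: "ann (e k) y2"
      using null_swap[OF fixk[unfolded fixedby_def]] by (simp add: ann_def act2)
    \<comment> \<open>For \<open>?y1\<close> the index \<open>k\<close> joins \<open>U\<close>, for
      \<open>y2\<close> it joins \<open>W\<close>. It is first removed from the other set because it
      may have been decided before.\<close>
    have "null (\<lambda>w. \<Sum>i\<in>I. c i * act (pe (e i)) ?y1 w)"
      using insert.prems insert.hyps fix1 ann1 fixk by (intro insert.IH[of "insert k (U - {k})" "W - {k}"] y1) auto
    moreover have "null (\<lambda>w. \<Sum>i\<in>I. c i * act (pe (e i)) y2 w)"
      using insert.prems insert.hyps fix2 ann2 annk by (intro insert.IH[of "U - {k}" "insert k W"] y2) auto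
    ultimately have "null (\<lambda>w. (\<Sum>i\<in>I. c i * act (pe (e i)) ?y1 w) + (\<Sum>i\<in>I. c i * act (pe (e i)) y2 w))"
      by (rule null_add)
    then show ?case
      by (simp add: act2 sum.distrib[symmetric] distrib_left[symmetric])
  qed
  from this[of I "{}" "{}" y] I y show ?thesis by simp
qed

text \<open>Modulo \<open>p\<close>, \<open>x\<close> is a combination of projections whose
  coefficients sum to 0 at each tight filter, so \<open>null_combination\<close> makes
  \<open>x y\<close> null for every \<open>y\<close> in the carrier. For
  \<open>y = x\<^sup>*\<close> the C*-identity turns this into \<open>p x = 0\<close>.\<close>

lemma degree_one_kernel:
  assumes x: "x \<in> gen.fr_one" and rep: "\<And>\<xi>. gen.rep x [] \<xi> = 0"
  shows "p x = 0"
proof -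
  have xc: "x \<in> carrier gen.fr"
    using x by (simp add: gen.fr_one_def)
  let ?S = "{w. x w \<noteq> 0}"
  let ?I = "{w \<in> ?S. \<not> wz w}"
  note fin = gen.fr_finite[OF xc]
  have "\<forall>w\<in>?I. \<exists>e. elem e \<and> w \<doteq> pe e"
  proof
    fix w assume w: "w \<in> ?I"
    then have "w \<noteq> []" "gw w" "gen.wdeg w = []"
      using x gen.fr_letters[OF xc, of w] by (auto simp: gen.fr_one_def)
    from degree_one_form[OF this] w show "\<exists>e. elem e \<and> w \<doteq> pe e"
      by auto
  qed
  then obtain e where e: "\<And>w. w \<in> ?I \<Longrightarrow> elem (e w)" "\<And>w. w \<in> ?I \<Longrightarrow> w \<doteq> pe (e w)"
    by (metis (no_types, lifting))
  define y where "y = star_sa gen.fr x"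
  have y: "y \<in> carrier gen.fr"
    unfolding y_def by (rule gen.hom.R.star_closed[OF xc])
  have "null (\<lambda>v. \<Sum>w\<in>?I. x w * act (pe (e w)) y v)"
  proof (rule null_combination)
    show "finite ?I"
      using fin by simp
    fix \<xi> assume \<xi>: "\<xi> \<in> tight"
    \<comment> \<open>Evaluation at \<open>\<xi>\<close> adds the coefficients of those words whose
      idempotent belongs to \<open>\<xi>\<close>: the hypothesis of
      \<open>null_combination\<close>.\<close>
    have "gen.rep x [] \<xi> = (\<Sum>w\<in>?S. if w \<in> {w \<in> ?I. Some (e w) \<in> \<xi>} then x w else 0)"
      unfolding gen.rep_def
    proof (rule sum.cong[OF refl])
      fix w assume w: "w \<in> ?S"
      have "gen.wdeg w = []"
        using x w by (auto simp: gen.fr_one_def)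
      moreover have "\<xi> \<in> gen.wset w \<longleftrightarrow> w \<in> {w \<in> ?I. Some (e w) \<in> \<xi>}"
      proof (cases "wz w")
        case True
        then show ?thesis by (simp add: wz_def)
      next
        case False
        with w have "w \<in> ?I" by simp
        with e[OF this] wset_pe[OF e(1)[OF this]] \<xi> show ?thesis
          by (auto simp: weq_def mem_cyl)
      qed
      ultimately show "x w * gen.ind w [] \<xi> = (if w \<in> {w \<in> ?I. Some (e w) \<in> \<xi>} then x w else 0)"
        by (simp add: gen.ind_def)
    qed
    also have "\<dots> = (\<Sum>w\<in>{w \<in> ?I. Some (e w) \<in> \<xi>}. x w)"
      using fin by (subst sum.inter_restrict[symmetric]) (auto intro!: sum.cong)
    finally show "(\<Sum>w\<in>{w \<in> ?I. Some (e w) \<in> \<xi>}. x w) = 0"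
      using rep by simp
  qed (use e y in auto)
  moreover have "null (\<lambda>v. \<Sum>w\<in>?I. x w * (act w y v - act (pe (e w)) y v))"
    using e(2) by (intro null_sum null_scale null_diff_act y weq_null) blast
  moreover have "null (\<lambda>v. \<Sum>w\<in>?S - ?I. x w * act w y v)"
    by (intro null_sum null_scale null_right y) (auto simp: wz_def)
  ultimately have "null (\<lambda>v. (\<Sum>w\<in>?I. x w * act (pe (e w)) y v) + (\<Sum>w\<in>?I. x w * (act w y v - act (pe (e w)) y v)) +
      (\<Sum>w\<in>?S - ?I. x w * act w y v))"
    by (intro null_add)
  moreover have "(\<Sum>w\<in>?I. x w * act (pe (e w)) y v) + (\<Sum>w\<in>?I. x w * (act w y v - act (pe (e w)) y v)) +
      (\<Sum>w\<in>?S - ?I. x w * act w y v) = mul x y v" for v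
  proof -
    have "x = (\<lambda>v. \<Sum>w\<in>?S. x w * word w v)"
    proof
      fix v
      have "(\<Sum>w\<in>?S. x w * word w v) = (\<Sum>w\<in>?S. if w = v then x v else 0)"
        by (intro sum.cong) (auto simp: word_def)
      then show "x v = (\<Sum>w\<in>?S. x w * word w v)"
        using fin by simp
    qed
    then have "mul x y = mul (\<lambda>v. \<Sum>w\<in>?S. x w * word w v) y"
      by (rule arg_cong[where f = "\<lambda>f. mul f y"])
    also have "\<dots> = (\<lambda>v. \<Sum>w\<in>?S. x w * act w y v)"
      by (simp only: mul_sum_left) (simp add: mul_def sum_distrib_left mult.assoc)
    finally have "mul x y v = (\<Sum>w\<in>?S - ?I. x w * act w y v) + (\<Sum>w\<in>?I. x w * act w y v)"
      using sum.subset_diff[of ?I ?S "\<lambda>w. x w * act w y v"] fin by auto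
    then show ?thesis
      by (simp add: right_diff_distrib sum_subtractf)
  qed
  ultimately have "p (mul x y) = 0"
    by (simp add: null_def)
  then have "(p y)\<^sup>2 = 0"
    using p.p_cstar[OF y] gen.hom.R.star_star[OF xc] by (simp add: mul_def y_def del: free_star_algebra_simps)
  then show ?thesis
    using p.p_star[OF xc] by (simp add: y_def)
qed

end

section \<open>Simple functions as images in trivial degree, and the seminorm bound\<close>

context normal_labelled_space
begin

lemma rep_fr_one:
  assumes f: "f \<in> gen.fr_one"
  shows "gen.rep f = gen.mono [] (gen.rep f [])"
proof (intro ext)
  fix t \<xi>
  have "gen.rep f t \<xi> = 0" if "t \<noteq> []"
    unfolding gen.rep_def
  proof (rule sum.neutral, rule ballI)
    fix w assume "w \<in> {w. f w \<noteq> 0}"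
    then have "gen.wdeg w = []"
      using f by (simp add: gen.fr_one_def)
    with that show "f w * gen.ind w t \<xi> = 0"
      by (simp add: gen.ind_def)
  qed
  then show "gen.rep f t \<xi> = gen.mono [] (gen.rep f []) t \<xi>"
    by (simp add: gen.mono_def)
qed

lemma fr_one_closed:
  assumes "f \<in> gen.fr_one" "g \<in> gen.fr_one"
  shows "(\<lambda>w. f w + g w) \<in> gen.fr_one" "(\<lambda>w. c * f w) \<in> gen.fr_one"
proof -
  have c: "f \<in> carrier gen.fr" "g \<in> carrier gen.fr"
    using assms by (simp_all add: gen.fr_one_def)
  have "gen.wdeg w = []" if "f w + g w \<noteq> 0" for w
    using assms that by (cases "f w = 0") (auto simp: gen.fr_one_def)
  then show "(\<lambda>w. f w + g w) \<in> gen.fr_one"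
    using gen.hom.R.plus_closed[OF c] by (simp add: gen.fr_one_def)
  show "(\<lambda>w. c * f w) \<in> gen.fr_one"
    using gen.hom.R.scale_closed[OF c(1), of c] assms(1) by (simp add: gen.fr_one_def)
qed

lemma rep_fr_one_simps:
  assumes "f \<in> gen.fr_one" "g \<in> gen.fr_one"
  shows "gen.rep (\<lambda>w. f w + g w) [] = (\<lambda>\<xi>. gen.rep f [] \<xi> + gen.rep g [] \<xi>)"
    "gen.rep (\<lambda>w. c * f w) [] = (\<lambda>\<xi>. c * gen.rep f [] \<xi>)"
proof -
  have c: "f \<in> carrier gen.fr" "g \<in> carrier gen.fr"
    using assms by (simp_all add: gen.fr_one_def)
  show "gen.rep (\<lambda>w. f w + g w) [] = (\<lambda>\<xi>. gen.rep f [] \<xi> + gen.rep g [] \<xi>)"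
    "gen.rep (\<lambda>w. c * f w) [] = (\<lambda>\<xi>. c * gen.rep f [] \<xi>)"
    using gen.rep_plus[OF c] gen.rep_scale[OF c(1), of c] by simp_all
qed

lemma simple_fun_rep:
  "g \<in> simple_funs \<Longrightarrow> \<exists>f\<in>gen.fr_one. gen.rep f [] = g"
proof (induction rule: simple_funs.induct)
  case (basis e)
  have A: "snd e \<in> B"
    using basis by (simp add: elem_def)
  have d: "gen.wdeg (pe e) = []"
    unfolding pe_def wdeg_nf[OF A] ..
  have "word (pe e) \<in> carrier gen.fr"
    using gw_pe[OF basis] by (intro word_carrier) (simp_all add: pe_def)
  then have "word (pe e) \<in> gen.fr_one"
    using d by (simp add: gen.fr_one_def word_def)
  moreover have "gen.rep (word (pe e)) [] = indicator (cyl e)"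
    using d by (simp add: gen.rep_word wset_pe[OF basis] gen.mono_def)
  ultimately show ?case by blast
next
  case (add f g)
  then obtain x y where "x \<in> gen.fr_one" "gen.rep x [] = f" "y \<in> gen.fr_one" "gen.rep y [] = g"
    by blast
  with fr_one_closed(1)[of x y] rep_fr_one_simps(1)[of x y] show ?case
    by (intro bexI[of _ "\<lambda>w. x w + y w"]) simp_all
next
  case (scale f c)
  then obtain x where "x \<in> gen.fr_one" "gen.rep x [] = f"
    by blast
  with fr_one_closed(2)[of x x c] rep_fr_one_simps(2)[of x x c] show ?case
    by (intro bexI[of _ "\<lambda>w. c * x w"]) simp_all
qed

end

context relation_seminorm
begin

text \<open>By the normal form, the set of a word of trivial degree is empty or a cylinder.\<close>

lemma rep_fr_one_simple:
  assumes f: "f \<in> gen.fr_one"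
  shows "gen.rep f [] \<in> simple_funs"
proof -
  have "gen.rep f [] = (\<lambda>\<xi>. \<Sum>w | f w \<noteq> 0. f w * indicator (gen.wset w) \<xi>)"
    using f by (auto simp: fun_eq_iff gen.rep_def gen.ind_def gen.fr_one_def indicator_def intro!: sum.cong)
  also have "\<dots> \<in> simple_funs"
  proof (rule simple_sum)
    fix w assume "w \<in> {w. f w \<noteq> 0}"
    then have "w \<noteq> []" "gw w" "gen.wdeg w = []"
      using f gen.fr_letters[of f w] by (auto simp: gen.fr_one_def)
    then consider "wz w" | e where "elem e" "w \<doteq> pe e"
      using degree_one_form[of w] by blast
    then have "gen.wset w \<in> cylinder_sets"
    proof cases
      case 1
      then show ?thesis
        using cylinder_empty by (simp add: wz_def)
    next
      case (2 e)
      then show ?thesis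
        using cylinder_cyl[of e] wset_pe[of e] by (simp add: weq_def)
    qed
    then show "(\<lambda>\<xi>. f w * indicator (gen.wset w) \<xi>) \<in> simple_funs"
      by (intro simple_funs.scale) (simp add: cylinder_sets_def)
  qed
  finally show ?thesis .
qed

text \<open>By \<open>degree_one_kernel\<close>, \<open>p f\<close> depends only on the function
  \<open>gen.rep f []\<close>. So \<open>p\<close> descends to a C*-seminorm \<open>q\<close> on
  simple functions, which contain their square roots, and \<open>cstar_seminorm_le_sup\<close>
  applies to \<open>q\<close>.\<close>

lemma fr_one_bound:
  assumes f: "f \<in> gen.fr_one" and M: "\<And>\<xi>. cmod (gen.rep f [] \<xi>) \<le> M"
  shows "p f \<le> M"
proof -
  define q where "q g = p (SOME f. f \<in> gen.fr_one \<and> gen.rep f [] = g)" for g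
  have q: "q (gen.rep f []) = p f" if f: "f \<in> gen.fr_one" for f
  proof -
    define h where "h = (SOME h. h \<in> gen.fr_one \<and> gen.rep h [] = gen.rep f [])"
    have h: "h \<in> gen.fr_one" "gen.rep h [] = gen.rep f []"
      using someI[of "\<lambda>h. h \<in> gen.fr_one \<and> gen.rep h [] = gen.rep f []" f] f by (simp_all add: h_def)
    let ?d = "\<lambda>w. h w + - 1 * f w"
    have d: "?d \<in> gen.fr_one"
      by (rule fr_one_closed(1)[OF h(1) fr_one_closed(2)[OF f f]])
    have "gen.rep ?d [] \<xi> = 0" for \<xi>
      unfolding rep_fr_one_simps(1)[OF h(1) fr_one_closed(2)[OF f f]] rep_fr_one_simps(2)[OF f f] by (simp add: h(2))
    then have "p ?d = 0"
      by (rule degree_one_kernel[OF d])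
    moreover have "\<bar>p h - p f\<bar> \<le> p ?d"
      using p.p_diff_abs[of h f] h f by (simp add: gen.fr_one_def)
    ultimately show ?thesis
      by (simp add: q_def h_def)
  qed
  have pre: "\<exists>f\<in>gen.fr_one. gen.rep f [] = g \<and> q g = p f" if "g \<in> simple_funs" for g
    using simple_fun_rep[OF that] q by blast
  have carrier: "f \<in> carrier gen.fr" if "f \<in> gen.fr_one" for f
    using that by (simp add: gen.fr_one_def)
  have "q (gen.rep f []) \<le> M"
  proof (rule cstar_seminorm_le_sup[of simple_funs])
    fix h :: "_ \<Rightarrow> real"
    assume "(\<lambda>x. of_real (h x)) \<in> simple_funs"
    then show "(\<lambda>x. of_real (sqrt (1 - (h x)\<^sup>2) - 1)) \<in> simple_funs"
      using simple_compose[of "\<lambda>x. of_real (h x)" "\<lambda>z. of_real (sqrt (1 - (Re z)\<^sup>2) - 1)"] by simp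
  next
    fix g assume "g \<in> simple_funs"
    then obtain f where f: "f \<in> gen.fr_one" "gen.rep f [] = g" "q g = p f"
      using pre by blast
    show "0 \<le> q g"
      using p.p_nonneg[OF carrier[OF f(1)]] by (simp only: f(3))
    show "q (\<lambda>x. c * g x) = cmod c * q g" for c
      using q[OF fr_one_closed(2)[OF f(1) f(1)], of c] rep_fr_one_simps(2)[OF f(1) f(1), of c]
        p.p_scale[OF carrier[OF f(1)], of c] f by simp
    let ?h = "times_sa gen.fr (star_sa gen.fr f) f"
    have h: "?h \<in> gen.fr_one"
      using f(1) by (intro gen.star_times_fr_one) (auto simp: gen.fr_one_def)
    have C0: "gen.rep f [] \<in> C0 tight_topology (V_action [])"
      using gen.cp_component[OF gen.rep_closed[OF carrier[OF f(1)]], of "[]"] by simp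
    have "gen.rep ?h = times_sa gen.cp (star_sa gen.cp (gen.rep f)) (gen.rep f)"
      using gen.hom.hom_times[OF gen.hom.R.star_closed[OF carrier[OF f(1)]] carrier[OF f(1)]]
        gen.hom.hom_star[OF carrier[OF f(1)]] by (simp only:)
    also have "\<dots> = times_sa gen.cp (star_sa gen.cp (gen.mono [] (gen.rep f []))) (gen.mono [] (gen.rep f []))"
      using rep_fr_one[OF f(1)] by (simp only:)
    also have "\<dots> = gen.mono [] (\<lambda>x. if x \<in> tight then of_real ((cmod (gen.rep f [] x))\<^sup>2) else 0)"
      using gen.star_mono_times_mono[OF _ C0] by (simp add: if_distrib cong: if_cong)
    finally have eq: "gen.rep ?h [] x = (if x \<in> tight then of_real ((cmod (g x))\<^sup>2) else 0)" for x
      by (simp only: gen.mono_def if_True refl f(2))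
    have "gen.rep ?h [] = (\<lambda>x. cnj (g x) * g x)"
    proof
      fix x
      have "complex_of_real ((cmod (g x))\<^sup>2) = cnj (g x) * g x"
        by (simp only: complex_norm_square mult.commute)
      then show "gen.rep ?h [] x = cnj (g x) * g x"
        using gen.C0_off[OF C0, of x] unfolding eq f(2) by simp
    qed
    then show "q (\<lambda>x. cnj (g x) * g x) = (q g)\<^sup>2"
      using q[OF h] p.p_cstar[OF carrier[OF f(1)]] f(3) by (simp only:)
    fix g' assume "g' \<in> simple_funs"
    then obtain f' where f': "f' \<in> gen.fr_one" "gen.rep f' [] = g'" "q g' = p f'"
      using pre by blast
    show "q (\<lambda>x. g x + g' x) \<le> q g + q g'"
      using q[OF fr_one_closed(1)[OF f(1) f'(1)]] rep_fr_one_simps(1)[OF f(1) f'(1)]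
        p.p_plus[OF carrier[OF f(1)] carrier[OF f'(1)]] f f' by simp
  qed (use M rep_fr_one_simple[OF f] in \<open>simp_all add: simple_funs.add simple_funs.scale simple_times simple_cnj\<close>)
  then show ?thesis
    by (simp only: q[OF f])
qed

lemma seminorm_bound: "f \<in> carrier gen.fr \<Longrightarrow> p f \<le> gen.l1_norm (gen.rep f)"
  using seminorm fr_one_bound by (intro gen.seminorm_le_l1_norm) simp_all

end

section \<open>Density of the range and the isomorphism\<close>

context normal_labelled_space
begin

primrec letter_gen :: "'c letter \<Rightarrow> ('a, 'c) generator \<times> bool" where
  "letter_gen (Pos a) = Sl a"
| "letter_gen (Neg a) = Sl' a"

lemma gw_letter_gen: "gw (map letter_gen t)"
proof -
  have "fst (letter_gen x) \<in> generators" for x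
    by (cases x) (simp_all add: generators_iff)
  then show ?thesis by auto
qed

lemma wdeg_letter_gen: "reduced t \<Longrightarrow> gen.wdeg (map letter_gen t) = t"
proof (induction t)
  case (Cons x t)
  then have "gen.wdeg (map letter_gen t) = t"
    using reduced_ConsD by blast
  moreover have "gen.ldeg (letter_gen x) = [x]"
    by (cases x) simp_all
  ultimately show ?case
    using letter_mult_reduced[OF Cons.prems] by simp
qed simp

lemma wset_letter_gen: "reduced t \<Longrightarrow> gen.wset (map letter_gen t) = V_action t"
proof (induction t)
  case (Cons x t)
  then have "gen.wset (map letter_gen t) = V_action t"
    using reduced_ConsD by blast
  with V_action_Cons[OF Cons.prems] show ?case
    by (cases x) simp_all
qed simp

text \<open>The word spelling \<open>t\<close> in the generators represents the indicator of
  \<open>V_action t\<close> in degree \<open>t\<close>. Multiplying it by an element of trivial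
  degree that represents a simple approximant of \<open>f\<close> gives the monomial; for
  \<open>t = []\<close> the approximant itself is taken, as \<open>word []\<close> is not in the
  carrier.\<close>

lemma monomial_approx:
  assumes t: "reduced t" and f: "f \<in> C0 tight_topology (V_action t)" and d: "d > 0"
  shows "\<exists>x\<in>carrier gen.fr. \<exists>h. gen.rep x = gen.mono t h \<and> (\<forall>\<xi>. cmod (f \<xi> - h \<xi>) \<le> d)"
proof -
  have off: "\<xi> \<notin> V_action t \<Longrightarrow> f \<xi> = 0" for \<xi>
    by (rule gen.C0_off[OF f])
  have "approximable f"
    using f C0_V_action[OF t] by simp
  then obtain g where g: "g \<in> simple_funs" "\<And>\<xi>. cmod (f \<xi> - g \<xi>) < d"
    using d by (rule approximableE) blast
  obtain x where x: "x \<in> gen.fr_one" "gen.rep x [] = g"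
    using simple_fun_rep[OF g(1)] by blast
  have xc: "x \<in> carrier gen.fr"
    using x(1) by (simp add: gen.fr_one_def)
  have rx: "gen.rep x = gen.mono [] g"
    using rep_fr_one[OF x(1)] by (simp only: x(2))
  show ?thesis
  proof (cases "t = []")
    case True
    then show ?thesis
      using xc rx g(2) less_imp_le by blast
  next
    case False
    let ?w = "map letter_gen t"
    have w: "word ?w \<in> carrier gen.fr"
      using False by (intro word_carrier gw_letter_gen) simp
    have rw: "gen.rep (word ?w) = gen.mono t (indicator (V_action t))"
      by (simp only: gen.rep_word wdeg_letter_gen[OF t] wset_letter_gen[OF t])
    have C0: "g \<in> C0 tight_topology (V_action [])" "indicator (V_action t) \<in> C0 tight_topology (V_action t)"
      using gen.cp_component[OF gen.rep_closed[OF xc], of "[]"] gen.cp_component[OF gen.rep_closed[OF w], of t] t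
      by (simp_all add: rx rw gen.mono_def)
    have "gen.rep (times_sa gen.fr x (word ?w)) = gen.mono t (\<lambda>\<xi>. g \<xi> * indicator (V_action t) \<xi>)"
      using gen.rep_times[OF xc w] gen.mono_times[of "[]" t g "indicator (V_action t)"] C0 t
      by (simp add: rx rw del: free_star_algebra_simps)
    moreover have "cmod (f \<xi> - g \<xi> * indicator (V_action t) \<xi>) \<le> d" for \<xi>
      using g(2)[of \<xi>] off[of \<xi>] d by (cases "\<xi> \<in> V_action t") (auto intro: less_imp_le)
    ultimately show ?thesis
      using gen.hom.R.times_closed[OF xc w] by blast
  qed
qed

lemma rep_dense:
  assumes y: "y \<in> carrier gen.cp" and e: "e > 0"
  shows "\<exists>x\<in>carrier gen.fr. gen.l1_norm (diff_sa gen.cp y (gen.rep x)) < e"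
proof -
  \<comment> \<open>The error must be exactly 0 in degrees outside \<open>S\<close>; otherwise the
    support of the difference could add further terms to the l1 norm.\<close>
  have approx: "\<exists>x\<in>carrier gen.fr. \<forall>t \<xi>. cmod ((if t \<in> S then y t \<xi> else 0) - gen.rep x t \<xi>) \<le> (if t \<in> S then d else 0)"
    if "finite S" "S \<subseteq> carrier free_group" "d > 0" for S d
    using that
  proof (induction S)
    case empty
    have "(\<lambda>w. 0) \<in> carrier gen.fr"
      by (simp add: carrier_free_star_algebra)
    then show ?case
      by (intro bexI[of _ "\<lambda>w. 0"]) (simp_all add: gen.rep_def)
  next
    case (insert s S)
    then obtain x where x: "x \<in> carrier gen.fr"
        "\<And>t \<xi>. cmod ((if t \<in> S then y t \<xi> else 0) - gen.rep x t \<xi>) \<le> (if t \<in> S then d else 0)"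
      by auto
    have s: "reduced s" "y s \<in> C0 tight_topology (V_action s)"
      using insert.prems gen.cp_component[OF y, of s] by auto
    obtain z h where z: "z \<in> carrier gen.fr" "gen.rep z = gen.mono s h" "\<And>\<xi>. cmod (y s \<xi> - h \<xi>) \<le> d"
      using monomial_approx[OF s \<open>d > 0\<close>] by blast
    have "cmod ((if t \<in> insert s S then y t \<xi> else 0) - gen.rep (plus_sa gen.fr x z) t \<xi>) \<le> (if t \<in> insert s S then d else 0)" for t \<xi>
    proof -
      have r: "gen.rep (plus_sa gen.fr x z) t \<xi> = gen.rep x t \<xi> + gen.mono s h t \<xi>"
        using gen.rep_plus[OF x(1) z(1)] z(2) by simp
      show ?thesis
        using x(2)[of t \<xi>] z(3)[of \<xi>] insert.hyps unfolding r by (auto simp: gen.mono_def)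
    qed
    then show ?case
      using gen.hom.R.plus_closed[OF x(1) z(1)] by blast
  qed
  let ?S = "gen.supp y"
  \<comment> \<open>The summand 1 avoids division by 0 for \<open>y = 0\<close>, and the factor 2
    leaves room for a strict inequality.\<close>
  define d where "d = e / (2 * (real (card ?S) + 1))"
  have d: "d > 0"
    using e by (simp add: d_def)
  obtain x where x: "x \<in> carrier gen.fr"
      "\<And>t \<xi>. cmod ((if t \<in> ?S then y t \<xi> else 0) - gen.rep x t \<xi>) \<le> (if t \<in> ?S then d else 0)"
    using approx[OF gen.finite_supp[OF y] gen.supp_carrier[OF y] d] by blast
  have le: "cmod (y t \<xi> - gen.rep x t \<xi>) \<le> (if t \<in> ?S then d else 0)" for t \<xi>
    using x(2)[of t \<xi>] gen.not_supp[of t y \<xi>] by (auto split: if_splits)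
  have "gen.l1_norm (diff_sa gen.cp y (gen.rep x)) = (\<Sum>t\<in>?S. sup_norm (diff_sa gen.cp y (gen.rep x) t))"
  proof (rule gen.l1_norm_eq[OF gen.finite_supp[OF y]], rule subsetI, rule ccontr)
    fix t assume t: "t \<in> gen.supp (diff_sa gen.cp y (gen.rep x))" and "t \<notin> ?S"
    then have "diff_sa gen.cp y (gen.rep x) t = (\<lambda>\<xi>. 0)"
      using le[of t] by (simp add: fun_eq_iff)
    with t show False
      unfolding gen.supp_def by simp
  qed
  also have "\<dots> \<le> (\<Sum>t\<in>?S. d)"
  proof (intro sum_mono sup_norm_least)
    fix t \<xi> assume "t \<in> ?S"
    then show "cmod (diff_sa gen.cp y (gen.rep x) t \<xi>) \<le> d"
      using le[of t \<xi>] by simp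
  qed
  also have "\<dots> = real (card ?S) * d"
    by simp
  also have "\<dots> < e"
    using e by (simp add: d_def field_simps add_pos_nonneg)
  finally show ?thesis
    using x(1) by blast
qed

theorem cstar_algebra_isomorphic_crossed_product:
  "\<exists>\<psi>. star_isomorphism cstar_algebra tight_crossed_product \<psi> \<and>
    (\<forall>A\<in>B. \<psi> (cs_proj A) = tight_monomial (indicator (V_elem [] A)) []) \<and>
    (\<forall>a. \<psi> (cs_isom a) = tight_monomial (indicator (V_elem [a] (range_of [a]))) [Pos a])"
proof -
  let ?N = "universal_seminorm gen.fr relations" and ?M = "universal_seminorm gen.cp {}"
  have "\<exists>\<psi>. star_isomorphism (completion gen.fr ?N) (completion gen.cp ?M) \<psi> \<and>
      (\<forall>x\<in>carrier gen.fr. \<psi> (completion_embed gen.fr ?N x) = completion_embed gen.cp ?M (gen.rep x))"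
  proof (rule gen.hom.universal_completion_isomorphism[where N = gen.l1_norm])
    fix p x assume p: "cstar_seminorm gen.fr p" "\<forall>(y, z)\<in>relations. p (diff_sa gen.fr y z) = 0" and x: "x \<in> carrier gen.fr"
    interpret relation_seminorm G lab B p
      by unfold_locales (use p in auto)
    show "p x \<le> gen.l1_norm (gen.rep x)"
      by (rule seminorm_bound[OF x])
  qed (use relations_carrier relations_rep in \<open>auto intro: gen.l1_norm_plus gen.l1_norm_scale gen.l1_norm_times
      gen.l1_norm_star gen.cstar_seminorm_le_l1_norm rep_dense simp del: gen.cp_simps gen.cp_diff\<close>)
  then obtain \<psi> where iso: "star_isomorphism (completion gen.fr ?N) (completion gen.cp ?M) \<psi>"
    and \<psi>: "\<And>x. x \<in> carrier gen.fr \<Longrightarrow> \<psi> (completion_embed gen.fr ?N x) = completion_embed gen.cp ?M (gen.rep x)"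
    by blast
  have "\<psi> (completion_embed gen.fr ?N (free_gen g)) =
      completion_embed gen.cp ?M (gen.mono (gen_deg g) (indicator (gen_set g)))" if g: "g \<in> generators" for g
  proof -
    have "gen.rep (free_gen g) = gen.mono (gen_deg g) (indicator (gen_set g))"
      unfolding free_gen_word gen.rep_word
    proof (cases g)
      case (Proj A)
      then show "gen.mono (gen.wdeg [(g, False)]) (indicator (gen.wset [(g, False)])) = gen.mono (gen_deg g) (indicator (gen_set g))"
        using cyl_subset[of "([], A)"] by (simp add: Int_absorb2)
    next
      case (Isom a)
      \<comment> \<open>The set of a one-letter word still asks that the point reached lie in
        \<open>tight\<close>; cutting always ends there.\<close>
      have "{\<xi> \<in> V_letter (Pos a). phi_letter (Neg a) \<xi> \<in> tight} = V_letter (Pos a)"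
        using phi_mem by auto
      then show "gen.mono (gen.wdeg [(g, False)]) (indicator (gen.wset [(g, False)])) = gen.mono (gen_deg g) (indicator (gen_set g))"
        by (simp add: Isom V_letter_cyl)
    qed
    then show ?thesis
      using \<psi>[of "free_gen g"] g by (simp add: free_gen_word word_carrier)
  qed
  note gen = this
  have "\<psi> (cs_proj A) = tight_monomial (indicator (V_elem [] A)) []" if "A \<in> B" for A
    using gen[of "Proj A"] that
    by (simp add: cs_proj_def universal_gen_def tight_monomial_def crossed_monomial_def gen.mono_def V_elem_cyl generators_iff)
  moreover have "\<psi> (cs_isom a) = tight_monomial (indicator (V_elem [a] (range_of [a]))) [Pos a]" for a
    using gen[of "Isom a"]
    by (simp add: cs_isom_def universal_gen_def tight_monomial_def crossed_monomial_def gen.mono_def V_elem_cyl generators_iff)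
  ultimately show ?thesis
    using iso by (intro exI[of _ \<psi>])
      (simp add: cstar_algebra_def universal_cstar_algebra_def tight_crossed_product_def crossed_product_def)
qed

end

theorem theorem4p8:
  fixes G :: "('v, 'e) pre_digraph" and lab :: "'e \<Rightarrow> 'a" and B :: "'v set set"
  assumes "normal_labelled_space G lab B"
  shows "\<exists>\<psi>.
    star_isomorphism (labelled_space.cstar_algebra G lab B)
      (labelled_space.tight_crossed_product G lab B) \<psi> \<and>
    (\<forall>A\<in>B. \<psi> (labelled_space.cs_proj G lab B A) =
      labelled_space.tight_monomial G lab B
        (indicator (labelled_space.V_elem G lab B [] A)) []) \<and>
    (\<forall>a. \<psi> (labelled_space.cs_isom G lab B a) =
      labelled_space.tight_monomial G lab B
        (indicator (labelled_space.V_elem G lab B [a] (labelled_graph.range_of G lab [a]))) [Pos a])"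
  by (rule normal_labelled_space.cstar_algebra_isomorphic_crossed_product[OF assms])

end
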